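(* Let $N\ge2$, $1<p\le N$, $p-1<q<q_c:=\frac{N(p-1)}{N-1}$, let $\Omega\subset\mathbb{R}^N$ be a domain containing $0$ and let $u\in C^1(\Omega\setminus\{0\})$ be a nonnegative solution of $-\Delta_p u+|\nabla u|^q=0$ in $\Omega\setminus\{0\}$. Then: (i) either there exists $c\ge0$ such that $$\lim_{x\to0}\frac{u(x)}{\mu_p(x)}=c,$$ and furthermore $u$ satisfies $$-\Delta_p u+|\nabla u|^q=c_{N,p}\,c^{p-1}\delta_0\quad\text{in }\mathcal{D}'(\Omega);$$ (ii) or $$\lim_{x\to0}|x|^{\beta_q}u(x)=\lambda_{N,p,q},$$ where $\beta_q=\frac{p-q}{q+1-p}$ and $\lambda_{N,p,q}=\beta_q^{-1}\big(\beta_q(p-1)+p-N\big)^{\frac{1}{q+1-p}}$.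
   Context: $\Delta_p u=\operatorname{div}(|\nabla u|^{p-2}\nabla u)$; $C^1$ solutions are understood in the distributional sense. $\mu_p(x)=\frac{p-1}{N-p}|x|^{\frac{p-N}{p-1}}$ if $1<p<N$ and $\mu_N(x)=-\ln|x|$ if $p=N$. $c_{N,p}>0$ is the constant such that $-\Delta_p\mu_p=c_{N,p}\delta_0$ in $\mathcal{D}'(\mathbb{R}^N)$, where $\delta_0$ is the Dirac mass at $0$. *)

theory Defs
  imports "HOL-Analysis.Analysis"
begin

text \<open>Throughout, \<open>\<real>\<^sup>N\<close> is an arbitrary Euclidean space \<open>'a\<close> with \<open>N = DIM('a)\<close>.\<close>

definition grad :: "('a::euclidean_space \<Rightarrow> real) \<Rightarrow> 'a \<Rightarrow> 'a" where
  "grad f x = (THE D. GDERIV f x :> D)"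

lemma grad_eqI:
  assumes "GDERIV f x :> D"
  shows "grad f x = D"
  unfolding grad_def
proof (rule the_equality)
  show "GDERIV f x :> D" by (fact assms)
next
  fix D' assume "GDERIV f x :> D'"
  then have "(\<lambda>h. h \<bullet> D') = (\<lambda>h. h \<bullet> D)"
    using assms unfolding gderiv_def by (rule has_derivative_unique)
  then have "\<forall>h. h \<bullet> D' = h \<bullet> D" by (rule fun_cong [THEN allI])
  then show "D' = D" by (rule vector_eq_ldot [THEN iffD1])
qed

text \<open>\<open>C_k_on k U f\<close>: \<open>f\<close> is of class \<open>C\<^sup>k\<close> on the open set \<open>U\<close>; the values of \<open>f\<close> off \<open>U\<close>
  play no role.\<close>

primrec C_k_on :: "nat \<Rightarrow> 'a::euclidean_space set \<Rightarrow> ('a \<Rightarrow> real) \<Rightarrow> bool" where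
  "C_k_on 0 U f \<longleftrightarrow> continuous_on U f"
| "C_k_on (Suc k) U f \<longleftrightarrow>
     (\<forall>x\<in>U. f differentiable (at x)) \<and> (\<forall>e\<in>Basis. C_k_on k U (\<lambda>x. grad f x \<bullet> e))"

definition test_functions :: "'a::euclidean_space set \<Rightarrow> ('a \<Rightarrow> real) set" where
  "test_functions U =
     {\<phi>. (\<forall>k. C_k_on k UNIV \<phi>) \<and> compact (closure {x. \<phi> x \<noteq> 0}) \<and> closure {x. \<phi> x \<noteq> 0} \<subseteq> U}"

definition L1_loc :: "'a::euclidean_space set \<Rightarrow> ('a \<Rightarrow> 'b::euclidean_space) \<Rightarrow> bool" where
  "L1_loc U f \<longleftrightarrow> (\<forall>K. compact K \<and> K \<subseteq> U \<longrightarrow> set_integrable lborel K f)"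

text \<open>\<open>dist_eq U F g m\<close>: the equation \<open>- div F + g = m \<delta>\<^sub>0\<close> holds in \<open>\<D>'(U)\<close>, where the field \<open>F\<close>
  and the function \<open>g\<close> are locally integrable in \<open>U\<close> and so define distributions. If
  \<open>0 \<notin> U\<close>, then \<open>\<phi> 0 = 0\<close> for every test function and the right-hand side vanishes.\<close>

definition dist_eq ::
    "'a::euclidean_space set \<Rightarrow> ('a \<Rightarrow> 'a) \<Rightarrow> ('a \<Rightarrow> real) \<Rightarrow> real \<Rightarrow> bool" where
  "dist_eq U F g m \<longleftrightarrow>
     L1_loc U F \<and> L1_loc U g \<and>
     (\<forall>\<phi>\<in>test_functions U. (LINT x:U|lborel. F x \<bullet> grad \<phi> x + g x * \<phi> x) = m * \<phi> 0)"

text \<open>The field \<open>\<bar>\<nabla>u\<bar>\<^bsup>p-2\<^esup>\<nabla>u\<close>, whose divergence is \<open>\<Delta>\<^sub>p u\<close>. It is \<open>0\<close> where \<open>\<nabla>u = 0\<close>,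
  also for \<open>p < 2\<close>.\<close>

definition p_flux :: "real \<Rightarrow> ('a::euclidean_space \<Rightarrow> real) \<Rightarrow> 'a \<Rightarrow> 'a" where
  "p_flux p u x = norm (grad u x) powr (p - 2) *\<^sub>R grad u x"

text \<open>\<open>HJ_eq p q U u m\<close>: \<open>- \<Delta>\<^sub>p u + \<bar>\<nabla>u\<bar>\<^sup>q = m \<delta>\<^sub>0\<close> in \<open>\<D>'(U)\<close>, for a function \<open>u\<close> that is
  \<open>C\<^sup>1\<close> at least off the origin. The gradient is the classical one there; its value at the
  origin is irrelevant because points are Lebesgue null sets.\<close>

definition HJ_eq ::
    "real \<Rightarrow> real \<Rightarrow> 'a::euclidean_space set \<Rightarrow> ('a \<Rightarrow> real) \<Rightarrow> real \<Rightarrow> bool" where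
  "HJ_eq p q U u m \<longleftrightarrow> dist_eq U (p_flux p u) (\<lambda>x. norm (grad u x) powr q) m"

definition mu :: "real \<Rightarrow> 'a::euclidean_space \<Rightarrow> real" where
  "mu p x =
     (if p = real DIM('a) then - ln (norm x)
      else (p - 1) / (real DIM('a) - p) * norm x powr ((p - real DIM('a)) / (p - 1)))"

text \<open>The constant \<open>c\<^bsub>N,p\<^esub>\<close> with \<open>- \<Delta>\<^sub>p \<mu>\<^sub>p = c\<^bsub>N,p\<^esub> \<delta>\<^sub>0\<close> in \<open>\<D>'(\<real>\<^sup>N)\<close>.\<close>

definition dirac_const :: "'a::euclidean_space itself \<Rightarrow> real \<Rightarrow> real" where
  "dirac_const _ p =
     (THE c. c > 0 \<and> dist_eq (UNIV :: 'a set) (p_flux p (mu p)) (\<lambda>_. 0) c)"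

definition q_crit :: "nat \<Rightarrow> real \<Rightarrow> real" where
  "q_crit N p = real N * (p - 1) / (real N - 1)"

definition beta_exp :: "real \<Rightarrow> real \<Rightarrow> real" where
  "beta_exp p q = (p - q) / (q + 1 - p)"

definition lambda_const :: "nat \<Rightarrow> real \<Rightarrow> real \<Rightarrow> real" where
  "lambda_const N p q =
     inverse (beta_exp p q) *
       (beta_exp p q * (p - 1) + p - real N) powr (1 / (q + 1 - p))"

end

theory Submission
  imports Defs
begin

text \<open>
  The singular behaviour is read off from the radial solutions \<open>w\<^sub>A\<close> with
  \<open>- w\<^sub>A'(r) = r\<^bsup>-\<alpha>\<^esup> (A + B r\<^bsup>\<theta>\<^esup>)\<^bsup>-\<kappa>\<^esup>\<close>: for \<open>A > 0\<close> they behave like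
  \<open>A\<^bsup>-\<kappa>\<^esup> \<mu>\<^sub>p\<close>, for \<open>A = 0\<close> like \<open>\<lambda> r\<^bsup>-\<beta>\<^esup>\<close>, and for \<open>A < 0\<close> they blow up on a sphere. A
  comparison principle, obtained by touching \<open>u\<close> with a strict subsolution and applied to \<open>u\<close>
  and its reflections, bounds the oscillation of \<open>u\<close> on spheres by a constant; hence for every
  \<open>A > 0\<close> either \<open>w\<^sub>A \<le> u\<close> or \<open>u \<le> w\<^sub>A + K\<close> near the origin, and the critical value of \<open>A\<close>
  (infinite, positive, or zero) decides between a bounded solution, \<open>u \<sim> c \<mu>\<^sub>p\<close>, and the strong
  singularity. In the first two cases Caccioppoli estimates on dyadic annuli make \<open>\<bar>\<nabla>u\<bar>\<^bsup>p-1\<^esup>\<close>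
  and \<open>\<bar>\<nabla>u\<bar>\<^sup>q\<close> locally integrable, so that the equation holds across the origin up to a Dirac
  mass; its size is found by a capacity argument if \<open>u\<close> is bounded, and otherwise by comparing
  the energies of \<open>u\<close> and \<open>c \<mu>\<^sub>p\<close> between level sets.
\<close>

section \<open>The flux and weak solutions\<close>

text \<open>The argument uses no regularity theory: no Harnack inequality, no pointwise gradient
  estimate, nothing beyond the C1 hypothesis. Three things follow. Strictness in a comparison comes
  from multiplying one solution by t < 1, which works because \<open>q > p - 1\<close>, but only
  where the gradient is nonzero; critical points are the real obstacle, and sliding one function
  over the other is the way around them. Reflection stands in for Harnack: the additive error is a
  bound for \<open>u\<close> on one fixed outer sphere, hence negligible against everything that
  blows up at the origin. Finally, convergence of \<open>u x / mu p x\<close> says nothing about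
  gradients, so the mass cannot be read off from the flux through small spheres; energies between
  level sets need only the ratio of the two functions. Subcriticality enters as positivity of the
  exponent \<theta>, which lets the free constant \<open>A\<close> dominate near the origin, and as
  integrability of |grad mu_p|^q.\<close>

definition flux :: "real \<Rightarrow> 'a::euclidean_space \<Rightarrow> 'a" where
  "flux p a = norm a powr (p - 2) *\<^sub>R a"

lemma norm_flux: "norm (flux p a) = norm a powr (p - 1)"
proof (cases "a = 0")
  case False
  then have "norm a powr (p - 2) * norm a powr 1 = norm a powr (p - 1)"
    unfolding powr_add [symmetric] by simp
  with False show ?thesis by (simp add: flux_def)
qed (simp add: flux_def)

lemma flux_inner: "flux p a \<bullet> a = norm a powr p"
proof (cases "a = 0")
  case False
  then have "norm a powr (p - 2) * norm a powr 2 = norm a powr p"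
    unfolding powr_add [symmetric] by simp
  with False show ?thesis
    by (simp add: flux_def power2_norm_eq_inner [symmetric] powr_numeral)
qed (simp add: flux_def)

lemma flux_scale: "0 < t \<Longrightarrow> flux p (t *\<^sub>R a) = t powr (p - 1) *\<^sub>R flux p a"
proof (goal_cases)
  case 1
  then have "t powr (p - 2) * t powr 1 = t powr (p - 1)"
    unfolding powr_add [symmetric] by simp
  with 1 show ?case by (simp add: flux_def powr_mult algebra_simps)
qed

lemma flux_minus [simp]: "flux p (- a) = - flux p a"
  by (simp add: flux_def)

lemma flux_0 [simp]: "flux p 0 = 0"
  by (simp add: flux_def)

lemma flux_inner_le: "flux p a \<bullet> b \<le> norm a powr (p - 1) * norm b"
  using norm_cauchy_schwarz [of "flux p a" b] by (simp add: norm_flux)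

text \<open>Expanding the product and applying Cauchy-Schwarz to the two mixed terms leaves a
  product of differences of norms. Besides monotonicity this gives a quantitative gain whenever the
  two norms differ by a fixed factor, which is what \<open>touch_pointwise\<close> uses.\<close>

lemma flux_mono_strong:
  "(norm a powr (p - 1) - norm b powr (p - 1)) * (norm a - norm b) \<le> (flux p a - flux p b) \<bullet> (a - b)"
proof -
  have *: "norm c powr (p - 1) * norm c = norm c powr p" for c :: 'a
    using powr_add [of "norm c" "p - 1" 1] by (cases "c = 0") auto
  have "(flux p a - flux p b) \<bullet> (a - b) = norm a powr p + norm b powr p - flux p a \<bullet> b - flux p b \<bullet> a"
    by (simp add: inner_diff_left inner_diff_right flux_inner)
  with flux_inner_le [of p a b] flux_inner_le [of p b a] *[of a] *[of b] show ?thesis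
    by (simp add: algebra_simps)
qed

lemma flux_mono: "1 < p \<Longrightarrow> 0 \<le> (flux p a - flux p b) \<bullet> (a - b)"
proof (goal_cases)
  case 1
  have "0 \<le> (norm a powr (p - 1) - norm b powr (p - 1)) * (norm a - norm b)"
    using 1 by (cases "norm a \<le> norm b") (auto simp: mult_nonneg_nonneg mult_nonpos_nonpos powr_mono2)
  with flux_mono_strong show ?case by (rule order_trans [rotated])
qed

lemma continuous_on_flux: "1 < p \<Longrightarrow> continuous_on S (flux p)"
proof -
  assume p: "1 < p"
  have "isCont (flux p) a" for a :: 'a
  proof (cases "a = 0")
    case True
    \<comment> \<open>For p < 2 the factor \<open>norm a powr (p - 2)\<close> is unbounded near 0;
      continuity there rests on the norm of the whole product.\<close>
    have "((\<lambda>x::'a. norm x powr (p - 1)) \<longlongrightarrow> 0) (at 0)"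
      using p by (auto intro!: tendsto_eq_intros)
    then have "((\<lambda>x::'a. norm (flux p x)) \<longlongrightarrow> 0) (at 0)"
      by (simp add: norm_flux)
    then show ?thesis
      using True by (simp add: isCont_def tendsto_norm_zero_cancel)
  next
    case False
    then show ?thesis unfolding flux_def by (intro continuous_intros) auto
  qed
  then show ?thesis by (simp add: continuous_at_imp_continuous_on)
qed

lemma continuous_on_flux_comp:
  "1 < p \<Longrightarrow> continuous_on S D \<Longrightarrow> continuous_on S (\<lambda>x. flux p (D x))"
  by (rule continuous_on_compose2 [OF continuous_on_flux]) auto

section \<open>Continuously differentiable functions carried together with their gradient\<close>

definition C1_on :: "'a::euclidean_space set \<Rightarrow> ('a \<Rightarrow> real) \<Rightarrow> ('a \<Rightarrow> 'a) \<Rightarrow> bool" where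
  "C1_on U f D \<longleftrightarrow> (\<forall>x\<in>U. GDERIV f x :> D x) \<and> continuous_on U D"

lemma C1_on_grad: "C1_on U f D \<Longrightarrow> x \<in> U \<Longrightarrow> grad f x = D x"
  by (auto simp: C1_on_def intro: grad_eqI)

lemma C1_on_subset: "C1_on U f D \<Longrightarrow> V \<subseteq> U \<Longrightarrow> C1_on V f D"
  by (auto simp: C1_on_def intro: continuous_on_subset)

lemma GDERIV_isCont: "GDERIV f x :> D \<Longrightarrow> isCont f x"
  unfolding gderiv_def by (rule has_derivative_continuous)

lemma C1_on_continuous: "C1_on U f D \<Longrightarrow> continuous_on U f"
  by (auto simp: C1_on_def intro!: continuous_at_imp_continuous_on GDERIV_isCont)

lemma GDERIV_transform_open:
  assumes "GDERIV f x :> D" "open S" "x \<in> S" "\<And>y. y \<in> S \<Longrightarrow> f y = g y"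
  shows "GDERIV g x :> D"
  using has_derivative_transform_within_open [of f _ x UNIV S g] assms unfolding gderiv_def by simp

lemma C1_on_cong:
  assumes "C1_on U f D" "open U" "\<And>x. x \<in> U \<Longrightarrow> f x = g x" "\<And>x. x \<in> U \<Longrightarrow> D x = E x"
  shows "C1_on U g E"
proof -
  have "GDERIV g x :> E x" if "x \<in> U" for x
    using assms that GDERIV_transform_open [of f x "D x" U g] by (auto simp: C1_on_def)
  moreover have "continuous_on U E"
    using assms(1,4) by (auto simp: C1_on_def intro: continuous_on_eq)
  ultimately show ?thesis by (simp add: C1_on_def)
qed

lemma GDERIV_unique:
  fixes f :: "'a::euclidean_space \<Rightarrow> real"
  assumes "GDERIV f x :> D" "GDERIV f x :> E"
  shows "D = E"
  using grad_eqI [OF assms(1)] grad_eqI [OF assms(2)] by simp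

lemma C1_on_add: "C1_on U f D \<Longrightarrow> C1_on U g E \<Longrightarrow> C1_on U (\<lambda>x. f x + g x) (\<lambda>x. D x + E x)"
  by (auto simp: C1_on_def intro!: GDERIV_add continuous_intros)

lemma C1_on_diff: "C1_on U f D \<Longrightarrow> C1_on U g E \<Longrightarrow> C1_on U (\<lambda>x. f x - g x) (\<lambda>x. D x - E x)"
  by (auto simp: C1_on_def intro!: GDERIV_diff continuous_intros)

lemma C1_on_const: "C1_on U (\<lambda>x. c) (\<lambda>x. 0)"
  by (auto simp: C1_on_def intro!: GDERIV_const)

lemma C1_on_mult:
  assumes "C1_on U f D" "C1_on U g E"
  shows "C1_on U (\<lambda>x. f x * g x) (\<lambda>x. f x *\<^sub>R E x + g x *\<^sub>R D x)"
  using assms C1_on_continuous [OF assms(1)] C1_on_continuous [OF assms(2)]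
  by (auto simp: C1_on_def intro!: GDERIV_mult continuous_intros)

lemma C1_on_cmult: "C1_on U f D \<Longrightarrow> C1_on U (\<lambda>x. c * f x) (\<lambda>x. c *\<^sub>R D x)"
  using C1_on_mult [OF C1_on_const [of U c], of f D] by simp

lemma C1_on_compose:
  assumes "C1_on U f D" "\<And>x. x \<in> U \<Longrightarrow> (h has_real_derivative h' (f x)) (at (f x))"
    and "continuous_on (f ` U) h'"
  shows "C1_on U (\<lambda>x. h (f x)) (\<lambda>x. h' (f x) *\<^sub>R D x)"
proof -
  have "continuous_on U (\<lambda>x. h' (f x))"
    using continuous_on_compose2 [OF assms(3) C1_on_continuous [OF assms(1)]] by auto
  with assms(1,2) show ?thesis
    by (auto simp: C1_on_def intro!: continuous_intros GDERIV_DERIV_compose [where f = f and g = h])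
qed

text \<open>Test functions are only C1, because the decisive ones are truncations and powers of the
  solutions themselves. The passage between these and smooth test functions is made once, by
  mollification.\<close>

definition C1c :: "'a::euclidean_space set \<Rightarrow> ('a \<Rightarrow> real) \<Rightarrow> ('a \<Rightarrow> 'a) \<Rightarrow> bool" where
  "C1c U \<phi> D \<longleftrightarrow> C1_on UNIV \<phi> D \<and> (\<exists>K. compact K \<and> K \<subseteq> U \<and> (\<forall>x. x \<notin> K \<longrightarrow> \<phi> x = 0))"

lemma C1_on_zero_off:
  assumes "C1_on U f D" "open U" "closed K" "\<And>x. x \<in> U - K \<Longrightarrow> f x = 0" "x \<in> U - K"
  shows "D x = 0"
proof -
  have "GDERIV f x :> D x" using assms by (auto simp: C1_on_def)
  moreover have "GDERIV f x :> 0"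
    by (rule GDERIV_transform_open [OF GDERIV_const [of 0], where S = "U - K"])
       (use assms in \<open>auto simp: open_Diff\<close>)
  ultimately show ?thesis by (rule GDERIV_unique)
qed

lemma C1cE:
  assumes "C1c U \<phi> D"
  obtains K where "compact K" "K \<subseteq> U" "\<And>x. x \<notin> K \<Longrightarrow> \<phi> x = 0" "\<And>x. x \<notin> K \<Longrightarrow> D x = 0"
    "continuous_on UNIV \<phi>" "continuous_on UNIV D"
proof -
  from assms obtain K where K: "compact K" "K \<subseteq> U" "\<forall>x. x \<notin> K \<longrightarrow> \<phi> x = 0" and C: "C1_on UNIV \<phi> D"
    by (auto simp: C1c_def)
  have "D x = 0" if "x \<notin> K" for x
    by (rule C1_on_zero_off [OF C open_UNIV compact_imp_closed [OF K(1)]]) (use K that in auto)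
  with K that C C1_on_continuous [OF C] show ?thesis by (auto simp: C1_on_def)
qed

text \<open>\<open>U\<close> and the complement of \<open>K\<close> are open and cover the space,
  and the extended function is visibly C1 on each of them.\<close>

lemma C1c_extend:
  assumes f: "C1_on U f D" and U: "open U" and K: "compact K" "K \<subseteq> U" "\<And>x. x \<in> U - K \<Longrightarrow> f x = 0"
    and V: "K \<subseteq> V"
  shows "C1c V (\<lambda>x. if x \<in> U then f x else 0) (\<lambda>x. if x \<in> U then D x else 0)"
proof -
  have clK: "closed K" using K by (simp add: compact_imp_closed)
  have D0: "x \<in> U - K \<Longrightarrow> D x = 0" for x
    using C1_on_zero_off [OF f U clK K(3)] by blast
  have cover: "UNIV = U \<union> (- K)" using K by auto
  have "GDERIV (\<lambda>x. if x \<in> U then f x else 0) x :> (if x \<in> U then D x else 0)" for x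
  proof (cases "x \<in> U")
    case True
    then show ?thesis
      using f U by (auto simp: C1_on_def intro: GDERIV_transform_open [where S = U])
  next
    case False
    then have "x \<in> - K" using K by auto
    then have "GDERIV (\<lambda>x. if x \<in> U then f x else 0) x :> 0"
      using clK K(3) by (intro GDERIV_transform_open [OF GDERIV_const [of 0], where S = "- K"]) (auto simp: open_Compl)
    with False show ?thesis by simp
  qed
  moreover have "continuous_on (U \<union> (- K)) (\<lambda>x. if x \<in> U then D x else 0)"
  proof (rule continuous_on_open_Un)
    show "continuous_on U (\<lambda>x. if x \<in> U then D x else 0)"
      using f by (auto simp: C1_on_def cong: continuous_on_cong)
    show "continuous_on (- K) (\<lambda>x. if x \<in> U then D x else 0)"
      by (rule continuous_on_eq [OF continuous_on_const [of _ 0]]) (use D0 in auto)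
  qed (use U clK in \<open>auto simp: open_Compl\<close>)
  ultimately have "C1_on UNIV (\<lambda>x. if x \<in> U then f x else 0) (\<lambda>x. if x \<in> U then D x else 0)"
    using cover by (auto simp: C1_on_def)
  then show ?thesis using K V by (auto simp: C1c_def)
qed

lemma C1c_mono: "C1c U \<phi> D \<Longrightarrow> U \<subseteq> V \<Longrightarrow> C1c V \<phi> D"
  unfolding C1c_def by blast

lemma C1c_mult:
  assumes "C1c U \<phi> D" "C1_on UNIV f E"
  shows "C1c U (\<lambda>x. f x * \<phi> x) (\<lambda>x. f x *\<^sub>R D x + \<phi> x *\<^sub>R E x)"
proof -
  from assms(1) obtain K where K: "C1_on UNIV \<phi> D" "compact K" "K \<subseteq> U" "\<forall>x. x \<notin> K \<longrightarrow> \<phi> x = 0"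
    unfolding C1c_def by blast
  have "\<forall>x. x \<notin> K \<longrightarrow> f x * \<phi> x = 0" using K(4) by simp
  with C1_on_mult [OF assms(2) K(1)] K(2,3) show ?thesis unfolding C1c_def by blast
qed

lemma integrable_compact_support:
  fixes h :: "'a::euclidean_space \<Rightarrow> 'b::{banach, second_countable_topology}"
  assumes "compact K" "continuous_on K h" "\<And>x. x \<notin> K \<Longrightarrow> h x = 0"
  shows "integrable lborel h"
proof -
  have "integrable lborel (\<lambda>x. indicator K x *\<^sub>R h x)"
    by (rule borel_integrable_compact [OF assms(1,2)])
  moreover have "(\<lambda>x. indicator K x *\<^sub>R h x) = h"
    using assms(3) by (auto simp: indicator_def fun_eq_iff)
  ultimately show ?thesis by simp
qed

text \<open>Encodes - div F + g = m \<delta> against C1 test functions. No integrability is built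
  in, and a Bochner integral that does not exist is 0; so integrability is always supplied
  separately, by continuity on \<open>U\<close> or by \<open>L1_loc\<close>.\<close>

definition weak_eq :: "'a::euclidean_space set \<Rightarrow> ('a \<Rightarrow> 'a) \<Rightarrow> ('a \<Rightarrow> real) \<Rightarrow> real \<Rightarrow> bool" where
  "weak_eq U F g m \<longleftrightarrow>
     (\<forall>\<phi> D. C1c U \<phi> D \<longrightarrow> (LINT x|lborel. F x \<bullet> D x + g x * \<phi> x) = m * \<phi> 0)"

lemma weak_eq_subset: "weak_eq U F g m \<Longrightarrow> V \<subseteq> U \<Longrightarrow> weak_eq V F g m"
  unfolding weak_eq_def using C1c_mono by metis

lemma weak_eq_cong:
  assumes "weak_eq U F g m" "\<And>x. x \<in> U \<Longrightarrow> F x = F' x" "\<And>x. x \<in> U \<Longrightarrow> g x = g' x"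
  shows "weak_eq U F' g' m"
  unfolding weak_eq_def
proof (intro allI impI)
  fix \<phi> D assume C: "C1c U \<phi> D"
  from C obtain K where K: "K \<subseteq> U" "\<And>x. x \<notin> K \<Longrightarrow> \<phi> x = 0" "\<And>x. x \<notin> K \<Longrightarrow> D x = 0"
    by (rule C1cE) blast
  have "F' x \<bullet> D x + g' x * \<phi> x = F x \<bullet> D x + g x * \<phi> x" for x
    using assms(2,3) K by (cases "x \<in> K") (auto simp: subset_iff)
  then show "(LINT x|lborel. F' x \<bullet> D x + g' x * \<phi> x) = m * \<phi> 0"
    using assms(1) C by (simp add: weak_eq_def)
qed

lemma weak_eq_scale:
  assumes "weak_eq U F g m"
  shows "weak_eq U (\<lambda>x. c *\<^sub>R F x) (\<lambda>x. c * g x) (c * m)"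
proof -
  have "(LINT x|lborel. (c *\<^sub>R F x) \<bullet> D x + c * g x * \<phi> x) = c * (LINT x|lborel. F x \<bullet> D x + g x * \<phi> x)"
    for D \<phi> by (subst integral_mult_right_zero [symmetric]) (simp add: algebra_simps)
  with assms show ?thesis unfolding weak_eq_def by auto
qed

lemma weak_integrable:
  fixes F :: "'a::euclidean_space \<Rightarrow> 'a" and g :: "'a \<Rightarrow> real"
  assumes "continuous_on U F" "continuous_on U g" "C1c U \<phi> D"
  shows "integrable lborel (\<lambda>x. F x \<bullet> D x)" "integrable lborel (\<lambda>x. g x * \<phi> x)"
    "integrable lborel (\<lambda>x. F x \<bullet> D x + g x * \<phi> x)"
proof -
  from assms(3) obtain K where K: "compact K" "K \<subseteq> U" "\<And>x. x \<notin> K \<Longrightarrow> \<phi> x = 0" "\<And>x. x \<notin> K \<Longrightarrow> D x = 0"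
    "continuous_on UNIV \<phi>" "continuous_on UNIV D"
    by (rule C1cE) blast
  have c: "continuous_on K F" "continuous_on K g" "continuous_on K \<phi>" "continuous_on K D"
    using assms K by (auto intro: continuous_on_subset)
  show *: "integrable lborel (\<lambda>x. F x \<bullet> D x)" "integrable lborel (\<lambda>x. g x * \<phi> x)"
    using c K by (auto intro!: integrable_compact_support [of K] continuous_intros)
  then show "integrable lborel (\<lambda>x. F x \<bullet> D x + g x * \<phi> x)" by simp
qed

lemma uniformly_continuous_compact_support:
  fixes f :: "'a::euclidean_space \<Rightarrow> 'b::real_normed_vector"
  assumes "continuous_on UNIV f" "compact K" "\<And>x. x \<notin> K \<Longrightarrow> f x = 0"
  shows "uniformly_continuous_on UNIV f"
  unfolding uniformly_continuous_on_def
proof (intro allI impI)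
  fix e :: real assume "0 < e"
  obtain R where R: "K \<subseteq> cball 0 R"
    using compact_imp_bounded [OF assms(2)] by (metis bounded_iff mem_cball_0 subsetI)
  have "uniformly_continuous_on (cball 0 (R + 1)) f"
    by (intro compact_uniformly_continuous continuous_on_subset [OF assms(1)]) auto
  then obtain d where d: "0 < d"
      "\<And>x y. x \<in> cball 0 (R + 1) \<Longrightarrow> y \<in> cball 0 (R + 1) \<Longrightarrow> dist y x < d \<Longrightarrow> dist (f y) (f x) < e"
    using \<open>0 < e\<close> unfolding uniformly_continuous_on_def by metis
  show "\<exists>d>0. \<forall>x\<in>UNIV. \<forall>y\<in>UNIV. dist y x < d \<longrightarrow> dist (f y) (f x) < e"
  proof (intro exI [of _ "min d 1"] conjI ballI impI)
    fix x y :: 'a assume xy: "dist y x < min d 1"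
    show "dist (f y) (f x) < e"
    proof (cases "x \<in> K \<or> y \<in> K")
      case True
      have "norm x \<le> norm y + dist y x" "norm y \<le> norm x + dist y x"
        using norm_triangle_ineq2 [of x y] norm_triangle_ineq2 [of y x]
        by (auto simp: dist_norm norm_minus_commute)
      moreover have "norm x \<le> R \<or> norm y \<le> R"
        using R True by (auto simp: subset_iff)
      ultimately have "x \<in> cball 0 (R + 1)" "y \<in> cball 0 (R + 1)"
        using xy by auto
      then show ?thesis using d(2) xy by simp
    next
      case False
      with assms(3) \<open>0 < e\<close> show ?thesis by simp
    qed
  qed (use d in simp)
qed

text \<open>The remainder is uniform in x because D is uniformly continuous. This takes the place of
  differentiation under the integral sign, both for integrating by parts and for
  convolutions.\<close>

lemma C1c_uniform_diff:
  assumes "C1c UNIV \<phi> D" "0 < \<epsilon>"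
  shows "\<exists>\<delta>>0. \<forall>x h. norm h < \<delta> \<longrightarrow> \<bar>\<phi> (x + h) - \<phi> x - h \<bullet> D x\<bar> \<le> \<epsilon> * norm h"
proof -
  from assms(1) obtain K where K: "compact K" "\<And>x. x \<notin> K \<Longrightarrow> D x = 0" "continuous_on UNIV D"
    by (rule C1cE) blast
  have "uniformly_continuous_on UNIV D"
    by (rule uniformly_continuous_compact_support [OF K(3,1,2)])
  then obtain d where d: "0 < d" "\<And>x y. dist y x < d \<Longrightarrow> dist (D y) (D x) < \<epsilon>"
    using \<open>0 < \<epsilon>\<close> unfolding uniformly_continuous_on_def by (metis UNIV_I)
  have der: "(\<phi> has_derivative (\<lambda>h. h \<bullet> D x)) (at x)" for x
    using assms(1) by (auto simp: C1c_def C1_on_def gderiv_def)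
  show ?thesis
  proof (intro exI [of _ d] conjI allI impI d(1))
    fix x h :: 'a assume h: "norm h < d"
    have "norm (\<phi> (x + h) - \<phi> x - (x + h - x) \<bullet> D x) \<le> norm (x + h - x) * \<epsilon>"
    proof (rule differentiable_bound_linearization [where S = "ball x d" and f' = "\<lambda>x h. h \<bullet> D x"])
      show "x + t *\<^sub>R (x + h - x) \<in> ball x d" if "t \<in> {0..1}" for t
      proof -
        have "t * norm h \<le> 1 * norm h" using that by (intro mult_right_mono) auto
        then show ?thesis using h that by (simp add: dist_norm)
      qed
      show "(\<phi> has_derivative (\<lambda>h. h \<bullet> D y)) (at y within ball x d)" for y
        using der has_derivative_at_withinI by blast
      show "onorm ((\<lambda>h. h \<bullet> D y) - (\<lambda>h. h \<bullet> D x)) \<le> \<epsilon>" if "y \<in> ball x d" for y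
        unfolding fun_diff_def
      proof (rule onorm_le)
        fix k :: 'a
        have "dist (D y) (D x) < \<epsilon>" using d(2) [of y x] that by (simp add: dist_commute)
        then have "norm k * norm (D y - D x) \<le> norm k * \<epsilon>" by (intro mult_left_mono) (auto simp: dist_norm)
        then show "norm (k \<bullet> D y - k \<bullet> D x) \<le> \<epsilon> * norm k"
          using Cauchy_Schwarz_ineq2 [of k "D y - D x"] by (simp add: inner_diff_right mult.commute)
      qed
    qed (use d in auto)
    then show "\<bar>\<phi> (x + h) - \<phi> x - h \<bullet> D x\<bar> \<le> \<epsilon> * norm h" by (simp add: mult.commute)
  qed
qed

section \<open>Translation invariance and integration by parts\<close>

lemma lborel_integral_shift:
  fixes f :: "'a::euclidean_space \<Rightarrow> 'b::{banach, second_countable_topology}"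
  assumes "f \<in> borel_measurable borel"
  shows "(LINT x|lborel. f (a + x)) = (LINT x|lborel. f x)"
  using assms by (subst (2) lborel_distr_plus [symmetric, of a]) (simp add: integral_distr)

lemma C1c_measurable:
  assumes "C1c U \<phi> D"
  shows "\<phi> \<in> borel_measurable borel" "D \<in> borel_measurable borel"
proof -
  have "continuous_on UNIV \<phi>" "continuous_on UNIV D"
    using assms by (rule C1cE, blast)+
  then show "\<phi> \<in> borel_measurable borel" "D \<in> borel_measurable borel"
    by (auto intro: borel_measurable_continuous_onI)
qed

text \<open>Translation does not change the integral of \<phi>, so the integral of its difference
  quotient in direction e vanishes; the quotient differs from the directional derivative by a
  uniformly small error on a fixed ball.\<close>

lemma C1c_integral_partial:
  assumes "C1c UNIV \<phi> D"
  shows "(LINT x|lborel. D x \<bullet> e) = 0"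
proof -
  from assms obtain K where K: "compact K" "\<And>x. x \<notin> K \<Longrightarrow> \<phi> x = 0" "\<And>x. x \<notin> K \<Longrightarrow> D x = 0"
    "continuous_on UNIV \<phi>" "continuous_on UNIV D"
    by (rule C1cE) blast
  obtain R where R: "K \<subseteq> cball 0 R"
    using compact_imp_bounded [OF K(1)] by (metis bounded_iff mem_cball_0 subsetI)
  define V where "V = measure lborel (cball (0::'a) (R + norm e))"
  have intD: "integrable lborel (\<lambda>x. D x \<bullet> e)"
    by (rule integrable_compact_support [OF K(1)])
       (use K in \<open>auto intro!: continuous_intros intro: continuous_on_subset\<close>)
  have intphi: "integrable lborel \<phi>"
    by (rule integrable_compact_support [OF K(1)])
       (use K in \<open>auto intro: continuous_on_subset\<close>)
  have main: "\<bar>LINT x|lborel. D x \<bullet> e\<bar> \<le> \<epsilon> * (norm e * V)" if \<epsilon>: "0 < \<epsilon>" for \<epsilon>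
  proof -
    from C1c_uniform_diff [OF assms \<epsilon>] obtain \<delta> where \<delta>: "0 < \<delta>"
      "\<And>x h. norm h < \<delta> \<Longrightarrow> \<bar>\<phi> (x + h) - \<phi> x - h \<bullet> D x\<bar> \<le> \<epsilon> * norm h" by blast
    \<comment> \<open>t <= 1 keeps the supports of all translates in the ball of radius
      \<open>R + norm e\<close>; the denominator \<open>norm e + 1\<close> also covers e =
      0.\<close>
    define t where "t = min 1 (\<delta> / 2 / (norm e + 1))"
    have n1: "0 < norm e + 1" by (simp add: add_nonneg_pos)
    have t: "0 < t" "t \<le> 1" using \<delta>(1) n1 by (auto simp: t_def)
    have "t * (norm e + 1) \<le> (\<delta> / 2 / (norm e + 1)) * (norm e + 1)"
      using n1 by (intro mult_right_mono) (auto simp: t_def)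
    moreover have "(\<delta> / 2 / (norm e + 1)) * (norm e + 1) = \<delta> / 2"
      using n1 by (intro nonzero_eq_divide_eq [THEN iffD1]) auto
    ultimately have "t * (norm e + 1) \<le> \<delta> / 2" by (rule ord_le_eq_trans)
    then have "t * norm e + t \<le> \<delta> / 2" by (simp only: distrib_left mult_1_right)
    moreover have "norm (t *\<^sub>R e) = t * norm e" using t by simp
    ultimately have te: "norm (t *\<^sub>R e) < \<delta>" using t \<delta>(1) by linarith
    define q where "q = (\<lambda>x. \<phi> (t *\<^sub>R e + x) - \<phi> x - t * (D x \<bullet> e))"
    have m: "(\<lambda>x. \<phi> (t *\<^sub>R e + x)) \<in> borel_measurable borel"
      using C1c_measurable(1) [OF assms] by measurable
    have int1: "integrable lborel (\<lambda>x. \<phi> (t *\<^sub>R e + x))"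
      using intphi C1c_measurable(1) [OF assms] m
      by (subst (asm) lborel_distr_plus [symmetric, of "t *\<^sub>R e"]) (simp add: integrable_distr_eq)
    have "(LINT x|lborel. q x) = (LINT x|lborel. \<phi> (t *\<^sub>R e + x)) - (LINT x|lborel. \<phi> x) - t * (LINT x|lborel. D x \<bullet> e)"
      unfolding q_def using int1 intphi intD by simp
    also have "\<dots> = - t * (LINT x|lborel. D x \<bullet> e)"
      using lborel_integral_shift [OF C1c_measurable(1) [OF assms]] by simp
    finally have q1: "\<bar>LINT x|lborel. q x\<bar> = t * \<bar>LINT x|lborel. D x \<bullet> e\<bar>"
      using t by (simp add: abs_mult)
    have intq: "integrable lborel q" unfolding q_def using int1 intphi intD by simp
    have q0: "\<bar>q x\<bar> \<le> indicator (cball 0 (R + norm e)) x * (\<epsilon> * (t * norm e))" for x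
    proof (cases "x \<in> cball 0 (R + norm e)")
      case True
      then show ?thesis using \<delta>(2) [OF te, of x] t
        by (simp add: q_def algebra_simps inner_commute)
    next
      case False
      have "norm (x::'a) \<le> norm (t *\<^sub>R e + x) + t * norm e"
        using norm_triangle_ineq4 [of "t *\<^sub>R e + x" "t *\<^sub>R e"] t by simp
      moreover have "t * norm e \<le> norm e" using t by (simp add: mult_left_le_one_le)
      moreover have "R + norm e < norm x" using False by simp
      ultimately have "R < norm x" "R < norm (t *\<^sub>R e + x)"
        using norm_ge_zero [of e] by linarith+
      then have "x \<notin> K" "t *\<^sub>R e + x \<notin> K" using R by (auto simp: subset_iff)
      then have "q x = 0" using K by (simp add: q_def)
      then show ?thesis using t \<epsilon> by simp
    qed
    have "\<bar>LINT x|lborel. q x\<bar> \<le> (LINT x|lborel. \<bar>q x\<bar>)"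
      using integral_norm_bound [of lborel q] by simp
    also have "\<dots> \<le> (LINT x|lborel. indicator (cball (0::'a) (R + norm e)) x * (\<epsilon> * (t * norm e)))"
    proof (rule Bochner_Integration.integral_mono)
      show "integrable lborel (\<lambda>x::'a. indicator (cball 0 (R + norm e)) x * (\<epsilon> * (t * norm e)))"
        by (intro integrable_mult_left integrable_real_indicator) (use emeasure_lborel_cball_finite in auto)
    qed (use intq q0 in auto)
    also have "\<dots> = V * (\<epsilon> * (t * norm e))"
      by (simp add: V_def)
    finally have "t * \<bar>LINT x|lborel. D x \<bullet> e\<bar> \<le> t * (\<epsilon> * (norm e * V))"
      using q1 by (simp add: algebra_simps)
    then show ?thesis using t by simp
  qed
  have "\<bar>LINT x|lborel. D x \<bullet> e\<bar> \<le> 0"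
  proof (rule field_le_epsilon)
    fix d :: real assume d: "0 < d"
    have nn: "0 \<le> norm e * V" by (simp add: V_def)
    have "\<bar>LINT x|lborel. D x \<bullet> e\<bar> \<le> d / (norm e * V + 1) * (norm e * V)"
      by (rule main) (use d nn in simp)
    also have "\<dots> \<le> d" using d nn by (simp add: field_simps)
    finally show "\<bar>LINT x|lborel. D x \<bullet> e\<bar> \<le> 0 + d" by simp
  qed
  then show ?thesis by simp
qed

text \<open>\<open>weak_eq\<close> carries the sign of - div, so here g is + div G. The identity is
  the sum over coordinates of the vanishing integrals of partial derivatives of
  \<open>(G x \<bullet> e) * \<phi> x\<close>.\<close>

lemma weak_eq_div:
  fixes G :: "'a::euclidean_space \<Rightarrow> 'a"
  assumes U: "open U" and G: "\<And>e. e \<in> Basis \<Longrightarrow> C1_on U (\<lambda>x. G x \<bullet> e) (DG e)"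
  shows "weak_eq U G (\<lambda>x. \<Sum>e\<in>Basis. DG e x \<bullet> e) 0"
  unfolding weak_eq_def
proof (intro allI impI)
  fix \<phi> D assume C: "C1c U \<phi> D"
  from C obtain K where K: "compact K" "K \<subseteq> U" "\<And>x. x \<notin> K \<Longrightarrow> \<phi> x = 0" "\<And>x. x \<notin> K \<Longrightarrow> D x = 0"
    by (rule C1cE) blast
  have CU: "C1_on U \<phi> D" using C by (auto simp: C1c_def intro: C1_on_subset)
  have eq: "(\<lambda>x. (G x \<bullet> e) * (D x \<bullet> e) + \<phi> x * (DG e x \<bullet> e)) =
      (\<lambda>x. (if x \<in> U then (G x \<bullet> e) *\<^sub>R D x + \<phi> x *\<^sub>R DG e x else 0) \<bullet> e)" for e
  proof
    fix x
    show "(G x \<bullet> e) * (D x \<bullet> e) + \<phi> x * (DG e x \<bullet> e) =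
      (if x \<in> U then (G x \<bullet> e) *\<^sub>R D x + \<phi> x *\<^sub>R DG e x else 0) \<bullet> e"
      using K(2) K(3) [of x] K(4) [of x] by (cases "x \<in> K") (auto simp: inner_add_left)
  qed
  have C': "C1c UNIV (\<lambda>x. if x \<in> U then (G x \<bullet> e) * \<phi> x else 0)
            (\<lambda>x. if x \<in> U then (G x \<bullet> e) *\<^sub>R D x + \<phi> x *\<^sub>R DG e x else 0)" if "e \<in> Basis" for e
    by (rule C1c_extend [OF C1_on_mult [OF G [OF that] CU] U K(1,2)]) (use K in auto)
  have z: "(LINT x|lborel. (G x \<bullet> e) * (D x \<bullet> e) + \<phi> x * (DG e x \<bullet> e)) = 0" if "e \<in> Basis" for e
    unfolding eq by (rule C1c_integral_partial [OF C' [OF that]])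
  have i: "integrable lborel (\<lambda>x. (G x \<bullet> e) * (D x \<bullet> e) + \<phi> x * (DG e x \<bullet> e))" if e: "e \<in> Basis" for e
    unfolding eq using C' [OF e]
  proof (rule C1cE)
    fix L :: "'a set"
    assume L: "compact L" "\<And>x. x \<notin> L \<Longrightarrow> (if x \<in> U then (G x \<bullet> e) *\<^sub>R D x + \<phi> x *\<^sub>R DG e x else 0) = 0"
      and c: "continuous_on UNIV (\<lambda>x. if x \<in> U then (G x \<bullet> e) *\<^sub>R D x + \<phi> x *\<^sub>R DG e x else 0)"
    show "integrable lborel (\<lambda>x. (if x \<in> U then (G x \<bullet> e) *\<^sub>R D x + \<phi> x *\<^sub>R DG e x else 0) \<bullet> e)"
      by (rule integrable_compact_support [OF L(1)])
         (use L(2) in \<open>auto intro!: continuous_on_inner continuous_on_subset [OF c]\<close>)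
  qed
  have "(LINT x|lborel. G x \<bullet> D x + (\<Sum>e\<in>Basis. DG e x \<bullet> e) * \<phi> x)
      = (LINT x|lborel. (\<Sum>e\<in>Basis. (G x \<bullet> e) * (D x \<bullet> e) + \<phi> x * (DG e x \<bullet> e)))"
  proof (intro Bochner_Integration.integral_cong refl)
    fix x
    show "G x \<bullet> D x + (\<Sum>e\<in>Basis. DG e x \<bullet> e) * \<phi> x
      = (\<Sum>e\<in>Basis. (G x \<bullet> e) * (D x \<bullet> e) + \<phi> x * (DG e x \<bullet> e))"
      by (subst euclidean_inner) (simp add: sum.distrib sum_distrib_left mult.commute)
  qed
  also have "\<dots> = (\<Sum>e\<in>Basis. LINT x|lborel. (G x \<bullet> e) * (D x \<bullet> e) + \<phi> x * (DG e x \<bullet> e))"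
    by (rule Bochner_Integration.integral_sum) (rule i)
  also have "\<dots> = 0" using z by simp
  finally show "(LINT x|lborel. G x \<bullet> D x + (\<Sum>e\<in>Basis. DG e x \<bullet> e) * \<phi> x) = 0 * \<phi> 0" by simp
qed

section \<open>Radial functions and radial fields\<close>

lemma GDERIV_norm_shift:
  assumes "x \<noteq> y"
  shows "GDERIV (\<lambda>x. norm (x - y)) x :> sgn (x - y)"
proof -
  have "((\<lambda>x. x - y) has_derivative (\<lambda>h. h)) (at x)" by (auto intro!: derivative_eq_intros)
  then have "((\<lambda>x. norm (x - y)) has_derivative (\<lambda>h. h \<bullet> sgn (x - y))) (at x)"
    using GDERIV_norm [of "x - y"] assms unfolding gderiv_def
    by (intro has_derivative_compose [where f = "\<lambda>x. x - y" and g = norm]) auto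
  then show ?thesis by (simp add: gderiv_def)
qed

lemma C1_on_norm_shift:
  assumes "y \<notin> U"
  shows "C1_on U (\<lambda>x. norm (x - y)) (\<lambda>x. sgn (x - y))"
proof -
  have "continuous_on U (\<lambda>x. (x - y) /\<^sub>R norm (x - y))"
    using assms by (intro continuous_intros) auto
  then have "continuous_on U (\<lambda>x. sgn (x - y))" by (simp only: sgn_div_norm)
  then show ?thesis using assms GDERIV_norm_shift unfolding C1_on_def by metis
qed

lemma C1_on_radial:
  assumes "\<And>r. r \<in> I \<Longrightarrow> (h has_real_derivative h' r) (at r)" "continuous_on I h'" "I \<subseteq> {0<..}"
  shows "C1_on {x. norm (x - y) \<in> I} (\<lambda>x. h (norm (x - y))) (\<lambda>x. h' (norm (x - y)) *\<^sub>R sgn (x - y))"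
  by (rule C1_on_compose [OF C1_on_norm_shift]) (use assms in \<open>auto intro: continuous_on_subset\<close>)

lemma C1_on_linear: "C1_on U (\<lambda>x. (x - y) \<bullet> e) (\<lambda>x. e)"
  unfolding C1_on_def gderiv_def by (auto intro!: derivative_eq_intros)

lemma open_radial: "open I \<Longrightarrow> open {x::'a::euclidean_space. norm (x - y) \<in> I}"
  using open_vimage [of I "\<lambda>x. norm (x - y)"] by (simp add: vimage_def continuous_intros)

text \<open>The explicit solutions all come from this formula: mu_p, the Hopf barrier and the family
  w_A. With the field written as a radial factor times the linear x - y, each coordinate is a
  product of two simple C1 functions.\<close>

lemma weak_eq_radial:
  fixes y :: "'a::euclidean_space" and \<omega> :: "real \<Rightarrow> real"
  assumes "\<And>r. r \<in> I \<Longrightarrow> (\<omega> has_real_derivative \<omega>' r) (at r)" "continuous_on I \<omega>'" "I \<subseteq> {0<..}" "open I"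
  shows "weak_eq {x. norm (x - y) \<in> I} (\<lambda>x. \<omega> (norm (x - y)) *\<^sub>R (x - y))
      (\<lambda>x. norm (x - y) * \<omega>' (norm (x - y)) + real DIM('a) * \<omega> (norm (x - y))) 0"
proof -
  let ?U = "{x. norm (x - y) \<in> I}"
  have C: "C1_on ?U (\<lambda>x. (\<omega> (norm (x - y)) *\<^sub>R (x - y)) \<bullet> e)
     (\<lambda>x. \<omega> (norm (x - y)) *\<^sub>R e + ((x - y) \<bullet> e) *\<^sub>R (\<omega>' (norm (x - y)) *\<^sub>R sgn (x - y)))" for e
    using C1_on_mult [OF C1_on_radial [OF assms(1,2,3)] C1_on_linear, of y y e]
    by (simp add: algebra_simps)
  have "weak_eq ?U (\<lambda>x. \<omega> (norm (x - y)) *\<^sub>R (x - y))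
    (\<lambda>x. \<Sum>e\<in>Basis. (\<omega> (norm (x - y)) *\<^sub>R e + ((x - y) \<bullet> e) *\<^sub>R (\<omega>' (norm (x - y)) *\<^sub>R sgn (x - y))) \<bullet> e) 0"
    by (rule weak_eq_div [OF open_radial [OF assms(4)] C])
  moreover have "(\<Sum>e\<in>Basis. (\<omega> (norm (x - y)) *\<^sub>R e + ((x - y) \<bullet> e) *\<^sub>R (\<omega>' (norm (x - y)) *\<^sub>R sgn (x - y))) \<bullet> e)
    = norm (x - y) * \<omega>' (norm (x - y)) + real DIM('a) * \<omega> (norm (x - y))" for x
  proof -
    have "(\<Sum>e\<in>Basis. ((x - y) \<bullet> e) * (sgn (x - y) \<bullet> e)) = (x - y) \<bullet> sgn (x - y)"
      by (rule euclidean_inner [symmetric])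
    also have "\<dots> = norm (x - y)"
      by (cases "x = y") (simp_all add: sgn_div_norm divide_inverse [symmetric] power2_norm_eq_inner [symmetric] power2_eq_square)
    finally have "(\<Sum>e\<in>Basis. \<omega>' (norm (x - y)) * (((x - y) \<bullet> e) * (sgn (x - y) \<bullet> e))) = \<omega>' (norm (x - y)) * norm (x - y)"
      by (simp add: sum_distrib_left [symmetric])
    then show ?thesis
      by (simp add: inner_add_left sum.distrib mult_ac)
  qed
  ultimately show ?thesis by simp
qed

section \<open>Cutoff functions and truncations\<close>

text \<open>\<theta> is the antiderivative of a trapezoid \<tau>, hence a C1 truncation between the
  levels a and b. Knowing its height J up to 2 is enough, since b - a is made large wherever the
  height counts.\<close>

lemma smooth_step:
  fixes a b :: real
  assumes "a + 2 \<le> b"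
  obtains \<theta> \<tau> :: "real \<Rightarrow> real" and J where
    "\<And>s. (\<theta> has_real_derivative \<tau> s) (at s)" "continuous_on UNIV \<tau>"
    "\<And>s. 0 \<le> \<tau> s" "\<And>s. \<tau> s \<le> 1" "\<And>s. a + 1 \<le> s \<Longrightarrow> s \<le> b - 1 \<Longrightarrow> \<tau> s = 1"
    "\<And>s. s \<le> a \<Longrightarrow> \<tau> s = 0" "\<And>s. b \<le> s \<Longrightarrow> \<tau> s = 0"
    "\<And>s. s \<le> a \<Longrightarrow> \<theta> s = 0" "\<And>s. b \<le> s \<Longrightarrow> \<theta> s = J"
    "\<And>s. 0 \<le> \<theta> s" "\<And>s. \<theta> s \<le> J" "b - a - 2 \<le> J" "J \<le> b - a" "0 < J"
proof -
  define \<tau> where "\<tau> = (\<lambda>s. max 0 (min 1 (min (s - a) (b - s))))"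
  define \<theta> where "\<theta> = (\<lambda>s. integral {a..s} \<tau>)"
  have cont: "continuous_on S \<tau>" for S
    unfolding \<tau>_def by (intro continuous_intros)
  then have int: "\<tau> integrable_on {c..d}" for c d
    by (intro integrable_continuous_real)
  have \<tau>: "0 \<le> \<tau> s" "\<tau> s \<le> 1" for s by (auto simp: \<tau>_def)
  have zero_a: "\<tau> s = 0" if "s \<le> a" for s using that by (auto simp: \<tau>_def)
  have zero_b: "\<tau> s = 0" if "b \<le> s" for s using that by (auto simp: \<tau>_def)
  have \<theta>a: "\<theta> s = 0" if "s \<le> a" for s
    using that by (cases "s = a") (auto simp: \<theta>_def)
  have der: "(\<theta> has_real_derivative \<tau> s) (at s)" for s
  proof -
    \<comment> \<open>The integral from a says nothing about the derivative at s <= a. Starting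
      further left makes s an interior point, and \<tau> contributes nothing on the added
      piece.\<close>
    define c where "c = min (a - 1) (s - 1)"
    have "((\<lambda>u. integral {c..u} \<tau>) has_real_derivative \<tau> s) (at s within {c..s + 1})"
      using integral_has_real_derivative [OF cont, of s c "s + 1"] by (auto simp: c_def)
    moreover have "at s within {c..s + 1} = at s"
      by (rule at_within_interior) (auto simp: c_def)
    ultimately have d: "((\<lambda>u. integral {c..u} \<tau>) has_real_derivative \<tau> s) (at s)" by simp
    have "integral {c..u} \<tau> = \<theta> u" for u
    proof (cases "u \<le> a")
      case True
      have "integral {c..u} \<tau> = integral {c..u} (\<lambda>_. 0)"
        by (rule integral_cong) (use True zero_a in auto)
      then show ?thesis using \<theta>a True by simp
    next
      case False
      have "integral {c..a} \<tau> = integral {c..a} (\<lambda>_. 0)"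
        by (rule integral_cong) (use zero_a in auto)
      moreover have "integral {c..a} \<tau> + integral {a..u} \<tau> = integral {c..u} \<tau>"
        by (rule Henstock_Kurzweil_Integration.integral_combine) (use False int in \<open>auto simp: c_def\<close>)
      ultimately show ?thesis by (simp add: \<theta>_def)
    qed
    with d show ?thesis by simp
  qed
  define J where "J = \<theta> b"
  have mono: "\<theta> s \<le> \<theta> t" if "s \<le> t" for s t
    by (rule DERIV_nonneg_imp_nondecreasing [OF that]) (use der \<tau> in blast)
  have \<theta>b: "\<theta> s = J" if "b \<le> s" for s
  proof -
    have "\<theta> s \<le> \<theta> b"
      by (rule DERIV_nonpos_imp_nonincreasing [OF that]) (use der zero_b in \<open>metis order_refl\<close>)
    with mono [OF that] show ?thesis by (simp add: J_def)
  qed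
  have "(\<lambda>s. s - \<theta> s) a \<le> (\<lambda>s. s - \<theta> s) b"
  proof (rule DERIV_nonneg_imp_nondecreasing [where f = "\<lambda>s. s - \<theta> s"])
    show "\<exists>y. ((\<lambda>s. s - \<theta> s) has_real_derivative y) (at x) \<and> 0 \<le> y" for x
      by (rule exI [of _ "1 - \<tau> x"]) (use \<tau> in \<open>auto intro!: derivative_eq_intros der\<close>)
  qed (use assms in simp)
  then have J1: "J \<le> b - a" using \<theta>a [of a] by (simp add: J_def)
  have one: "\<tau> s = 1" if "a + 1 \<le> s" "s \<le> b - 1" for s using that by (auto simp: \<tau>_def)
  have "(\<lambda>s. \<theta> s - s) (a + 1) \<le> (\<lambda>s. \<theta> s - s) (b - 1)"
  proof (rule DERIV_nonneg_imp_nondecreasing [where f = "\<lambda>s. \<theta> s - s"])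
    show "\<exists>y. ((\<lambda>s. \<theta> s - s) has_real_derivative y) (at x) \<and> 0 \<le> y" if "a + 1 \<le> x" "x \<le> b - 1" for x
      by (rule exI [of _ "\<tau> x - 1"]) (use one [OF that] in \<open>auto intro!: derivative_eq_intros der\<close>)
  qed (use assms in simp)
  \<comment> \<open>This gives \<open>0 < J\<close> also in the borderline case b = a + 2, where the
    plateau of \<tau> is a single point.\<close>
  moreover have half: "1 / 4 \<le> \<theta> (a + 1)"
  proof -
    have t: "s - a = \<tau> s" if "a \<le> s" "s \<le> a + 1" for s using that assms by (auto simp: \<tau>_def)
    have "(\<lambda>s. \<theta> s - (s - a)\<^sup>2 / 2) a \<le> (\<lambda>s. \<theta> s - (s - a)\<^sup>2 / 2) (a + 1)"
    proof (rule DERIV_nonneg_imp_nondecreasing [where f = "\<lambda>s. \<theta> s - (s - a)\<^sup>2 / 2"])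
      show "\<exists>y. ((\<lambda>s. \<theta> s - (s - a)\<^sup>2 / 2) has_real_derivative y) (at x) \<and> 0 \<le> y"
        if "a \<le> x" "x \<le> a + 1" for x
        by (rule exI [of _ "\<tau> x - (x - a)"]) (use t [OF that] in \<open>auto intro!: derivative_eq_intros der\<close>)
    qed simp
    then show ?thesis using \<theta>a [of a] by simp
  qed
  ultimately have J2: "b - a - 2 < J" using mono [of "b - 1" b] by (simp add: J_def)
  have th0: "0 \<le> \<theta> s" for s using mono [of "min s a" s] \<theta>a [of "min s a"] by simp
  have thJ: "\<theta> s \<le> J" for s using mono [of s "max s b"] \<theta>b [of "max s b"] by simp
  show thesis
  proof (rule that [of \<theta> \<tau> J])
    show "b - a - 2 \<le> J" "0 < J" using J2 assms by simp_all
  qed (fact der cont \<tau> one zero_a zero_b \<theta>a \<theta>b th0 thJ J1)+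
qed

lemma integral_pos_continuous:
  fixes h :: "'a::euclidean_space \<Rightarrow> real"
  assumes "integrable lborel h" "\<And>x. 0 \<le> h x" "isCont h x0" "0 < h x0"
  shows "0 < (LINT x|lborel. h x)"
proof -
  obtain d where d: "0 < d" "\<And>y. dist y x0 < d \<Longrightarrow> dist (h y) (h x0) < h x0 / 2"
    using assms(3,4) unfolding continuous_at_eps_delta by (metis half_gt_zero)
  have ge: "indicator (ball x0 d) x * (h x0 / 2) \<le> h x" for x
  proof (cases "x \<in> ball x0 d")
    case True
    then have "dist (h x) (h x0) < h x0 / 2" by (intro d(2)) (simp add: dist_commute)
    then show ?thesis using True by (simp add: dist_real_def abs_if split: if_splits)
  qed (use assms(2) in auto)
  have "0 < measure lborel (ball x0 d)" using d(1) by (simp add: content_ball_pos)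
  then have "0 < measure lborel (ball x0 d) * (h x0 / 2)" using assms(4) by simp
  also have "\<dots> = (LINT x|lborel. indicator (ball x0 d) x * (h x0 / 2))" by simp
  also have "\<dots> \<le> (LINT x|lborel. h x)"
    by (intro Bochner_Integration.integral_mono assms(1) ge integrable_mult_left integrable_real_indicator)
       (use emeasure_lborel_ball_finite in auto)
  finally show ?thesis .
qed

text \<open>Near the pole the truncation is the constant J, since u exceeds b there, so it is C1
  across z; on the outer shell it is 0. Thus the solution itself, singular as it is, becomes a test
  function.\<close>

lemma truncation_C1c:
  fixes u :: "'a::euclidean_space \<Rightarrow> real"
  assumes u: "C1_on (ball z \<rho> - {z}) u D" and lim: "filterlim u at_top (at z)"
    and "0 < \<rho>'" "\<rho>' < \<rho>" and shell: "\<And>x. \<rho>' \<le> norm (x - z) \<Longrightarrow> norm (x - z) < \<rho> \<Longrightarrow> u x \<le> a"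
    and der: "\<And>s. (\<theta> has_real_derivative \<tau> s) (at s)" and cont: "continuous_on UNIV \<tau>"
    and "\<And>s. s \<le> a \<Longrightarrow> \<theta> s = 0" "\<And>s. b \<le> s \<Longrightarrow> \<theta> s = J" "\<And>s. b \<le> s \<Longrightarrow> \<tau> s = 0"
  shows "C1c (ball z \<rho>) (\<lambda>x. if x = z then J else if x \<in> ball z \<rho> then \<theta> (u x) else 0)
      (\<lambda>x. if x = z then 0 else if x \<in> ball z \<rho> then \<tau> (u x) *\<^sub>R D x else 0)"
proof -
  let ?f = "\<lambda>x. if x = z then J else \<theta> (u x)" and ?D = "\<lambda>x. if x = z then 0 else \<tau> (u x) *\<^sub>R D x"
  have c1: "C1_on (ball z \<rho> - {z}) ?f ?D"
    by (rule C1_on_cong [OF C1_on_compose [OF u der continuous_on_subset [OF cont]]]) auto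
  have "\<forall>\<^sub>F x in at z. b \<le> u x" using lim by (simp add: filterlim_at_top)
  then obtain d where d: "0 < d" "\<And>x. x \<noteq> z \<Longrightarrow> dist x z < d \<Longrightarrow> b \<le> u x"
    unfolding eventually_at by auto
  define d' where "d' = min d \<rho>"
  have c2: "C1_on (ball z d') ?f ?D"
    by (rule C1_on_cong [OF C1_on_const [of _ J]]) (use assms d in \<open>auto simp: d'_def dist_commute\<close>)
  have cov: "ball z \<rho> = (ball z \<rho> - {z}) \<union> ball z d'" using assms d by (auto simp: d'_def)
  have "continuous_on ((ball z \<rho> - {z}) \<union> ball z d') ?D"
    by (rule continuous_on_open_Un) (use c1 c2 in \<open>auto simp: C1_on_def\<close>)
  with c1 c2 cov have c: "C1_on (ball z \<rho>) ?f ?D" unfolding C1_on_def by (metis Un_iff)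
  have "C1c (ball z \<rho>) (\<lambda>x. if x \<in> ball z \<rho> then ?f x else 0) (\<lambda>x. if x \<in> ball z \<rho> then ?D x else 0)"
  proof (rule C1c_extend [OF c _ compact_cball [of z \<rho>']])
    show "?f x = 0" if "x \<in> ball z \<rho> - cball z \<rho>'" for x
      using that assms(3,8) shell [of x] by (auto simp: dist_norm norm_minus_commute)
  qed (use assms in auto)
  moreover have "(\<lambda>x. if x \<in> ball z \<rho> then ?f x else 0) = (\<lambda>x. if x = z then J else if x \<in> ball z \<rho> then \<theta> (u x) else 0)"
    "(\<lambda>x. if x \<in> ball z \<rho> then ?D x else 0) = (\<lambda>x. if x = z then 0 else if x \<in> ball z \<rho> then \<tau> (u x) *\<^sub>R D x else 0)"
    using assms(3,4) by auto
  ultimately show ?thesis by simp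
qed

lemma radial_cutoff:
  fixes z :: "'a::euclidean_space"
  assumes "0 < r" "r < s"
  obtains \<phi> D where "C1c (ball z s) \<phi> D" "\<And>x. norm (x - z) \<le> r \<Longrightarrow> \<phi> x = 1" "\<And>x. 0 \<le> \<phi> x" "\<And>x. \<phi> x \<le> 1"
    "\<And>x. norm (D x) \<le> 8 / (s - r)"
    "\<And>x. norm (x - z) < r \<Longrightarrow> D x = 0" "\<And>x. s < norm (x - z) \<Longrightarrow> D x = 0"
proof -
  \<comment> \<open>The step from 1 to 4 has slope at most 1 and height at least 1; with this k the
    argument \<open>k * (t - r)\<close> reaches 4 at the midpoint of r and s, so the cutoff has
    compact support in the open ball.\<close>
  define k where "k = 8 / (s - r)"
  have k: "0 < k" using assms by (simp add: k_def)
  obtain \<theta> \<tau> :: "real \<Rightarrow> real" and J where th: "\<And>s. (\<theta> has_real_derivative \<tau> s) (at s)" "continuous_on UNIV \<tau>"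
    "\<And>s. 0 \<le> \<tau> s" "\<And>s. \<tau> s \<le> 1" 
    "\<And>s. s \<le> 1 \<Longrightarrow> \<tau> s = 0" "\<And>s. 4 \<le> s \<Longrightarrow> \<tau> s = 0"
    "\<And>s. s \<le> 1 \<Longrightarrow> \<theta> s = 0" "\<And>s. 4 \<le> s \<Longrightarrow> \<theta> s = J"
    "\<And>s. 0 \<le> \<theta> s" "\<And>s. \<theta> s \<le> J" "4 - 1 - 2 \<le> J" "0 < J"
    by (rule smooth_step [of 1 4]) auto
  define h where "h = (\<lambda>t. 1 - \<theta> (k * (t - r)) / J)"
  define h' where "h' = (\<lambda>t. - (\<tau> (k * (t - r)) * k / J))"
  have J: "1 \<le> J" using th(11) by simp
  have hd: "(h has_real_derivative h' t) (at t)" for t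
    unfolding h_def h'_def
  proof -
    have "((\<lambda>t. \<theta> (k * (t - r))) has_real_derivative \<tau> (k * (t - r)) * k) (at t)"
      by (rule DERIV_chain2 [OF th(1)]) (auto intro!: derivative_eq_intros)
    from DERIV_diff [OF DERIV_const [of 1] DERIV_cdivide [OF this, of J]]
    show "((\<lambda>t. 1 - \<theta> (k * (t - r)) / J) has_real_derivative - (\<tau> (k * (t - r)) * k / J)) (at t)"
      by simp
  qed
  have hc: "continuous_on UNIV h'" unfolding h'_def
    using J by (intro continuous_intros continuous_on_compose2 [OF th(2)]) auto
  have h1: "h t = 1" if "t \<le> r + 1 / k" for t
  proof -
    have "k * (t - r) \<le> k * (1 / k)" using that k by (intro mult_left_mono) auto
    then show ?thesis using k th(7) by (simp add: h_def)
  qed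
  have h'1: "h' t = 0" if "t \<le> r + 1 / k" for t
  proof -
    have "k * (t - r) \<le> k * (1 / k)" using that k by (intro mult_left_mono) auto
    then show ?thesis using k th(5) by (simp add: h'_def)
  qed
  have big: "4 \<le> k * (t - r)" if "(r + s) / 2 \<le> t" for t
  proof -
    have "k * ((r + s) / 2 - r) \<le> k * (t - r)" using that k by (intro mult_left_mono) auto
    moreover have "k * ((r + s) / 2 - r) = 4" using assms by (simp add: k_def field_simps)
    ultimately show ?thesis by simp
  qed
  have h2: "h t = 0" if "(r + s) / 2 \<le> t" for t using th(8) [OF big [OF that]] J by (simp add: h_def)
  have h'2: "h' t = 0" if "(r + s) / 2 \<le> t" for t using th(6) [OF big [OF that]] by (simp add: h'_def)
  let ?f = "\<lambda>x. h (norm (x - z))" and ?D = "\<lambda>x. h' (norm (x - z)) *\<^sub>R sgn (x - z)"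
  have c1: "C1_on (- {z}) ?f ?D"
    by (rule C1_on_compose [OF C1_on_norm_shift hd continuous_on_subset [OF hc]]) auto
  have rk: "0 < r + 1 / k" using assms k by (simp add: add_pos_pos)
  have c2: "C1_on (ball z (r + 1 / k)) ?f ?D"
    by (rule C1_on_cong [OF C1_on_const [of _ 1]]) (auto simp: h1 h'1 dist_norm norm_minus_commute)
  have cov: "UNIV = (- {z}) \<union> ball z (r + 1 / k)" using rk by auto
  have "continuous_on ((- {z}) \<union> ball z (r + 1 / k)) ?D"
    by (rule continuous_on_open_Un) (use c1 c2 in \<open>auto simp: C1_on_def\<close>)
  with c1 c2 cov have c: "C1_on UNIV ?f ?D" unfolding C1_on_def by (metis Un_iff)
  have C: "C1c (ball z s) ?f ?D"
    unfolding C1c_def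
    by (intro conjI c exI [of _ "cball z ((r + s) / 2)"])
       (use assms h2 in \<open>auto simp: dist_norm norm_minus_commute\<close>)
  have hb: "\<bar>h' t\<bar> \<le> k" for t
  proof -
    have "\<tau> (k * (t - r)) * k / J \<le> 1 * k / 1"
      using th(3,4) k J by (intro frac_le mult_right_mono) (auto simp: mult_nonneg_nonneg)
    then show ?thesis using th(3) k J by (simp add: h'_def)
  qed
  show thesis
  proof (rule that [OF C])
    show "norm (?D x) \<le> 8 / (s - r)" for x
      using mult_mono [OF hb [of "norm (x - z)"], of "norm (sgn (x - z))" 1] k
      by (simp add: norm_sgn k_def)
    show "?f x = 1" if "norm (x - z) \<le> r" for x using that k by (intro h1) (simp add: add_increasing2)
    show "?D x = 0" if "norm (x - z) < r" for x
      using h'1 [of "norm (x - z)"] that k by (simp add: add_increasing2)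
    show "?D x = 0" if "s < norm (x - z)" for x
      using h'2 [of "norm (x - z)"] that assms by simp
    show "0 \<le> ?f x" for x using th(10) [of "k * (norm (x - z) - r)"] J by (simp add: h_def)
    show "?f x \<le> 1" for x using th(9) [of "k * (norm (x - z) - r)"] J by (simp add: h_def)
  qed
qed

section \<open>Point masses and the fundamental solution\<close>

text \<open>On shells of radii (\<rho> / 4) 2^(-n) the bounds C r^k with k > 0 form a geometric
  series. Nonnegative integrals are summed, so that integrability comes out as finiteness.\<close>

lemma annuli_integrable:
  fixes g :: "'a::euclidean_space \<Rightarrow> real"
  assumes cont: "continuous_on (ball 0 \<rho> - {0}) g" and nn: "\<And>x. x \<in> ball 0 \<rho> - {0} \<Longrightarrow> 0 \<le> g x"
    and "0 < \<rho>" "0 < k" "0 \<le> C"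
    and bd: "\<And>r. 0 < r \<Longrightarrow> 2 * r < \<rho> \<Longrightarrow>
      (LINT x|lborel. indicator (cball 0 (2 * r) - ball 0 r) x * g x) \<le> C * r powr k"
  shows "set_integrable lborel (ball 0 (\<rho> / 2)) g"
proof -
  define r where "r = (\<lambda>n::nat. \<rho> / 4 * (1 / 2) ^ n)"
  define A where "A = (\<lambda>n. cball (0::'a) (2 * r n) - ball 0 (r n))"
  have r: "0 < r n" "2 * r n < \<rho>" for n
  proof -
    show "0 < r n" using assms(3) by (simp add: r_def)
    have "(1 / 2) ^ n \<le> (1::real)" by (simp add: power_le_one)
    then have "2 * r n \<le> 2 * (\<rho> / 4 * 1)" unfolding r_def using assms(3) by (intro mult_left_mono) auto
    then show "2 * r n < \<rho>" using assms(3) by simp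
  qed
  have cA: "compact (A n)" for n unfolding A_def by (simp add: compact_diff)
  have sA: "A n \<subseteq> ball 0 \<rho> - {0}" for n
    using r [of n] by (auto simp: A_def)
  have iA: "integrable lborel (\<lambda>x. indicator (A n) x * g x)" for n
    using borel_integrable_compact [OF cA continuous_on_subset [OF cont sA], of n] by simp
  have gA: "0 \<le> indicator (A n) x * g x" for n x
    using nn [of x] sA [of n] by (cases "x \<in> A n") (simp_all add: subset_iff)
  define h where "h = (\<lambda>x. indicator (ball 0 (\<rho> / 2) - {0}) x *\<^sub>R g x)"
  have hm: "h \<in> borel_measurable lborel"
  proof -
    have "continuous_on (ball 0 (\<rho> / 2) - {0}) g"
      using assms(3) by (intro continuous_on_subset [OF cont]) auto
    then show ?thesis
      unfolding h_def using borel_measurable_continuous_on_indicator [of "ball 0 (\<rho> / 2) - {0}" g] by simp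
  qed
  have h0: "0 \<le> h x" for x
    using nn [of x] assms(3) by (cases "x \<in> ball 0 (\<rho> / 2) - {0}") (auto simp: h_def)
  have cover: "\<exists>n. x \<in> A n" if x: "x \<in> ball 0 (\<rho> / 2) - {0}" for x
  proof -
    have "(\<lambda>n. \<rho> / 4 * (1 / 2) ^ n) \<longlonglongrightarrow> \<rho> / 4 * 0"
      by (intro tendsto_mult tendsto_const LIMSEQ_power_zero) simp
    then have "r \<longlonglongrightarrow> 0" unfolding r_def by (simp only: mult_zero_right)
    then have "\<forall>\<^sub>F n in sequentially. r n < norm x"
      by (rule order_tendstoD) (use x in auto)
    then obtain m where "r m < norm x" by (auto simp: eventually_sequentially)
    then have m: "r m \<le> norm x" by simp
    \<comment> \<open>The first shell radius not exceeding |x| is within a factor 2 of |x|; for n =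
      0 this is the bound |x| < \<rho> / 2.\<close>
    define n where "n = (LEAST n. r n \<le> norm x)"
    have n: "r n \<le> norm x" unfolding n_def by (rule LeastI [where P = "\<lambda>n. r n \<le> norm x", OF m])
    have "norm x \<le> 2 * r n"
    proof (cases n)
      case 0
      then show ?thesis using x by (simp add: r_def)
    next
      case (Suc j)
      then have "\<not> r j \<le> norm x" using not_less_Least [of j "\<lambda>n. r n \<le> norm x"] by (simp add: n_def)
      then show ?thesis using Suc by (simp add: r_def)
    qed
    with n show ?thesis by (auto simp: A_def)
  qed
  have le: "ennreal (h x) \<le> (\<Sum>n. ennreal (indicator (A n) x * g x))" for x
  proof (cases "x \<in> ball 0 (\<rho> / 2) - {0}")
    case True
    from cover [OF this] obtain n where n: "x \<in> A n" by blast
    have "ennreal (h x) = ennreal (indicator (A n) x * g x)" using True n by (simp add: h_def)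
    also have "\<dots> \<le> (\<Sum>n. ennreal (indicator (A n) x * g x))"
      using sum_le_suminf [of "\<lambda>n. ennreal (indicator (A n) x * g x)" "{n}"] by simp
    finally show ?thesis .
  qed (simp add: h_def)
  have sm: "summable (\<lambda>n. C * r n powr k)"
  proof -
    have "r n powr k = (\<rho> / 4) powr k * ((1 / 2) powr k) ^ n" for n
    proof -
      have "((1 / 2 :: real) ^ n) powr k = ((1 / 2) powr k) ^ n"
        by (simp add: powr_realpow [symmetric] powr_powr mult.commute)
      then show ?thesis using assms(3) unfolding r_def by (subst powr_mult) auto
    qed
    moreover have "norm ((1 / 2 :: real) powr k) < 1"
      using assms(4) powr_less_mono2 [of k "1 / 2" 1] by simp
    ultimately show ?thesis by (auto intro!: summable_mult summable_geometric)
  qed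
  have "(\<integral>\<^sup>+x. ennreal (h x) \<partial>lborel) \<le> (\<integral>\<^sup>+x. (\<Sum>n. ennreal (indicator (A n) x * g x)) \<partial>lborel)"
    by (intro nn_integral_mono le)
  also have "\<dots> = (\<Sum>n. \<integral>\<^sup>+x. ennreal (indicator (A n) x * g x) \<partial>lborel)"
    by (rule nn_integral_suminf) (use borel_measurable_integrable [OF iA] in measurable)
  also have "\<dots> \<le> (\<Sum>n. ennreal (C * r n powr k))"
  proof (rule suminf_le)
    fix n
    have "(\<integral>\<^sup>+x. ennreal (indicator (A n) x * g x) \<partial>lborel) = ennreal (LINT x|lborel. indicator (A n) x * g x)"
      using nn_integral_eq_integral [OF iA] gA by simp
    also have "\<dots> \<le> ennreal (C * r n powr k)"
      using bd [OF r] unfolding A_def by (rule ennreal_leI)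
    finally show "(\<integral>\<^sup>+x. ennreal (indicator (A n) x * g x) \<partial>lborel) \<le> ennreal (C * r n powr k)" .
  qed auto
  also have "\<dots> = ennreal (\<Sum>n. C * r n powr k)"
    by (rule suminf_ennreal2 [OF _ sm]) (simp add: assms)
  also have "\<dots> < \<infinity>" by simp
  finally have "integrable lborel h"
    using h0 hm by (intro integrableI_bounded) auto
  moreover have "AE x in lborel. h x = indicator (ball 0 (\<rho> / 2)) x *\<^sub>R g x"
    using AE_lborel_singleton [of 0] by eventually_elim (auto simp: h_def indicator_def)
  moreover have "(\<lambda>x. indicator (ball 0 (\<rho> / 2)) x *\<^sub>R g x) \<in> borel_measurable lborel"
  proof -
    have "(\<lambda>x. indicator (ball 0 (\<rho> / 2)) x *\<^sub>R g x) = (\<lambda>x. h x + indicator {0} x * (indicator (ball 0 (\<rho> / 2)) (0::'a) * g 0))"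
      by (auto simp: h_def indicator_def fun_eq_iff)
    moreover have "(\<lambda>x. h x + indicator {0} x * (indicator (ball 0 (\<rho> / 2)) (0::'a) * g 0)) \<in> borel_measurable lborel"
      using hm by (intro borel_measurable_add borel_measurable_times borel_measurable_indicator borel_measurable_const) simp_all
    ultimately show ?thesis by (simp only:)
  qed
  ultimately show ?thesis
    unfolding set_integrable_def using integrable_cong_AE hm by blast
qed

lemma L1_loc_punctured:
  fixes F :: "'a::euclidean_space \<Rightarrow> 'b::euclidean_space"
  assumes "open U" "continuous_on (U - {0}) F" "0 < \<rho>" "set_integrable lborel (ball 0 \<rho>) F"
  shows "L1_loc U F"
  unfolding L1_loc_def
proof (intro allI impI, elim conjE)
  fix K assume K: "compact K" "K \<subseteq> U"
  have "compact (K - ball 0 \<rho>)" using K by (simp add: compact_diff)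
  moreover have "continuous_on (K - ball 0 \<rho>) F"
    using K assms(3) by (intro continuous_on_subset [OF assms(2)]) auto
  ultimately have 1: "set_integrable lborel (K - ball 0 \<rho>) F"
    unfolding set_integrable_def by (rule borel_integrable_compact)
  have 2: "set_integrable lborel (K \<inter> ball 0 \<rho>) F"
    by (rule set_integrable_subset [OF assms(4)]) (use K in \<open>auto intro: borel_compact\<close>)
  have "set_integrable lborel ((K - ball 0 \<rho>) \<union> (K \<inter> ball 0 \<rho>)) F"
    by (rule set_integrable_Un [OF 1 2]) (use K in \<open>auto intro: borel_compact\<close>)
  moreover have "(K - ball 0 \<rho>) \<union> (K \<inter> ball 0 \<rho>) = K" by auto
  ultimately show "set_integrable lborel K F" by simp
qed

lemma C1c_bounded:
  assumes "C1c U \<phi> D"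
  obtains B where "0 < B" "\<And>x. \<bar>\<phi> x\<bar> \<le> B" "\<And>x. norm (D x) \<le> B"
proof -
  from assms obtain K where K: "compact K" "\<And>x. x \<notin> K \<Longrightarrow> \<phi> x = 0" "\<And>x. x \<notin> K \<Longrightarrow> D x = 0"
    "continuous_on UNIV \<phi>" "continuous_on UNIV D"
    by (rule C1cE) blast
  have "bounded (\<phi> ` K)" "bounded (D ` K)"
    using K by (auto intro!: compact_imp_bounded compact_continuous_image intro: continuous_on_subset)
  then obtain B1 B2 where B: "\<forall>x\<in>K. norm (\<phi> x) \<le> B1" "\<forall>x\<in>K. norm (D x) \<le> B2"
    unfolding bounded_iff by auto
  show thesis
  proof (rule that [of "\<bar>B1\<bar> + \<bar>B2\<bar> + 1"])
    show "\<bar>\<phi> x\<bar> \<le> \<bar>B1\<bar> + \<bar>B2\<bar> + 1" for x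
      using B(1) K(2) by (cases "x \<in> K") force+
    show "norm (D x) \<le> \<bar>B1\<bar> + \<bar>B2\<bar> + 1" for x
      using B(2) K(3) by (cases "x \<in> K") force+
  qed auto
qed

lemma L1_loc_integrable_mult:
  fixes F :: "'a::euclidean_space \<Rightarrow> 'a" and g :: "'a \<Rightarrow> real"
  assumes C: "C1c U \<phi> D"
  shows "L1_loc U F \<Longrightarrow> integrable lborel (\<lambda>x. F x \<bullet> D x)"
    and "L1_loc U g \<Longrightarrow> integrable lborel (\<lambda>x. g x * \<phi> x)"
    and "L1_loc U F \<Longrightarrow> integrable lborel (\<lambda>x. norm (F x) * \<bar>\<phi> x\<bar>)"
proof -
  from C obtain K where K: "compact K" "K \<subseteq> U" "\<And>x. x \<notin> K \<Longrightarrow> \<phi> x = 0" "\<And>x. x \<notin> K \<Longrightarrow> D x = 0"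
    "continuous_on UNIV \<phi>" "continuous_on UNIV D"
    by (rule C1cE) blast
  from C obtain B where B: "0 < B" "\<And>x. \<bar>\<phi> x\<bar> \<le> B" "\<And>x. norm (D x) \<le> B"
    by (rule C1c_bounded) blast
  note m [measurable] = C1c_measurable [OF C]
  show "integrable lborel (\<lambda>x. F x \<bullet> D x)" if "L1_loc U F"
  proof -
    have i: "integrable lborel (\<lambda>x. indicator K x *\<^sub>R F x)"
      using that K by (auto simp: L1_loc_def set_integrable_def)
    then have [measurable]: "(\<lambda>x. indicator K x *\<^sub>R F x) \<in> borel_measurable lborel" by auto
    have "integrable lborel (\<lambda>x. (indicator K x *\<^sub>R F x) \<bullet> D x)"
    proof (rule Bochner_Integration.integrable_bound [OF integrable_mult_right [OF integrable_norm [OF i], of B]])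
      show "AE x in lborel. norm ((indicator K x *\<^sub>R F x) \<bullet> D x) \<le> norm (B * norm (indicator K x *\<^sub>R F x))"
      proof (intro AE_I2)
        fix x
        have "norm ((indicator K x *\<^sub>R F x) \<bullet> D x) \<le> norm (indicator K x *\<^sub>R F x) * norm (D x)"
          using Cauchy_Schwarz_ineq2 [of "indicator K x *\<^sub>R F x" "D x"] by (simp only: real_norm_def)
        also have "\<dots> \<le> norm (indicator K x *\<^sub>R F x) * B" by (intro mult_left_mono B) auto
        finally show "norm ((indicator K x *\<^sub>R F x) \<bullet> D x) \<le> norm (B * norm (indicator K x *\<^sub>R F x))"
          using B(1) by (simp add: mult.commute abs_mult)
      qed
    qed measurable
    moreover have "(\<lambda>x. (indicator K x *\<^sub>R F x) \<bullet> D x) = (\<lambda>x. F x \<bullet> D x)"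
      using K(4) by (auto simp: indicator_def fun_eq_iff)
    ultimately show ?thesis by simp
  qed
  show "integrable lborel (\<lambda>x. norm (F x) * \<bar>\<phi> x\<bar>)" if "L1_loc U F"
  proof -
    have i: "integrable lborel (\<lambda>x. indicator K x *\<^sub>R F x)"
      using that K by (auto simp: L1_loc_def set_integrable_def)
    then have [measurable]: "(\<lambda>x. indicator K x *\<^sub>R F x) \<in> borel_measurable lborel" by auto
    have "integrable lborel (\<lambda>x. norm (indicator K x *\<^sub>R F x) * \<bar>\<phi> x\<bar>)"
    proof (rule Bochner_Integration.integrable_bound [OF integrable_mult_right [OF integrable_norm [OF i], of B]])
      show "AE x in lborel. norm (norm (indicator K x *\<^sub>R F x) * \<bar>\<phi> x\<bar>) \<le> norm (B * norm (indicator K x *\<^sub>R F x))"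
      proof (intro AE_I2)
        fix x
        have "norm (indicator K x *\<^sub>R F x) * \<bar>\<phi> x\<bar> \<le> norm (indicator K x *\<^sub>R F x) * B"
          by (intro mult_left_mono B) auto
        then show "norm (norm (indicator K x *\<^sub>R F x) * \<bar>\<phi> x\<bar>) \<le> norm (B * norm (indicator K x *\<^sub>R F x))"
          using B(1) by (simp add: mult.commute abs_mult)
      qed
    qed measurable
    moreover have "(\<lambda>x. norm (indicator K x *\<^sub>R F x) * \<bar>\<phi> x\<bar>) = (\<lambda>x. norm (F x) * \<bar>\<phi> x\<bar>)"
      using K(3) by (auto simp: indicator_def fun_eq_iff)
    ultimately show ?thesis by simp
  qed
  show "integrable lborel (\<lambda>x. g x * \<phi> x)" if "L1_loc U g"
  proof -
    have i: "integrable lborel (\<lambda>x. indicator K x *\<^sub>R g x)"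
      using that K by (auto simp: L1_loc_def set_integrable_def)
    then have [measurable]: "(\<lambda>x. indicator K x *\<^sub>R g x) \<in> borel_measurable lborel" by auto
    have "integrable lborel (\<lambda>x. (indicator K x *\<^sub>R g x) * \<phi> x)"
    proof (rule Bochner_Integration.integrable_bound [OF integrable_mult_right [OF integrable_norm [OF i], of B]])
      show "AE x in lborel. norm ((indicator K x *\<^sub>R g x) * \<phi> x) \<le> norm (B * norm (indicator K x *\<^sub>R g x))"
      proof (intro AE_I2)
        fix x
        have "\<bar>indicator K x *\<^sub>R g x\<bar> * \<bar>\<phi> x\<bar> \<le> \<bar>indicator K x *\<^sub>R g x\<bar> * B"
          by (intro mult_left_mono B) auto
        then show "norm ((indicator K x *\<^sub>R g x) * \<phi> x) \<le> norm (B * norm (indicator K x *\<^sub>R g x))"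
          using B(1) by (simp add: mult.commute abs_mult)
      qed
    qed measurable
    moreover have "(\<lambda>x. (indicator K x *\<^sub>R g x) * \<phi> x) = (\<lambda>x. g x * \<phi> x)"
      using K(3) by (auto simp: indicator_def fun_eq_iff)
    ultimately show ?thesis by simp
  qed
qed

lemma C1c_lipschitz:
  assumes "C1c U \<phi> D"
  obtains B where "0 < B" "\<And>x y. \<bar>\<phi> x - \<phi> y\<bar> \<le> B * norm (x - y)"
proof -
  from assms obtain B where B: "0 < B" "\<And>x. norm (D x) \<le> B"
    by (rule C1c_bounded) blast
  have "norm (\<phi> x - \<phi> y) \<le> B * norm (x - y)" for x y
  proof (rule differentiable_bound [of UNIV])
    show "(\<phi> has_derivative (\<lambda>h. h \<bullet> D z)) (at z within UNIV)" for z
      using assms by (auto simp: C1c_def C1_on_def gderiv_def)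
    show "onorm (\<lambda>h. h \<bullet> D z) \<le> B" for z
    proof (rule onorm_le)
      fix h :: 'a
      have "\<bar>h \<bullet> D z\<bar> \<le> norm h * norm (D z)" by (rule Cauchy_Schwarz_ineq2)
      also have "\<dots> \<le> norm h * B" by (intro mult_left_mono B) auto
      finally show "norm (h \<bullet> D z) \<le> B * norm h" by (simp add: mult.commute)
    qed
  qed auto
  with B show thesis by (intro that [of B]) auto
qed

text \<open>A distribution of order one supported at the origin whose coefficients are integrable is
  a multiple of the Dirac mass: the error made by cutting off a test function \<open>\<phi>\<close> with
  \<open>\<phi> 0 = 0\<close> is controlled since \<open>\<bar>\<phi>\<bar>\<close> compensates the gradient of the cut-off.\<close>

lemma point_mass:
  fixes F :: "'a::euclidean_space \<Rightarrow> 'a"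
  assumes W: "weak_eq (U - {0}) F g 0" and "open U" "0 \<in> U" and LF: "L1_loc U F" and Lg: "L1_loc U g"
  shows "\<exists>m. weak_eq U F g m"
proof -
  obtain \<rho> where \<rho>: "0 < \<rho>" "ball 0 \<rho> \<subseteq> U" using assms by (meson open_contains_ball)
  have int: "integrable lborel (\<lambda>x. F x \<bullet> D x + g x * \<phi> x)" if "C1c U \<phi> D" for \<phi> D
    using L1_loc_integrable_mult [OF that] LF Lg by simp
  have zero: "(LINT x|lborel. F x \<bullet> D x + g x * \<phi> x) = 0" if C: "C1c U \<phi> D" and \<phi>0: "\<phi> 0 = 0" for \<phi> D
  proof -
    from C obtain K where K: "compact K" "K \<subseteq> U" "\<And>x. x \<notin> K \<Longrightarrow> \<phi> x = 0" "\<And>x. x \<notin> K \<Longrightarrow> D x = 0"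
      by (rule C1cE) blast
    from C obtain B where B: "0 < B" "\<And>x y. \<bar>\<phi> x - \<phi> y\<bar> \<le> B * norm (x - y)"
      by (rule C1c_lipschitz) blast
    define r where "r = (\<lambda>n::nat. 1 / real (Suc n))"
    have r: "0 < r n" for n by (simp add: r_def)
    define Q where "Q = (\<lambda>n \<eta> (E :: 'a \<Rightarrow> 'a). C1_on UNIV \<eta> E \<and> (\<forall>x. norm x \<le> r n \<longrightarrow> \<eta> x = 1) \<and> (\<forall>x. 2 * r n \<le> norm x \<longrightarrow> \<eta> x = 0) \<and> (\<forall>x. 0 \<le> \<eta> x \<and> \<eta> x \<le> 1)
       \<and> (\<forall>x. norm (E x) \<le> 8 / r n) \<and> (\<forall>x. 2 * r n < norm x \<longrightarrow> E x = 0))"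
    have "\<exists>\<eta> E. Q n \<eta> E" for n
    proof -
      obtain \<eta> and E :: "'a \<Rightarrow> 'a" where 1: "C1c (ball 0 (2 * r n)) \<eta> E" "\<And>x. norm (x - 0) \<le> r n \<Longrightarrow> \<eta> x = 1"
        "\<And>x. 0 \<le> \<eta> x" "\<And>x. \<eta> x \<le> 1" "\<And>x. norm (E x) \<le> 8 / (2 * r n - r n)"
        "\<And>x. 2 * r n < norm (x - 0) \<Longrightarrow> E x = 0"
        by (rule radial_cutoff [of "r n" "2 * r n" 0]) (use r [of n] in auto)
      from 1(1) have 2: "C1_on UNIV \<eta> E" "\<And>x. 2 * r n \<le> norm x \<Longrightarrow> \<eta> x = 0"
        unfolding C1c_def by (auto simp: subset_iff)
      show ?thesis
        unfolding Q_def by (intro exI [of _ \<eta>] exI [of _ E]) (use 1 2 in auto)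
    qed
    then obtain \<eta> E where "\<And>n. Q n (\<eta> n) (E n)" by metis
    then obtain \<eta> and E :: "nat \<Rightarrow> 'a \<Rightarrow> 'a" where \<eta>: "\<And>n. C1_on UNIV (\<eta> n) (E n)" "\<And>n x. norm x \<le> r n \<Longrightarrow> \<eta> n x = 1"
      "\<And>n x. 2 * r n \<le> norm x \<Longrightarrow> \<eta> n x = 0" "\<And>n x. 0 \<le> \<eta> n x" "\<And>n x. \<eta> n x \<le> 1"
      "\<And>n x. norm (E n x) \<le> 8 / r n" "\<And>n x. 2 * r n < norm x \<Longrightarrow> E n x = 0"
      unfolding Q_def by blast
    define f where "f = (\<lambda>n x. (1 - \<eta> n x) * \<phi> x)"
    define G where "G = (\<lambda>n x. (1 - \<eta> n x) *\<^sub>R D x + \<phi> x *\<^sub>R (0 - E n x))"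
    have CU: "C1c U (f n) (G n)" for n
      unfolding f_def G_def by (rule C1c_mult [OF C C1_on_diff [OF C1_on_const \<eta>(1)]])
    have C0: "C1c (U - {0}) (f n) (G n)" for n
    proof -
      have "compact (K - ball 0 (r n))" using K by (simp add: compact_diff)
      moreover have "f n x = 0" if "x \<notin> K - ball 0 (r n)" for x
        using that K(3) [of x] \<eta>(2) [of x n] by (auto simp: f_def)
      moreover have "K - ball 0 (r n) \<subseteq> U - {0}" using K r [of n] by auto
      ultimately show ?thesis using CU [of n] unfolding C1c_def by blast
    qed
    have T0: "(LINT x|lborel. F x \<bullet> G n x + g x * f n x) = 0" for n
      using W C0 unfolding weak_eq_def by (metis mult_zero_left)
    \<comment> \<open>16 = 2 * 8: on the support of the cutoff gradient, of size at most 8 / r, the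
      test function is at most 2 B r. The majorant is therefore independent of n.\<close>
    define w where "w = (\<lambda>x. \<bar>F x \<bullet> D x + g x * \<phi> x\<bar> + 16 * B * (norm (F x) * indicator K x))"
    have iFK: "integrable lborel (\<lambda>x. norm (F x) * indicator K x)"
    proof -
      have "integrable lborel (\<lambda>x. norm (indicator K x *\<^sub>R F x))"
        using LF K by (intro integrable_norm) (auto simp: L1_loc_def set_integrable_def)
      then show ?thesis by (simp add: mult.commute)
    qed
    have "(\<lambda>n. LINT x|lborel. F x \<bullet> G n x + g x * f n x) \<longlonglongrightarrow> (LINT x|lborel. F x \<bullet> D x + g x * \<phi> x)"
    proof (rule integral_dominated_convergence [where w = w])
      show "integrable lborel w" unfolding w_def using int [OF C] iFK by simp
      show "AE x in lborel. (\<lambda>n. F x \<bullet> G n x + g x * f n x) \<longlonglongrightarrow> F x \<bullet> D x + g x * \<phi> x"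
        using AE_lborel_singleton [of 0]
      proof eventually_elim
        case (elim x)
        have "(\<lambda>n. 2 * r n) \<longlonglongrightarrow> 2 * 0"
          unfolding r_def by (intro tendsto_mult tendsto_const LIMSEQ_inverse_real_of_nat [unfolded inverse_eq_divide])
        then have "\<forall>\<^sub>F n in sequentially. 2 * r n < norm x"
          by (rule order_tendstoD) (use elim in auto)
        then have "\<forall>\<^sub>F n in sequentially. F x \<bullet> D x + g x * \<phi> x = F x \<bullet> G n x + g x * f n x"
          by eventually_elim (use \<eta>(3,7) in \<open>simp add: G_def f_def\<close>)
        then show ?case by (rule Lim_transform_eventually [OF tendsto_const])
      qed
      show "AE x in lborel. norm (F x \<bullet> G n x + g x * f n x) \<le> w x" for n
      proof (intro AE_I2)
        fix x
        have e: "F x \<bullet> G n x + g x * f n x = (1 - \<eta> n x) * (F x \<bullet> D x + g x * \<phi> x) - \<phi> x * (F x \<bullet> E n x)"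
          by (simp add: G_def f_def inner_add_right inner_diff_right algebra_simps)
        have "\<bar>(1 - \<eta> n x) * (F x \<bullet> D x + g x * \<phi> x)\<bar> \<le> 1 * \<bar>F x \<bullet> D x + g x * \<phi> x\<bar>"
          unfolding abs_mult by (intro mult_right_mono) (use \<eta>(4,5) [of n x] in auto)
        moreover have "\<bar>\<phi> x * (F x \<bullet> E n x)\<bar> \<le> 16 * B * (norm (F x) * indicator K x)"
        proof (cases "x \<in> K \<and> norm x \<le> 2 * r n")
          case True
          have "\<bar>\<phi> x\<bar> \<le> B * norm x" using B(2) [of x 0] \<phi>0 by simp
          also have "\<dots> \<le> B * (2 * r n)" using True B by (intro mult_left_mono) auto
          finally have 1: "\<bar>\<phi> x\<bar> \<le> B * (2 * r n)" .
          have "\<bar>F x \<bullet> E n x\<bar> \<le> norm (F x) * norm (E n x)" by (rule Cauchy_Schwarz_ineq2)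
          also have "\<dots> \<le> norm (F x) * (8 / r n)" by (intro mult_left_mono \<eta>) auto
          finally have 2: "\<bar>F x \<bullet> E n x\<bar> \<le> norm (F x) * (8 / r n)" .
          have "\<bar>\<phi> x * (F x \<bullet> E n x)\<bar> \<le> (B * (2 * r n)) * (norm (F x) * (8 / r n))"
            unfolding abs_mult using B r [of n] by (intro mult_mono 1 2) auto
          also have "\<dots> = 16 * B * norm (F x)" using r [of n] by simp
          finally show ?thesis using True by simp
        next
          case False
          then have "\<phi> x = 0 \<or> E n x = 0" using K(3) [of x] \<eta>(7) [of n x] by auto
          then show ?thesis using B by auto
        qed
        ultimately show "norm (F x \<bullet> G n x + g x * f n x) \<le> w x"
          unfolding e w_def by simp
      qed
    qed (use int [OF C] int [OF CU] in \<open>auto intro: borel_measurable_integrable\<close>)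
    then show ?thesis using T0 by (simp add: LIMSEQ_const_iff)
  qed
  \<comment> \<open>A general test function is reduced to one vanishing at 0 by subtracting a
    multiple of one fixed function that equals 1 there; the value of the functional on that function
    is the mass.\<close>
  obtain \<phi>0 and D0 :: "'a \<Rightarrow> 'a" where \<phi>0: "C1c (ball 0 \<rho>) \<phi>0 D0" "\<And>x. norm (x - 0) \<le> \<rho> / 2 \<Longrightarrow> \<phi>0 x = 1"
    by (rule radial_cutoff [of "\<rho> / 2" \<rho> 0]) (use \<rho> in auto)
  have C0: "C1c U \<phi>0 D0" using C1c_mono [OF \<phi>0(1) \<rho>(2)] .
  have one: "\<phi>0 0 = 1" using \<phi>0(2) [of 0] \<rho> by simp
  define m where "m = (LINT x|lborel. F x \<bullet> D0 x + g x * \<phi>0 x)"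
  have "weak_eq U F g m"
    unfolding weak_eq_def
  proof (intro allI impI)
    fix \<phi> D assume C: "C1c U \<phi> D"
    define c where "c = \<phi> 0"
    have Cd: "C1c U (\<lambda>x. \<phi> x - c * \<phi>0 x) (\<lambda>x. D x - c *\<^sub>R D0 x)"
    proof -
      from C obtain K where K: "compact K" "K \<subseteq> U" "\<forall>x. x \<notin> K \<longrightarrow> \<phi> x = 0" "C1_on UNIV \<phi> D"
        unfolding C1c_def by blast
      from C0 obtain L where L: "compact L" "L \<subseteq> U" "\<forall>x. x \<notin> L \<longrightarrow> \<phi>0 x = 0" "C1_on UNIV \<phi>0 D0"
        unfolding C1c_def by blast
      show ?thesis unfolding C1c_def
        by (intro conjI C1_on_diff C1_on_cmult K(4) L(4) exI [of _ "K \<union> L"]) (use K L in auto)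
    qed
    have "0 = (LINT x|lborel. F x \<bullet> (D x - c *\<^sub>R D0 x) + g x * (\<phi> x - c * \<phi>0 x))"
      using zero [OF Cd] one by (simp add: c_def)
    also have "\<dots> = (LINT x|lborel. (F x \<bullet> D x + g x * \<phi> x) - c * (F x \<bullet> D0 x + g x * \<phi>0 x))"
      by (intro Bochner_Integration.integral_cong refl) (simp add: inner_diff_right algebra_simps)
    also have "\<dots> = (LINT x|lborel. F x \<bullet> D x + g x * \<phi> x) - c * m"
      using int [OF C] int [OF C0] by (simp add: m_def)
    finally show "(LINT x|lborel. F x \<bullet> D x + g x * \<phi> x) = m * \<phi> 0" by (simp add: c_def mult.commute)
  qed
  then show ?thesis ..
qed

section \<open>The fundamental solution and its flux\<close>

definition grad_mu :: "real \<Rightarrow> 'a::euclidean_space \<Rightarrow> 'a" where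
  "grad_mu p x = - (norm x powr ((1 - real DIM('a)) / (p - 1))) *\<^sub>R sgn x"

definition mu_profile :: "nat \<Rightarrow> real \<Rightarrow> real \<Rightarrow> real" where
  "mu_profile N p r = (if p = real N then - ln r
     else (p - 1) / (real N - p) * r powr ((p - real N) / (p - 1)))"

lemma mu_eq_profile: "mu p (x :: 'a::euclidean_space) = mu_profile DIM('a) p (norm x)"
  by (simp add: mu_def mu_profile_def)

text \<open>The factor (p - 1) / (N - p) in \<open>mu\<close> is chosen so that power and logarithm
  have the same derivative; gradients of mu_p then need no separate case p = N.\<close>

lemma DERIV_mu_profile:
  assumes "1 < p" "0 < r"
  shows "(mu_profile N p has_real_derivative - (r powr ((1 - real N) / (p - 1)))) (at r)"
proof (cases "p = real N")
  case True
  then have "(1 - real N) / (p - 1) = - 1" using assms by (simp add: field_simps)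
  moreover have "((\<lambda>r. - ln r) has_real_derivative - (1 / r)) (at r)"
    using assms by (auto intro!: derivative_eq_intros)
  ultimately show ?thesis
    using True assms by (simp add: mu_profile_def [abs_def] powr_minus divide_inverse)
next
  case False
  have e: "(p - real N) / (p - 1) - 1 = (1 - real N) / (p - 1)"
    using assms by (simp add: field_simps)
  have "((\<lambda>r. (p - 1) / (real N - p) * r powr ((p - real N) / (p - 1))) has_real_derivative
    (p - 1) / (real N - p) * ((p - real N) / (p - 1) * r powr ((p - real N) / (p - 1) - 1))) (at r)"
    using has_real_derivative_powr [OF assms(2)] by (rule DERIV_cmult)
  moreover have "(p - 1) / (real N - p) * ((p - real N) / (p - 1) * r powr ((p - real N) / (p - 1) - 1))
     = - (r powr ((1 - real N) / (p - 1)))"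
  proof -
    have "(p - 1) / (real N - p) * ((p - real N) / (p - 1)) = - 1" using assms False by (simp add: divide_simps)
    then have "(p - 1) / (real N - p) * ((p - real N) / (p - 1) * z) = - z" for z
      by (simp only: mult.assoc [symmetric])
    then show ?thesis unfolding e .
  qed
  ultimately show ?thesis using False by (simp add: mu_profile_def [abs_def])
qed

lemma C1_on_mu: "1 < p \<Longrightarrow> C1_on (- {0}) (mu p) (grad_mu p)"
proof -
  assume p: "1 < p"
  have "C1_on {x. norm (x - 0) \<in> {0<..}} (\<lambda>x::'a. mu_profile DIM('a) p (norm (x - 0)))
    (\<lambda>x. - (norm (x - 0) powr ((1 - real DIM('a)) / (p - 1))) *\<^sub>R sgn (x - 0))"
    by (rule C1_on_radial) (use p in \<open>auto intro!: DERIV_mu_profile continuous_intros\<close>)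
  then have "C1_on {x. norm (x - 0) \<in> {0<..}} (mu p) (grad_mu p :: 'a \<Rightarrow> 'a)"
    by (simp add: mu_eq_profile [abs_def] grad_mu_def [abs_def])
  moreover have "{x. norm (x - 0) \<in> {0<..}} = - {0::'a}" by auto
  ultimately show ?thesis by simp
qed

text \<open>Raising the gradient to the power p - 1 removes p: all mu_p share one flux, which is
  divergence free off the origin.\<close>

lemma flux_grad_mu:
  fixes x :: "'a::euclidean_space"
  assumes "1 < p"
  shows "flux p (grad_mu p x) = - (norm x powr (- real DIM('a))) *\<^sub>R x"
proof (cases "x = 0")
  case False
  let ?a = "norm x powr ((1 - real DIM('a)) / (p - 1))"
  have "?a > 0" using False by simp
  then have "flux p (grad_mu p x) = - (?a powr (p - 1)) *\<^sub>R flux p (sgn x)"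
    using flux_scale [of ?a p "- sgn x"] by (simp add: grad_mu_def)
  also have "flux p (sgn x) = sgn x" using False by (simp add: flux_def norm_sgn)
  also have "?a powr (p - 1) = norm x powr (1 - real DIM('a))"
    using assms by (simp add: powr_powr)
  also have "norm x powr (1 - real DIM('a)) = norm x powr (- real DIM('a)) * norm x"
    using powr_add [of "norm x" "- real DIM('a)" 1] by simp
  finally show ?thesis using False by (simp add: sgn_div_norm)
qed (simp add: grad_mu_def)

lemma norm_grad_mu:
  fixes x :: "'a::euclidean_space"
  shows "x \<noteq> 0 \<Longrightarrow> norm (grad_mu p x) = norm x powr ((1 - real DIM('a)) / (p - 1))"
  by (simp add: grad_mu_def norm_sgn)

lemma continuous_on_flux_mu: "1 < p \<Longrightarrow> continuous_on (U - {0}) (\<lambda>x. flux p (grad_mu p x))"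
  using C1_on_subset [OF C1_on_mu [of p], of "U - {0}"] continuous_on_flux_comp [of p "U - {0}" "grad_mu p"]
  by (auto simp: C1_on_def)

lemma weak_eq_mu0:
  assumes "1 < p"
  shows "weak_eq (- {0 :: 'a::euclidean_space}) (\<lambda>x. flux p (grad_mu p x)) (\<lambda>x. 0) 0"
proof -
  let ?N = "real DIM('a)"
  let ?w = "\<lambda>r. - (r powr (- ?N))" and ?w' = "\<lambda>r. ?N * r powr (- ?N - 1)"
  have d: "(?w has_real_derivative ?w' r) (at r)" if "r \<in> {0<..}" for r
    using DERIV_minus [OF has_real_derivative_powr [of r "- ?N"]] that by simp
  have W: "weak_eq {x. norm (x - 0) \<in> {0<..}} (\<lambda>x. ?w (norm (x - 0)) *\<^sub>R (x - 0))
      (\<lambda>x::'a. norm (x - 0) * ?w' (norm (x - 0)) + ?N * ?w (norm (x - 0))) 0"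
    by (rule weak_eq_radial [OF d]) (auto intro!: continuous_intros)
  have "norm x * ?w' (norm x) + ?N * ?w (norm x) = 0" if "x \<noteq> 0" for x :: 'a
    using powr_add [of "norm x" "- ?N - 1" 1] that by (simp add: algebra_simps)
  moreover have "{x. norm (x - 0) \<in> {0<..}} = - {0::'a}" by auto
  moreover have "?w (norm x) *\<^sub>R x = flux p (grad_mu p x)" for x :: 'a
    by (simp add: flux_grad_mu [OF assms])
  ultimately show ?thesis
    using weak_eq_cong [OF W, of "\<lambda>x. flux p (grad_mu p x)" "\<lambda>x. 0"] by simp
qed

lemma powr_antimono_base: "0 < a \<Longrightarrow> a \<le> b \<Longrightarrow> c \<le> 0 \<Longrightarrow> b powr c \<le> a powr (c::real)"
  using powr_mono2' [of c a b] by simp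

lemma annulus_measure:
  fixes r :: real
  assumes "0 < r"
  shows "measure lborel (cball (0::'a::euclidean_space) (2 * r) - ball 0 r)
    \<le> unit_ball_vol (real DIM('a)) * 2 ^ DIM('a) * r powr real DIM('a)"
proof -
  have "measure lborel (cball (0::'a) (2 * r) - ball 0 r) \<le> measure lborel (cball (0::'a) (2 * r))"
    by (rule measure_mono_fmeasurable) (auto intro: fmeasurable_compact)
  also have "\<dots> = unit_ball_vol (real DIM('a)) * 2 ^ DIM('a) * r powr real DIM('a)"
    using assms by (simp add: content_cball powr_realpow power_mult_distrib)
  finally show ?thesis .
qed

text \<open>The bound on an annulus scales like \<open>r\<close> to the power \<open>k\<close>, so dyadic annuli sum up.\<close>

lemma annuli_integrable_powr:
  fixes g :: "'a::euclidean_space \<Rightarrow> real"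
  assumes cont: "continuous_on (ball 0 \<rho> - {0}) g" and nn: "\<And>x. x \<in> ball 0 \<rho> - {0} \<Longrightarrow> 0 \<le> g x"
    and "0 < \<rho>" "- real DIM('a) < e" "e \<le> 0" "0 \<le> C"
    and bd: "\<And>x. x \<in> ball 0 \<rho> - {0} \<Longrightarrow> g x \<le> C * norm x powr e"
  shows "set_integrable lborel (ball 0 (\<rho> / 2)) g"
proof (rule annuli_integrable [OF cont nn])
  let ?V = "unit_ball_vol (real DIM('a)) * 2 ^ DIM('a)"
  show "0 < real DIM('a) + e" using assms by simp
  show "0 \<le> C * ?V" using assms by simp
  fix r assume r: "0 < r" "2 * r < \<rho>"
  let ?A = "cball (0::'a) (2 * r) - ball 0 r"
  have sub: "?A \<subseteq> ball 0 \<rho> - {0}" using r by auto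
  have fin: "emeasure lborel ?A < \<infinity>" by (rule emeasure_compact_finite) (simp add: compact_diff)
  have "(LINT x|lborel. indicator ?A x * g x) \<le> (LINT x|lborel. indicator ?A x * (C * r powr e))"
  proof (rule Bochner_Integration.integral_mono)
    show "integrable lborel (\<lambda>x. indicator ?A x * g x)"
      using borel_integrable_compact [of ?A g] continuous_on_subset [OF cont sub]
      by (simp add: compact_diff)
    show "integrable lborel (\<lambda>x. indicator ?A x * (C * r powr e))"
      using fin by (intro integrable_mult_left integrable_real_indicator) auto
    show "indicator ?A x * g x \<le> indicator ?A x * (C * r powr e)" for x
    proof (cases "x \<in> ?A")
      case True
      have "norm x powr e \<le> r powr e" using True r assms by (intro powr_antimono_base) auto
      then have "C * norm x powr e \<le> C * r powr e" using assms by (intro mult_left_mono) auto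
      moreover have "g x \<le> C * norm x powr e" using bd [of x] sub True by blast
      ultimately show ?thesis using True by simp
    qed simp
  qed
  also have "\<dots> = measure lborel ?A * (C * r powr e)" by simp
  also have "\<dots> \<le> (?V * r powr real DIM('a)) * (C * r powr e)"
    using annulus_measure [OF r(1), where 'a = 'a] assms by (intro mult_right_mono) auto
  also have "\<dots> = C * ?V * r powr (real DIM('a) + e)" by (simp add: powr_add)
  finally show "(LINT x|lborel. indicator ?A x * g x) \<le> C * ?V * r powr (real DIM('a) + e)" .
qed (use assms in auto)

lemma set_integrable_norm_cancel:
  fixes F :: "'a::euclidean_space \<Rightarrow> 'b::euclidean_space"
  assumes "set_integrable lborel (ball 0 \<rho>) (\<lambda>x. norm (F x))" "continuous_on (ball 0 \<rho> - {0}) F"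
  shows "set_integrable lborel (ball 0 \<rho>) F"
proof -
  let ?f = "\<lambda>x. indicator (ball 0 \<rho> - {0}) x *\<^sub>R F x"
  have m: "?f \<in> borel_measurable lborel"
    using borel_measurable_continuous_on_indicator [OF _ assms(2)] by simp
  have eq: "(\<lambda>x. indicator (ball 0 \<rho>) x *\<^sub>R F x) = (\<lambda>x. ?f x + indicator {0} x *\<^sub>R (indicator (ball 0 \<rho>) (0::'a) *\<^sub>R F 0))"
    by (auto simp: indicator_def fun_eq_iff)
  have m2: "(\<lambda>x. ?f x + indicator {0} x *\<^sub>R (indicator (ball 0 \<rho>) (0::'a) *\<^sub>R F 0)) \<in> borel_measurable lborel"
    by (rule borel_measurable_add [OF m]) (intro borel_measurable_scaleR borel_measurable_indicator borel_measurable_const, simp)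
  have m: "(\<lambda>x. indicator (ball 0 \<rho>) x *\<^sub>R F x) \<in> borel_measurable lborel"
    unfolding eq by (rule m2)
  show ?thesis
    unfolding set_integrable_def
    by (rule Bochner_Integration.integrable_bound [OF assms(1) [unfolded set_integrable_def] m])
       (auto simp: indicator_def)
qed

lemma L1_loc_flux_mu:
  assumes "1 < p" "open (U :: 'a::euclidean_space set)"
  shows "L1_loc U (\<lambda>x. flux p (grad_mu p x))"
proof (rule L1_loc_punctured [OF assms(2) continuous_on_flux_mu [OF assms(1)]])
  have c: "continuous_on (ball 0 2 - {0 :: 'a}) (\<lambda>x. flux p (grad_mu p x))"
    by (rule continuous_on_flux_mu [OF assms(1)])
  have "set_integrable lborel (ball (0::'a) (2 / 2)) (\<lambda>x. norm (flux p (grad_mu p x)))"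
  proof (rule annuli_integrable_powr [where C = 1 and e = "1 - real DIM('a)"])
    show "continuous_on (ball 0 2 - {0 :: 'a}) (\<lambda>x. norm (flux p (grad_mu p x)))"
      using c by (intro continuous_intros)
    show "norm (flux p (grad_mu p x)) \<le> 1 * norm x powr (1 - real DIM('a))" if "x \<in> ball 0 2 - {0}" for x :: 'a
      using that powr_add [of "norm x" "- real DIM('a)" 1] by (simp add: flux_grad_mu [OF assms(1)])
    have "1 \<le> real DIM('a)" using DIM_positive [where 'a = 'a] by linarith
    then show "1 - real DIM('a) \<le> 0" by simp
  qed auto
  then have "set_integrable lborel (ball (0::'a) 1) (\<lambda>x. norm (flux p (grad_mu p x)))" by simp
  then show "set_integrable lborel (ball (0::'a) 1) (\<lambda>x. flux p (grad_mu p x))"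
    by (rule set_integrable_norm_cancel [OF _ continuous_on_flux_mu [OF assms(1)]])
qed simp

lemma mu_profile_at_0:
  assumes "1 < p" "p \<le> real N"
  shows "filterlim (mu_profile N p) at_top (at_right 0)"
proof (cases "p = real N")
  case True
  have "filterlim (\<lambda>r::real. - ln r) at_top (at_right 0)"
    by (rule filterlim_uminus_at_bot [THEN iffD1, OF ln_at_0])
  with True show ?thesis by (simp add: mu_profile_def [abs_def])
next
  case False
  then have n: "(p - real N) / (p - 1) < 0" "0 < (p - 1) / (real N - p)"
    using assms by (auto intro!: divide_neg_pos divide_pos_pos)
  have "filterlim (\<lambda>r::real. r powr ((p - real N) / (p - 1))) at_top (at_right 0)"
  proof -
    have "filterlim (\<lambda>r::real. exp ((p - real N) / (p - 1) * ln r)) at_top (at_right 0)"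
    proof (rule filterlim_compose [OF exp_at_top])
      have "filterlim (\<lambda>r::real. - ln r) at_top (at_right 0)"
        by (rule filterlim_uminus_at_bot [THEN iffD1, OF ln_at_0])
      then have "filterlim (\<lambda>r::real. - ((p - real N) / (p - 1)) * - ln r) at_top (at_right 0)"
        using n by (intro filterlim_tendsto_pos_mult_at_top [where c = "- ((p - real N) / (p - 1))", OF tendsto_const]) simp_all
      then show "filterlim (\<lambda>r::real. (p - real N) / (p - 1) * ln r) at_top (at_right 0)" by simp
    qed
    moreover have "\<forall>\<^sub>F r::real in at_right 0. exp ((p - real N) / (p - 1) * ln r) = r powr ((p - real N) / (p - 1))"
      using eventually_at_right_less [of 0] by eventually_elim (simp add: powr_def)
    ultimately show ?thesis by (rule filterlim_cong [OF refl refl, THEN iffD1, rotated])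
  qed
  then have "filterlim (\<lambda>r::real. (p - 1) / (real N - p) * r powr ((p - real N) / (p - 1))) at_top (at_right 0)"
    by (rule filterlim_tendsto_pos_mult_at_top [OF tendsto_const n(2)])
  with False show ?thesis by (simp add: mu_profile_def [abs_def])
qed

lemma norm_at_0: "filterlim (norm :: 'a::euclidean_space \<Rightarrow> real) (at_right 0) (at 0)"
proof -
  have "(norm \<longlongrightarrow> 0) (at (0::'a))" by (rule tendsto_norm_zero) (rule tendsto_ident_at)
  moreover have "\<forall>\<^sub>F x in at (0::'a). norm x \<in> {0<..} \<and> norm x \<noteq> 0"
    unfolding eventually_at by (intro exI [of _ 1]) simp
  ultimately show ?thesis unfolding filterlim_at by simp
qed

lemma mu_at_0: "1 < p \<Longrightarrow> p \<le> real DIM('a) \<Longrightarrow> filterlim (mu p :: 'a::euclidean_space \<Rightarrow> real) at_top (at 0)"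
  unfolding mu_eq_profile [abs_def] by (rule filterlim_compose [OF mu_profile_at_0 norm_at_0])

text \<open>A truncation of u weighs the mass by the height J, while the gradient term sees only the
  levels between a and b. If F is the flux of u itself, this is the energy identity behind the
  positivity and the comparison of masses.\<close>

lemma truncation_test:
  fixes u :: "'a::euclidean_space \<Rightarrow> real"
  assumes W: "weak_eq (ball 0 \<rho>) F g m" and u: "C1_on (ball 0 \<rho> - {0}) u D" and lim: "filterlim u at_top (at 0)"
    and "0 < \<rho>'" "\<rho>' < \<rho>" and shell: "\<And>x. \<rho>' \<le> norm x \<Longrightarrow> norm x < \<rho> \<Longrightarrow> u x \<le> a"
    and der: "\<And>s. (\<theta> has_real_derivative \<tau> s) (at s)" "continuous_on UNIV \<tau>"
    and "\<And>s. s \<le> a \<Longrightarrow> \<theta> s = 0" "\<And>s. b \<le> s \<Longrightarrow> \<theta> s = J" "\<And>s. b \<le> s \<Longrightarrow> \<tau> s = 0"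
    and LF: "L1_loc (ball 0 \<rho>) F" and Lg: "L1_loc (ball 0 \<rho>) g"
  defines "B \<equiv> ball 0 \<rho> - {0}"
  shows "integrable lborel (\<lambda>x. indicator B x * (\<tau> (u x) * (F x \<bullet> D x)))"
    and "integrable lborel (\<lambda>x. indicator B x * (g x * \<theta> (u x)))"
    and "(LINT x|lborel. indicator B x * (\<tau> (u x) * (F x \<bullet> D x))) + (LINT x|lborel. indicator B x * (g x * \<theta> (u x))) = m * J"
proof -
  let ?\<phi> = "\<lambda>x. if x = 0 then J else if x \<in> ball 0 \<rho> then \<theta> (u x) else 0"
  let ?E = "\<lambda>x. if x = 0 then 0 else if x \<in> ball 0 \<rho> then \<tau> (u x) *\<^sub>R D x else 0"
  have C: "C1c (ball 0 \<rho>) ?\<phi> ?E"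
    by (rule truncation_C1c [OF u lim assms(4,5) _ der(1,2) assms(9,10,11)]) (use shell in auto)
  have e1: "(\<lambda>x. F x \<bullet> ?E x) = (\<lambda>x. indicator B x * (\<tau> (u x) * (F x \<bullet> D x)))"
    by (auto simp: B_def indicator_def fun_eq_iff)
  show i1: "integrable lborel (\<lambda>x. indicator B x * (\<tau> (u x) * (F x \<bullet> D x)))"
    using L1_loc_integrable_mult(1) [OF C LF] unfolding e1 .
  have i2': "integrable lborel (\<lambda>x. g x * ?\<phi> x)"
    by (rule L1_loc_integrable_mult(2) [OF C Lg])
  have ae: "AE x in lborel. g x * ?\<phi> x = indicator B x * (g x * \<theta> (u x))"
    using AE_lborel_singleton [of 0] by eventually_elim (auto simp: B_def indicator_def)
  have e2: "(\<lambda>x. indicator B x * (g x * \<theta> (u x))) = (\<lambda>x. indicator (- {0}) x * (g x * ?\<phi> x))"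
    by (auto simp: B_def indicator_def fun_eq_iff)
  show i2: "integrable lborel (\<lambda>x. indicator B x * (g x * \<theta> (u x)))"
    unfolding e2 using integrable_mult_indicator [OF _ i2', of "- {0}"] by simp
  have "(LINT x|lborel. F x \<bullet> ?E x) + (LINT x|lborel. g x * ?\<phi> x) = m * J"
  proof -
    have "(LINT x|lborel. F x \<bullet> ?E x + g x * ?\<phi> x) = m * ?\<phi> 0" using W C unfolding weak_eq_def by blast
    moreover have "(LINT x|lborel. F x \<bullet> ?E x + g x * ?\<phi> x) = (LINT x|lborel. F x \<bullet> ?E x) + (LINT x|lborel. g x * ?\<phi> x)"
      by (rule Bochner_Integration.integral_add [OF L1_loc_integrable_mult(1) [OF C LF] i2'])
    ultimately show ?thesis by simp
  qed
  moreover have "(LINT x|lborel. g x * ?\<phi> x) = (LINT x|lborel. indicator B x * (g x * \<theta> (u x)))"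
    by (rule integral_cong_AE) (use ae i2 i2' in \<open>auto intro: borel_measurable_integrable\<close>)
  ultimately show "(LINT x|lborel. indicator B x * (\<tau> (u x) * (F x \<bullet> D x))) + (LINT x|lborel. indicator B x * (g x * \<theta> (u x))) = m * J"
    unfolding e1 by simp
qed

lemma C1_on_bounded_shell:
  fixes u :: "'a::euclidean_space \<Rightarrow> real"
  assumes "continuous_on (cball 0 \<rho> - ball 0 \<rho>') u"
  obtains a where "\<And>x. \<rho>' \<le> norm x \<Longrightarrow> norm x \<le> \<rho> \<Longrightarrow> u x \<le> a"
proof -
  have "bounded (u ` (cball 0 \<rho> - ball 0 \<rho>'))"
    by (intro compact_imp_bounded compact_continuous_image assms) (simp add: compact_diff)
  then obtain a where "\<forall>x\<in>cball 0 \<rho> - ball 0 \<rho>'. \<bar>u x\<bar> \<le> a" unfolding bounded_iff by auto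
  then show thesis by (intro that [of a]) force
qed

text \<open>Existence is \<open>point_mass\<close>. The sign follows by testing with a truncation of
  mu_p: c J is then a weighted energy of mu_p between two levels.\<close>

lemma weak_eq_mu:
  assumes "1 < p" "p \<le> real DIM('a)"
  obtains c where "0 < c" "weak_eq (UNIV :: 'a::euclidean_space set) (\<lambda>x. flux p (grad_mu p x)) (\<lambda>x. 0) c"
proof -
  have "weak_eq (UNIV - {0 :: 'a}) (\<lambda>x. flux p (grad_mu p x)) (\<lambda>x. 0) 0"
    using weak_eq_mu0 [OF assms(1)] by (simp add: Compl_eq_Diff_UNIV)
  moreover have "L1_loc (UNIV :: 'a set) (\<lambda>x. 0::real)" by (simp add: L1_loc_def set_integrable_def)
  ultimately obtain c where c: "weak_eq (UNIV :: 'a set) (\<lambda>x. flux p (grad_mu p x)) (\<lambda>x. 0) c"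
    using point_mass [OF _ open_UNIV UNIV_I L1_loc_flux_mu [OF assms(1) open_UNIV]] by blast
  have cm: "C1_on S (mu p) (grad_mu p)" if "0 \<notin> S" for S :: "'a set"
    using C1_on_subset [OF C1_on_mu [OF assms(1)]] that by auto
  obtain a where a: "\<And>x::'a. 1 \<le> norm x \<Longrightarrow> norm x \<le> 2 \<Longrightarrow> mu p x \<le> a"
    by (rule C1_on_bounded_shell [OF C1_on_continuous [OF cm], where \<rho> = 2 and \<rho>' = 1]) auto
  obtain \<theta> \<tau> :: "real \<Rightarrow> real" and J where th: "\<And>s. (\<theta> has_real_derivative \<tau> s) (at s)" "continuous_on UNIV \<tau>"
    "\<And>s. 0 \<le> \<tau> s" "\<And>s. a + 1 \<le> s \<Longrightarrow> s \<le> (a + 4) - 1 \<Longrightarrow> \<tau> s = 1"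
    "\<And>s. (a + 4) \<le> s \<Longrightarrow> \<tau> s = 0" "\<And>s. s \<le> a \<Longrightarrow> \<theta> s = 0" "\<And>s. (a + 4) \<le> s \<Longrightarrow> \<theta> s = J" "0 < J"
    by (rule smooth_step [of a "a + 4"]) (simp, blast)
  define h where "h = (\<lambda>x::'a. indicator (ball 0 2 - {0}) x * (\<tau> (mu p x) * (flux p (grad_mu p x) \<bullet> grad_mu p x)))"
  have W2: "weak_eq (ball (0::'a) 2) (\<lambda>x. flux p (grad_mu p x)) (\<lambda>x. 0) c"
    by (rule weak_eq_subset [OF c]) simp
  note T = truncation_test [OF W2 cm mu_at_0 [OF assms] _ _ _ th(1,2,6,7,5) L1_loc_flux_mu [OF assms(1) open_ball], where \<rho>' = 1 and a = a and b = "a + 4"]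
  have i: "integrable lborel h" and e: "(LINT x|lborel. h x) = c * J"
    unfolding h_def using T(1,3) a by (simp_all add: L1_loc_def set_integrable_def)
  have h0: "0 \<le> h x" for x using th(3) by (simp add: h_def flux_inner)
  \<comment> \<open>A level on the plateau of \<tau> is attained on a ray by the intermediate value
    theorem, as mu_p runs from at most a to infinity.\<close>
  obtain x0 :: 'a where x0: "x0 \<in> ball 0 2 - {0}" "mu p x0 = a + 2"
  proof -
    have "\<forall>\<^sub>F r in at_right 0. a + 2 \<le> mu_profile DIM('a) p r"
      using mu_profile_at_0 [OF assms] by (simp add: filterlim_at_top)
    moreover have "\<forall>\<^sub>F r in at_right 0. r \<in> {0<..<1::real}" by (rule eventually_at_right_real) simp
    ultimately have "\<forall>\<^sub>F r in at_right 0. a + 2 \<le> mu_profile DIM('a) p r \<and> r < 1 \<and> 0 < r"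
      by eventually_elim simp
    then obtain r where r: "a + 2 \<le> mu_profile DIM('a) p r" "r < 1" "0 < r"
      using eventually_happens' [OF trivial_limit_at_right_real] by blast
    have cont: "continuous_on {r..1} (mu_profile DIM('a) p)"
      using r by (intro continuous_at_imp_continuous_on ballI DERIV_isCont [OF DERIV_mu_profile [OF assms(1)]]) auto
    obtain e :: 'a where e: "e \<in> Basis" using nonempty_Basis by blast
    have "mu_profile DIM('a) p 1 \<le> a" using a [of e] e by (simp add: mu_eq_profile)
    then obtain s where s: "r \<le> s" "s \<le> 1" "mu_profile DIM('a) p s = a + 2"
      using IVT2' [of "mu_profile DIM('a) p" 1 "a + 2" r] r cont by auto
    show thesis
      by (rule that [of "s *\<^sub>R e"]) (use s r e in \<open>auto simp: mu_eq_profile\<close>)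
  qed
  have "isCont h x0"
  proof -
    have op: "open (ball 0 2 - {0 :: 'a})" by auto
    have "continuous_on (ball 0 2 - {0}) (\<lambda>x::'a. \<tau> (mu p x) * (flux p (grad_mu p x) \<bullet> grad_mu p x))"
      using cm [of "ball 0 2 - {0}"] C1_on_continuous [OF cm, of "ball 0 2 - {0}"] assms(1)
      by (intro continuous_intros continuous_on_compose2 [OF th(2)] continuous_on_flux_comp) (auto simp: C1_on_def)
    then have "continuous_on (ball 0 2 - {0}) h"
      by (rule continuous_on_eq) (simp add: h_def)
    then show ?thesis using x0 op by (simp add: continuous_on_eq_continuous_at)
  qed
  moreover have "0 < h x0"
    using x0 th(4) [of "a + 2"] by (simp add: h_def flux_inner norm_grad_mu)
  ultimately have "0 < c * J" using integral_pos_continuous [OF i h0] e by simp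
  then have "0 < c" using th(8) by (simp add: zero_less_mult_iff)
  with c show thesis by (intro that)
qed

text \<open>Points have zero \<open>p\<close>-capacity, as \<open>p \<le> N\<close>: truncations of \<open>\<mu>\<^sub>p\<close> have small energy.\<close>

lemma capacity_cutoff:
  fixes z :: "'a::euclidean_space"
  assumes "1 < p" "p \<le> real DIM('a)" "0 < r" "0 < \<epsilon>"
  obtains \<psi> D \<delta> where "C1_on UNIV \<psi> D" "\<And>x. 0 \<le> \<psi> x" "\<And>x. \<psi> x \<le> 1" "0 < \<delta>"
    "\<And>x. norm (x - z) < \<delta> \<Longrightarrow> \<psi> x = 0" "\<And>x. r \<le> norm (x - z) \<Longrightarrow> \<psi> x = 1"
    "\<And>x. r < norm (x - z) \<Longrightarrow> D x = 0"
    "integrable lborel (\<lambda>x. norm (D x) powr p)" "(LINT x|lborel. norm (D x) powr p) \<le> \<epsilon>"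
proof -
  obtain c where c: "0 < c" "weak_eq (UNIV :: 'a set) (\<lambda>x. flux p (grad_mu p x)) (\<lambda>x. 0) c"
    by (rule weak_eq_mu [OF assms(1,2)]) auto
  have cm: "C1_on S (mu p) (grad_mu p)" if "0 \<notin> S" for S :: "'a set"
    using C1_on_subset [OF C1_on_mu [OF assms(1)]] that by auto
  obtain a where a: "\<And>x::'a. r / 2 \<le> norm x \<Longrightarrow> norm x \<le> r \<Longrightarrow> mu p x \<le> a"
    by (rule C1_on_bounded_shell [OF C1_on_continuous [OF cm], where \<rho> = r and \<rho>' = "r / 2"]) (use assms in auto)
  \<comment> \<open>Divided by its height J, the truncation has energy at most c J^(1-p); J >= L
    makes this at most \<epsilon>.\<close>
  define L where "L = max 1 ((c / \<epsilon>) powr (1 / (p - 1)))"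
  obtain \<theta> \<tau> :: "real \<Rightarrow> real" and J where th: "\<And>s. (\<theta> has_real_derivative \<tau> s) (at s)" "continuous_on UNIV \<tau>"
    "\<And>s. 0 \<le> \<tau> s" "\<And>s. \<tau> s \<le> 1" 
    "\<And>s. (a + L + 2) \<le> s \<Longrightarrow> \<tau> s = 0" "\<And>s. s \<le> a \<Longrightarrow> \<theta> s = 0" "\<And>s. (a + L + 2) \<le> s \<Longrightarrow> \<theta> s = J" "0 < J"
    "\<And>s. 0 \<le> \<theta> s" "\<And>s. \<theta> s \<le> J" "(a + L + 2) - a - 2 \<le> J"
    by (rule smooth_step [of a "a + L + 2"]) (simp add: L_def, blast)
  have LJ: "L \<le> J" using th(11) by simp
  have "c / \<epsilon> = ((c / \<epsilon>) powr (1 / (p - 1))) powr (p - 1)"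
    using c assms by (simp add: powr_powr)
  also have "\<dots> \<le> J powr (p - 1)"
    using LJ assms by (intro powr_mono2) (auto simp: L_def)
  finally have cJ: "c \<le> \<epsilon> * J powr (p - 1)" using assms by (simp add: field_simps)
  let ?B = "ball (0::'a) r - {0}"
  have W2: "weak_eq (ball (0::'a) r) (\<lambda>x. flux p (grad_mu p x)) (\<lambda>x. 0) c"
    by (rule weak_eq_subset [OF c(2)]) simp
  note T = truncation_test [OF W2 cm mu_at_0 [OF assms(1,2)] _ _ _ th(1,2,6,7,5) L1_loc_flux_mu [OF assms(1) open_ball], where \<rho>' = "r / 2" and a = a and b = "a + L + 2"]
  have i: "integrable lborel (\<lambda>x. indicator ?B x * (\<tau> (mu p x) * norm (grad_mu p x) powr p))"
   and e: "(LINT x|lborel. indicator ?B x * (\<tau> (mu p x) * norm (grad_mu p x) powr p)) = c * J"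
    using T(1,3) a assms(1,3) by (simp_all add: L1_loc_def set_integrable_def flux_inner)
  have lim: "filterlim (mu p :: 'a \<Rightarrow> real) at_top (at 0)" by (rule mu_at_0 [OF assms(1,2)])
  let ?\<phi> = "\<lambda>x. if x = 0 then J else if x \<in> ball 0 r then \<theta> (mu p x) else 0"
  let ?E = "\<lambda>x::'a. if x = 0 then 0 else if x \<in> ball 0 r then \<tau> (mu p x) *\<^sub>R grad_mu p x else 0"
  have C: "C1c (ball 0 r) ?\<phi> ?E"
    by (rule truncation_C1c [OF cm lim _ _ _ th(1,2,6,7,5), where \<rho>' = "r / 2"]) (use a assms in auto)
  define \<psi>0 :: "'a \<Rightarrow> real" where "\<psi>0 = (\<lambda>x. 1 - 1 / J * ?\<phi> x)"
  define D0 where "D0 = (\<lambda>x. 0 - (1 / J) *\<^sub>R ?E x)"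
  have CE: "C1_on UNIV ?\<phi> ?E" using C by (simp add: C1c_def)
  have C0: "C1_on UNIV \<psi>0 D0"
    unfolding \<psi>0_def D0_def by (rule C1_on_diff [OF C1_on_const C1_on_cmult [OF CE]])
  have C\<psi>: "C1_on UNIV (\<lambda>x. \<psi>0 (x - z)) (\<lambda>x. D0 (x - z))"
  proof -
    have "GDERIV (\<lambda>x. \<psi>0 (x - z)) x :> D0 (x - z)" for x
    proof -
      have "((\<lambda>x. x - z) has_derivative (\<lambda>h. h)) (at x)" by (auto intro!: derivative_eq_intros)
      moreover have "(\<psi>0 has_derivative (\<lambda>h. h \<bullet> D0 (x - z))) (at (x - z))"
        using C0 by (auto simp: C1_on_def gderiv_def)
      ultimately show ?thesis
        unfolding gderiv_def by (rule has_derivative_compose)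
    qed
    moreover have "continuous_on UNIV (\<lambda>x. D0 (x - z))"
    proof (rule continuous_on_compose2 [of UNIV D0])
      show "continuous_on UNIV D0" using C0 by (simp add: C1_on_def)
      show "continuous_on UNIV (\<lambda>x. x - z)" by (intro continuous_intros)
    qed simp
    ultimately show ?thesis by (simp add: C1_on_def)
  qed
  have "\<forall>\<^sub>F x in at (0::'a). a + L + 2 \<le> mu p x" using lim by (simp add: filterlim_at_top)
  then obtain d where d: "0 < d" "\<And>x::'a. x \<noteq> 0 \<Longrightarrow> norm x < d \<Longrightarrow> a + L + 2 \<le> mu p x"
    unfolding eventually_at by (auto simp: dist_norm)
  have bd: "norm (D0 x) powr p \<le> J powr (- p) * (indicator ?B x * (\<tau> (mu p x) * norm (grad_mu p x) powr p))" for x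
  proof (cases "x \<in> ?B")
    case True
    have "norm (D0 x) = (\<tau> (mu p x) * norm (grad_mu p x)) / J"
      using True th(3) [of "mu p x"] th(8) by (simp add: D0_def)
    then have "norm (D0 x) powr p = J powr (- p) * (\<tau> (mu p x) powr p * norm (grad_mu p x) powr p)"
      using th(3,8) by (simp only: powr_divide powr_mult powr_minus norm_ge_zero mult_nonneg_nonneg less_imp_le divide_inverse inverse_powr mult_ac)
    also have "\<dots> \<le> J powr (- p) * (\<tau> (mu p x) * norm (grad_mu p x) powr p)"
    proof (intro mult_left_mono mult_right_mono)
      show "\<tau> (mu p x) powr p \<le> \<tau> (mu p x)"
        using powr_mono' [of 1 p "\<tau> (mu p x)"] th(3,4) assms by (cases "\<tau> (mu p x) = 0") auto
    qed auto
    finally show ?thesis using True by simp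
  next
    case False
    then have "D0 x = 0" by (auto simp: D0_def)
    then show ?thesis using th(3) by simp
  qed
  have m0: "(\<lambda>x. norm (D0 x) powr p) \<in> borel_measurable borel"
  proof -
    have "continuous_on UNIV (\<lambda>x. norm (D0 x))"
      using C0 by (intro continuous_on_norm) (simp add: C1_on_def)
    then have "continuous_on UNIV (\<lambda>x. norm (D0 x) powr p)"
      by (rule continuous_on_powr' [OF _ continuous_on_const]) (use assms in auto)
    then show ?thesis by (rule borel_measurable_continuous_onI)
  qed
  have i0: "integrable lborel (\<lambda>x. norm (D0 x) powr p)"
    by (rule Bochner_Integration.integrable_bound [OF integrable_mult_right [OF i, of "J powr (- p)"]])
       (use m0 in simp, intro AE_I2, unfold real_norm_def abs_of_nonneg [OF powr_ge_zero],
        rule order_trans [OF bd abs_ge_self])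
  have "(LINT x|lborel. norm (D0 x) powr p) \<le> J powr (- p) * (c * J)"
    unfolding e [symmetric] integral_mult_right_zero [symmetric]
    by (rule Bochner_Integration.integral_mono [OF i0 integrable_mult_right [OF i] bd])
  also have "\<dots> \<le> \<epsilon>"
  proof -
    have "J powr (- p) * (c * J) \<le> J powr (- p) * ((\<epsilon> * J powr (p - 1)) * J)"
      using cJ th(8) by (intro mult_left_mono mult_right_mono) auto
    also have "\<dots> = \<epsilon> * (J powr (- p) * J powr (p - 1) * J powr 1)" using th(8) by simp
    also have "J powr (- p) * J powr (p - 1) * J powr 1 = 1"
      using th(8) by (simp only: powr_add [symmetric]) simp
    finally show ?thesis by simp
  qed
  finally have le: "(LINT x|lborel. norm (D0 x) powr p) \<le> \<epsilon>" .
  have sh: "(\<lambda>x. norm (D0 (x - z)) powr p) = (\<lambda>x. norm (D0 (- z + x)) powr p)" by simp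
  show thesis
  proof (rule that [OF C\<psi> _ _ d(1)])
    show "0 \<le> \<psi>0 (x - z)" "\<psi>0 (x - z) \<le> 1" for x
      using th(8) th(9,10) [of "mu p (x - z)"] by (auto simp: \<psi>0_def)
    show "\<psi>0 (x - z) = 0" if "norm (x - z) < d" for x
    proof (cases "x = z")
      case True
      then show ?thesis using th(8) by (simp add: \<psi>0_def)
    next
      case False
      then have *: "a + L + 2 \<le> mu p (x - z)" using d(2) [of "x - z"] that by simp
      \<comment> \<open>If d exceeded r, points at distance r would have mu_p both at least a + L +
        2 and at most a.\<close>
      have "\<not> r \<le> norm (x - z)"
      proof
        assume "r \<le> norm (x - z)"
        have d1: "r < d" using \<open>r \<le> norm (x - z)\<close> that by simp
        obtain e :: 'a where e: "e \<in> Basis" using nonempty_Basis by blast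
        have "a + L + 2 \<le> mu p (r *\<^sub>R e)" using d(2) [of "r *\<^sub>R e"] e d1 assms nonzero_Basis [OF e] by auto
        moreover have "mu p (r *\<^sub>R e) \<le> a" using a [of "r *\<^sub>R e"] e assms by auto
        ultimately show False by (simp add: L_def)
      qed
      then show ?thesis using th(7) [OF *] th(8) False by (simp add: \<psi>0_def)
    qed
    show "\<psi>0 (x - z) = 1" if "r \<le> norm (x - z)" for x
      using that assms by (auto simp: \<psi>0_def)
    show "D0 (x - z) = 0" if "r < norm (x - z)" for x
      using that assms by (auto simp: D0_def)
    show "integrable lborel (\<lambda>x. norm (D0 (x - z)) powr p)"
      unfolding sh using i0 m0
      by (subst (asm) lborel_distr_plus [symmetric, of "- z"]) (simp add: integrable_distr_eq)
    show "(LINT x|lborel. norm (D0 (x - z)) powr p) \<le> \<epsilon>"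
      unfolding sh using le m0 lborel_integral_shift [of "\<lambda>x. norm (D0 x) powr p" "- z"] by simp
  qed
qed

section \<open>Comparison\<close>

lemma DERIV_pos_part_powr:
  assumes "1 < a"
  shows "((\<lambda>t. max 0 t powr a) has_real_derivative a * max 0 t powr (a - 1)) (at t)"
proof -
  consider "t < 0" | "0 < t" | "t = 0" by linarith
  then show ?thesis
  proof cases
    case 1
    have "((\<lambda>t. 0) has_real_derivative 0) (at t)" by simp
    then have "((\<lambda>t. max 0 t powr a) has_real_derivative 0) (at t)"
      by (rule has_field_derivative_transform_within_open [where S = "{..<0}"]) (use 1 in auto)
    with 1 show ?thesis by simp
  next
    case 2
    then have "((\<lambda>t. t powr a) has_real_derivative a * t powr (a - 1)) (at t)"
      by (rule has_real_derivative_powr)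
    then have "((\<lambda>t. max 0 t powr a) has_real_derivative a * t powr (a - 1)) (at t)"
      by (rule has_field_derivative_transform_within_open [where S = "{0<..}"]) (use 2 in auto)
    with 2 show ?thesis by simp
  next
    case 3
    have "((\<lambda>y. \<bar>y\<bar> powr (a - 1)) \<longlongrightarrow> 0) (at (0::real))"
      using assms by (auto intro!: tendsto_eq_intros)
    then have "((\<lambda>y. (max 0 y powr a - max 0 0 powr a) / (y - 0)) \<longlongrightarrow> 0) (at (0::real))"
    proof (rule Lim_null_comparison [rotated])
      show "\<forall>\<^sub>F y in at 0. norm ((max 0 y powr a - max 0 0 powr a) / (y - 0)) \<le> \<bar>y\<bar> powr (a - 1)"
      proof (intro always_eventually allI)
        fix y :: real
        show "norm ((max 0 y powr a - max 0 0 powr a) / (y - 0)) \<le> \<bar>y\<bar> powr (a - 1)"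
          using powr_diff [of y a 1] by (cases "0 < y") auto
      qed
    qed
    then show ?thesis using 3 assms by (simp add: has_field_derivative_iff)
  qed
qed

text \<open>Split according to y <= \<epsilon> x. The constants are not sharp; where sharp ones
  matter, \<open>flux_inner_young\<close> is used.\<close>

lemma young_simple:
  fixes x y :: real
  assumes "0 \<le> x" "0 \<le> y" "0 < \<epsilon>" "1 < p"
  shows "x powr (p - 1) * y \<le> \<epsilon> * x powr p + \<epsilon> powr (1 - p) * y powr p"
proof (cases "y \<le> \<epsilon> * x")
  case True
  have "x powr (p - 1) * y \<le> x powr (p - 1) * (\<epsilon> * x)" using True by (intro mult_left_mono) auto
  also have "\<dots> = \<epsilon> * x powr p"
    using powr_add [of x "p - 1" 1] assms by (cases "x = 0") auto
  finally show ?thesis by (rule order_trans) simp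
next
  case False
  then have xy: "x \<le> y / \<epsilon>" "0 < y" using assms by (auto simp: field_simps mult_nonneg_nonneg intro: le_less_trans [of 0 "\<epsilon> * x"])
  have "x powr (p - 1) * y \<le> (y / \<epsilon>) powr (p - 1) * y"
    using xy assms by (intro mult_right_mono powr_mono2) auto
  also have "\<dots> = \<epsilon> powr (1 - p) * y powr p"
    using powr_add [of y "p - 1" 1] powr_minus [of \<epsilon> "p - 1"] xy assms
    by (simp add: powr_mult inverse_powr divide_inverse)
  finally show ?thesis by (rule order_trans) (use assms in simp)
qed

text \<open>Here a and b are the gradients of f and V, and w is the height of f - V above a level.
  If |b| is not much larger than |a|, the strict source \<open>g0\<close> wins by \<gamma> / 2 and
  the flux term is dropped. Otherwise |b| >= \<kappa> |a| with \<kappa> > 1, and strong monotonicity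
  yields a multiple of |b|^p that absorbs |b|^q w, because w <= \<tau> is small, q < p and |b| >=
  c0. The weight 1 + |b|^p on the left is later spent on the gradient of the cutoff.\<close>

lemma touch_pointwise:
  assumes "1 < p" "0 < q" "q < p" "0 < c0" "c0 \<le> C0" "0 < \<gamma>"
  obtains \<tau> c1 where "0 < \<tau>" "0 < c1"
    "\<And>(a :: 'a::euclidean_space) b g0 gv w. c0 \<le> norm a \<Longrightarrow> norm a \<le> C0 \<Longrightarrow> norm a powr q + \<gamma> \<le> g0 \<Longrightarrow> gv \<le> norm b powr q
       \<Longrightarrow> 0 \<le> w \<Longrightarrow> w \<le> \<tau> \<Longrightarrow>
       c1 * (w\<^sup>2 * (1 + norm b powr p)) \<le> 2 * w * ((flux p a - flux p b) \<bullet> (a - b)) + (g0 - gv) * w\<^sup>2"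
proof -
  define \<Lambda> where "\<Lambda> = (C0 powr q + \<gamma> / 2) powr (1 / q)"
  \<comment> \<open>Read off from the second regime: |b|^q > |a|^q + \<gamma> / 2 together with |a|
    <= C0 forces |b|^q >= \<kappa>^q |a|^q.\<close>
  define \<kappa> where "\<kappa> = (1 + \<gamma> / (2 * C0 powr q)) powr (1 / q)"
  define m where "m = (1 - \<kappa> powr (1 - p)) * (1 - 1 / \<kappa>)"
  have C0: "0 < C0" using assms by simp
  have \<kappa>: "1 < \<kappa>"
    unfolding \<kappa>_def using C0 assms by (intro gr_one_powr) auto
  have "\<kappa> powr (1 - p) < 1" using \<kappa> assms powr_less_mono [of "1 - p" 0 \<kappa>] by simp
  then have m: "0 < m" unfolding m_def using \<kappa> by simp
  define \<tau> where "\<tau> = min 1 (m * c0 powr (p - q))"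
  define c1 where "c1 = min (\<gamma> / 2 / (1 + \<Lambda> powr p)) (min (m / 2) (m / 2 * c0 powr p))"
  have L: "0 < 1 + \<Lambda> powr p" by (simp add: add_pos_nonneg)
  have \<tau>: "0 < \<tau>" using m assms by (simp add: \<tau>_def)
  have c1: "0 < c1" using m assms L by (simp add: c1_def)
  show thesis
  proof (rule that [OF \<tau> c1])
    fix a b :: 'a and g0 gv w
    assume h: "c0 \<le> norm a" "norm a \<le> C0" "norm a powr q + \<gamma> \<le> g0" "gv \<le> norm b powr q" "0 \<le> w" "w \<le> \<tau>"
    define M where "M = (flux p a - flux p b) \<bullet> (a - b)"
    have M0: "0 \<le> M" unfolding M_def by (rule flux_mono [OF assms(1)])
    have "c1 * (w * (1 + norm b powr p)) \<le> 2 * M + (g0 - gv) * w"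
    proof (cases "norm b powr q \<le> norm a powr q + \<gamma> / 2")
      case True
      have "norm a powr q \<le> C0 powr q" using h assms by (intro powr_mono2) auto
      with True have "norm b powr q \<le> C0 powr q + \<gamma> / 2" by simp
      then have "(norm b powr q) powr (1 / q) \<le> \<Lambda>" unfolding \<Lambda>_def using assms by (intro powr_mono2) auto
      then have "norm b \<le> \<Lambda>" using assms by (simp add: powr_powr)
      then have "norm b powr p \<le> \<Lambda> powr p" using assms by (intro powr_mono2) auto
      then have "c1 * (1 + norm b powr p) \<le> c1 * (1 + \<Lambda> powr p)" using c1 by (intro mult_left_mono) auto
      also have "\<dots> \<le> (\<gamma> / 2 / (1 + \<Lambda> powr p)) * (1 + \<Lambda> powr p)"
        using L by (intro mult_right_mono) (auto simp: c1_def)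
      also have "\<dots> = \<gamma> / 2" using L by (intro nonzero_eq_divide_eq [THEN iffD1]) auto
      also have "\<dots> \<le> g0 - gv" using h True by linarith
      finally have "c1 * (1 + norm b powr p) * w \<le> (g0 - gv) * w" using h by (intro mult_right_mono) auto
      then show ?thesis using M0 by (simp add: mult_ac)
    next
      case False
      let ?\<sigma> = "norm a" and ?\<beta> = "norm b"
      have s0: "0 < ?\<sigma>" using h assms by linarith
      have "?\<sigma> powr q \<le> C0 powr q" using h assms by (intro powr_mono2) auto
      then have "?\<sigma> powr q * (\<gamma> / (2 * C0 powr q)) \<le> C0 powr q * (\<gamma> / (2 * C0 powr q))"
        using assms by (intro mult_right_mono) auto
      then have "?\<sigma> powr q * (1 + \<gamma> / (2 * C0 powr q)) \<le> ?\<sigma> powr q + \<gamma> / 2"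
        using C0 by (simp add: distrib_left)
      then have "?\<sigma> powr q * (1 + \<gamma> / (2 * C0 powr q)) \<le> ?\<beta> powr q" using False by simp
      then have "(?\<sigma> powr q * (1 + \<gamma> / (2 * C0 powr q))) powr (1 / q) \<le> (?\<beta> powr q) powr (1 / q)"
        using assms C0 by (intro powr_mono2) auto
      moreover have "(?\<sigma> powr q * (1 + \<gamma> / (2 * C0 powr q))) powr (1 / q) = (?\<sigma> powr q) powr (1 / q) * \<kappa>"
        unfolding \<kappa>_def by (rule powr_mult)
      ultimately have k: "\<kappa> * ?\<sigma> \<le> ?\<beta>" using assms by (simp add: powr_powr mult.commute)
      have s: "?\<sigma> \<le> ?\<beta> / \<kappa>" using k \<kappa> by (simp add: field_simps)
      have b0: "0 < ?\<beta>" using k \<kappa> s0 by (meson less_le_trans less_trans mult_pos_pos zero_less_one)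
      have "1 * ?\<sigma> \<le> \<kappa> * ?\<sigma>" using \<kappa> by (intro mult_right_mono) auto
      with k have sb: "?\<sigma> \<le> ?\<beta>" by simp
      have "?\<sigma> powr (p - 1) \<le> (?\<beta> / \<kappa>) powr (p - 1)" using s assms by (intro powr_mono2) auto
      also have "\<dots> = \<kappa> powr (1 - p) * ?\<beta> powr (p - 1)"
        using \<kappa> powr_minus [of \<kappa> "p - 1"] by (simp add: powr_mult inverse_powr divide_inverse)
      finally have d1: "(1 - \<kappa> powr (1 - p)) * ?\<beta> powr (p - 1) \<le> ?\<beta> powr (p - 1) - ?\<sigma> powr (p - 1)"
        by (simp add: algebra_simps)
      have d2: "(1 - 1 / \<kappa>) * ?\<beta> \<le> ?\<beta> - ?\<sigma>" using s by (simp add: algebra_simps)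
      have "m * ?\<beta> powr p = ((1 - \<kappa> powr (1 - p)) * ?\<beta> powr (p - 1)) * ((1 - 1 / \<kappa>) * ?\<beta>)"
        using powr_add [of ?\<beta> "p - 1" 1] b0 by (simp add: m_def)
      also have "\<dots> \<le> (?\<beta> powr (p - 1) - ?\<sigma> powr (p - 1)) * (?\<beta> - ?\<sigma>)"
        using d1 d2 \<kappa> \<open>\<kappa> powr (1 - p) < 1\<close> b0 sb powr_mono2 [of "p - 1" ?\<sigma> ?\<beta>] assms
        by (intro mult_mono) auto
      also have "\<dots> \<le> M"
        using flux_mono_strong [of a p b] unfolding M_def by (simp add: algebra_simps)
      finally have mM: "m * ?\<beta> powr p \<le> M" .
      have cb: "c0 \<le> ?\<beta>" using sb h by simp
      have "?\<beta> powr q = ?\<beta> powr (q - p) * ?\<beta> powr p" using b0 by (simp add: powr_add [symmetric])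
      also have "\<dots> \<le> c0 powr (q - p) * ?\<beta> powr p"
        using powr_mono2' [of "q - p" c0 ?\<beta>] cb assms by (intro mult_right_mono) auto
      finally have bq: "?\<beta> powr q \<le> c0 powr (q - p) * ?\<beta> powr p" .
      have "gv * w - g0 * w \<le> ?\<beta> powr q * w"
      proof -
        have "gv * w \<le> ?\<beta> powr q * w" using h by (intro mult_right_mono) auto
        moreover have "0 \<le> g0 * w" using h assms powr_ge_zero [of ?\<sigma> q]
          by (intro mult_nonneg_nonneg) linarith+
        ultimately show ?thesis by simp
      qed
      also have "\<dots> \<le> (c0 powr (q - p) * ?\<beta> powr p) * \<tau>"
        using bq h by (intro mult_mono) auto
      also have "\<dots> \<le> (c0 powr (q - p) * ?\<beta> powr p) * (m * c0 powr (p - q))"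
        by (intro mult_left_mono) (auto simp: \<tau>_def)
      also have "\<dots> = m * ?\<beta> powr p * (c0 powr (q - p) * c0 powr (p - q))" by simp
      also have "c0 powr (q - p) * c0 powr (p - q) = 1"
        using assms by (simp add: powr_add [symmetric])
      finally have 1: "gv * w - g0 * w \<le> m * ?\<beta> powr p" by simp
      have "c0 powr p \<le> ?\<beta> powr p" using cb assms by (intro powr_mono2) auto
      then have "m / 2 * c0 powr p \<le> m / 2 * ?\<beta> powr p" using m by (intro mult_left_mono) auto
      moreover have "c1 \<le> m / 2 * c0 powr p" unfolding c1_def by (intro min.coboundedI2) simp
      ultimately have "c1 \<le> m / 2 * ?\<beta> powr p" by linarith
      moreover have "c1 \<le> m / 2" unfolding c1_def by (intro min.coboundedI2 min.coboundedI1) simp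
      then have "c1 * ?\<beta> powr p \<le> m / 2 * ?\<beta> powr p" by (intro mult_right_mono) auto
      ultimately have "c1 * (1 + ?\<beta> powr p) \<le> m * ?\<beta> powr p" by (simp add: algebra_simps)
      moreover have "c1 * (w * (1 + ?\<beta> powr p)) \<le> c1 * (1 * (1 + ?\<beta> powr p))"
        using c1 h by (intro mult_left_mono mult_right_mono) (auto simp: \<tau>_def)
      ultimately have "c1 * (w * (1 + ?\<beta> powr p)) \<le> m * ?\<beta> powr p" by simp
      with 1 mM show ?thesis by (simp add: algebra_simps)
    qed
    then have "c1 * (w * (1 + norm b powr p)) * w \<le> (2 * M + (g0 - gv) * w) * w"
      using h by (intro mult_right_mono) auto
    then show "c1 * (w\<^sup>2 * (1 + norm b powr p)) \<le> 2 * w * ((flux p a - flux p b) \<bullet> (a - b)) + (g0 - gv) * w\<^sup>2"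
      unfolding M_def [symmetric] by (simp add: algebra_simps power2_eq_square)
  qed
qed

lemma usc_attains_max:
  fixes H :: "'a::euclidean_space \<Rightarrow> real"
  assumes "compact X" "X \<noteq> {}" and usc: "\<And>c. closed {x\<in>X. c \<le> H x}"
  shows "\<exists>x\<in>X. \<forall>y\<in>X. H y \<le> H x"
proof (rule ccontr)
  assume "\<not> ?thesis"
  then have no: "\<forall>x\<in>X. \<exists>y\<in>X. H x < H y" by (auto simp: not_le)
  let ?O = "\<lambda>y. - {x\<in>X. H y \<le> H x}"
  have cov: "X \<subseteq> (\<Union>y\<in>X. ?O y)" using no by (auto simp: not_le)
  have op: "open (?O y)" for y using usc by (rule open_Compl)
  obtain T where T: "T \<subseteq> X" "finite T" "X \<subseteq> (\<Union>y\<in>T. ?O y)"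
    by (rule compactE_image [OF assms(1) op cov])
  then have "T \<noteq> {}" using assms(2) by auto
  then have "Max (H ` T) \<in> H ` T" using T(2) by (intro Max_in) auto
  then obtain z where "z \<in> T" "H z = Max (H ` T)" by auto
  then have z: "z \<in> T" "\<forall>y\<in>T. H y \<le> H z" using T(2) by simp_all
  then have "z \<in> (\<Union>y\<in>T. ?O y)" using T by auto
  then show False using z T by auto
qed

lemma weak_eqD:
  "weak_eq U F g m \<Longrightarrow> C1c U \<phi> D \<Longrightarrow> (LINT x|lborel. F x \<bullet> D x + g x * \<phi> x) = m * \<phi> 0"
  by (simp add: weak_eq_def)

text \<open>Touching principle. The test function is the squared positive part of \<open>f - V - k\<close> for \<open>k\<close>
  slightly below the maximum, cut off near \<open>z\<close>, where \<open>V\<close> may be singular.\<close>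

lemma touching:
  fixes f V :: "'a::euclidean_space \<Rightarrow> real"
  assumes p: "1 < p" "p \<le> real DIM('a)" and q: "0 < q" "q < p"
    and X: "compact X" and U: "open U" "U \<subseteq> X"
    and f: "C1_on U f Df" and wf: "weak_eq U (\<lambda>x. flux p (Df x)) g 0" and cg: "continuous_on U g"
    and V: "C1_on (U - {z}) V Dv" and wV: "weak_eq (U - {z}) (\<lambda>x. flux p (Dv x)) gv 0"
    and cgv: "continuous_on (U - {z}) gv" and gv: "\<And>x. x \<in> U - {z} \<Longrightarrow> gv x \<le> norm (Dv x) powr q"
    and usc: "\<And>c. closed {x\<in>X. c \<le> f x - V x}"
    and S: "\<And>x. x \<in> X \<Longrightarrow> f x - V x \<le> S" "\<And>x. x \<in> X - U \<Longrightarrow> f x - V x < S" "\<exists>x\<in>X. f x - V x = S"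
    and contact: "\<And>x. x \<in> U \<Longrightarrow> f x - V x = S \<Longrightarrow> Df x \<noteq> 0 \<and> norm (Df x) powr q < g x"
    and approach: "\<And>k. z \<in> U \<Longrightarrow> f z - V z = S \<Longrightarrow> k < S \<Longrightarrow> \<exists>x\<in>U - {z}. k < f x - V x"
  shows False
proof -
  define Z where "Z = {x\<in>X. S \<le> f x - V x}"
  have cZ: "compact Z"
    using compact_Int_closed [OF X usc [of S]] by (simp add: Z_def Int_def conj_commute cong: conj_cong)
  have ZU: "Z \<subseteq> U" using S(2) by (force simp: Z_def)
  have Z0: "Z \<noteq> {}" using S(3) by (force simp: Z_def)
  have Zeq: "x \<in> Z \<Longrightarrow> f x - V x = S" for x using S(1) by (force simp: Z_def)
  have cDf: "continuous_on U (\<lambda>x. norm (Df x))" using f by (auto simp: C1_on_def intro: continuous_intros)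
  define G where "G = (\<lambda>x. g x - norm (Df x) powr q)"
  have cG: "continuous_on U G"
    unfolding G_def
    by (intro continuous_on_diff cg continuous_on_powr' [OF cDf continuous_on_const]) (use q in auto)
  obtain z1 where z1: "z1 \<in> Z" "\<And>x. x \<in> Z \<Longrightarrow> norm (Df z1) \<le> norm (Df x)"
    using continuous_attains_inf [OF cZ Z0 continuous_on_subset [OF cDf ZU]] by blast
  obtain z2 where z2: "z2 \<in> Z" "\<And>x. x \<in> Z \<Longrightarrow> norm (Df x) \<le> norm (Df z2)"
    using continuous_attains_sup [OF cZ Z0 continuous_on_subset [OF cDf ZU]] by blast
  obtain z3 where z3: "z3 \<in> Z" "\<And>x. x \<in> Z \<Longrightarrow> G z3 \<le> G x"
    using continuous_attains_inf [OF cZ Z0 continuous_on_subset [OF cG ZU]] by blast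
  \<comment> \<open>Extremes of |Df| and of the strictness gap over the compact contact set, relaxed
    by a factor or by 1, so that the bounds persist on a neighbourhood W of that set.\<close>
  define c0 where "c0 = norm (Df z1) / 2"
  define C0 where "C0 = norm (Df z2) + 1"
  define \<gamma> where "\<gamma> = G z3 / 2"
  have c0: "0 < c0" using contact Zeq z1(1) ZU by (auto simp: c0_def)
  have \<gamma>: "0 < \<gamma>" using contact Zeq z3(1) ZU by (auto simp: \<gamma>_def G_def)
  have cC: "c0 \<le> C0" using z2(2) [OF z1(1)] norm_ge_zero [of "Df z1"] unfolding c0_def C0_def by linarith
  define W where "W = U \<inter> ((\<lambda>x. norm (Df x)) -` {c0<..<C0}) \<inter> (G -` {\<gamma><..})"
  have oW: "open W"
  proof -
    have "open (U \<inter> (\<lambda>x. norm (Df x)) -` {c0<..<C0})" "open (U \<inter> G -` {\<gamma><..})"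
      using continuous_open_preimage [OF cDf U(1)] continuous_open_preimage [OF cG U(1)] by auto
    then have "open ((U \<inter> (\<lambda>x. norm (Df x)) -` {c0<..<C0}) \<inter> (U \<inter> G -` {\<gamma><..}))" by (rule open_Int)
    moreover have "(U \<inter> (\<lambda>x. norm (Df x)) -` {c0<..<C0}) \<inter> (U \<inter> G -` {\<gamma><..}) = W" by (auto simp: W_def)
    ultimately show ?thesis by simp
  qed
  have ZW: "Z \<subseteq> W"
  proof
    fix x assume x: "x \<in> Z"
    have "norm (Df z1) \<le> norm (Df x)" "norm (Df x) \<le> norm (Df z2)" "G z3 \<le> G x"
      using x z1 z2 z3 by auto
    moreover have "c0 < norm (Df z1)" using c0 by (simp add: c0_def)
    moreover have "norm (Df z2) < C0" by (simp add: C0_def)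
    moreover have "\<gamma> < G z3" using \<gamma> by (simp add: \<gamma>_def)
    ultimately have "c0 < norm (Df x)" "norm (Df x) < C0" "\<gamma> < G x" by linarith+
    then show "x \<in> W" using x ZU by (auto simp: W_def)
  qed
  obtain k1 where k1: "k1 < S" "\<And>x. x \<in> X - W \<Longrightarrow> f x - V x \<le> k1"
  proof (cases "X - W = {}")
    case True
    then show ?thesis using that [of "S - 1"] by auto
  next
    case False
    have "compact (X - W)" using X oW by (rule compact_diff)
    moreover have "closed {x \<in> X - W. c \<le> f x - V x}" for c
    proof -
      have "{x \<in> X - W. c \<le> f x - V x} = {x \<in> X. c \<le> f x - V x} - W" by auto
      then show ?thesis using usc oW by (metis closed_Diff)
    qed
    ultimately obtain y where y: "y \<in> X - W" "\<forall>x\<in>X - W. f x - V x \<le> f y - V y"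
      using usc_attains_max [of "X - W" "\<lambda>x. f x - V x"] False by blast
    have "y \<notin> Z" using y ZW by auto
    then have "f y - V y < S" using y by (auto simp: Z_def)
    then show ?thesis using y by (intro that) auto
  qed
  obtain \<tau> c1 where tc: "0 < \<tau>" "0 < c1"
    "\<And>(a :: 'a) b g0 gv w. c0 \<le> norm a \<Longrightarrow> norm a \<le> C0 \<Longrightarrow> norm a powr q + \<gamma> \<le> g0 \<Longrightarrow> gv \<le> norm b powr q
       \<Longrightarrow> 0 \<le> w \<Longrightarrow> w \<le> \<tau> \<Longrightarrow>
       c1 * (w\<^sup>2 * (1 + norm b powr p)) \<le> 2 * w * ((flux p a - flux p b) \<bullet> (a - b)) + (g0 - gv) * w\<^sup>2"
    by (rule touch_pointwise [OF p(1) q c0 cC \<gamma>, where 'a = 'a]) blast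
  \<comment> \<open>k > k1 confines the set where f - V exceeds k to W, and k >= S - \<tau> keeps
    the height w below \<tau>.\<close>
  define k where "k = max ((k1 + S) / 2) (S - \<tau>)"
  have k: "k1 < k" "k < S" "S - k \<le> \<tau>" using k1 tc by (auto simp: k_def max_def field_simps)
  define w where "w = (\<lambda>x. max 0 (f x - V x - k))"
  define U0 where "U0 = U - {z}"
  have oU0: "open U0" using U by (auto simp: U0_def)
  have fU0: "C1_on U0 f Df" using f by (rule C1_on_subset) (auto simp: U0_def)
  have VU0: "C1_on U0 V Dv" using V by (simp add: U0_def)
  have wx: "0 \<le> w x" for x by (simp add: w_def)
  have w\<tau>: "w x \<le> \<tau>" if "x \<in> U" for x using S(1) [of x] that U k tc(1) by (auto simp: w_def)
  have wW: "x \<in> W" if "x \<in> U" "w x \<noteq> 0" for x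
  proof (rule ccontr)
    assume "x \<notin> W"
    then have "f x - V x \<le> k1" using k1(2) [of x] that U by auto
    then show False using that(2) k by (simp add: w_def max_def split: if_splits)
  qed
  \<comment> \<open>Contact may happen at z alone, where V has no equation; \<open>approach\<close>
    then supplies a point of \<open>U - {z}\<close> above the level k.\<close>
  obtain x1 where x1: "x1 \<in> U0" "k < f x1 - V x1"
  proof -
    obtain x where x: "x \<in> Z" using Z0 by auto
    show ?thesis
    proof (cases "x = z")
      case True
      then show ?thesis using approach [of k] x ZU Zeq k that by (auto simp: U0_def)
    next
      case False
      then show ?thesis using that [of x] x ZU Zeq [OF x] k by (auto simp: U0_def)
    qed
  qed
  define r where "r = norm (x1 - z) / 2"
  have r: "0 < r" using x1 by (simp add: r_def U0_def)
  define A where "A = U0 \<inter> ball x1 r"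
  have oA: "open A" using oU0 by (auto simp: A_def)
  have A1: "x1 \<in> A" using x1 r by (simp add: A_def)
  define h0 where "h0 = (\<lambda>x. indicator A x * (w x)\<^sup>2)"
  have cw: "continuous_on U0 w"
    unfolding w_def using C1_on_continuous [OF fU0] C1_on_continuous [OF VU0] by (intro continuous_intros)
  have h0m: "h0 \<in> borel_measurable lborel"
  proof -
    have "continuous_on A (\<lambda>x. (w x)\<^sup>2)"
      by (intro continuous_intros continuous_on_subset [OF cw]) (auto simp: A_def)
    then have "(\<lambda>x. indicator A x *\<^sub>R (w x)\<^sup>2) \<in> borel_measurable borel"
      using oA by (intro borel_measurable_continuous_on_indicator) auto
    then show ?thesis by (simp add: h0_def)
  qed
  have h0b: "norm (h0 x) \<le> norm (\<tau>\<^sup>2 * indicator (ball x1 r) x)" for x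
  proof (cases "x \<in> A")
    case True
    then have "(w x)\<^sup>2 \<le> \<tau>\<^sup>2" using w\<tau> wx by (intro power_mono) (auto simp: A_def U0_def)
    then show ?thesis using True by (simp add: h0_def A_def)
  qed (simp add: h0_def)
  have ib: "integrable lborel (\<lambda>x. \<tau>\<^sup>2 * indicator (ball x1 r) x)"
    by (intro integrable_mult_right integrable_real_indicator) (use emeasure_lborel_ball_finite in auto)
  have h0i: "integrable lborel h0"
    by (rule Bochner_Integration.integrable_bound [OF ib h0m]) (use h0b in auto)
  have c3: "0 < (LINT x|lborel. h0 x)"
  proof (rule integral_pos_continuous [OF h0i])
    show "0 \<le> h0 x" for x by (simp add: h0_def)
    have "continuous_on A h0"
      by (rule continuous_on_eq [where f = "\<lambda>x. (w x)\<^sup>2"])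
         (auto simp: h0_def A_def intro!: continuous_intros continuous_on_subset [OF cw])
    then show "isCont h0 x1" using A1 oA by (simp add: continuous_on_eq_continuous_at)
    show "0 < h0 x1" using A1 x1 by (simp add: h0_def w_def)
  qed
  \<comment> \<open>Small enough that the gradient part of the Young error is c1 / 2 times 1 +
    |b|^p, half of the pointwise gain.\<close>
  define e1 where "e1 = c1 / 2 / p / (C0 powr p + 1)"
  have e1: "0 < e1" using tc p by (simp add: e1_def add_nonneg_pos)
  define C2 where "C2 = 2 * p * e1 powr (1 - p)"
  have C2: "0 < C2" using p e1 by (simp add: C2_def)
  \<comment> \<open>The capacity budget: the error C2 \<tau>^2 \<epsilon> is half of the positive
    integral over A. That integral does not depend on \<epsilon>, because A keeps distance r from z
    and the cutoff is 1 there.\<close>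
  define \<epsilon> where "\<epsilon> = c1 / 2 * (LINT x|lborel. h0 x) / (2 * C2 * \<tau>\<^sup>2)"
  have \<epsilon>: "0 < \<epsilon>" using c3 C2 tc by (simp add: \<epsilon>_def)
  obtain \<psi> D\<psi> \<delta> where \<psi>: "C1_on UNIV \<psi> D\<psi>" "\<And>x. 0 \<le> \<psi> x" "\<And>x. \<psi> x \<le> 1" "0 < \<delta>"
    "\<And>x. norm (x - z) < \<delta> \<Longrightarrow> \<psi> x = 0" "\<And>x. r \<le> norm (x - z) \<Longrightarrow> \<psi> x = 1"
    "integrable lborel (\<lambda>x. norm (D\<psi> x) powr p)" "(LINT x|lborel. norm (D\<psi> x) powr p) \<le> \<epsilon>"
    by (rule capacity_cutoff [OF p r \<epsilon>]) blast
  \<comment> \<open>The square makes the truncation C1; the cutoff enters as its p-th power so that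
    Young's inequality reproduces the weight \<psi>^p.\<close>
  let ?P = "\<lambda>t::real. max 0 t powr 2"
  let ?\<phi> = "\<lambda>x. ?P (f x - V x - k) * (max 0 (\<psi> x) powr p)"
  let ?E = "\<lambda>x. ?P (f x - V x - k) *\<^sub>R ((p * max 0 (\<psi> x) powr (p - 1)) *\<^sub>R D\<psi> x)
     + (max 0 (\<psi> x) powr p) *\<^sub>R ((2 * max 0 (f x - V x - k) powr (2 - 1)) *\<^sub>R (Df x - Dv x - 0))"
  have cpp: "continuous_on UNIV (\<lambda>t::real. a * max 0 t powr (a - 1))" if "1 < a" for a
  proof -
    have "continuous_on UNIV (\<lambda>t::real. max 0 t)" by (intro continuous_intros)
    then show ?thesis
      by (intro continuous_on_mult_left continuous_on_powr' [OF _ continuous_on_const]) (use that in auto)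
  qed
  have CP: "C1_on U0 ?\<phi> ?E"
  proof (rule C1_on_mult)
    show "C1_on U0 (\<lambda>x. ?P (f x - V x - k)) (\<lambda>x. (2 * max 0 (f x - V x - k) powr (2 - 1)) *\<^sub>R (Df x - Dv x - 0))"
      by (rule C1_on_compose [OF C1_on_diff [OF C1_on_diff [OF fU0 VU0] C1_on_const] DERIV_pos_part_powr])
         (use cpp [of 2] in \<open>auto intro: continuous_on_subset\<close>)
    show "C1_on U0 (\<lambda>x. max 0 (\<psi> x) powr p) (\<lambda>x. (p * max 0 (\<psi> x) powr (p - 1)) *\<^sub>R D\<psi> x)"
      by (rule C1_on_compose [OF C1_on_subset [OF \<psi>(1)] DERIV_pos_part_powr])
         (use p cpp [of p] in \<open>auto intro: continuous_on_subset\<close>)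
  qed
  define K where "K = {x\<in>X. k \<le> f x - V x} - ball z \<delta>"
  have "compact {x\<in>X. k \<le> f x - V x}"
    using compact_Int_closed [OF X usc [of k]] by (simp add: Int_def conj_commute cong: conj_cong)
  then have cK: "compact K" unfolding K_def by (rule compact_diff) simp
  have KU: "K \<subseteq> U0"
  proof
    fix x assume x: "x \<in> K"
    then have "x \<in> W" using k1(2) [of x] k by (auto simp: K_def)
    then show "x \<in> U0" using x \<psi>(4) by (auto simp: K_def U0_def W_def)
  qed
  have off: "?\<phi> x = 0" if "x \<in> U0 - K" for x
  proof -
    have "f x - V x < k \<or> norm (x - z) < \<delta>"
      using that U by (auto simp: K_def U0_def dist_norm norm_minus_commute)
    then show ?thesis using \<psi>(5) by auto
  qed
  let ?\<phi>' = "\<lambda>x. if x \<in> U0 then ?\<phi> x else 0" and ?E' = "\<lambda>x. if x \<in> U0 then ?E x else 0"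
  have CC': "C1c U0 ?\<phi>' ?E'"
    by (rule C1c_extend [OF CP oU0 cK KU off KU])
  define \<phi> where "\<phi> = ?\<phi>'"
  define E where "E = ?E'"
  have CC: "C1c U0 \<phi> E" unfolding \<phi>_def E_def by (rule CC')
  have cF: "continuous_on U0 (\<lambda>x. flux p (Df x))" "continuous_on U0 (\<lambda>x. flux p (Dv x))" "continuous_on U0 g" "continuous_on U0 gv"
    using fU0 VU0 cgv continuous_on_subset [OF cg, of U0] p
    by (auto simp: C1_on_def U0_def intro: continuous_on_flux_comp)
  define I where "I = (\<lambda>x. (flux p (Df x) - flux p (Dv x)) \<bullet> E x + (g x - gv x) * \<phi> x)"
  have i1: "integrable lborel (\<lambda>x. flux p (Df x) \<bullet> E x + g x * \<phi> x)"
    by (rule weak_integrable(3) [OF cF(1,3) CC])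
  have i2: "integrable lborel (\<lambda>x. flux p (Dv x) \<bullet> E x + gv x * \<phi> x)"
    by (rule weak_integrable(3) [OF cF(2,4) CC])
  have Ieq: "I = (\<lambda>x. (flux p (Df x) \<bullet> E x + g x * \<phi> x) - (flux p (Dv x) \<bullet> E x + gv x * \<phi> x))"
    unfolding I_def by (auto simp: fun_eq_iff inner_diff_left algebra_simps)
  have "weak_eq U0 (\<lambda>x. flux p (Df x)) g 0" by (rule weak_eq_subset [OF wf]) (auto simp: U0_def)
  from weak_eqD [OF this CC] have 1: "(LINT x|lborel. flux p (Df x) \<bullet> E x + g x * \<phi> x) = 0" by simp
  from weak_eqD [OF wV CC [unfolded U0_def]]
  have 2: "(LINT x|lborel. flux p (Dv x) \<bullet> E x + gv x * \<phi> x) = 0" by simp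
  have Ii: "integrable lborel I"
    unfolding Ieq by (rule Bochner_Integration.integrable_diff [OF i1 i2])
  have I0: "(LINT x|lborel. I x) = 0"
    unfolding Ieq Bochner_Integration.integral_diff [OF i1 i2] 1 2 by simp
  have Ige: "c1 / 2 * h0 x - C2 * \<tau>\<^sup>2 * norm (D\<psi> x) powr p \<le> I x" for x
  proof (cases "x \<in> U0 \<and> w x \<noteq> 0")
    case False
    then have "h0 x = 0" "I x = 0" by (auto simp: h0_def A_def I_def w_def \<phi>_def E_def)
    then show ?thesis using C2 by simp
  next
    case True
    then have xU: "x \<in> U" and xW: "x \<in> W" using wW by (auto simp: U0_def)
    let ?a = "Df x" and ?b = "Dv x" and ?w = "w x" and ?s = "\<psi> x" and ?d = "norm (D\<psi> x)"
    have ab: "c0 \<le> norm ?a" "norm ?a \<le> C0" "norm ?a powr q + \<gamma> \<le> g x"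
      using xW by (auto simp: W_def G_def)
    have gb: "gv x \<le> norm ?b powr q" using gv True by (simp add: U0_def)
    note main = tc(3) [OF ab gb wx w\<tau> [OF xU]]
    have P2: "?P (f x - V x - k) = ?w\<^sup>2" by (simp add: w_def powr_numeral)
    have mw: "max 0 (f x - V x - k) = ?w" by (simp add: w_def)
    have ms: "max 0 ?s = ?s" using \<psi>(2) by simp
    let ?X = "(flux p ?a - flux p ?b) \<bullet> D\<psi> x"
    have Ix: "I x = ?s powr p * (2 * ?w * ((flux p ?a - flux p ?b) \<bullet> (?a - ?b)) + (g x - gv x) * ?w\<^sup>2)
       + ?w\<^sup>2 * (p * ?s powr (p - 1) * ?X)"
    proof -
      have e: "E x = ?w\<^sup>2 *\<^sub>R ((p * ?s powr (p - 1)) *\<^sub>R D\<psi> x) + (?s powr p) *\<^sub>R ((2 * ?w) *\<^sub>R (?a - ?b))"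
        using True wx [of x] unfolding E_def P2 mw ms by simp
      have f: "\<phi> x = ?w\<^sup>2 * ?s powr p" using True unfolding \<phi>_def P2 ms by simp
      show ?thesis unfolding I_def e f by (simp add: inner_add_right algebra_simps)
    qed
    have "?s powr (p - 1) * \<bar>?X\<bar> \<le> ?s powr (p - 1) * ((norm ?a powr (p - 1) + norm ?b powr (p - 1)) * ?d)"
    proof (intro mult_left_mono)
      have "\<bar>?X\<bar> \<le> norm (flux p ?a - flux p ?b) * ?d" by (rule Cauchy_Schwarz_ineq2)
      also have "\<dots> \<le> (norm ?a powr (p - 1) + norm ?b powr (p - 1)) * ?d"
        using norm_triangle_ineq4 [of "flux p ?a" "flux p ?b"]
        by (intro mult_right_mono) (auto simp: norm_flux)
      finally show "\<bar>?X\<bar> \<le> (norm ?a powr (p - 1) + norm ?b powr (p - 1)) * ?d" .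
    qed simp
    also have "\<dots> = (?s * norm ?a) powr (p - 1) * ?d + (?s * norm ?b) powr (p - 1) * ?d"
      using \<psi>(2) by (simp add: powr_mult algebra_simps)
    also have "\<dots> \<le> (e1 * (?s * norm ?a) powr p + e1 powr (1 - p) * ?d powr p)
       + (e1 * (?s * norm ?b) powr p + e1 powr (1 - p) * ?d powr p)"
      using \<psi>(2) e1 p by (intro add_mono young_simple) auto
    also have "\<dots> = e1 * (?s powr p * (norm ?a powr p + norm ?b powr p)) + 2 * e1 powr (1 - p) * ?d powr p"
      using \<psi>(2) by (simp add: powr_mult algebra_simps)
    also have "\<dots> \<le> e1 * (?s powr p * ((C0 powr p + 1) * (1 + norm ?b powr p))) + 2 * e1 powr (1 - p) * ?d powr p"
    proof (intro add_right_mono mult_left_mono)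
      have "norm ?a powr p \<le> C0 powr p" using ab p by (intro powr_mono2) auto
      moreover have "0 \<le> C0 powr p * norm ?b powr p" by simp
      ultimately show "norm ?a powr p + norm ?b powr p \<le> (C0 powr p + 1) * (1 + norm ?b powr p)"
        by (simp only: distrib_left distrib_right mult_1 mult_1_right)
    qed (use e1 in auto)
    finally have cross: "?s powr (p - 1) * \<bar>?X\<bar> \<le> e1 * (?s powr p * ((C0 powr p + 1) * (1 + norm ?b powr p))) + 2 * e1 powr (1 - p) * ?d powr p" .
    have pe: "p * e1 * (C0 powr p + 1) = c1 / 2"
    proof -
      have "0 < C0 powr p + 1" by (simp add: add_nonneg_pos)
      moreover have "p * (y / p / t) * t = y" if "t \<noteq> 0" for y t :: real using p that by simp
      ultimately show ?thesis unfolding e1_def by (metis less_irrefl)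
    qed
    have "p * (?s powr (p - 1) * \<bar>?X\<bar>) \<le> p * (e1 * (?s powr p * ((C0 powr p + 1) * (1 + norm ?b powr p))) + 2 * e1 powr (1 - p) * ?d powr p)"
      using cross p by (intro mult_left_mono) auto
    also have "\<dots> = (p * e1 * (C0 powr p + 1)) * (?s powr p * (1 + norm ?b powr p)) + C2 * ?d powr p"
      by (simp add: C2_def algebra_simps)
    finally have cr: "p * (?s powr (p - 1) * \<bar>?X\<bar>) \<le> c1 / 2 * (?s powr p * (1 + norm ?b powr p)) + C2 * ?d powr p"
      unfolding pe .
    have "?w\<^sup>2 * (p * (?s powr (p - 1) * \<bar>?X\<bar>)) \<le> ?w\<^sup>2 * (c1 / 2 * (?s powr p * (1 + norm ?b powr p)) + C2 * ?d powr p)"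
      using cr by (intro mult_left_mono) auto
    moreover have "?w\<^sup>2 * (C2 * ?d powr p) \<le> \<tau>\<^sup>2 * (C2 * ?d powr p)"
      using C2 wx w\<tau> [OF xU] by (intro mult_right_mono power_mono) auto
    moreover have "- (?w\<^sup>2 * (p * (?s powr (p - 1) * \<bar>?X\<bar>))) \<le> ?w\<^sup>2 * (p * ?s powr (p - 1) * ?X)"
    proof -
      have "?w\<^sup>2 * (p * ?s powr (p - 1)) * (- \<bar>?X\<bar>) \<le> ?w\<^sup>2 * (p * ?s powr (p - 1)) * ?X"
        using p by (intro mult_left_mono) auto
      then show ?thesis by (simp add: mult_ac)
    qed
    moreover have "?s powr p * (c1 * (?w\<^sup>2 * (1 + norm ?b powr p))) \<le>
       ?s powr p * (2 * ?w * ((flux p ?a - flux p ?b) \<bullet> (?a - ?b)) + (g x - gv x) * ?w\<^sup>2)"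
      using main by (intro mult_left_mono) auto
    ultimately have I1: "c1 / 2 * (?s powr p * (?w\<^sup>2 * (1 + norm ?b powr p))) - \<tau>\<^sup>2 * (C2 * ?d powr p) \<le> I x"
      unfolding Ix by (simp add: algebra_simps)
    have "c1 / 2 * h0 x \<le> c1 / 2 * (?s powr p * (?w\<^sup>2 * (1 + norm ?b powr p)))"
    proof (intro mult_left_mono)
      show "h0 x \<le> ?s powr p * (?w\<^sup>2 * (1 + norm ?b powr p))"
      proof (cases "x \<in> A")
        case True
        have "norm (x1 - z) \<le> norm (x - z) + norm (x1 - x)"
          using norm_triangle_ineq [of "x1 - x" "x - z"] by simp
        then have "r \<le> norm (x - z)" using True by (simp add: A_def r_def dist_norm)
        then have "?s = 1" by (rule \<psi>(6))
        moreover have "?w\<^sup>2 * 1 \<le> ?w\<^sup>2 * (1 + norm ?b powr p)" by (intro mult_left_mono) auto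
        ultimately show ?thesis using True by (simp add: h0_def)
      next
        case False
        then show ?thesis by (simp add: h0_def)
      qed
    qed (use tc in auto)
    with I1 show ?thesis by (simp add: mult_ac)
  qed
  have "c1 / 2 * (LINT x|lborel. h0 x) - C2 * \<tau>\<^sup>2 * (LINT x|lborel. norm (D\<psi> x) powr p)
      = (LINT x|lborel. c1 / 2 * h0 x - C2 * \<tau>\<^sup>2 * norm (D\<psi> x) powr p)"
    using h0i \<psi>(7) by simp
  also have "\<dots> \<le> (LINT x|lborel. I x)"
    using h0i \<psi>(7) Ii Ige by (intro Bochner_Integration.integral_mono) auto
  finally have "c1 / 2 * (LINT x|lborel. h0 x) \<le> C2 * \<tau>\<^sup>2 * (LINT x|lborel. norm (D\<psi> x) powr p)"
    using I0 by simp
  also have "\<dots> \<le> C2 * \<tau>\<^sup>2 * \<epsilon>" using C2 \<psi>(8) by (intro mult_left_mono) auto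
  also have "\<dots> = (c1 / 2 * (LINT x|lborel. h0 x)) / 2" using C2 tc by (simp add: \<epsilon>_def)
  finally show False using c3 tc by simp
qed

section \<open>Reflections and the oscillation on spheres\<close>

lemma nn_integral_shift:
  fixes f :: "'a::euclidean_space \<Rightarrow> ennreal"
  assumes "f \<in> borel_measurable borel"
  shows "(\<integral>\<^sup>+x. f (a + x) \<partial>lborel) = (\<integral>\<^sup>+x. f x \<partial>lborel)"
  using assms by (subst (2) lborel_distr_plus [symmetric, of a]) (simp add: nn_integral_distr)

text \<open>Lebesgue measure is invariant under a linear isometric involution \<open>L\<close>: compare
  \<open>\<integral>\<integral> k(y) f(L x) dx dy\<close> with \<open>\<integral>\<integral> k(y - L x) f(y) dx dy\<close>, where \<open>k\<close> is the indicator of a ball.\<close>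

lemma nn_integral_involution:
  fixes f :: "'a::euclidean_space \<Rightarrow> ennreal" and L :: "'a \<Rightarrow> 'a"
  assumes f [measurable]: "f \<in> borel_measurable borel" and L: "linear L" "\<And>x. norm (L x) = norm x" "\<And>x. L (L x) = x"
  shows "(\<integral>\<^sup>+x. f (L x) \<partial>lborel) = (\<integral>\<^sup>+x. f x \<partial>lborel)"
proof -
  define k :: "'a \<Rightarrow> ennreal" where "k = indicator (ball 0 1)"
  have k [measurable]: "k \<in> borel_measurable borel"
    unfolding k_def by (rule borel_measurable_indicator) simp
  have Lm [measurable]: "L \<in> borel_measurable borel"
    using linear_continuous_on [of L UNIV] L(1) by (intro borel_measurable_continuous_onI) (simp add: linear_conv_bounded_linear)
  let ?k = "\<integral>\<^sup>+y. k y \<partial>lborel"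
  have k0: "?k = emeasure lborel (ball (0::'a) 1)" by (simp add: k_def)
  have kfin: "?k < \<infinity>" unfolding k0 by (rule emeasure_lborel_ball_finite)
  have kpos: "0 < ?k"
  proof -
    have "0 < measure lborel (ball (0::'a) 1)" by (simp add: content_ball_pos)
    then show ?thesis unfolding k0 by (simp add: measure_def enn2real_positive_iff)
  qed
  have "(\<integral>\<^sup>+x. f (L x) \<partial>lborel) * ?k = (\<integral>\<^sup>+y. (\<integral>\<^sup>+x. k y * f (L x) \<partial>lborel) \<partial>lborel)"
    by (simp add: nn_integral_cmult nn_integral_multc mult.commute)
  also have "\<dots> = (\<integral>\<^sup>+y. (\<integral>\<^sup>+x. k y * f (L x + y) \<partial>lborel) \<partial>lborel)"
  proof (rule nn_integral_cong)
    fix y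
    have "(\<integral>\<^sup>+x. k y * f (L (L y + x)) \<partial>lborel) = (\<integral>\<^sup>+x. k y * f (L x) \<partial>lborel)"
      by (rule nn_integral_shift [of "\<lambda>x. k y * f (L x)"]) measurable
    then show "(\<integral>\<^sup>+x. k y * f (L x) \<partial>lborel) = (\<integral>\<^sup>+x. k y * f (L x + y) \<partial>lborel)"
      by (simp add: linear_add [OF L(1)] L(3) add.commute)
  qed
  also have "\<dots> = (\<integral>\<^sup>+x. (\<integral>\<^sup>+y. k y * f (L x + y) \<partial>lborel) \<partial>lborel)"
    by (rule lborel_pair.Fubini') measurable
  also have "\<dots> = (\<integral>\<^sup>+x. (\<integral>\<^sup>+y. k (y - L x) * f y \<partial>lborel) \<partial>lborel)"
  proof (rule nn_integral_cong)
    fix x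
    have "(\<integral>\<^sup>+y. k ((L x + y) - L x) * f (L x + y) \<partial>lborel) = (\<integral>\<^sup>+y. k (y - L x) * f y \<partial>lborel)"
      by (rule nn_integral_shift [of "\<lambda>y. k (y - L x) * f y"]) measurable
    then show "(\<integral>\<^sup>+y. k y * f (L x + y) \<partial>lborel) = (\<integral>\<^sup>+y. k (y - L x) * f y \<partial>lborel)" by simp
  qed
  also have "\<dots> = (\<integral>\<^sup>+y. (\<integral>\<^sup>+x. k (y - L x) * f y \<partial>lborel) \<partial>lborel)"
    by (rule lborel_pair.Fubini' [symmetric]) measurable
  also have "\<dots> = (\<integral>\<^sup>+y. ?k * f y \<partial>lborel)"
  proof (rule nn_integral_cong)
    fix y
    have "(\<integral>\<^sup>+x. k (y - L (L y + x)) * f y \<partial>lborel) = (\<integral>\<^sup>+x. k (y - L x) * f y \<partial>lborel)"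
      by (rule nn_integral_shift [of "\<lambda>x. k (y - L x) * f y"]) measurable
    moreover have "k (y - L (L y + x)) = k x" for x
      by (simp add: linear_add [OF L(1)] L(2,3) k_def indicator_def)
    ultimately show "(\<integral>\<^sup>+x. k (y - L x) * f y \<partial>lborel) = ?k * f y" by (simp add: nn_integral_multc)
  qed
  also have "\<dots> = (\<integral>\<^sup>+y. f y \<partial>lborel) * ?k"
    by (subst nn_integral_cmult) (use f in \<open>simp_all add: mult.commute\<close>)
  finally have e: "(\<integral>\<^sup>+x. f (L x) \<partial>lborel) * ?k = (\<integral>\<^sup>+x. f x \<partial>lborel) * ?k" .
  have "?k \<noteq> 0" "?k \<noteq> top" using kfin kpos by auto
  then have "a * ?k / ?k = a" for a by (rule mult_divide_eq_ennreal)
  then show ?thesis using arg_cong [OF e, of "\<lambda>t. t / ?k"] by simp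
qed

lemma lborel_integral_involution:
  fixes f :: "'a::euclidean_space \<Rightarrow> real" and L :: "'a \<Rightarrow> 'a"
  assumes f: "f \<in> borel_measurable borel" and L: "linear L" "\<And>x. norm (L x) = norm x" "\<And>x. L (L x) = x"
  shows "(LINT x|lborel. f (a + L x)) = (LINT x|lborel. f x)"
proof -
  have Lm: "L \<in> borel_measurable borel"
    using linear_continuous_on [of L UNIV] L(1) by (intro borel_measurable_continuous_onI) (simp add: linear_conv_bounded_linear)
  have "distr lborel borel L = lborel"
  proof (rule measure_eqI)
    fix A assume "A \<in> sets (distr lborel borel L)"
    then have A: "A \<in> sets borel" by simp
    have "emeasure (distr lborel borel L) A = (\<integral>\<^sup>+x. indicator A (L x) \<partial>lborel)"
    proof -
      have "emeasure (distr lborel borel L) A = (\<integral>\<^sup>+x. indicator A x \<partial>distr lborel borel L)"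
        using A by simp
      also have "\<dots> = (\<integral>\<^sup>+x. indicator A (L x) \<partial>lborel)"
        by (rule nn_integral_distr) (use A Lm in auto)
      finally show ?thesis .
    qed
    also have "\<dots> = (\<integral>\<^sup>+x. indicator A x \<partial>lborel)"
      using A by (intro nn_integral_involution L) auto
    finally show "emeasure (distr lborel borel L) A = emeasure lborel A" using A by simp
  qed simp
  then have "(LINT x|lborel. f (a + x)) = (LINT x|distr lborel borel L. f (a + x))" by simp
  also have "\<dots> = (LINT x|lborel. f (a + L x))"
    using Lm f by (subst integral_distr) auto
  finally show ?thesis using lborel_integral_shift [OF f] by simp
qed

section \<open>Transport of weak equations under translations and reflections\<close>

lemma weak_eq_shift:
  fixes F :: "'a::euclidean_space \<Rightarrow> 'a"
  assumes W: "weak_eq U F g 0" and c: "continuous_on U F" "continuous_on U g"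
  shows "weak_eq {x. x + h \<in> U} (\<lambda>x. F (x + h)) (\<lambda>x. g (x + h)) 0"
  unfolding weak_eq_def
proof (intro allI impI)
  fix \<phi> D assume C: "C1c {x. x + h \<in> U} \<phi> D"
  then obtain K where K: "compact K" "K \<subseteq> {x. x + h \<in> U}" "\<And>x. x \<notin> K \<Longrightarrow> \<phi> x = 0" and C1: "C1_on UNIV \<phi> D"
    by (auto simp: C1c_def)
  have C': "C1c U (\<lambda>y. \<phi> (y - h)) (\<lambda>y. D (y - h))"
    unfolding C1c_def
  proof (intro conjI exI [of _ "(\<lambda>x. x + h) ` K"])
    have "GDERIV (\<lambda>x. \<phi> (x - h)) x :> D (x - h)" for x
    proof -
      have "((\<lambda>x. x - h) has_derivative (\<lambda>h. h)) (at x)" by (auto intro!: derivative_eq_intros)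
      moreover have "(\<phi> has_derivative (\<lambda>k. k \<bullet> D (x - h))) (at (x - h))"
        using C1 by (auto simp: C1_on_def gderiv_def)
      ultimately show ?thesis
        unfolding gderiv_def by (rule has_derivative_compose)
    qed
    moreover have "continuous_on UNIV (\<lambda>x. D (x - h))"
    proof (rule continuous_on_compose2 [of UNIV D])
      show "continuous_on UNIV D" using C1 by (simp add: C1_on_def)
      show "continuous_on UNIV (\<lambda>x. x - h)" by (intro continuous_intros)
    qed simp
    ultimately show "C1_on UNIV (\<lambda>y. \<phi> (y - h)) (\<lambda>y. D (y - h))" by (simp add: C1_on_def)
    show "compact ((\<lambda>x. x + h) ` K)" by (intro compact_continuous_image continuous_intros K)
    show "\<forall>x. x \<notin> (\<lambda>x. x + h) ` K \<longrightarrow> \<phi> (x - h) = 0"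
    proof (intro allI impI)
      fix x assume x: "x \<notin> (\<lambda>x. x + h) ` K"
      have "x - h \<notin> K"
      proof
        assume "x - h \<in> K"
        then have "(x - h) + h \<in> (\<lambda>x. x + h) ` K" by (rule imageI)
        with x show False by simp
      qed
      then show "\<phi> (x - h) = 0" by (rule K(3))
    qed
  qed (use K in auto)
  have "(LINT x|lborel. F (h + x) \<bullet> D (h + x - h) + g (h + x) * \<phi> (h + x - h)) = (LINT y|lborel. F y \<bullet> D (y - h) + g y * \<phi> (y - h))"
    by (rule lborel_integral_shift [of "\<lambda>y. F y \<bullet> D (y - h) + g y * \<phi> (y - h)" h])
       (use borel_measurable_integrable [OF weak_integrable(3) [OF c C']] in simp)
  also have "\<dots> = 0" using weak_eqD [OF W C'] by simp
  finally show "(LINT x|lborel. F (x + h) \<bullet> D x + g (x + h) * \<phi> x) = 0 * \<phi> 0" by (simp add: add.commute)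
qed

definition refl_dir :: "'a::euclidean_space \<Rightarrow> 'a \<Rightarrow> 'a" where
  "refl_dir e x = x - (2 * (x \<bullet> e)) *\<^sub>R e"

lemma refl_dir:
  assumes "norm e = 1"
  shows "linear (refl_dir e)" "norm (refl_dir e x) = norm x" "refl_dir e (refl_dir e x) = x"
    "refl_dir e a \<bullet> b = a \<bullet> refl_dir e b"
proof -
  have e: "e \<bullet> e = 1" using assms by (simp add: dot_square_norm)
  show "linear (refl_dir e)"
    unfolding refl_dir_def by (rule linearI) (auto simp: inner_add_left algebra_simps)
  show "refl_dir e (refl_dir e x) = x"
    by (simp add: refl_dir_def inner_diff_left e)
  show s: "refl_dir e a \<bullet> b = a \<bullet> refl_dir e b" for a b
    by (simp add: refl_dir_def inner_diff_left inner_diff_right inner_commute)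
  have "(norm (refl_dir e x))\<^sup>2 = (norm x)\<^sup>2"
    by (simp add: power2_norm_eq_inner refl_dir_def inner_diff_left inner_diff_right e inner_commute)
  then show "norm (refl_dir e x) = norm x" by simp
qed

lemma flux_refl_dir: "norm e = 1 \<Longrightarrow> flux p (refl_dir e x) = refl_dir e (flux p x)"
  using linear_scale [OF refl_dir(1), of e] by (simp add: flux_def refl_dir(2))

lemma C1_on_refl:
  fixes f :: "'a::euclidean_space \<Rightarrow> real"
  assumes f: "C1_on U f D" and e: "norm e = 1"
  shows "C1_on {x. a + refl_dir e x \<in> U} (\<lambda>x. f (a + refl_dir e x)) (\<lambda>x. refl_dir e (D (a + refl_dir e x)))"
proof -
  have bl: "bounded_linear (refl_dir e)" using refl_dir(1) [OF e] by (simp add: linear_conv_bounded_linear)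
  have "GDERIV (\<lambda>x. f (a + refl_dir e x)) x :> refl_dir e (D (a + refl_dir e x))" if "a + refl_dir e x \<in> U" for x
  proof -
    have "((\<lambda>x. a + refl_dir e x) has_derivative refl_dir e) (at x)"
      using bounded_linear.has_derivative [OF bl has_derivative_ident, of "at x"] by (auto intro!: derivative_eq_intros)
    moreover have "(f has_derivative (\<lambda>k. k \<bullet> D (a + refl_dir e x))) (at (a + refl_dir e x))"
      using f that by (auto simp: C1_on_def gderiv_def)
    ultimately have "((\<lambda>x. f (a + refl_dir e x)) has_derivative (\<lambda>k. refl_dir e k \<bullet> D (a + refl_dir e x))) (at x)"
      by (rule has_derivative_compose)
    then show ?thesis unfolding gderiv_def by (simp add: refl_dir(4) [OF e])
  qed
  moreover have "continuous_on {x. a + refl_dir e x \<in> U} (\<lambda>x. refl_dir e (D (a + refl_dir e x)))"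
  proof -
    have "continuous_on {x. a + refl_dir e x \<in> U} (\<lambda>x. D (a + refl_dir e x))"
    proof (rule continuous_on_compose2 [of U D])
      show "continuous_on U D" using f by (simp add: C1_on_def)
      show "continuous_on {x. a + refl_dir e x \<in> U} (\<lambda>x. a + refl_dir e x)"
        by (intro continuous_intros linear_continuous_on bl)
    qed auto
    then show ?thesis by (rule bounded_linear.continuous_on [OF bl])
  qed
  ultimately show ?thesis by (simp add: C1_on_def)
qed

text \<open>\<open>refl_dir e a = - a\<close> says that a is a multiple of e, so x -> a + refl_dir e
  x is an involution: the same map carries test functions forth and domains back.\<close>

lemma weak_eq_refl:
  fixes F :: "'a::euclidean_space \<Rightarrow> 'a"
  assumes W: "weak_eq U F g 0" and c: "continuous_on U F" "continuous_on U g" and e: "norm e = 1"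
    and a: "refl_dir e a = - a"
  shows "weak_eq {x. a + refl_dir e x \<in> U} (\<lambda>x. refl_dir e (F (a + refl_dir e x))) (\<lambda>x. g (a + refl_dir e x)) 0"
  unfolding weak_eq_def
proof (intro allI impI)
  let ?T = "\<lambda>x. a + refl_dir e x"
  have bl: "bounded_linear (refl_dir e)" using refl_dir(1) [OF e] by (simp add: linear_conv_bounded_linear)
  have TT: "?T (?T x) = x" for x
    by (simp add: linear_add [OF refl_dir(1) [OF e]] a refl_dir(3) [OF e])
  fix \<phi> D assume C: "C1c {x. ?T x \<in> U} \<phi> D"
  then obtain K where K: "compact K" "K \<subseteq> {x. ?T x \<in> U}" "\<And>x. x \<notin> K \<Longrightarrow> \<phi> x = 0" and C1: "C1_on UNIV \<phi> D"
    by (auto simp: C1c_def)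
  have C': "C1c U (\<lambda>y. \<phi> (?T y)) (\<lambda>y. refl_dir e (D (?T y)))"
    unfolding C1c_def
  proof (intro conjI exI [of _ "?T ` K"])
    show "C1_on UNIV (\<lambda>y. \<phi> (?T y)) (\<lambda>y. refl_dir e (D (?T y)))"
      using C1_on_refl [OF C1 e, of a] by simp
    show "compact (?T ` K)"
      by (intro compact_continuous_image continuous_intros K linear_continuous_on bl)
    show "\<forall>x. x \<notin> ?T ` K \<longrightarrow> \<phi> (?T x) = 0"
    proof (intro allI impI)
      fix x assume x: "x \<notin> ?T ` K"
      have "?T x \<notin> K"
      proof
        assume "?T x \<in> K"
        then have "?T (?T x) \<in> ?T ` K" by (rule imageI)
        with x show False by (simp only: TT)
      qed
      then show "\<phi> (?T x) = 0" by (rule K(3))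
    qed
  qed (use K in auto)
  let ?I = "\<lambda>y. F y \<bullet> refl_dir e (D (?T y)) + g y * \<phi> (?T y)"
  have "(LINT x|lborel. ?I (?T x)) = (LINT y|lborel. ?I y)"
    by (rule lborel_integral_involution [of ?I, OF _ refl_dir(1-3) [OF e]])
       (use borel_measurable_integrable [OF weak_integrable(3) [OF c C']] in simp)
  also have "\<dots> = 0" using weak_eqD [OF W C'] by simp
  finally have "(LINT x|lborel. ?I (?T x)) = 0" .
  moreover have "?I (?T x) = refl_dir e (F (?T x)) \<bullet> D x + g (?T x) * \<phi> x" for x
    unfolding TT by (simp add: refl_dir(4) [OF e])
  ultimately show "(LINT x|lborel. refl_dir e (F (?T x)) \<bullet> D x + g (?T x) * \<phi> x) = 0 * \<phi> 0" by simp
qed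

section \<open>Strong minimum principle and comparison of two weak solutions\<close>

lemma flux_radial:
  fixes x :: "'a::euclidean_space"
  assumes "0 < a" "x \<noteq> 0"
  shows "flux p (a *\<^sub>R sgn x) = (a powr (p - 1) / norm x) *\<^sub>R x"
  using assms flux_scale [of a p "sgn x"]
  by (simp add: flux_def norm_sgn sgn_div_norm divide_inverse)

text \<open>The comparison function V is continuous except at one point, where it is given its lower
  limit; semicontinuity is what makes f - V attain its maximum on compact sets.\<close>

definition lsc_on :: "'a::euclidean_space set \<Rightarrow> ('a \<Rightarrow> real) \<Rightarrow> bool" where
  "lsc_on X V \<longleftrightarrow> (\<forall>x\<in>X. \<forall>e>0. \<exists>d>0. \<forall>y\<in>X. dist y x < d \<longrightarrow> V x - e < V y)"

lemma lsc_on_subset: "lsc_on X V \<Longrightarrow> Y \<subseteq> X \<Longrightarrow> lsc_on Y V"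
  unfolding lsc_on_def by (meson subsetD)

lemma lsc_on_continuous: "continuous_on X V \<Longrightarrow> lsc_on X V"
  unfolding lsc_on_def
proof (intro ballI allI impI)
  fix x e assume c: "continuous_on X V" and x: "x \<in> X" and e: "(0::real) < e"
  then obtain d where d: "0 < d" "\<And>y. y \<in> X \<Longrightarrow> dist y x < d \<Longrightarrow> dist (V y) (V x) < e"
    unfolding continuous_on_iff by meson
  show "\<exists>d>0. \<forall>y\<in>X. dist y x < d \<longrightarrow> V x - e < V y"
  proof (intro exI [of _ d] conjI ballI impI d(1))
    fix y assume "y \<in> X" "dist y x < d"
    then have "\<bar>V y - V x\<bar> < e" using d(2) by (simp add: dist_real_def)
    then show "V x - e < V y" by linarith
  qed
qed

lemma usc_closed:
  assumes "closed X" "continuous_on X f" "lsc_on X V"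
  shows "closed {x\<in>X. c \<le> f x - V x}"
proof -
  have "x \<in> {x\<in>X. c \<le> f x - V x}" if lim: "(s \<longlongrightarrow> x) sequentially" and s: "\<And>n. s n \<in> {x\<in>X. c \<le> f x - V x}" for s x
  proof -
    have x: "x \<in> X" using assms(1) lim s unfolding closed_sequential_limits by auto
    have "c \<le> f x - V x"
    proof (rule ccontr)
      assume "\<not> ?thesis"
      then have e: "0 < (c - (f x - V x)) / 2" (is "0 < ?e") by simp
      obtain d1 where d1: "0 < d1" "\<And>y. y \<in> X \<Longrightarrow> dist y x < d1 \<Longrightarrow> V x - ?e < V y"
        using assms(3) x e unfolding lsc_on_def by meson
      obtain d2 where d2: "0 < d2" "\<And>y. y \<in> X \<Longrightarrow> dist y x < d2 \<Longrightarrow> dist (f y) (f x) < ?e"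
        using assms(2) x e unfolding continuous_on_iff by meson
      have "\<forall>\<^sub>F n in sequentially. dist (s n) x < min d1 d2"
        using lim d1(1) d2(1) by (intro tendstoD) auto
      then obtain n where n: "dist (s n) x < min d1 d2" by (auto simp: eventually_sequentially)
      have "V x - ?e < V (s n)" "\<bar>f (s n) - f x\<bar> < ?e"
        using d1(2) [of "s n"] d2(2) [of "s n"] n s [of n] by (auto simp: dist_real_def)
      moreover have "c \<le> f (s n) - V (s n)" using s [of n] by simp
      ultimately show False by (simp add: field_simps abs_if split: if_splits)
    qed
    with x show ?thesis by simp
  qed
  then show ?thesis unfolding closed_sequential_limits by blast
qed

text \<open>Hopf's argument: on the largest ball around \<open>y\<close> on which \<open>V\<close> stays above its minimum, compare
  with a radial barrier; its gradient does not vanish, so the touching principle applies.\<close>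

lemma strong_min:
  fixes V :: "'a::euclidean_space \<Rightarrow> real"
  assumes p: "1 < p" "p \<le> real DIM('a)" and q: "p - 1 < q" "q < p"
    and V: "C1_on (U - {z}) V Dv" and wV: "weak_eq (U - {z}) (\<lambda>x. flux p (Dv x)) gv 0"
    and cgv: "continuous_on (U - {z}) gv" and gv: "\<And>x. x \<in> U - {z} \<Longrightarrow> gv x \<le> norm (Dv x) powr q"
    and lsc: "lsc_on U V"
    and approach: "\<And>e d. z \<in> U \<Longrightarrow> 0 < e \<Longrightarrow> 0 < d \<Longrightarrow> \<exists>y. y \<noteq> z \<and> dist y z < d \<and> V y < V z + e"
    and ball: "ball x0 \<rho> \<subseteq> U" and min: "\<And>x. x \<in> ball x0 \<rho> \<Longrightarrow> V x0 \<le> V x"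
    and y: "y \<in> ball x0 (\<rho> / 4)"
  shows "V y = V x0"
proof (rule ccontr)
  assume "V y \<noteq> V x0"
  define m where "m = V x0"
  have yy: "dist x0 y < \<rho> / 4" using y by simp
  have \<rho>: "0 < \<rho>" using yy zero_le_dist [of x0 y] by linarith
  have mle: "m \<le> V x" if "dist x0 x < \<rho>" for x using min that by (simp add: m_def)
  have "V y > m" using mle [of y] \<open>V y \<noteq> V x0\<close> yy \<rho> by (simp add: m_def)
  define Q where "Q = {x \<in> cball x0 (\<rho> / 2). - m \<le> 0 - V x}"
  have sub: "cball x0 (\<rho> / 2) \<subseteq> U" using ball \<rho> by (auto simp: subset_iff)
  have cQ: "closed Q" unfolding Q_def
    by (rule usc_closed) (use sub lsc in \<open>auto intro: lsc_on_subset\<close>)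
  have x0Q: "x0 \<in> Q" using \<rho> by (simp add: Q_def m_def)
  \<comment> \<open>z' is the point of the minimum set nearest to y, so V > m on the open ball of
    radius d about y, and that ball touches the set at z'.\<close>
  obtain z' where z': "z' \<in> Q" "\<And>x. x \<in> Q \<Longrightarrow> dist y z' \<le> dist y x"
    using distance_attains_inf [OF cQ, of y] x0Q by blast
  define d where "d = dist y z'"
  have "z' \<noteq> y" using z'(1) \<open>V y > m\<close> by (auto simp: Q_def)
  then have d: "0 < d" by (simp add: d_def)
  have d4: "d < \<rho> / 4" using z'(2) [OF x0Q] yy by (simp add: d_def dist_commute)
  have Vz': "V z' = m" using z'(1) mle [of z'] \<rho> by (auto simp: Q_def)
  have inball: "dist x0 x < \<rho>" if "dist y x \<le> 3 * d / 2" for x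
    using dist_triangle [of x0 x y] yy d4 that \<rho> by linarith
  have above: "m < V x" if "dist y x < d" for x
  proof -
    have "dist x0 x < \<rho> / 2" using dist_triangle [of x0 x y] yy d4 that by linarith
    moreover have "x \<notin> Q" using z'(2) [of x] that by (auto simp: d_def)
    ultimately show ?thesis by (auto simp: Q_def)
  qed
  define S where "S = sphere y (d / 2)"
  have SU: "S \<subseteq> U" using ball inball d by (force simp: S_def subset_iff)
  obtain \<eta> where \<eta>: "0 < \<eta>" "\<And>x. x \<in> S \<Longrightarrow> m + \<eta> \<le> V x"
  proof -
    have cS: "compact S" by (simp add: S_def)
    have "S \<noteq> {}" using d by (simp add: S_def)
    moreover have "closed {x\<in>S. c \<le> 0 - V x}" for c
      by (rule usc_closed) (use SU lsc in \<open>auto simp: S_def intro: lsc_on_subset\<close>)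
    ultimately obtain x where x: "x \<in> S" "\<forall>y\<in>S. 0 - V y \<le> 0 - V x"
      using usc_attains_max [OF cS, of "\<lambda>x. 0 - V x"] by blast
    have "m < V x" using x(1) above [of x] d by (simp add: S_def)
    then show ?thesis using that [of "V x - m"] x by auto
  qed
  let ?N = "real DIM('a)"
  have N: "1 \<le> ?N" using DIM_positive [where 'a = 'a] by linarith
  \<comment> \<open>With this exponent the flux of the barrier is - s^(p-1) r^(-N-1) (x - y), whose
    divergence is strictly positive; the exponent of mu_p would give the divergence-free factor
    r^(-N).\<close>
  define \<alpha> where "\<alpha> = ?N / (p - 1) - 1"
  have \<alpha>: "0 < \<alpha>" using p by (simp add: \<alpha>_def field_simps)
  have \<alpha>1: "(\<alpha> + 1) * (p - 1) = ?N" using p by (simp add: \<alpha>_def)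
  \<comment> \<open>|D\<psi>|^q < g amounts to s^(q+1-p) < r^E, and \<mu> is the minimum of r^E over
    the shell.\<close>
  define E where "E = (\<alpha> + 1) * q - ?N - 1"
  define \<mu> where "\<mu> = min ((d / 2) powr E) ((3 * d / 2) powr E)"
  have \<mu>: "0 < \<mu>" using d by (simp add: \<mu>_def)
  have \<mu>le: "\<mu> \<le> r powr E" if "d / 2 \<le> r" "r \<le> 3 * d / 2" for r
  proof (cases "0 \<le> E")
    case True
    then have "(d / 2) powr E \<le> r powr E" using that d by (intro powr_mono2) auto
    then show ?thesis by (simp add: \<mu>_def)
  next
    case False
    then have "(3 * d / 2) powr E \<le> r powr E" using that d by (intro powr_mono2') auto
    then show ?thesis by (simp add: \<mu>_def)
  qed
  \<comment> \<open>The first entry makes the barrier a strict subsolution, the second keeps it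
    below m + \<eta> on the inner sphere.\<close>
  define s where "s = min ((\<mu> / 2) powr (1 / (q + 1 - p))) (\<alpha> * \<eta> / 2 * (d / 2) powr \<alpha>)"
  have s: "0 < s" using \<mu> \<eta> \<alpha> d by (simp add: s_def)
  have sq: "s powr (q + 1 - p) < \<mu>"
  proof -
    have "s powr (q + 1 - p) \<le> ((\<mu> / 2) powr (1 / (q + 1 - p))) powr (q + 1 - p)"
      using s q by (intro powr_mono2) (auto simp: s_def)
    also have "\<dots> = \<mu> / 2" using q \<mu> by (simp add: powr_powr)
    finally show ?thesis using \<mu> by simp
  qed
  define I where "I = {d / 2<..<3 * d / 2}"
  define U' where "U' = {x. norm (x - y) \<in> I}"
  define X where "X = cball y (3 * d / 2) - ball y (d / 2)"
  define \<psi> where "\<psi> = (\<lambda>x. m + s / \<alpha> * (norm (x - y) powr (- \<alpha>) - d powr (- \<alpha>)))"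
  define D\<psi> where "D\<psi> = (\<lambda>x. - (s * norm (x - y) powr (- \<alpha> - 1)) *\<^sub>R sgn (x - y))"
  define g where "g = (\<lambda>x. s powr (p - 1) * norm (x - y) powr (- ?N - 1))"
  have Ipos: "I \<subseteq> {0<..}" using d by (auto simp: I_def)
  have oI: "open I" by (simp add: I_def)
  have C\<psi>: "C1_on U' \<psi> D\<psi>"
    unfolding \<psi>_def D\<psi>_def U'_def
  proof (rule C1_on_radial [OF _ _ Ipos])
    fix r assume r: "r \<in> I"
    have "((\<lambda>r. m + s / \<alpha> * (r powr (- \<alpha>) - d powr (- \<alpha>))) has_real_derivative 0 + s / \<alpha> * (- \<alpha> * r powr (- \<alpha> - 1) - 0)) (at r)"
      using r Ipos by (intro DERIV_add DERIV_const DERIV_cmult DERIV_diff has_real_derivative_powr) auto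
    then show "((\<lambda>r. m + s / \<alpha> * (r powr (- \<alpha>) - d powr (- \<alpha>))) has_real_derivative - (s * r powr (- \<alpha> - 1))) (at r)"
      using \<alpha> by simp
  next
    show "continuous_on I (\<lambda>r. - (s * r powr (- \<alpha> - 1)))"
      using Ipos by (intro continuous_intros) auto
  qed
  have flux\<psi>: "flux p (D\<psi> x) = - (s powr (p - 1) * norm (x - y) powr (- ?N - 1)) *\<^sub>R (x - y)" if "x \<in> U'" for x
  proof -
    have pos: "0 < norm (x - y)" using that Ipos by (auto simp: U'_def)
    then have "flux p (D\<psi> x) = - flux p ((s * norm (x - y) powr (- \<alpha> - 1)) *\<^sub>R sgn (x - y))"
      by (simp add: D\<psi>_def)
    also have "\<dots> = - ((s * norm (x - y) powr (- \<alpha> - 1)) powr (p - 1) / norm (x - y)) *\<^sub>R (x - y)"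
      using pos s by (subst flux_radial) auto
    also have "(s * norm (x - y) powr (- \<alpha> - 1)) powr (p - 1) / norm (x - y) = s powr (p - 1) * norm (x - y) powr (- ?N - 1)"
    proof -
      have e: "(- \<alpha> - 1) * (p - 1) = - ?N" using \<alpha>1 by (simp add: algebra_simps)
      have "(s * norm (x - y) powr (- \<alpha> - 1)) powr (p - 1) = s powr (p - 1) * norm (x - y) powr (- ?N)"
        by (simp add: powr_mult powr_powr e)
      moreover have "norm (x - y) powr (- ?N - 1) = norm (x - y) powr (- ?N) / norm (x - y)"
        using powr_diff [of "norm (x - y)" "- ?N" 1] pos by simp
      ultimately show ?thesis by simp
    qed
    finally show ?thesis .
  qed
  have w\<psi>: "weak_eq U' (\<lambda>x. flux p (D\<psi> x)) g 0"
  proof -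
    let ?w = "\<lambda>r. - (s powr (p - 1) * r powr (- ?N - 1))"
    let ?w' = "\<lambda>r. s powr (p - 1) * (?N + 1) * r powr (- ?N - 1 - 1)"
    have dd: "(?w has_real_derivative ?w' r) (at r)" if "r \<in> I" for r
    proof -
      have "(?w has_real_derivative - (s powr (p - 1) * ((- ?N - 1) * r powr (- ?N - 1 - 1)))) (at r)"
        using that Ipos by (intro DERIV_minus DERIV_cmult has_real_derivative_powr) auto
      then show ?thesis by (simp add: algebra_simps)
    qed
    have "weak_eq {x. norm (x - y) \<in> I} (\<lambda>x. ?w (norm (x - y)) *\<^sub>R (x - y))
      (\<lambda>x. norm (x - y) * ?w' (norm (x - y)) + ?N * ?w (norm (x - y))) 0"
      by (rule weak_eq_radial [OF dd _ Ipos oI]) (use Ipos in \<open>auto intro!: continuous_intros\<close>)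
    from this [folded U'_def] show ?thesis
    proof (rule weak_eq_cong)
      fix x assume x: "x \<in> U'"
      show "?w (norm (x - y)) *\<^sub>R (x - y) = flux p (D\<psi> x)" by (simp add: flux\<psi> [OF x])
      have pos: "0 < norm (x - y)" using x Ipos by (auto simp: U'_def)
      have "norm (x - y) * norm (x - y) powr (- ?N - 1 - 1) = norm (x - y) powr (- ?N - 1)"
        using powr_diff [of "norm (x - y)" "- ?N - 1" 1] pos by (simp only: powr_one) simp
      then have "norm (x - y) * ?w' (norm (x - y)) = s powr (p - 1) * (?N + 1) * norm (x - y) powr (- ?N - 1)"
        by (simp add: mult_ac)
      then show "norm (x - y) * ?w' (norm (x - y)) + ?N * ?w (norm (x - y)) = g x"
        by (simp add: g_def algebra_simps)
    qed
  qed
  have U'X: "U' \<subseteq> X" by (auto simp: U'_def X_def I_def dist_norm norm_minus_commute)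
  have XU: "X \<subseteq> U"
  proof
    fix x assume "x \<in> X"
    then have "dist x0 x < \<rho>" using inball by (auto simp: X_def)
    then show "x \<in> U" using ball by auto
  qed
  have oU': "open U'" unfolding U'_def by (rule open_radial [OF oI])
  have cX: "compact X" by (simp add: X_def compact_diff)
  have X0: "x \<noteq> y" if "x \<in> X" for x using that d by (auto simp: X_def)
  have c\<psi>: "continuous_on X \<psi>"
    unfolding \<psi>_def using X0 \<alpha> by (intro continuous_intros) auto
  have usc: "closed {x\<in>X. c \<le> \<psi> x - V x}" for c
    by (rule usc_closed [OF compact_imp_closed [OF cX] c\<psi> lsc_on_subset [OF lsc XU]])
  have z'X: "z' \<in> X" using d by (auto simp: X_def d_def)
  obtain x1 where x1: "x1 \<in> X" "\<forall>x\<in>X. \<psi> x - V x \<le> \<psi> x1 - V x1"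
    using usc_attains_max [OF cX _ usc] z'X by blast
  define M where "M = \<psi> x1 - V x1"
  \<comment> \<open>Barrier and V agree at z', so the maximum of \<psi> - V is at least 0, whereas
    \<psi> - V is negative on both boundary spheres; contact is therefore interior.\<close>
  have "\<psi> z' = m" by (simp add: \<psi>_def d_def dist_norm norm_minus_commute)
  then have M0: "0 \<le> M" using x1(2) z'X Vz' by (force simp: M_def)
  have bdry: "\<psi> x - V x < M" if "x \<in> X - U'" for x
  proof -
    have "norm (x - y) = d / 2 \<or> norm (x - y) = 3 * d / 2"
      using that by (auto simp: X_def U'_def I_def dist_norm norm_minus_commute)
    then show ?thesis
    proof
      assume r: "norm (x - y) = d / 2"
      then have "x \<in> S" by (simp add: S_def dist_norm norm_minus_commute)
      then have V1: "m + \<eta> \<le> V x" by (rule \<eta>(2))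
      have "s / \<alpha> * (norm (x - y) powr (- \<alpha>) - d powr (- \<alpha>)) \<le> s / \<alpha> * (d / 2) powr (- \<alpha>)"
        unfolding r using s \<alpha> by (intro mult_left_mono) auto
      also have "\<dots> \<le> (\<alpha> * \<eta> / 2 * (d / 2) powr \<alpha>) / \<alpha> * (d / 2) powr (- \<alpha>)"
        using \<alpha> by (intro mult_right_mono divide_right_mono) (auto simp: s_def)
      also have "\<dots> = \<eta> / 2 * ((d / 2) powr \<alpha> * (d / 2) powr (- \<alpha>))" using \<alpha> by simp
      also have "(d / 2) powr \<alpha> * (d / 2) powr (- \<alpha>) = 1" using d by (simp add: powr_minus)
      finally have "\<psi> x \<le> m + \<eta> / 2" by (simp add: \<psi>_def)
      then show ?thesis using V1 \<eta>(1) M0 by linarith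
    next
      assume r: "norm (x - y) = 3 * d / 2"
      have "m \<le> V x" using mle inball [of x] r by (simp add: dist_norm norm_minus_commute)
      moreover have "(3 * d / 2) powr (- \<alpha>) < d powr (- \<alpha>)"
        using d \<alpha> by (intro powr_less_mono2_neg) auto
      then have "s / \<alpha> * ((3 * d / 2) powr (- \<alpha>) - d powr (- \<alpha>)) < 0"
        using s \<alpha> by (intro mult_pos_neg) auto
      then have "\<psi> x < m" unfolding \<psi>_def r by simp
      ultimately show ?thesis using M0 by linarith
    qed
  qed
  have q0: "0 < q" using p q by simp
  have U'U: "U' \<subseteq> U" using U'X XU by simp
  have False
  proof (rule touching [OF p q0 q(2) cX oU' U'X C\<psi> w\<psi> _ C1_on_subset [OF V] weak_eq_subset [OF wV] _ _ usc])
    show "continuous_on U' g"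
      unfolding g_def using X0 U'X by (intro continuous_intros) auto
    show "U' - {z} \<subseteq> U - {z}" "U' - {z} \<subseteq> U - {z}" using U'U by auto
    show "continuous_on (U' - {z}) gv" by (rule continuous_on_subset [OF cgv]) (use U'U in auto)
    show "gv x \<le> norm (Dv x) powr q" if "x \<in> U' - {z}" for x using gv that U'U by auto
    show "\<psi> x - V x \<le> M" if "x \<in> X" for x using x1 that by (simp add: M_def)
    show "\<psi> x - V x < M" if "x \<in> X - U'" for x by (rule bdry [OF that])
    show "\<exists>x\<in>X. \<psi> x - V x = M" using x1 by (auto simp: M_def)
    show "D\<psi> x \<noteq> 0 \<and> norm (D\<psi> x) powr q < g x" if x: "x \<in> U'" "\<psi> x - V x = M" for x
    proof -
      have r: "d / 2 \<le> norm (x - y)" "norm (x - y) \<le> 3 * d / 2" using x by (auto simp: U'_def I_def)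
      have pos: "0 < norm (x - y)" using r d by linarith
      let ?r = "norm (x - y)"
      have nD: "norm (D\<psi> x) = s * ?r powr (- \<alpha> - 1)"
        using pos s by (simp add: D\<psi>_def norm_sgn abs_mult)
      have "norm (D\<psi> x) powr q = s powr (p - 1) * (s powr (q + 1 - p) * ?r powr ((- \<alpha> - 1) * q))"
        using s by (simp add: nD powr_mult powr_powr powr_add [symmetric] mult.assoc [symmetric])
      also have "\<dots> < s powr (p - 1) * (?r powr E * ?r powr ((- \<alpha> - 1) * q))"
        using sq \<mu>le [OF r] s pos by (intro mult_strict_left_mono mult_strict_right_mono) auto
      also have "?r powr E * ?r powr ((- \<alpha> - 1) * q) = ?r powr (- ?N - 1)"
      proof -
        have "E + (- \<alpha> - 1) * q = - ?N - 1" by (simp add: E_def algebra_simps)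
        then show ?thesis unfolding powr_add [symmetric] by simp
      qed
      finally have "norm (D\<psi> x) powr q < g x" by (simp add: g_def)
      moreover have "norm (D\<psi> x) \<noteq> 0" using s pos unfolding nD by simp
      ultimately show ?thesis by auto
    qed
    show "\<exists>x\<in>U' - {z}. k < \<psi> x - V x" if h: "z \<in> U'" "\<psi> z - V z = M" "k < M" for k
    proof -
      have e: "0 < (M - k) / 2" using h by simp
      have "isCont \<psi> z" using C\<psi> h(1) unfolding C1_on_def by (auto intro: GDERIV_isCont)
      then obtain d1 where d1: "0 < d1" "\<And>x. dist x z < d1 \<Longrightarrow> dist (\<psi> x) (\<psi> z) < (M - k) / 2"
        using e unfolding continuous_at_eps_delta by meson
      obtain d2 where d2: "0 < d2" "ball z d2 \<subseteq> U'" using oU' h(1) open_contains_ball by blast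
      obtain x where x: "x \<noteq> z" "dist x z < min d1 d2" "V x < V z + (M - k) / 2"
        using approach [of "(M - k) / 2" "min d1 d2"] e d1(1) d2(1) h(1) U'U by auto
      have "\<bar>\<psi> x - \<psi> z\<bar> < (M - k) / 2" using d1(2) [of x] x by (simp add: dist_real_def)
      then have "k < \<psi> x - V x" using x(3) h(2) by (simp add: field_simps abs_if split: if_splits)
      moreover have "x \<in> U' - {z}" using x d2 by (auto simp: dist_commute)
      ultimately show ?thesis by blast
    qed
  qed
  then show False .
qed

text \<open>A continuous function that is nowhere touched from above by a paraboloid
  \<open>c \<bar>h - h2\<bar>\<^sup>2\<close> with nonzero gradient at the touching point is locally constant.\<close>

lemma constant_or_touched:
  fixes \<Theta> :: "'a::euclidean_space \<Rightarrow> real"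
  assumes c: "continuous_on (ball 0 R) \<Theta>" and R: "0 < R"
  obtains (const) "\<And>h. h \<in> ball 0 (R / 8) \<Longrightarrow> \<Theta> h = \<Theta> 0"
  | (touched) h0 h2 c r where "0 < c" "0 < r" "h0 \<noteq> h2" "ball h0 r \<subseteq> ball 0 R" "h0 \<in> ball 0 R"
      "\<And>h. h \<in> ball h0 r \<Longrightarrow> \<Theta> h - c * (norm (h - h2))\<^sup>2 \<le> \<Theta> h0 - c * (norm (h0 - h2))\<^sup>2"
proof -
  have cc: "continuous_on (cball 0 (3 * R / 4)) \<Theta>"
    by (rule continuous_on_subset [OF c]) (use R in auto)
  have "bounded (\<Theta> ` cball 0 (3 * R / 4))"
    by (intro compact_imp_bounded compact_continuous_image cc compact_cball)
  then obtain B where B: "\<And>h. h \<in> cball 0 (3 * R / 4) \<Longrightarrow> \<bar>\<Theta> h\<bar> \<le> B"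
    unfolding bounded_iff by (metis imageI real_norm_def)
  define d where "d = R / 4"
  have d: "0 < d" using R by (simp add: d_def)
  \<comment> \<open>At distance d the penalty k d^2 = 2|B| + 1 exceeds the oscillation of \<Theta>,
    so a maximum of the penalised function that beats the centre cannot lie on the sphere.\<close>
  define k where "k = (2 * \<bar>B\<bar> + 1) / d\<^sup>2"
  have k: "0 < k" using d by (simp add: k_def)
  have inb: "h \<in> cball 0 (3 * R / 4)" if "h2 \<in> ball 0 (R / 2)" "h \<in> cball h2 d" for h h2 :: 'a
    using norm_triangle_ineq [of h2 "h - h2"] that by (simp add: d_def dist_norm norm_minus_commute)
  show thesis
  proof (cases "\<forall>h2\<in>ball 0 (R / 2). \<forall>h\<in>cball h2 d. \<Theta> h - k * (norm (h - h2))\<^sup>2 \<le> \<Theta> h2")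
    case True
    let ?S = "ball (0::'a) (R / 8)"
    \<comment> \<open>Used in both directions, the one-sided bounds give a quadratic modulus of
      continuity, so the derivative vanishes.\<close>
    have quad: "\<bar>\<Theta> x - \<Theta> y\<bar> \<le> k * (norm (x - y))\<^sup>2" if "x \<in> ?S" "y \<in> ?S" for x y
    proof -
      have "norm (x - y) \<le> norm x + norm y" by (rule norm_triangle_ineq4)
      then have n: "norm (x - y) \<le> d" using that by (simp add: d_def)
      have "\<Theta> x - k * (norm (x - y))\<^sup>2 \<le> \<Theta> y" "\<Theta> y - k * (norm (y - x))\<^sup>2 \<le> \<Theta> x"
      proof -
        have b: "x \<in> ball 0 (R / 2)" "y \<in> ball 0 (R / 2)" using that R by auto
        have c: "x \<in> cball y d" "y \<in> cball x d" using n by (auto simp: dist_norm norm_minus_commute)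
        show "\<Theta> x - k * (norm (x - y))\<^sup>2 \<le> \<Theta> y" using True b(2) c(1) by blast
        show "\<Theta> y - k * (norm (y - x))\<^sup>2 \<le> \<Theta> x" using True b(1) c(2) by blast
      qed
      then show ?thesis by (simp add: abs_le_iff norm_minus_commute algebra_simps)
    qed
    have "\<exists>a. \<forall>x\<in>?S. \<Theta> x = a"
    proof (rule has_derivative_zero_constant)
      fix x assume x: "x \<in> ?S"
      show "(\<Theta> has_derivative (\<lambda>h. 0)) (at x within ?S)"
        unfolding has_derivative_within_alt
      proof (intro conjI bounded_linear_zero allI impI)
        fix e :: real assume e: "0 < e"
        show "\<exists>d>0. \<forall>y\<in>?S. norm (y - x) < d \<longrightarrow> norm (\<Theta> y - \<Theta> x - 0) \<le> e * norm (y - x)"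
        proof (intro exI [of _ "e / k"] conjI ballI impI)
          fix y assume y: "y \<in> ?S" "norm (y - x) < e / k"
          have "k * norm (y - x) \<le> e" using y(2) k by (simp add: field_simps)
          then have "k * norm (y - x) * norm (y - x) \<le> e * norm (y - x)" by (intro mult_right_mono) auto
          then show "norm (\<Theta> y - \<Theta> x - 0) \<le> e * norm (y - x)"
            using quad [OF y(1) x] by (simp add: power2_eq_square mult.assoc)
        qed (use e k in simp)
      qed
    qed simp
    then obtain a where a: "\<forall>x\<in>?S. \<Theta> x = a" ..
    have "\<Theta> h = \<Theta> 0" if "h \<in> ?S" for h using a that R by simp
    then show ?thesis by (rule const)
  next
    case False
    then obtain h2 h1 where h: "h2 \<in> ball 0 (R / 2)" "h1 \<in> cball h2 d"
        "\<Theta> h2 < \<Theta> h1 - k * (norm (h1 - h2))\<^sup>2" by (auto simp: not_le)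
    let ?q = "\<lambda>h. \<Theta> h - k * (norm (h - h2))\<^sup>2"
    have "continuous_on (cball h2 d) ?q"
      using inb [OF h(1)] by (intro continuous_intros continuous_on_subset [OF cc]) auto
    then obtain h0 where h0: "h0 \<in> cball h2 d" "\<And>h. h \<in> cball h2 d \<Longrightarrow> ?q h \<le> ?q h0"
      using continuous_attains_sup [OF compact_cball, of h2 d ?q] d by fastforce
    have gt: "\<Theta> h2 < ?q h0" using h(3) h0(2) [OF h(2)] by linarith
    then have ne: "h0 \<noteq> h2" by auto
    have lt: "norm (h0 - h2) < d"
    proof (rule ccontr)
      assume "\<not> ?thesis"
      then have "norm (h0 - h2) = d" using h0(1) by (simp add: dist_norm norm_minus_commute)
      then have "?q h0 = \<Theta> h0 - (2 * \<bar>B\<bar> + 1)" using d by (simp add: k_def)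
      moreover have "\<bar>\<Theta> h0\<bar> \<le> B" "\<bar>\<Theta> h2\<bar> \<le> B"
        using B inb [OF h(1) h0(1)] inb [OF h(1), of h2] d by auto
      ultimately show False using gt by linarith
    qed
    define r where "r = d - norm (h0 - h2)"
    have sub: "ball h0 r \<subseteq> cball h2 d"
    proof
      fix x assume "x \<in> ball h0 r"
      then show "x \<in> cball h2 d"
        using norm_triangle_ineq [of "x - h0" "h0 - h2"] by (simp add: r_def dist_norm norm_minus_commute)
    qed
    have big: "cball h2 d \<subseteq> ball 0 R"
    proof
      fix x assume "x \<in> cball h2 d"
      then have "norm x \<le> 3 * R / 4" using inb [OF h(1)] by simp
      then show "x \<in> ball 0 R" using R by simp
    qed
    show ?thesis
    proof (rule touched [OF k _ ne])
      show "0 < r" using lt by (simp add: r_def)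
      show "ball h0 r \<subseteq> ball 0 R" "h0 \<in> ball 0 R" using sub big h0(1) by auto
      show "?q h \<le> ?q h0" if "h \<in> ball h0 r" for h using h0(2) sub that by blast
    qed
  qed
qed

text \<open>Two functions none of which is smooth are compared by sliding: let \<open>\<Theta>(h)\<close> be the maximum of
  \<open>f(x) - V(x + h)\<close>. If \<open>\<Theta>\<close> is touched from above at some \<open>h\<close> with nonzero gradient, then this
  gradient is that of \<open>f\<close> at all maximum points, where the equation for \<open>f\<close> is hence strict and
  the touching principle applies. Otherwise \<open>\<Theta>\<close> is locally constant, all maximum points are
  local maxima of \<open>f\<close> and local minima of \<open>V\<close> on balls of a fixed radius, and the strong maximum principle
  makes the set of maximum points open.\<close>

lemma comparison:
  fixes f V :: "'a::euclidean_space \<Rightarrow> real"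
  assumes p: "1 < p" "p \<le> real DIM('a)" and q: "p - 1 < q" "q < p"
    and X: "compact X" and U: "open U" "U \<subseteq> X"
    and f: "C1_on U f Df" and wf: "weak_eq U (\<lambda>x. flux p (Df x)) g 0" and cg: "continuous_on U g"
    and fX: "continuous_on X f"
    and g: "\<And>x. x \<in> U \<Longrightarrow> 0 \<le> g x" "\<And>x. x \<in> U \<Longrightarrow> Df x \<noteq> 0 \<Longrightarrow> norm (Df x) powr q < g x"
    and V: "C1_on (U - {z}) V Dv" and wV: "weak_eq (U - {z}) (\<lambda>x. flux p (Dv x)) gv 0"
    and cgv: "continuous_on (U - {z}) gv" and gv: "\<And>x. x \<in> U - {z} \<Longrightarrow> gv x \<le> norm (Dv x) powr q"
    and lsc: "lsc_on X V"
    and approach: "\<And>e d. z \<in> U \<Longrightarrow> 0 < e \<Longrightarrow> 0 < d \<Longrightarrow> \<exists>y. y \<noteq> z \<and> dist y z < d \<and> V y < V z + e"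
    and bdry: "\<And>x. x \<in> X - U \<Longrightarrow> f x - V x \<le> K"
    and x: "x \<in> X"
  shows "f x - V x \<le> K"
proof (rule ccontr)
  assume "\<not> f x - V x \<le> K"
  have q0: "0 < q" using p q by simp
  have clX: "closed X" using X by (rule compact_imp_closed)
  have usc: "closed {x\<in>X. c \<le> f x - V x}" for c by (rule usc_closed [OF clX fX lsc])
  obtain x0 where x0: "x0 \<in> X" "\<And>y. y \<in> X \<Longrightarrow> f y - V y \<le> f x0 - V x0"
    using usc_attains_max [OF X _ usc] x by blast
  define S where "S = f x0 - V x0"
  have SK: "K < S" using x0(2) [OF x] \<open>\<not> f x - V x \<le> K\<close> by (simp add: S_def)
  \<comment> \<open>By compactness: pairs that are almost equal and almost maximal stay away from
    the boundary, since a limit point outside U would satisfy f - V <= K < S. One number serves as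
    distance and as tolerance.\<close>
  obtain \<rho> where \<rho>: "0 < \<rho>" "\<And>x y. x \<in> X \<Longrightarrow> y \<in> X \<Longrightarrow> dist x y < \<rho> \<Longrightarrow> S - \<rho> \<le> f x - V y \<Longrightarrow> ball x \<rho> \<subseteq> U \<and> ball y \<rho> \<subseteq> U"
  proof (rule ccontr)
    assume "\<not> thesis"
    then have "\<forall>n::nat. \<exists>x y. x \<in> X \<and> y \<in> X \<and> dist x y < 1 / real (Suc n) \<and> S - 1 / real (Suc n) \<le> f x - V y \<and>
        \<not> (ball x (1 / real (Suc n)) \<subseteq> U \<and> ball y (1 / real (Suc n)) \<subseteq> U)"
      using that by (metis zero_less_divide_1_iff of_nat_0_less_iff zero_less_Suc)
    then obtain xs ys where xs: "\<And>n. xs n \<in> X" "\<And>n. ys n \<in> X" "\<And>n. dist (xs n) (ys n) < 1 / real (Suc n)"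
        "\<And>n. S - 1 / real (Suc n) \<le> f (xs n) - V (ys n)"
        "\<And>n. \<not> (ball (xs n) (1 / real (Suc n)) \<subseteq> U \<and> ball (ys n) (1 / real (Suc n)) \<subseteq> U)"
      by metis
    obtain l \<sigma> where l: "l \<in> X" "strict_mono \<sigma>" "(xs \<circ> \<sigma>) \<longlonglongrightarrow> l"
      using X xs(1) unfolding compact_def by metis
    have r0: "(\<lambda>n. 1 / real (Suc n)) \<longlonglongrightarrow> 0"
      by (rule LIMSEQ_inverse_real_of_nat [unfolded inverse_eq_divide])
    then have r1: "(\<lambda>n. 1 / real (Suc (\<sigma> n))) \<longlonglongrightarrow> 0"
      using LIMSEQ_subseq_LIMSEQ [OF r0 l(2)] by (simp add: o_def)
    have ev: "\<forall>\<^sub>F n in sequentially. dist (xs (\<sigma> n)) l < e \<and> dist (ys (\<sigma> n)) l < e \<and> 1 / real (Suc (\<sigma> n)) < e" if e: "0 < e" for e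
    proof -
      have 1: "\<forall>\<^sub>F n in sequentially. dist ((xs \<circ> \<sigma>) n) l < e / 2" using tendstoD [OF l(3), of "e / 2"] e by simp
      have 2: "\<forall>\<^sub>F n in sequentially. 1 / real (Suc (\<sigma> n)) < e / 2" using order_tendstoD(2) [OF r1, of "e / 2"] e by simp
      from 1 2 show ?thesis
      proof eventually_elim
        case (elim n)
        have "dist (ys (\<sigma> n)) l \<le> dist (xs (\<sigma> n)) (ys (\<sigma> n)) + dist (xs (\<sigma> n)) l"
          using dist_triangle [of "ys (\<sigma> n)" l "xs (\<sigma> n)"] by (simp add: dist_commute)
        then show ?case using elim xs(3) [of "\<sigma> n"] e by simp
      qed
    qed
    have "l \<in> U"
    proof (rule ccontr)
      assume "l \<notin> U"
      then have "f l - V l \<le> K" using bdry l(1) by blast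
      then have e: "0 < (S - (f l - V l)) / 3" (is "0 < ?e") using SK by simp
      obtain d1 where d1: "0 < d1" "\<And>y. y \<in> X \<Longrightarrow> dist y l < d1 \<Longrightarrow> V l - ?e < V y"
        using lsc l(1) e unfolding lsc_on_def by meson
      obtain d2 where d2: "0 < d2" "\<And>y. y \<in> X \<Longrightarrow> dist y l < d2 \<Longrightarrow> dist (f y) (f l) < ?e"
        using fX l(1) e unfolding continuous_on_iff by meson
      have "0 < min (min d1 d2) ?e" using d1 d2 e by simp
      from ev [OF this] obtain n where n: "dist (xs (\<sigma> n)) l < min (min d1 d2) ?e" "dist (ys (\<sigma> n)) l < min (min d1 d2) ?e"
          "1 / real (Suc (\<sigma> n)) < min (min d1 d2) ?e"
        by (auto simp: eventually_sequentially)
      have "V l - ?e < V (ys (\<sigma> n))" using d1(2) xs(2) n by simp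
      moreover have "\<bar>f (xs (\<sigma> n)) - f l\<bar> < ?e" using d2(2) [OF xs(1), of "\<sigma> n"] n by (simp add: dist_real_def)
      moreover have "S - ?e \<le> f (xs (\<sigma> n)) - V (ys (\<sigma> n))" using xs(4) [of "\<sigma> n"] n by linarith
      moreover have "3 * ?e = S - (f l - V l)" by simp
      ultimately show False by linarith
    qed
    then obtain r where r: "0 < r" "ball l r \<subseteq> U" using U(1) open_contains_ball by blast
    have "0 < r / 2" using r by simp
    from ev [OF this] obtain n where n: "dist (xs (\<sigma> n)) l < r / 2" "dist (ys (\<sigma> n)) l < r / 2" "1 / real (Suc (\<sigma> n)) < r / 2"
      by (auto simp: eventually_sequentially)
    have "ball w (1 / real (Suc (\<sigma> n))) \<subseteq> U" if "dist w l < r / 2" for w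
    proof
      fix v assume "v \<in> ball w (1 / real (Suc (\<sigma> n)))"
      then have "dist v w < r / 2" using n(3) by (simp add: dist_commute)
      then have "dist v l < r" using that dist_triangle [of v l w] by simp
      then show "v \<in> U" using r(2) by (auto simp: dist_commute)
    qed
    then show False using xs(5) [of "\<sigma> n"] n by blast
  qed
  have x0U: "ball x0 \<rho> \<subseteq> U" using \<rho>(2) [OF x0(1) x0(1)] \<rho>(1) by (simp add: S_def)
  have x0U': "x0 \<in> U" using x0U \<rho>(1) by auto
  have ucf: "uniformly_continuous_on X f" by (rule compact_uniformly_continuous [OF fX X])
  obtain d0 where d0: "0 < d0" "\<And>y. y \<in> X \<Longrightarrow> dist y x0 < d0 \<Longrightarrow> dist (f y) (f x0) < \<rho>"
    using fX x0(1) \<rho>(1) unfolding continuous_on_iff by meson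
  \<comment> \<open>For shifts below R the value \<Theta> stays above S - \<rho>, so maximum points
    keep distance \<rho> from the boundary of U.\<close>
  define R where "R = min \<rho> d0 / 2"
  have R: "0 < R" "R < \<rho>" "R < d0" using \<rho>(1) d0(1) by (auto simp: R_def)
  define E where "E = (\<lambda>h. {x\<in>X. x + h \<in> X})"
  have cE: "compact (E h)" for h
  proof -
    have "closed ((\<lambda>x. x + h) -` X)" by (intro closed_vimage clX continuous_intros)
    then have "compact (X \<inter> (\<lambda>x. x + h) -` X)" by (rule compact_Int_closed [OF X])
    moreover have "X \<inter> (\<lambda>x. x + h) -` X = E h" by (auto simp: E_def)
    ultimately show ?thesis by simp
  qed
  have lscE: "lsc_on (E h) (\<lambda>x. V (x + h))" for h
    unfolding lsc_on_def
  proof (intro ballI allI impI)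
    fix x e assume x: "x \<in> E h" and e: "(0::real) < e"
    then obtain d where d: "0 < d" "\<And>y. y \<in> X \<Longrightarrow> dist y (x + h) < d \<Longrightarrow> V (x + h) - e < V y"
      using lsc unfolding lsc_on_def E_def by auto meson
    show "\<exists>d>0. \<forall>y\<in>E h. dist y x < d \<longrightarrow> V (x + h) - e < V (y + h)"
    proof (intro exI [of _ d] conjI ballI impI d(1))
      fix y assume "y \<in> E h" "dist y x < d"
      then show "V (x + h) - e < V (y + h)" using d(2) [of "y + h"] by (simp add: E_def dist_norm)
    qed
  qed
  have fE: "continuous_on (E h) f" for h by (rule continuous_on_subset [OF fX]) (auto simp: E_def)
  have uscE: "closed {x\<in>E h. c \<le> f x - V (x + h)}" for h c
    by (rule usc_closed [OF compact_imp_closed [OF cE] fE lscE])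
  have x0E: "x0 - h \<in> E h" if "h \<in> ball 0 R" for h
  proof -
    have "x0 - h \<in> ball x0 \<rho>" using that R by (simp add: dist_norm)
    then have "x0 - h \<in> X" using x0U U(2) by blast
    then show ?thesis using x0(1) by (simp add: E_def)
  qed
  have exm: "\<exists>x\<in>E h. \<forall>y\<in>E h. f y - V (y + h) \<le> f x - V (x + h)" if "h \<in> ball 0 R" for h
    by (rule usc_attains_max [OF cE _ uscE]) (use x0E [OF that] in auto)
  then obtain \<xi> where \<xi>: "\<And>h. h \<in> ball 0 R \<Longrightarrow> \<xi> h \<in> E h"
     "\<And>h y. h \<in> ball 0 R \<Longrightarrow> y \<in> E h \<Longrightarrow> f y - V (y + h) \<le> f (\<xi> h) - V (\<xi> h + h)"
    by metis
  define \<Theta> where "\<Theta> = (\<lambda>h. f (\<xi> h) - V (\<xi> h + h))"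
  have \<Theta>le: "f y - V (y + h) \<le> \<Theta> h" if "h \<in> ball 0 R" "y \<in> E h" for h y
    using \<xi>(2) [OF that] by (simp add: \<Theta>_def)
  have \<Theta>S: "S - \<rho> \<le> \<Theta> h" if h: "h \<in> ball 0 R" for h
  proof -
    have "x0 - h \<in> X" using x0E [OF h] by (simp add: E_def)
    then have "\<bar>f (x0 - h) - f x0\<bar> < \<rho>"
      using d0(2) [of "x0 - h"] h R by (simp add: dist_norm)
    moreover have "f (x0 - h) - V x0 \<le> \<Theta> h" using \<Theta>le [OF h x0E [OF h]] by simp
    ultimately show ?thesis by (simp add: S_def)
  qed
  have inU: "ball y \<rho> \<subseteq> U \<and> ball (y + h) \<rho> \<subseteq> U" if "h \<in> ball 0 R" "y \<in> E h" "f y - V (y + h) = \<Theta> h" for y h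
    using \<rho>(2) [of y "y + h"] that \<Theta>S [of h] R by (simp add: E_def dist_norm)
  have \<Theta>0: "\<Theta> 0 = S"
  proof (rule antisym)
    have 0: "0 \<in> ball (0::'a) R" using R by simp
    show "\<Theta> 0 \<le> S" using x0(2) [of "\<xi> 0"] \<xi>(1) [OF 0] by (simp add: \<Theta>_def S_def E_def)
    show "S \<le> \<Theta> 0" using \<Theta>le [OF 0, of x0] x0(1) by (simp add: E_def S_def)
  qed
  have c\<Theta>: "continuous_on (ball 0 R) \<Theta>"
    unfolding continuous_on_iff
  proof (intro ballI allI impI)
    fix h :: 'a and e :: real assume h: "h \<in> ball 0 R" and e: "0 < e"
    obtain d where d: "0 < d" "\<And>x y. x \<in> X \<Longrightarrow> y \<in> X \<Longrightarrow> dist y x < d \<Longrightarrow> dist (f y) (f x) < e"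
      using ucf e unfolding uniformly_continuous_on_def by meson
    have half: "\<Theta> b - e < \<Theta> a" if "a \<in> ball 0 R" "b \<in> ball 0 R" "dist a b < min d \<rho>" for a b
    proof -
      let ?x = "\<xi> b"
      have bU: "ball ?x \<rho> \<subseteq> U" using inU [OF that(2) \<xi>(1) [OF that(2)]] by (simp add: \<Theta>_def)
      have xX: "?x \<in> X" "?x + b \<in> X" using \<xi>(1) [OF that(2)] by (auto simp: E_def)
      have dd: "dist (?x + b - a) ?x < min d \<rho>" using that(3) by (simp add: dist_norm norm_minus_commute)
      then have "?x + b - a \<in> ball ?x \<rho>" by (simp add: dist_commute)
      then have y: "?x + b - a \<in> X" using bU U(2) by blast
      then have "?x + b - a \<in> E a" using xX by (simp add: E_def)
      from \<Theta>le [OF that(1) this] have "f (?x + b - a) - V (?x + b) \<le> \<Theta> a" by simp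
      moreover have "\<bar>f (?x + b - a) - f ?x\<bar> < e" using d(2) [OF xX(1) y] dd by (simp add: dist_real_def)
      ultimately show ?thesis by (simp add: \<Theta>_def)
    qed
    show "\<exists>d>0. \<forall>h'\<in>ball 0 R. dist h' h < d \<longrightarrow> dist (\<Theta> h') (\<Theta> h) < e"
    proof (intro exI [of _ "min d \<rho>"] conjI ballI impI)
      fix h' assume "h' \<in> ball 0 R" "dist h' h < min d \<rho>"
      then have "\<Theta> h - e < \<Theta> h'" "\<Theta> h' - e < \<Theta> h" using half h by (auto simp: dist_commute)
      then show "dist (\<Theta> h') (\<Theta> h) < e" by (simp add: dist_real_def abs_less_iff)
    qed (use d \<rho> in simp)
  qed
  from c\<Theta> R(1) show False
  proof (cases rule: constant_or_touched)
    case (touched h0 h2 c r)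
    note h0R = \<open>h0 \<in> ball 0 R\<close>
    \<comment> \<open>With y fixed, V(y + h0) is frozen along h -> y + h0 - h. Touching of \<Theta>
      thus becomes a local maximum of f(y + h0 - h) - c |h - h2|^2 at h = h0, whence Df y = - 2 c
      (h0 - h2).\<close>
    have Df0: "Df y \<noteq> 0" if y: "y \<in> E h0" "f y - V (y + h0) = \<Theta> h0" for y
    proof -
      have yU: "ball y \<rho> \<subseteq> U" and yU': "ball (y + h0) \<rho> \<subseteq> U" using inU [OF h0R y] by auto
      have "y \<in> U" using yU \<rho>(1) by auto
      define w where "w = (\<lambda>h. f (y + h0 - h) - c * ((h - h2) \<bullet> (h - h2)))"
      have dw: "(w has_derivative (\<lambda>k. (- k) \<bullet> Df y - c * (2 * ((h0 - h2) \<bullet> k)))) (at h0)"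
      proof -
        have "((\<lambda>h. y + h0 - h) has_derivative (\<lambda>k. - k)) (at h0)" by (auto intro!: derivative_eq_intros)
        moreover have "(f has_derivative (\<lambda>k. k \<bullet> Df y)) (at (y + h0 - h0))"
          using f \<open>y \<in> U\<close> by (auto simp: C1_on_def gderiv_def)
        ultimately have 1: "((\<lambda>h. f (y + h0 - h)) has_derivative (\<lambda>k. (- k) \<bullet> Df y)) (at h0)"
          by (rule has_derivative_compose)
        have 2: "((\<lambda>h. c * ((h - h2) \<bullet> (h - h2))) has_derivative (\<lambda>k. c * (2 * ((h0 - h2) \<bullet> k)))) (at h0)"
          by (auto intro!: derivative_eq_intros simp: inner_commute)
        show ?thesis unfolding w_def by (rule has_derivative_diff [OF 1 2])
      qed
      have wmax: "w h \<le> w h0" if h: "h \<in> ball h0 (min r \<rho>)" for h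
      proof -
        have "y + h0 - h \<in> ball y \<rho>" using h by (simp add: dist_norm norm_minus_commute)
        then have "y + h0 - h \<in> X" using yU U(2) by blast
        then have "y + h0 - h \<in> E h" using y(1) by (simp add: E_def)
        moreover have hR: "h \<in> ball 0 R" using h touched(4) by auto
        ultimately have "f (y + h0 - h) - V (y + h0) \<le> \<Theta> h" using \<Theta>le [of h "y + h0 - h"] by simp
        moreover have "\<Theta> h - c * (norm (h - h2))\<^sup>2 \<le> \<Theta> h0 - c * (norm (h0 - h2))\<^sup>2"
          using touched(6) h by simp
        ultimately show ?thesis using y(2) by (simp add: w_def power2_norm_eq_inner)
      qed
      have "(\<lambda>k. (- k) \<bullet> Df y - c * (2 * ((h0 - h2) \<bullet> k))) = (\<lambda>k. 0)"
        by (rule differential_zero_maxmin [OF _ _ dw, of "ball h0 (min r \<rho>)"]) (use wmax touched(2) \<rho>(1) in auto)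
      then have "(- (h0 - h2)) \<bullet> Df y - c * (2 * ((h0 - h2) \<bullet> (h0 - h2))) = 0" by (rule fun_cong)
      moreover have "0 < c * (2 * ((h0 - h2) \<bullet> (h0 - h2)))" using touched(1,3) by simp
      ultimately show ?thesis by auto
    qed
    define U' where "U' = {x\<in>U. x + h0 \<in> U}"
    have oU': "open U'"
    proof -
      have "open ((\<lambda>x. x + h0) -` U)" by (intro open_vimage U continuous_intros)
      then have "open (U \<inter> (\<lambda>x. x + h0) -` U)" using U(1) by blast
      moreover have "U \<inter> (\<lambda>x. x + h0) -` U = U'" by (auto simp: U'_def)
      ultimately show ?thesis by simp
    qed
    have U'E: "U' \<subseteq> E h0" using U(2) by (auto simp: U'_def E_def)
    have C1V: "C1_on (U' - {z - h0}) (\<lambda>x. V (x + h0)) (\<lambda>x. Dv (x + h0))"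
      unfolding C1_on_def
    proof (intro conjI ballI)
      fix x assume x: "x \<in> U' - {z - h0}"
      then have "x + h0 \<in> U - {z}" by (auto simp: U'_def)
      then have 1: "(V has_derivative (\<lambda>k. k \<bullet> Dv (x + h0))) (at (x + h0))"
        using V by (auto simp: C1_on_def gderiv_def)
      have "((\<lambda>x. x + h0) has_derivative (\<lambda>k. k)) (at x)" by (auto intro!: derivative_eq_intros)
      from has_derivative_compose [OF this 1]
      show "GDERIV (\<lambda>x. V (x + h0)) x :> Dv (x + h0)" by (simp add: gderiv_def)
    next
      show "continuous_on (U' - {z - h0}) (\<lambda>x. Dv (x + h0))"
        by (rule continuous_on_compose2 [of "U - {z}" Dv])
           (use V in \<open>auto simp: C1_on_def U'_def intro!: continuous_intros\<close>)
    qed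
    have cFv: "continuous_on (U - {z}) (\<lambda>x. flux p (Dv x))"
      using V p by (intro continuous_on_flux_comp) (auto simp: C1_on_def)
    have sh: "U' - {z - h0} \<subseteq> {x. x + h0 \<in> U - {z}}" by (auto simp: U'_def)
    show False
    proof (rule touching [OF p q0 q(2) cE oU' U'E C1_on_subset [OF f] weak_eq_subset [OF wf] continuous_on_subset [OF cg]
          C1V weak_eq_subset [OF weak_eq_shift [OF wV cFv cgv] sh] _ _ uscE])
      show "continuous_on (U' - {z - h0}) (\<lambda>x. gv (x + h0))"
        by (rule continuous_on_compose2 [OF cgv]) (auto simp: U'_def intro!: continuous_intros)
      show "gv (x + h0) \<le> norm (Dv (x + h0)) powr q" if "x \<in> U' - {z - h0}" for x
        using gv [of "x + h0"] that by (auto simp: U'_def eq_diff_eq)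
      show "f x - V (x + h0) \<le> \<Theta> h0" if "x \<in> E h0" for x by (rule \<Theta>le [OF h0R that])
      show "f x - V (x + h0) < \<Theta> h0" if x: "x \<in> E h0 - U'" for x
      proof (rule ccontr)
        assume "\<not> ?thesis"
        then have "f x - V (x + h0) = \<Theta> h0" using \<Theta>le [OF h0R, of x] x by auto
        then have "x \<in> U'" using inU [OF h0R, of x] x \<rho>(1) by (auto simp: U'_def)
        with x show False by simp
      qed
      show "\<exists>x\<in>E h0. f x - V (x + h0) = \<Theta> h0" using \<xi>(1) [OF h0R] by (auto simp: \<Theta>_def)
      show "Df x \<noteq> 0 \<and> norm (Df x) powr q < g x" if x: "x \<in> U'" "f x - V (x + h0) = \<Theta> h0" for x
        using Df0 [of x] g(2) [of x] x U'E by (auto simp: U'_def)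
      show "\<exists>x\<in>U' - {z - h0}. k < f x - V (x + h0)"
        if h: "z - h0 \<in> U'" "f (z - h0) - V (z - h0 + h0) = \<Theta> h0" "k < \<Theta> h0" for k
      proof -
        have e: "0 < (\<Theta> h0 - k) / 2" using h by simp
        have zU: "z \<in> U" "z - h0 \<in> U" using h(1) by (auto simp: U'_def)
        have "isCont f (z - h0)" using f zU(2) unfolding C1_on_def by (auto intro: GDERIV_isCont)
        then obtain d1 where d1: "0 < d1" "\<And>x. dist x (z - h0) < d1 \<Longrightarrow> dist (f x) (f (z - h0)) < (\<Theta> h0 - k) / 2"
          using e unfolding continuous_at_eps_delta by meson
        obtain d2 where d2: "0 < d2" "ball (z - h0) d2 \<subseteq> U'" using oU' h(1) open_contains_ball by blast
        obtain y where y: "y \<noteq> z" "dist y z < min d1 d2" "V y < V z + (\<Theta> h0 - k) / 2"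
          using approach [of "(\<Theta> h0 - k) / 2" "min d1 d2"] e d1(1) d2(1) zU by auto
        let ?x = "y - h0"
        have dx: "dist ?x (z - h0) = dist y z" by (simp add: dist_norm)
        have "\<bar>f ?x - f (z - h0)\<bar> < (\<Theta> h0 - k) / 2" using d1(2) [of ?x] y dx by (simp add: dist_real_def)
        moreover have "f (z - h0) - V z = \<Theta> h0" using h(2) by simp
        ultimately have "k < f ?x - V (?x + h0)" using y(3) by (simp add: field_simps abs_if split: if_splits)
        moreover have "?x \<in> U' - {z - h0}" using y dx d2 by (auto simp: dist_commute subset_iff)
        ultimately show ?thesis by blast
      qed
    qed (auto simp: U'_def)
  next
    case const
    define t where "t = R / 8"
    have t: "0 < t" "t < \<rho>" using R by (auto simp: t_def)
    have ct: "\<Theta> h = S" if "norm h < t" for h using const [of h] that \<Theta>0 by (simp add: t_def)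
    have hR: "h \<in> ball 0 R" if "norm h < t" for h :: 'a using that R by (simp add: t_def)
    define Z where "Z = {x\<in>X. S \<le> f x - V x}"
    have Zeq: "f y - V y = S" "y \<in> X" if "y \<in> Z" for y using that x0(2) [of y] by (auto simp: Z_def S_def)
    have ZU: "ball y \<rho> \<subseteq> U" if "y \<in> Z" for y
      using \<rho>(2) [of y y] Zeq [OF that] \<rho>(1) by simp
    \<comment> \<open>\<open>strong_min\<close> provides for one exceptional point; for - f there is
      none, so any point outside U takes its place.\<close>
    obtain z' where z': "z' \<notin> U"
    proof -
      have "bounded U" using X U(2) bounded_subset compact_imp_bounded by blast
      then have "U \<noteq> UNIV" using not_bounded_UNIV by auto
      then show ?thesis using that by auto
    qed
    \<comment> \<open>The radius t / 4 does not depend on y, so Z would be open as well as compact;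
      pushing its extremal point in a direction e gives the contradiction. \<open>strong_min\<close>
      accepts - f because the source - g is nonpositive.\<close>
    have ZZ: "ball y (t / 4) \<subseteq> Z" if y: "y \<in> Z" for y
    proof
      fix w assume w: "w \<in> ball y (t / 4)"
      have yt: "ball y t \<subseteq> U" using ZU [OF y] t by auto
      have yX: "y \<in> X" using Zeq [OF y] by simp
      have Vmin: "V y \<le> V v" if v: "v \<in> ball y t" for v
      proof -
        have n: "norm (v - y) < t" using v by (simp add: dist_norm norm_minus_commute)
        have "v \<in> X" using yt v U(2) by blast
        then have "y \<in> E (v - y)" using yX by (simp add: E_def)
        from \<Theta>le [OF hR [OF n] this] have "f y - V v \<le> S" using ct [OF n] by simp
        then show ?thesis using Zeq(1) [OF y] by simp
      qed
      have fmax: "- f y \<le> - f v" if v: "v \<in> ball y t" for v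
      proof -
        have n: "norm (y - v) < t" using v by (simp add: dist_norm)
        have "v \<in> X" using yt v U(2) by blast
        then have "v \<in> E (y - v)" using yX by (simp add: E_def)
        from \<Theta>le [OF hR [OF n] this] have "f v - V y \<le> S" using ct [OF n] by simp
        then show ?thesis using Zeq(1) [OF y] by simp
      qed
      have 1: "V w = V y"
        by (rule strong_min [OF p q V wV cgv gv lsc_on_subset [OF lsc U(2)] approach yt Vmin w])
      have Uz: "U - {z'} = U" using z' by auto
      have Cm: "C1_on (U - {z'}) (\<lambda>x. - f x) (\<lambda>x. - Df x)"
        using C1_on_cmult [OF f, of "- 1"] unfolding Uz by simp
      have wm: "weak_eq (U - {z'}) (\<lambda>x. flux p (- Df x)) (\<lambda>x. - g x) 0"
        using weak_eq_scale [OF wf, of "- 1"] unfolding Uz by simp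
      have 2: "- f w = - f y"
      proof (rule strong_min [OF p q Cm wm _ _ _ _ yt fmax w])
        show "continuous_on (U - {z'}) (\<lambda>x. - g x)" unfolding Uz by (intro continuous_intros cg)
        show "- g x \<le> norm (- Df x) powr q" if "x \<in> U - {z'}" for x
          using g(1) [of x] that by (intro order_trans [OF _ powr_ge_zero]) auto
        show "lsc_on U (\<lambda>x. - f x)"
          by (intro lsc_on_continuous continuous_intros C1_on_continuous [OF f])
      qed (use z' in auto)
      have "w \<in> ball y t" using w t by simp
      then have "w \<in> U" using yt by blast
      then show "w \<in> Z" using 1 2 Zeq [OF y] U(2) by (auto simp: Z_def)
    qed
    have "compact Z"
      using compact_Int_closed [OF X usc [of S]] by (simp add: Z_def Int_def conj_commute cong: conj_cong)
    moreover have "Z \<noteq> {}" using x0(1) by (auto simp: Z_def S_def)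
    moreover obtain e :: 'a where e: "e \<in> Basis" using nonempty_Basis by blast
    moreover have "continuous_on Z (\<lambda>x. x \<bullet> e)" by (intro continuous_intros)
    ultimately obtain y where y: "y \<in> Z" "\<And>v. v \<in> Z \<Longrightarrow> v \<bullet> e \<le> y \<bullet> e"
      using continuous_attains_sup [of Z "\<lambda>x. x \<bullet> e"] by blast
    have "y + (t / 8) *\<^sub>R e \<in> ball y (t / 4)" using e t by (simp add: dist_norm)
    then have "(y + (t / 8) *\<^sub>R e) \<bullet> e \<le> y \<bullet> e" using ZZ [OF y(1)] y(2) by blast
    then show False using e t by (simp add: inner_add_left)
  qed
qed

section \<open>Solutions, their reflections and their oscillation on spheres\<close>

definition HJ_sol :: "real \<Rightarrow> real \<Rightarrow> 'a::euclidean_space set \<Rightarrow> ('a \<Rightarrow> real) \<Rightarrow> ('a \<Rightarrow> 'a) \<Rightarrow> bool" where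
  "HJ_sol p q U u D \<longleftrightarrow> C1_on U u D \<and> weak_eq U (\<lambda>x. flux p (D x)) (\<lambda>x. norm (D x) powr q) 0"

lemma HJ_sol_subset: "HJ_sol p q U u D \<Longrightarrow> V \<subseteq> U \<Longrightarrow> HJ_sol p q V u D"
  unfolding HJ_sol_def by (blast intro: C1_on_subset weak_eq_subset)

lemma HJ_sol_add_const:
  assumes "HJ_sol p q U u D"
  shows "HJ_sol p q U (\<lambda>x. u x + K) D"
proof -
  have "C1_on U u D" using assms by (simp add: HJ_sol_def)
  from C1_on_add [OF this C1_on_const [of U K]] show ?thesis
    using assms by (simp add: HJ_sol_def)
qed

lemma continuous_on_norm_powr:
  "continuous_on U D \<Longrightarrow> 0 < q \<Longrightarrow> continuous_on U (\<lambda>x. norm (D x) powr q)"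
  by (rule continuous_on_powr' [OF continuous_on_norm continuous_on_const]) auto

text \<open>Multiplication by \<open>t < 1\<close> makes the equation strict wherever the gradient is nonzero,
  because \<open>q > p - 1\<close>.\<close>

lemma HJ_sol_shrink:
  assumes u: "HJ_sol p q U u D" and t: "0 < t" "t < 1" and q: "1 < p" "p - 1 < q"
  shows "C1_on U (\<lambda>x. t * u x) (\<lambda>x. t *\<^sub>R D x)"
    "weak_eq U (\<lambda>x. flux p (t *\<^sub>R D x)) (\<lambda>x. t powr (p - 1) * norm (D x) powr q) 0"
    "continuous_on U (\<lambda>x. t powr (p - 1) * norm (D x) powr q)"
    "\<And>x. 0 \<le> t powr (p - 1) * norm (D x) powr q"
    "\<And>x. t *\<^sub>R D x \<noteq> 0 \<Longrightarrow> norm (t *\<^sub>R D x) powr q < t powr (p - 1) * norm (D x) powr q"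
proof -
  show "C1_on U (\<lambda>x. t * u x) (\<lambda>x. t *\<^sub>R D x)" using u by (auto simp: HJ_sol_def intro: C1_on_cmult)
  show "weak_eq U (\<lambda>x. flux p (t *\<^sub>R D x)) (\<lambda>x. t powr (p - 1) * norm (D x) powr q) 0"
    using weak_eq_scale [of U "\<lambda>x. flux p (D x)" "\<lambda>x. norm (D x) powr q" 0 "t powr (p - 1)"] u
    by (simp add: HJ_sol_def flux_scale [OF t(1)])
  show "continuous_on U (\<lambda>x. t powr (p - 1) * norm (D x) powr q)"
    using u q by (intro continuous_on_mult_left continuous_on_norm_powr) (auto simp: HJ_sol_def C1_on_def)
  show "0 \<le> t powr (p - 1) * norm (D x) powr q" for x by simp
  show "norm (t *\<^sub>R D x) powr q < t powr (p - 1) * norm (D x) powr q" if "t *\<^sub>R D x \<noteq> 0" for x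
  proof -
    have "t powr q < t powr (p - 1)" using t q by (intro powr_less_mono') auto
    then have "t powr q * norm (D x) powr q < t powr (p - 1) * norm (D x) powr q"
      using that by (intro mult_strict_right_mono) auto
    then show ?thesis using t by (simp add: powr_mult)
  qed
qed

text \<open>t u1 is a strict subsolution for t < 1, and t -> 1 at the end; nonnegativity of u1 on
  the boundary keeps t u1 <= u1 there. As nothing is singular, the exceptional point is taken
  outside U.\<close>

lemma comparison_solutions:
  fixes u1 u2 :: "'a::euclidean_space \<Rightarrow> real"
  assumes p: "1 < p" "p \<le> real DIM('a)" and q: "p - 1 < q" "q < p"
    and X: "compact X" and U: "open U" "U \<subseteq> X" and W: "X \<subseteq> W"
    and u1: "HJ_sol p q W u1 D1" and u2: "HJ_sol p q W u2 D2"
    and nn: "\<And>x. x \<in> X - U \<Longrightarrow> 0 \<le> u1 x" and le: "\<And>x. x \<in> X - U \<Longrightarrow> u1 x \<le> u2 x" and x: "x \<in> X"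
  shows "u1 x \<le> u2 x"
proof (rule field_le_mult_one_interval)
  fix t :: real assume t: "0 < t" "t < 1"
  have bU: "bounded U" using X U(2) bounded_subset compact_imp_bounded by blast
  then have "U \<noteq> UNIV" using not_bounded_UNIV by auto
  then obtain z where z: "z \<notin> U" by auto
  have UW: "U \<subseteq> W" using U W by simp
  note u1U = HJ_sol_subset [OF u1 UW] and u2U = HJ_sol_subset [OF u2 UW]
  note s = HJ_sol_shrink [OF u1U t p(1) q(1)]
  have Uz: "U - {z} = U" using z by auto
  have cX: "continuous_on X u1" "continuous_on X u2"
    using u1 u2 W by (auto simp: HJ_sol_def intro: continuous_on_subset C1_on_continuous)
  have "t * u1 x - u2 x \<le> 0"
  proof (rule comparison [OF p q X U s(1,2,3) _ s(4,5) _ _ _ _ _ _ _ x, where z = z and V = u2 and Dv = D2 and gv = "\<lambda>x. norm (D2 x) powr q"])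
    show "continuous_on X (\<lambda>x. t * u1 x)" by (intro continuous_intros cX)
    show "C1_on (U - {z}) u2 D2" using u2U by (simp add: Uz HJ_sol_def)
    show "weak_eq (U - {z}) (\<lambda>x. flux p (D2 x)) (\<lambda>x. norm (D2 x) powr q) 0" using u2U by (simp add: Uz HJ_sol_def)
    show "continuous_on (U - {z}) (\<lambda>x. norm (D2 x) powr q)"
      using u2U p q by (intro continuous_on_norm_powr) (auto simp: Uz HJ_sol_def C1_on_def)
    show "lsc_on X u2" by (rule lsc_on_continuous [OF cX(2)])
    show "t * u1 x - u2 x \<le> 0" if "x \<in> X - U" for x
    proof -
      have "t * u1 x \<le> 1 * u1 x" using nn [OF that] t by (intro mult_right_mono) auto
      then show ?thesis using le [OF that] by simp
    qed
  qed (use z in auto)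
  then show "t * u1 x \<le> u2 x" by simp
qed

lemma HJ_sol_refl:
  fixes u :: "'a::euclidean_space \<Rightarrow> real"
  assumes u: "HJ_sol p q U u D" and p: "1 < p" "0 < q" and e: "norm e = 1" and a: "refl_dir e a = - a"
  shows "HJ_sol p q {x. a + refl_dir e x \<in> U} (\<lambda>x. u (a + refl_dir e x)) (\<lambda>x. refl_dir e (D (a + refl_dir e x)))"
proof -
  have c: "C1_on U u D" using u by (simp add: HJ_sol_def)
  have cF: "continuous_on U (\<lambda>x. flux p (D x))" "continuous_on U (\<lambda>x. norm (D x) powr q)"
    using c p by (auto simp: C1_on_def intro!: continuous_on_flux_comp continuous_on_norm_powr)
  have "weak_eq U (\<lambda>x. flux p (D x)) (\<lambda>x. norm (D x) powr q) 0" using u by (simp add: HJ_sol_def)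
  from weak_eq_refl [OF this cF e a] C1_on_refl [OF c e, of a] show ?thesis
    by (simp add: HJ_sol_def flux_refl_dir [OF e] refl_dir(2) [OF e])
qed

text \<open>Reflection argument: \<open>u\<close> is compared with its reflection across a hyperplane that separates
  \<open>x\<close> from the origin and maps \<open>x\<close> to \<open>y\<close>, in the part of the ball not containing the origin.
  The reflected function is singular at the reflected origin \<open>a\<close>; unless it tends to
  infinity there, its value at \<open>a\<close> is set to be the lower limit.\<close>

lemma oscillation_aux:
  fixes u :: "'a::euclidean_space \<Rightarrow> real"
  assumes p: "1 < p" "p \<le> real DIM('a)" and q: "p - 1 < q" "q < p"
    and \<Omega>: "open \<Omega>" "cball 0 R \<subseteq> \<Omega>" and u: "HJ_sol p q (\<Omega> - {0}) u D"
    and nn: "\<And>x. x \<in> \<Omega> - {0} \<Longrightarrow> 0 \<le> u x" and K: "\<And>x. norm x = R \<Longrightarrow> u x \<le> K"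
    and xy: "0 < norm y" "norm y < norm x" "norm x \<le> R"
  shows "u x \<le> u y + K"
proof -
  have q0: "0 < q" using p q by simp
  have R: "0 < R" using xy by linarith
  have K0: "0 \<le> K"
  proof -
    obtain b :: 'a where b: "b \<in> Basis" using nonempty_Basis by blast
    have "R *\<^sub>R b \<in> \<Omega> - {0}" using \<Omega>(2) R b by (auto simp: subset_iff)
    then show ?thesis using nn [of "R *\<^sub>R b"] K [of "R *\<^sub>R b"] R b by (auto intro: order_trans)
  qed
  have ne: "x \<noteq> y" using xy by auto
  define e where "e = sgn (x - y)"
  have e: "norm e = 1" using ne by (simp add: e_def norm_sgn)
  have ee: "e \<bullet> e = 1" using e by (simp add: dot_square_norm)
  \<comment> \<open>The mirror is the hyperplane of points z with z . e = s, bisecting the segment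
    from x to y. s > 0 because |y| < |x|, so the origin lies on the side of y.\<close>
  define s where "s = ((norm x)\<^sup>2 - (norm y)\<^sup>2) / (2 * norm (x - y))"
  have nxy: "0 < norm (x - y)" using ne by simp
  have "(norm y)\<^sup>2 < (norm x)\<^sup>2" using xy by (intro power_strict_mono) auto
  then have s: "0 < s" using nxy by (simp add: s_def)
  define a where "a = (2 * s) *\<^sub>R e"
  define T where "T = (\<lambda>z. a + refl_dir e z)"
  have aR: "refl_dir e a = - a"
  proof -
    have "refl_dir e a = (2 * s - 2 * (2 * s)) *\<^sub>R e"
      by (simp only: a_def refl_dir_def inner_scaleR_left ee mult_1_right scaleR_left_diff_distrib)
    also have "2 * s - 2 * (2 * s) = - (2 * s)" by simp
    finally show ?thesis by (simp add: a_def)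
  qed
  have TT: "T (T z) = z" for z
    by (simp add: T_def linear_add [OF refl_dir(1) [OF e]] aR refl_dir(3) [OF e])
  have Ta: "T a = 0" by (simp add: T_def aR)
  have Tz: "T z = z - (2 * (z \<bullet> e - s)) *\<^sub>R e" for z
    by (simp add: T_def a_def refl_dir_def algebra_simps)
  have Td: "norm (T z - T w) = norm (z - w)" for z w
    using refl_dir(2) [OF e, of "z - w"] by (simp add: T_def linear_diff [OF refl_dir(1) [OF e]])
  have T0: "norm (T z) = norm (z - a)" for z using Td [of z a] Ta by simp
  have T0iff: "T z = 0 \<longleftrightarrow> z = a" for z using T0 [of z] by auto
  \<comment> \<open>The reflection moves the cap \<open>X\<close> towards the origin, hence back
    into the ball of radius R; only a is sent to the singularity.\<close>
  have Tn: "(norm (T z))\<^sup>2 = (norm z)\<^sup>2 - 4 * s * (z \<bullet> e - s)" for z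
  proof -
    define c where "c = 2 * (z \<bullet> e - s)"
    have "(norm (z - c *\<^sub>R e))\<^sup>2 = (norm z)\<^sup>2 + c * (c - 2 * (z \<bullet> e))"
      unfolding power2_norm_eq_inner by (simp add: inner_diff_left inner_diff_right ee inner_commute algebra_simps)
    moreover have "c - 2 * (z \<bullet> e) = - 2 * s" by (simp add: c_def)
    ultimately show ?thesis unfolding Tz c_def [symmetric] by (simp add: c_def algebra_simps)
  qed
  have xe: "x \<bullet> e - s = norm (x - y) / 2"
  proof -
    have "x \<bullet> (x - y) - ((norm x)\<^sup>2 - (norm y)\<^sup>2) / 2 = (norm (x - y))\<^sup>2 / 2"
      by (simp add: power2_norm_eq_inner inner_diff_left inner_diff_right inner_commute field_simps)
    then have "(x \<bullet> (x - y) - ((norm x)\<^sup>2 - (norm y)\<^sup>2) / 2) / norm (x - y) = norm (x - y) / 2"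
      using nxy by (simp add: power2_eq_square)
    moreover have "x \<bullet> e = x \<bullet> (x - y) / norm (x - y)" by (simp add: e_def sgn_div_norm divide_inverse mult.commute)
    ultimately show ?thesis using nxy by (simp add: s_def diff_divide_distrib)
  qed
  have Tx: "T x = y"
  proof -
    have "T x = x - norm (x - y) *\<^sub>R e" by (simp add: Tz xe)
    also have "norm (x - y) *\<^sub>R e = x - y" using nxy by (simp add: e_def sgn_div_norm)
    finally show ?thesis by simp
  qed
  define X where "X = cball 0 R \<inter> {z. s \<le> e \<bullet> z}"
  define U where "U = ball 0 R \<inter> {z. s < e \<bullet> z}"
  have cX: "compact X" unfolding X_def by (intro compact_Int_closed compact_cball closed_halfspace_ge)
  have oU: "open U" unfolding U_def by (intro open_Int open_ball open_halfspace_gt)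
  have UX: "U \<subseteq> X" by (auto simp: U_def X_def)
  have xX: "x \<in> X"
  proof -
    have "s \<le> x \<bullet> e" using xe nxy by linarith
    then show ?thesis using xy by (simp add: X_def inner_commute)
  qed
  have xa: "x \<noteq> a" using Tx T0iff [of x] xy by auto
  have X\<Omega>: "X \<subseteq> \<Omega> - {0}" using \<Omega>(2) s by (auto simp: X_def)
  have TX: "norm (T z) \<le> norm z" if "z \<in> X" for z
  proof -
    have "0 \<le> 4 * s * (z \<bullet> e - s)" using that s by (intro mult_nonneg_nonneg) (auto simp: X_def inner_commute)
    then have "(norm (T z))\<^sup>2 \<le> (norm z)\<^sup>2" using Tn [of z] by simp
    then show ?thesis by (rule power2_le_imp_le) simp
  qed
  have T\<Omega>: "T z \<in> \<Omega> - {0}" if "z \<in> X - {a}" for z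
  proof -
    have "norm (T z) \<le> R" using TX [of z] that by (auto simp: X_def)
    then show ?thesis using \<Omega>(2) T0iff that by auto
  qed
  define W where "W = {z. T z \<in> \<Omega> - {0}}"
  have v: "HJ_sol p q W (\<lambda>z. u (T z)) (\<lambda>z. refl_dir e (D (T z)))"
    using HJ_sol_refl [OF u p(1) q0 e aR] by (simp add: W_def T_def)
  have XW: "X - {a} \<subseteq> W" using T\<Omega> by (auto simp: W_def)
  have bnd: "e \<bullet> z = s \<or> norm z = R" if "z \<in> X - U" for z using that by (auto simp: X_def U_def)
  have ba: "norm a = R" if "a \<in> X - U"
  proof -
    have "e \<bullet> a = 2 * s" by (simp add: a_def ee)
    then show ?thesis using bnd [OF that] s by auto
  qed
  have unn: "0 \<le> u z" if "z \<in> X" for z using nn X\<Omega> that by blast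
  have Tfix: "T z = z" if "e \<bullet> z = s" for z using that by (simp add: Tz inner_commute)
  have bdry: "u z \<le> u (T z) + K" if "z \<in> X - U" "z \<noteq> a" for z
    using bnd [OF that(1)]
  proof
    assume "e \<bullet> z = s"
    then show ?thesis using Tfix K0 by simp
  next
    assume "norm z = R"
    then show ?thesis using K [of z] nn [OF T\<Omega>, of z] that by auto
  qed
  have cu: "continuous_on X u"
    using u X\<Omega> by (auto simp: HJ_sol_def intro: continuous_on_subset C1_on_continuous)
  have cv: "continuous_on W (\<lambda>z. u (T z))" using v by (auto simp: HJ_sol_def intro: C1_on_continuous)
  have goal: "u x \<le> u (T x) + K"
  proof (cases "filterlim u at_top (at 0)")
    case True
    have "bounded (u ` X)" by (intro compact_imp_bounded compact_continuous_image cu cX)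
    then obtain B where B: "\<And>z. z \<in> X \<Longrightarrow> \<bar>u z\<bar> \<le> B" unfolding bounded_iff by (metis imageI real_norm_def)
    have "\<forall>\<^sub>F z in at 0. B \<le> u z" using True by (simp add: filterlim_at_top)
    then obtain d where d: "0 < d" "\<And>z. z \<noteq> 0 \<Longrightarrow> norm z < d \<Longrightarrow> B \<le> u z"
      unfolding eventually_at by (auto simp: dist_norm)
    \<comment> \<open>If u tends to infinity, the reflected function exceeds the maximum of u over X
      on a small sphere about a. The ball inside is removed and no singular point remains.\<close>
    define r where "r = min (d / 2) (norm (x - a) / 2)"
    have r: "0 < r" "r < d" "r < norm (x - a)" using d(1) xa by (auto simp: r_def min_def)
    define X' where "X' = X - ball a r"
    define U' where "U' = U - cball a r"
    have W': "X' \<subseteq> W \<inter> (\<Omega> - {0})" using XW X\<Omega> r by (auto simp: X'_def)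
    show ?thesis
    proof (rule comparison_solutions [OF p q, where X = X' and U = U' and W = "W \<inter> (\<Omega> - {0})" and ?u1.0 = u])
      show "compact X'" using cX by (simp add: X'_def compact_diff)
      show "open U'" using oU by (simp add: U'_def open_Diff)
      show "U' \<subseteq> X'" using UX by (auto simp: U'_def X'_def)
      show "X' \<subseteq> W \<inter> (\<Omega> - {0})" by (rule W')
      show "HJ_sol p q (W \<inter> (\<Omega> - {0})) u D" by (rule HJ_sol_subset [OF u]) auto
      show "HJ_sol p q (W \<inter> (\<Omega> - {0})) (\<lambda>z. u (T z) + K) (\<lambda>z. refl_dir e (D (T z)))"
        by (rule HJ_sol_subset [OF HJ_sol_add_const [OF v]]) auto
      show "0 \<le> u z" if "z \<in> X' - U'" for z using unn that by (auto simp: X'_def)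
      show "u z \<le> u (T z) + K" if z: "z \<in> X' - U'" for z
      proof (cases "z \<in> U")
        case False
        moreover have "z \<in> X" "z \<noteq> a" using z r by (auto simp: X'_def)
        ultimately show ?thesis using bdry [of z] by blast
      next
        case True
        then have "norm (T z) = r" using z T0 [of z] by (auto simp: X'_def U'_def dist_norm norm_minus_commute)
        then have "B \<le> u (T z)" using d(2) [of "T z"] r by auto
        moreover have "u z \<le> B" using B [of z] z by (auto simp: X'_def)
        ultimately show ?thesis using K0 by simp
      qed
      show "x \<in> X'" using xX r by (auto simp: X'_def dist_norm norm_minus_commute)
    qed
  next
    case False
    then obtain B where B: "\<not> (\<forall>\<^sub>F z in at 0. B \<le> u z)" by (auto simp: filterlim_at_top)
    \<comment> \<open>The supremum of A is the lower limit of u at 0, finite since u does not tend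
      to infinity. Its two defining properties give lower semicontinuity of V at a and the approach
      condition of \<open>comparison\<close>.\<close>
    define A :: "real set" where "A = {l. \<forall>\<^sub>F z in at 0. l \<le> u z}"
    have A0: "0 \<in> A"
    proof -
      have "ball 0 R - {0} \<subseteq> \<Omega> - {0}" using \<Omega>(2) by auto
      then have "\<forall>z. z \<noteq> 0 \<and> dist z 0 < R \<longrightarrow> 0 \<le> u z" using nn by (auto simp: subset_iff)
      then show ?thesis unfolding A_def eventually_at using R by auto
    qed
    have AB: "l \<le> B" if "l \<in> A" for l
    proof (rule ccontr)
      assume "\<not> l \<le> B"
      then have "\<forall>\<^sub>F z in at 0. B \<le> u z" using that unfolding A_def by (auto elim: eventually_mono)
      with B show False ..
    qed
    have bA: "bdd_above A" by (rule bdd_aboveI [of _ B]) (rule AB)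
    define L where "L = Sup A"
    have L0: "0 \<le> L" unfolding L_def by (rule cSup_upper [OF A0 bA])
    have Llow: "\<forall>\<^sub>F z in at 0. L - r < u z" if r: "0 < r" for r
    proof -
      obtain l where l: "l \<in> A" "L - r < l"
        using less_cSup_iff [of A "L - r"] A0 bA r unfolding L_def by auto
      then show ?thesis unfolding A_def by (auto elim: eventually_mono)
    qed
    have Lup: "\<exists>z. z \<noteq> 0 \<and> norm z < d \<and> u z < L + r" if r: "0 < r" "0 < d" for r d
    proof (rule ccontr)
      assume "\<not> ?thesis"
      then have "\<forall>z. z \<noteq> 0 \<and> dist z 0 < d \<longrightarrow> L + r \<le> u z" by (auto simp: not_less)
      then have "L + r \<in> A" unfolding A_def eventually_at using r(2) by auto
      then have "L + r \<le> L" unfolding L_def by (rule cSup_upper [OF _ bA])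
      then show False using r by simp
    qed
    define V where "V = (\<lambda>z. if z = a then L else u (T z))"
    have VC: "C1_on (W - {a}) V (\<lambda>z. refl_dir e (D (T z)))"
    proof (rule C1_on_cong)
      show "C1_on (W - {a}) (\<lambda>z. u (T z)) (\<lambda>z. refl_dir e (D (T z)))"
        using v by (auto simp: HJ_sol_def intro: C1_on_subset)
      have "continuous_on UNIV T" unfolding T_def
        using refl_dir(1) [OF e] by (intro continuous_intros linear_continuous_on) (simp add: linear_conv_bounded_linear)
      then have "open (T -` (\<Omega> - {0}))" using \<Omega>(1) by (intro open_vimage) auto
      moreover have "T -` (\<Omega> - {0}) = W" by (auto simp: W_def)
      ultimately show "open (W - {a})" by auto
    qed (auto simp: V_def)
    have lsc: "lsc_on X V"
      unfolding lsc_on_def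
    proof (intro ballI allI impI)
      fix z and r :: real assume z: "z \<in> X" and r: "0 < r"
      show "\<exists>d>0. \<forall>y\<in>X. dist y z < d \<longrightarrow> V z - r < V y"
      proof (cases "z = a")
        case True
        from Llow [OF r] obtain d where d: "0 < d" "\<And>w. w \<noteq> 0 \<Longrightarrow> norm w < d \<Longrightarrow> L - r < u w"
          unfolding eventually_at by (auto simp: dist_norm)
        show ?thesis
        proof (intro exI [of _ d] conjI ballI impI d(1))
          fix y assume y: "y \<in> X" "dist y z < d"
          show "V z - r < V y"
          proof (cases "y = a")
            case False
            then have "T y \<noteq> 0" "norm (T y) < d" using T0iff T0 y True by (auto simp: dist_norm)
            then show ?thesis using d(2) True False by (simp add: V_def)
          qed (use True r in simp)
        qed
      next
        case False
        have "continuous_on (X - {a}) (\<lambda>z. u (T z))" by (rule continuous_on_subset [OF cv XW])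
        then obtain d where d: "0 < d" "\<And>w. w \<in> X - {a} \<Longrightarrow> dist w z < d \<Longrightarrow> dist (u (T w)) (u (T z)) < r"
          using False z r unfolding continuous_on_iff by (metis DiffI singletonD)
        show ?thesis
        proof (intro exI [of _ "min d (dist a z)"] conjI ballI impI)
          fix y assume y: "y \<in> X" "dist y z < min d (dist a z)"
          then have "y \<noteq> a" by auto
          then have "\<bar>u (T y) - u (T z)\<bar> < r" using d(2) [of y] y by (simp add: dist_real_def)
          then show "V z - r < V y" using False \<open>y \<noteq> a\<close> by (simp add: V_def)
        qed (use d False in auto)
      qed
    qed
    have UW: "U - {a} \<subseteq> W - {a}" using XW UX by auto
    have main: "t * u x - V x \<le> K" if t: "0 < t" "t < 1" for t
    proof -
      have U\<Omega>: "U \<subseteq> \<Omega> - {0}" using UX X\<Omega> by auto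
      note sh = HJ_sol_shrink [OF HJ_sol_subset [OF u U\<Omega>] t p(1) q(1)]
      have tu: "t * u z \<le> u z" if "z \<in> X" for z
        using mult_right_mono [of t 1 "u z"] unn [OF that] t by simp
      show ?thesis
      proof (rule comparison [OF p q cX oU UX sh(1,2,3) _ sh(4,5) C1_on_subset [OF VC UW] _ _ _ lsc _ _ xX, where gv = "\<lambda>z. norm (refl_dir e (D (T z))) powr q"])
        show "continuous_on X (\<lambda>x. t * u x)" by (intro continuous_intros cu)
        show "weak_eq (U - {a}) (\<lambda>x. flux p (refl_dir e (D (T x)))) (\<lambda>z. norm (refl_dir e (D (T z))) powr q) 0"
          using v UW by (auto simp: HJ_sol_def intro: weak_eq_subset)
        show "continuous_on (U - {a}) (\<lambda>z. norm (refl_dir e (D (T z))) powr q)"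
          by (rule continuous_on_norm_powr [OF continuous_on_subset [of W] q0])
             (use v UW in \<open>auto simp: HJ_sol_def C1_on_def\<close>)
        show "\<exists>y. y \<noteq> a \<and> dist y a < d \<and> V y < V a + r" if r: "0 < r" "0 < d" for r d
        proof -
          obtain z where z: "z \<noteq> 0" "norm z < d" "u z < L + r" using Lup [OF r] by blast
          have "T z \<noteq> a" using z(1) TT [of z] Ta by auto
          moreover have "norm (T z - a) < d" using T0 [of "T z"] TT z by simp
          ultimately show ?thesis using z TT by (intro exI [of _ "T z"]) (simp add: V_def dist_norm)
        qed
        \<comment> \<open>The reflected origin a may lie on the boundary of X. As it is not on the
          mirror, |a| = R and the bound K applies.\<close>
        show "t * u z - V z \<le> K" if z: "z \<in> X - U" for z
        proof (cases "z = a")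
          case True
          then have "u z \<le> K" using ba z K by auto
          then show ?thesis using tu [of z] z L0 True by (simp add: V_def)
        next
          case False
          then show ?thesis using bdry [OF z False] tu [of z] z by (simp add: V_def)
        qed
      qed auto
    qed
    have "u x \<le> V x + K"
    proof (rule field_le_mult_one_interval)
      fix t :: real assume "0 < t" "t < 1"
      from main [OF this] show "t * u x \<le> V x + K" by simp
    qed
    then show ?thesis using xa by (simp add: V_def)
  qed
  then show ?thesis by (simp add: Tx)
qed

text \<open>Equal norms are a limiting case of \<open>oscillation_aux\<close>: y is approached along
  its ray, where norms are strictly smaller.\<close>

lemma oscillation:
  fixes u :: "'a::euclidean_space \<Rightarrow> real"
  assumes p: "1 < p" "p \<le> real DIM('a)" and q: "p - 1 < q" "q < p"
    and \<Omega>: "open \<Omega>" "cball 0 R \<subseteq> \<Omega>" and u: "HJ_sol p q (\<Omega> - {0}) u D"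
    and nn: "\<And>x. x \<in> \<Omega> - {0} \<Longrightarrow> 0 \<le> u x" and K: "\<And>x. norm x = R \<Longrightarrow> u x \<le> K"
    and xy: "0 < norm x" "norm y = norm x" "norm x \<le> R"
  shows "u x \<le> u y + K"
proof -
  have y\<Omega>: "y \<in> \<Omega> - {0}" using \<Omega>(2) xy by auto
  have "isCont u y"
    using u y\<Omega> by (auto simp: HJ_sol_def C1_on_def intro: GDERIV_isCont)
  moreover have "(\<lambda>n. (1 - 1 / real (Suc (Suc n))) *\<^sub>R y) \<longlonglongrightarrow> (1 - 0) *\<^sub>R y"
    by (intro tendsto_scaleR tendsto_diff tendsto_const LIMSEQ_ignore_initial_segment
          LIMSEQ_Suc [OF LIMSEQ_inverse_real_of_nat [unfolded inverse_eq_divide]])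
  ultimately have "(\<lambda>n. u ((1 - 1 / real (Suc (Suc n))) *\<^sub>R y) + K) \<longlonglongrightarrow> u y + K"
    by (intro tendsto_add tendsto_const isCont_tendsto_compose [where g = u]) auto
  moreover have "u x \<le> u ((1 - 1 / real (Suc (Suc n))) *\<^sub>R y) + K" for n
  proof (rule oscillation_aux [OF p q \<Omega> u nn K])
    let ?t = "1 - 1 / real (Suc (Suc n))"
    have t: "0 < ?t" "?t < 1" by (auto simp: field_simps)
    then show "0 < norm (?t *\<^sub>R y)" using xy by auto
    have "?t * norm y < 1 * norm y" using t xy by (intro mult_strict_right_mono) auto
    moreover have "norm (?t *\<^sub>R y) = ?t * norm y" using t by (simp only: norm_scaleR abs_of_pos)
    ultimately show "norm (?t *\<^sub>R y) < norm x" using xy by simp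
  qed (use xy in auto)
  ultimately show ?thesis by (intro LIMSEQ_le_const) auto
qed

section \<open>Radial solutions and the trichotomy\<close>

text \<open>Radial decreasing solutions: with \<open>z = - w'\<close> the function \<open>Y = r\<^bsup>N-1\<^esup> z\<^bsup>p-1\<^esup>\<close> solves a Bernoulli
  equation, whence the explicit formula below with a free parameter \<open>A\<close>. The value \<open>A = 0\<close> gives the
  strong singularity, \<open>A > 0\<close> the weak ones, and \<open>A < 0\<close> solutions which are infinite on
  a sphere.\<close>

locale radial =
  fixes N :: nat and p q R :: real
  assumes N: "2 \<le> N" and p: "1 < p" "p \<le> real N" and q: "p - 1 < q" "q < q_crit N p" and R: "0 < R"
begin

text \<open>The Bernoulli substitution: the power of Y with exponent - 1 / (\<kappa> (p - 1)) has
  derivative B \<theta> r^(\<theta>-1), hence equals A + B r^\<theta>. Solving for z yields the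
  exponents \<alpha> and \<kappa>; A is the constant of integration.\<close>

definition "\<kappa> = 1 / (q + 1 - p)"
definition "\<alpha> = (real N - 1) / (p - 1)"
definition "\<theta> = 1 - \<alpha> * (q + 1 - p)"
definition "B = (q + 1 - p) / ((p - 1) * \<theta>)"
definition "z A r = r powr (- \<alpha>) * (A + B * r powr \<theta>) powr (- \<kappa>)"
text \<open>Normalised to vanish on the outer sphere, where only 0 <= u <= K is known: there
  \<open>w A\<close> lies below u and \<open>w A\<close> + K above.\<close>

definition "w A r = integral {r..R} (z A)"
abbreviation "\<mu> \<equiv> mu_profile N p"
abbreviation "\<beta> \<equiv> beta_exp p q"
abbreviation "\<Lambda> \<equiv> lambda_const N p q"

lemma q_less: "q < p"
proof -
  have "real N * (p - 1) \<le> p * (real N - 1)" using p by (simp add: algebra_simps)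
  then have "q_crit N p \<le> p" using N by (simp add: q_crit_def pos_divide_le_eq)
  then show ?thesis using q by simp
qed

lemma \<kappa>: "0 < \<kappa>" "1 < \<kappa>" "\<kappa> * (q + 1 - p) = 1"
  using q q_less by (auto simp: \<kappa>_def)

lemma \<alpha>: "0 < \<alpha>" "\<alpha> * (p - 1) = real N - 1"
  using N p by (auto simp: \<alpha>_def)

text \<open>This is subcriticality: \<alpha> (q + 1 - p) < 1 rearranges to q < N (p - 1) / (N -
  1).\<close>

lemma \<theta>: "0 < \<theta>"
proof -
  have "q * (real N - 1) < real N * (p - 1)" using q N by (simp add: q_crit_def pos_less_divide_eq)
  then have "(real N - 1) * (q + 1 - p) < p - 1" by (simp add: algebra_simps)
  then show ?thesis using p by (simp add: \<theta>_def \<alpha>_def)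
qed

lemma B: "0 < B" "\<kappa> * (p - 1) * (B * \<theta>) = 1"
proof -
  show "0 < B" using q p \<theta> by (simp add: B_def)
  have "B * \<theta> = (q + 1 - p) / (p - 1)" using \<theta> by (simp add: B_def)
  then show "\<kappa> * (p - 1) * (B * \<theta>) = 1" using \<kappa>(3) p by (simp add: mult.assoc)
qed

lemma \<beta>: "0 < \<beta>" "\<beta> + 1 = \<kappa>" "\<theta> * \<kappa> = \<kappa> - \<alpha>"
proof -
  show "0 < \<beta>" using q q_less by (simp add: beta_exp_def)
  show "\<beta> + 1 = \<kappa>" using q by (simp add: beta_exp_def \<kappa>_def field_simps)
  have "\<theta> * \<kappa> = \<kappa> - \<alpha> * (\<kappa> * (q + 1 - p))" by (simp add: \<theta>_def algebra_simps)
  then show "\<theta> * \<kappa> = \<kappa> - \<alpha>" by (simp add: \<kappa>(3))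
qed

text \<open>For A = 0 the profile is z = B^(-\<kappa>) r^(-\<beta>-1), so its integral has leading
  coefficient B^(-\<kappa>) / \<beta>; this matches it with the closed form in
  \<open>lambda_const\<close>.\<close>

lemma \<Lambda>: "\<beta> * \<Lambda> = B powr (- \<kappa>)" "0 < \<Lambda>"
proof -
  have "\<beta> * (p - 1) + p - real N = (p - 1) * \<theta> * \<kappa>"
  proof -
    have "(p - 1) * \<theta> * \<kappa> = (p - 1) * (\<theta> * \<kappa>)" by simp
    also have "\<dots> = (p - 1) * \<kappa> - \<alpha> * (p - 1)" unfolding \<beta>(3) by (simp add: algebra_simps)
    finally show ?thesis unfolding \<alpha>(2) \<beta>(2) [symmetric] by (simp add: algebra_simps)
  qed
  also have "\<dots> = 1 / B" using \<kappa>(3) p \<theta> q by (simp add: B_def \<kappa>_def)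
  finally have 1: "\<beta> * (p - 1) + p - real N = 1 / B" .
  have "\<Lambda> = inverse \<beta> * (1 / B) powr \<kappa>"
    unfolding lambda_const_def 1 by (simp add: \<kappa>_def)
  moreover have "(1 / B) powr \<kappa> = B powr (- \<kappa>)"
    using B(1) by (simp add: powr_minus inverse_powr divide_inverse)
  ultimately show "\<beta> * \<Lambda> = B powr (- \<kappa>)" "0 < \<Lambda>" using \<beta>(1) B(1) by auto
qed

lemma pos_mono:
  assumes "0 < A + B * c powr \<theta>" "0 \<le> c" "c \<le> r"
  shows "0 < A + B * r powr \<theta>"
proof -
  have "B * c powr \<theta> \<le> B * r powr \<theta>"
    using assms B(1) \<theta> by (intro mult_left_mono powr_mono2) auto
  with assms(1) show ?thesis by linarith
qed

lemma pos_nonneg: "0 \<le> A \<Longrightarrow> 0 < r \<Longrightarrow> 0 < A + B * r powr \<theta>"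
  using B(1) by (intro add_nonneg_pos) auto

lemma one_plus_divide: "0 < y \<Longrightarrow> 1 + A / y = (A + y) / (y :: real)"
  by (simp add: add_divide_distrib)

lemma z_pos: "0 < r \<Longrightarrow> 0 < A + B * r powr \<theta> \<Longrightarrow> 0 < z A r"
  by (simp add: z_def)

lemma continuous_on_z:
  assumes "\<And>r. r \<in> I \<Longrightarrow> 0 < r \<and> 0 < A + B * r powr \<theta>"
  shows "continuous_on I (z A)"
proof -
  have 0: "r \<noteq> 0" "A + B * r powr \<theta> \<noteq> 0" if "r \<in> I" for r using assms [OF that] by auto
  show ?thesis unfolding z_def [abs_def]
    by (intro continuous_intros) (use 0 in auto)
qed

text \<open>As an integral up to R, \<open>w A\<close> need not be differentiable at R itself. The
  antiderivative lives beyond R, which is needed for a solution on an open set containing the closed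
  annulus.\<close>

lemma z_antiderivative:
  assumes c: "0 < c" "0 < A + B * c powr \<theta>" "c < R"
  obtains W where "\<And>r. r \<in> {c<..<R + 1} \<Longrightarrow> (W has_real_derivative - z A r) (at r)"
    "\<And>r. r \<in> {c..R} \<Longrightarrow> W r = w A r"
proof -
  have pos: "0 < r \<and> 0 < A + B * r powr \<theta>" if "r \<in> {c..R + 1}" for r
    using pos_mono [OF c(2), of r] c that by auto
  have cont: "continuous_on {c..R + 1} (z A)" by (rule continuous_on_z [OF pos])
  obtain F where F: "\<And>r. r \<in> {c..R + 1} \<Longrightarrow> (F has_vector_derivative z A r) (at r within {c..R + 1})"
    using antiderivative_continuous [OF cont] by blast
  show thesis
  proof (rule that [of "\<lambda>r. F R - F r"])
    fix r assume r: "r \<in> {c<..<R + 1}"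
    have "at r within {c..R + 1} = at r" by (rule at_within_interior) (use r in auto)
    then have "(F has_real_derivative z A r) (at r)"
      using F [of r] r by (simp add: has_real_derivative_iff_has_vector_derivative)
    from DERIV_diff [OF DERIV_const this] show "((\<lambda>r. F R - F r) has_real_derivative - z A r) (at r)" by simp
  next
    fix r assume r: "r \<in> {c..R}"
    have "(z A has_integral (F R - F r)) {r..R}"
    proof (rule fundamental_theorem_of_calculus)
      show "r \<le> R" using r by simp
      show "(F has_vector_derivative z A s) (at s within {r..R})" if "s \<in> {r..R}" for s
        by (rule has_vector_derivative_within_subset [OF F]) (use r that in auto)
    qed
    then show "F R - F r = w A r" by (simp add: w_def integral_unique)
  qed
qed

lemma z_integrable: "0 < r \<Longrightarrow> 0 < A + B * r powr \<theta> \<Longrightarrow> z A integrable_on {r..s}"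
  by (intro integrable_continuous_real continuous_on_z) (use pos_mono in force)

lemma mu_has_integral:
  assumes "0 < r" "r \<le> s"
  shows "((\<lambda>\<rho>. \<rho> powr (- \<alpha>)) has_integral (\<mu> r - \<mu> s)) {r..s}"
proof -
  have e: "(1 - real N) / (p - 1) = - \<alpha>" by (simp add: \<alpha>_def minus_divide_left)
  have "((\<lambda>\<rho>. \<rho> powr (- \<alpha>)) has_integral (- \<mu> s - - \<mu> r)) {r..s}"
  proof (rule fundamental_theorem_of_calculus [OF assms(2)])
    fix x assume x: "x \<in> {r..s}"
    have "(\<mu> has_real_derivative - (x powr (- \<alpha>))) (at x)"
      using DERIV_mu_profile [OF p(1), of x N] x assms unfolding e by simp
    from DERIV_minus [OF this]
    show "((\<lambda>x. - \<mu> x) has_vector_derivative x powr - \<alpha>) (at x within {r..s})"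
      by (simp add: has_real_derivative_iff_has_vector_derivative has_vector_derivative_at_within)
  qed
  then show ?thesis by simp
qed

lemma z0: "0 < r \<Longrightarrow> z 0 r = \<beta> * \<Lambda> * r powr (- \<beta> - 1)"
proof -
  assume r: "0 < r"
  have "z 0 r = r powr (- \<alpha>) * (B powr (- \<kappa>) * r powr (- (\<theta> * \<kappa>)))"
    using B(1) by (simp add: z_def powr_mult powr_powr)
  also have "\<dots> = B powr (- \<kappa>) * r powr (- \<alpha> + - (\<kappa> - \<alpha>))"
    unfolding \<beta>(3) powr_add by simp
  also have "- \<alpha> + - (\<kappa> - \<alpha>) = - \<beta> - 1" using \<beta>(2) by simp
  finally show ?thesis unfolding \<Lambda>(1) .
qed

lemma w0: "0 < r \<Longrightarrow> r \<le> R \<Longrightarrow> w 0 r = \<Lambda> * (r powr (- \<beta>) - R powr (- \<beta>))"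
proof -
  assume r: "0 < r" "r \<le> R"
  have "(z 0 has_integral (- (\<Lambda> * R powr (- \<beta>)) - - (\<Lambda> * r powr (- \<beta>)))) {r..R}"
  proof (rule fundamental_theorem_of_calculus [OF r(2)])
    fix x assume x: "x \<in> {r..R}"
    have "((\<lambda>x. - (\<Lambda> * x powr (- \<beta>))) has_real_derivative - (\<Lambda> * (- \<beta> * x powr (- \<beta> - 1)))) (at x)"
      using x r by (intro DERIV_minus DERIV_cmult has_real_derivative_powr) auto
    moreover have "- (\<Lambda> * (- \<beta> * x powr (- \<beta> - 1))) = z 0 x" using z0 [of x] x r by simp
    ultimately show "((\<lambda>x. - (\<Lambda> * x powr (- \<beta>))) has_vector_derivative z 0 x) (at x within {r..R})"
      by (simp add: has_real_derivative_iff_has_vector_derivative has_vector_derivative_at_within)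
  qed
  then show ?thesis by (simp add: w_def integral_unique algebra_simps)
qed

section \<open>Bounds for the radial solutions by mu_p and by the strong singularity\<close>

lemma w_nonneg:
  assumes "0 < r" "0 < A + B * r powr \<theta>"
  shows "0 \<le> w A r"
  unfolding w_def
proof (rule Henstock_Kurzweil_Integration.integral_nonneg [OF z_integrable [OF assms]])
  show "0 \<le> z A x" if "x \<in> {r..R}" for x
    using z_pos [of x A] pos_mono [OF assms(2), of x] assms that by auto
qed

lemma z_antimono:
  assumes "0 < r" "0 < A + B * r powr \<theta>" "A \<le> A'"
  shows "z A' r \<le> z A r"
  unfolding z_def using assms \<kappa>(1) by (intro mult_left_mono powr_mono2') auto

lemma w_antimono:
  assumes "0 < r" "0 < A + B * r powr \<theta>" "A \<le> A'"
  shows "w A' r \<le> w A r"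
  unfolding w_def
proof (rule Henstock_Kurzweil_Integration.integral_le)
  show "z A' integrable_on {r..R}" "z A integrable_on {r..R}" using assms by (auto intro!: z_integrable)
  show "z A' x \<le> z A x" if "x \<in> {r..R}" for x
    by (rule z_antimono) (use that assms pos_mono [OF assms(2), of x] in auto)
qed

lemma w_le_mu:
  assumes "0 < A" "0 < r" "r \<le> R"
  shows "w A r \<le> A powr (- \<kappa>) * (\<mu> r - \<mu> R)"
proof -
  have i: "((\<lambda>\<rho>. A powr (- \<kappa>) * \<rho> powr (- \<alpha>)) has_integral A powr (- \<kappa>) * (\<mu> r - \<mu> R)) {r..R}"
    by (rule has_integral_mult_right [OF mu_has_integral [OF assms(2,3)]])
  have "w A r \<le> integral {r..R} (\<lambda>\<rho>. A powr (- \<kappa>) * \<rho> powr (- \<alpha>))"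
    unfolding w_def
  proof (rule Henstock_Kurzweil_Integration.integral_le)
    show "z A integrable_on {r..R}" using assms by (intro z_integrable pos_nonneg) auto
    show "(\<lambda>\<rho>. A powr (- \<kappa>) * \<rho> powr (- \<alpha>)) integrable_on {r..R}" using i by blast
    fix x assume "x \<in> {r..R}"
    have "(A + B * x powr \<theta>) powr (- \<kappa>) \<le> A powr (- \<kappa>)"
      using assms \<kappa>(1) B(1) by (intro powr_mono2') auto
    then show "z A x \<le> A powr (- \<kappa>) * x powr (- \<alpha>)"
      unfolding z_def by (subst mult.commute) (intro mult_right_mono, auto)
  qed
  then show ?thesis unfolding integral_unique [OF i] .
qed

text \<open>A + B r^\<theta> is increasing, so freezing it at r2 bounds z from below on [r, r2];
  small r2 recovers the factor A^(-\<kappa>) of the upper bound.\<close>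

lemma w_ge_mu:
  assumes "0 < A" "0 < r" "r \<le> r2" "r2 \<le> R"
  shows "(A + B * r2 powr \<theta>) powr (- \<kappa>) * (\<mu> r - \<mu> r2) \<le> w A r"
proof -
  let ?C = "(A + B * r2 powr \<theta>) powr (- \<kappa>)"
  have i: "((\<lambda>\<rho>. ?C * \<rho> powr (- \<alpha>)) has_integral ?C * (\<mu> r - \<mu> r2)) {r..r2}"
    by (rule has_integral_mult_right [OF mu_has_integral [OF assms(2,3)]])
  have "integral {r..r2} (\<lambda>\<rho>. ?C * \<rho> powr (- \<alpha>)) \<le> integral {r..r2} (z A)"
  proof (rule Henstock_Kurzweil_Integration.integral_le)
    show "z A integrable_on {r..r2}" using assms by (intro z_integrable pos_nonneg) auto
    show "(\<lambda>\<rho>. ?C * \<rho> powr (- \<alpha>)) integrable_on {r..r2}" using i by blast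
    fix x assume x: "x \<in> {r..r2}"
    have "?C \<le> (A + B * x powr \<theta>) powr (- \<kappa>)"
    proof (rule powr_mono2')
      show "0 < A + B * x powr \<theta>" using pos_nonneg [of A x] assms x by auto
      have "x powr \<theta> \<le> r2 powr \<theta>" using x assms \<theta> by (intro powr_mono2) auto
      then show "A + B * x powr \<theta> \<le> A + B * r2 powr \<theta>" using B(1) by simp
    qed (use \<kappa>(1) in simp)
    then show "?C * x powr (- \<alpha>) \<le> z A x"
      unfolding z_def by (subst (2) mult.commute) (intro mult_right_mono, auto)
  qed
  also have "\<dots> \<le> integral {r..R} (z A)"
  proof (rule integral_subset_le)
    show "z A integrable_on {r..r2}" "z A integrable_on {r..R}" using assms by (auto intro!: z_integrable pos_nonneg)
    show "\<forall>x\<in>{r..R}. 0 \<le> z A x"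
    proof
      fix x assume "x \<in> {r..R}"
      then show "0 \<le> z A x" using z_pos [of x A] pos_nonneg [of A x] assms by auto
    qed
  qed (use assms in auto)
  finally show ?thesis unfolding integral_unique [OF i] w_def .
qed

text \<open>The ratio of the profiles for A and for 0 is monotone in r, so on [r, R] it can be
  frozen at the left end: from below for A > 0, from above for A < 0. At fixed r it tends to 1 as A
  -> 0, which is how the strong singularity is reached from both sides.\<close>

lemma z_ratio:
  assumes "0 < r" "0 < A + B * r powr \<theta>"
  shows "z A r = (1 + A / (B * r powr \<theta>)) powr (- \<kappa>) * z 0 r"
proof -
  have b: "0 < B * r powr \<theta>" using B(1) assms(1) by simp
  have "A + B * r powr \<theta> = (1 + A / (B * r powr \<theta>)) * (B * r powr \<theta>)"
  proof -
    have "A + y = (1 + A / y) * y" if "0 < y" for y using that by (simp add: distrib_right)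
    then show ?thesis using b by blast
  qed
  moreover have "0 < 1 + A / (B * r powr \<theta>)"
  proof -
    have "1 + A / (B * r powr \<theta>) = (A + B * r powr \<theta>) / (B * r powr \<theta>)" by (rule one_plus_divide [OF b])
    then show ?thesis using assms(2) b by simp
  qed
  ultimately have "(A + B * r powr \<theta>) powr (- \<kappa>) = (1 + A / (B * r powr \<theta>)) powr (- \<kappa>) * (B * r powr \<theta>) powr (- \<kappa>)"
    using b by (simp add: powr_mult)
  then show ?thesis by (simp add: z_def)
qed

lemma w_ge_w0:
  assumes "0 < A" "0 < r"
  shows "(1 + A / (B * r powr \<theta>)) powr (- \<kappa>) * w 0 r \<le> w A r"
proof -
  let ?C = "(1 + A / (B * r powr \<theta>)) powr (- \<kappa>)"
  have "integral {r..R} (\<lambda>x. ?C * z 0 x) \<le> integral {r..R} (z A)"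
  proof (rule Henstock_Kurzweil_Integration.integral_le)
    show "z A integrable_on {r..R}" using assms by (intro z_integrable pos_nonneg) auto
    show "(\<lambda>x. ?C * z 0 x) integrable_on {r..R}"
      using assms by (intro integrable_on_mult_right z_integrable pos_nonneg) auto
    fix x assume x: "x \<in> {r..R}"
    have x0: "0 < x" using x assms by simp
    have "?C \<le> (1 + A / (B * x powr \<theta>)) powr (- \<kappa>)"
    proof (rule powr_mono2')
      show "0 < 1 + A / (B * x powr \<theta>)" using assms x0 B(1) by (simp add: add_pos_pos)
      have "r powr \<theta> \<le> x powr \<theta>" using x assms \<theta> by (intro powr_mono2) auto
      then show "1 + A / (B * x powr \<theta>) \<le> 1 + A / (B * r powr \<theta>)"
        using assms B(1) x0 by (simp add: divide_left_mono)
    qed (use \<kappa>(1) in simp)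
    then show "?C * z 0 x \<le> z A x"
      unfolding z_ratio [OF x0 pos_nonneg [OF less_imp_le [OF assms(1)] x0]]
      using z_pos [OF x0 pos_nonneg [OF order_refl x0]] by (intro mult_right_mono) auto
  qed
  then show ?thesis by (simp add: w_def)
qed

lemma w_le_w0:
  assumes "A < 0" "0 < r" "0 < A + B * r powr \<theta>"
  shows "w A r \<le> (1 + A / (B * r powr \<theta>)) powr (- \<kappa>) * w 0 r"
proof -
  let ?C = "(1 + A / (B * r powr \<theta>)) powr (- \<kappa>)"
  have "integral {r..R} (z A) \<le> integral {r..R} (\<lambda>x. ?C * z 0 x)"
  proof (rule Henstock_Kurzweil_Integration.integral_le)
    show "z A integrable_on {r..R}" using assms by (intro z_integrable) auto
    show "(\<lambda>x. ?C * z 0 x) integrable_on {r..R}"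
      using assms by (intro integrable_on_mult_right z_integrable pos_nonneg) auto
    fix x assume x: "x \<in> {r..R}"
    have x0: "0 < x" using x assms by simp
    have ax: "0 < A + B * x powr \<theta>" using pos_mono [OF assms(3), of x] x assms by auto
    have br: "0 < B * r powr \<theta>" using B(1) assms by simp
    have "(1 + A / (B * x powr \<theta>)) powr (- \<kappa>) \<le> ?C"
    proof (rule powr_mono2')
      have "1 + A / (B * r powr \<theta>) = (A + B * r powr \<theta>) / (B * r powr \<theta>)" by (rule one_plus_divide [OF br])
      then show "0 < 1 + A / (B * r powr \<theta>)" using assms(3) br by simp
      have "r powr \<theta> \<le> x powr \<theta>" using x assms \<theta> by (intro powr_mono2) auto
      then have "B * r powr \<theta> \<le> B * x powr \<theta>" using B(1) by simp
      then have "- A / (B * x powr \<theta>) \<le> - A / (B * r powr \<theta>)"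
        using assms(1) br by (intro divide_left_mono) auto
      then show "1 + A / (B * r powr \<theta>) \<le> 1 + A / (B * x powr \<theta>)" by simp
    qed (use \<kappa>(1) in simp)
    then show "z A x \<le> ?C * z 0 x"
      unfolding z_ratio [OF x0 ax]
      using z_pos [OF x0 pos_nonneg [OF order_refl x0]] by (intro mult_right_mono) auto
  qed
  then show ?thesis by (simp add: w_def)
qed

text \<open>r^\<theta> is concave, so A + B r^\<theta> <= L (r - r0) and z >= C (r -
  r0)^(-\<kappa>). As \<kappa> > 1, which is q < p, this is not integrable at r0.\<close>

lemma w_blowup:
  assumes r0: "0 < r0" "A + B * r0 powr \<theta> = 0" and s: "r0 < s" "s \<le> R"
  shows "\<exists>r. r0 < r \<and> r < s \<and> M \<le> w A r"
proof -
  have pos: "0 < A + B * x powr \<theta>" if "r0 < x" for x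
  proof -
    have "B * r0 powr \<theta> < B * x powr \<theta>" using B(1) \<theta> r0 that by (simp add: powr_less_mono2)
    then show ?thesis using r0(2) by linarith
  qed
  define L where "L = B * (\<theta> * r0 powr (\<theta> - 1))"
  have L: "0 < L" using B(1) \<theta> r0 by (simp add: L_def)
  have \<theta>1: "\<theta> < 1" using \<alpha>(1) q by (simp add: \<theta>_def)
  have up: "A + B * x powr \<theta> \<le> L * (x - r0)" if x: "r0 < x" for x
  proof -
    obtain y where y: "r0 < y" "y < x" "x powr \<theta> - r0 powr \<theta> = (x - r0) * (\<theta> * y powr (\<theta> - 1))"
      using MVT2 [OF x, of "\<lambda>x. x powr \<theta>" "\<lambda>x. \<theta> * x powr (\<theta> - 1)"] r0 has_real_derivative_powr by force
    have "y powr (\<theta> - 1) \<le> r0 powr (\<theta> - 1)" using y r0 \<theta>1 by (intro powr_mono2') auto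
    then have "B * ((x - r0) * (\<theta> * y powr (\<theta> - 1))) \<le> B * ((x - r0) * (\<theta> * r0 powr (\<theta> - 1)))"
      using B(1) \<theta> x by (intro mult_left_mono) auto
    then have "B * (x powr \<theta> - r0 powr \<theta>) \<le> L * (x - r0)" unfolding y(3) L_def by (simp add: mult_ac)
    then show ?thesis using r0(2) by (simp add: algebra_simps)
  qed
  define C where "C = R powr (- \<alpha>) * L powr (- \<kappa>)"
  have C: "0 < C" using L R by (simp add: C_def)
  have zge: "C * (x - r0) powr (- \<kappa>) \<le> z A x" if x: "r0 < x" "x \<le> R" for x
  proof -
    have "R powr (- \<alpha>) \<le> x powr (- \<alpha>)" using x r0 \<alpha> by (intro powr_mono2') auto
    moreover have "(L * (x - r0)) powr (- \<kappa>) \<le> (A + B * x powr \<theta>) powr (- \<kappa>)"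
      using up pos x \<kappa>(1) by (intro powr_mono2') auto
    ultimately have "R powr (- \<alpha>) * (L * (x - r0)) powr (- \<kappa>) \<le> z A x"
      unfolding z_def by (intro mult_mono) auto
    then show ?thesis using L x by (simp add: C_def powr_mult mult.assoc)
  qed
  define G where "G = (\<lambda>r. C / (\<kappa> - 1) * (r - r0) powr (1 - \<kappa>))"
  have wG: "G r - G R \<le> w A r" if r: "r0 < r" "r \<le> R" for r
  proof -
    have i: "((\<lambda>x. C * (x - r0) powr (- \<kappa>)) has_integral (- G R - - G r)) {r..R}"
    proof (rule fundamental_theorem_of_calculus [OF r(2)])
      fix x assume x: "x \<in> {r..R}"
      have "((\<lambda>x. (x - r0) powr (1 - \<kappa>)) has_real_derivative (1 - \<kappa>) * (x - r0) powr (1 - \<kappa> - 1) * (1 - 0)) (at x)"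
        by (rule DERIV_chain2 [OF has_real_derivative_powr]) (use x r in \<open>auto intro!: derivative_eq_intros\<close>)
      then have "((\<lambda>x. (x - r0) powr (1 - \<kappa>)) has_real_derivative (1 - \<kappa>) * (x - r0) powr (- \<kappa>)) (at x)" by simp
      then have "((\<lambda>x. - G x) has_real_derivative - (C / (\<kappa> - 1) * ((1 - \<kappa>) * (x - r0) powr (- \<kappa>)))) (at x)"
        unfolding G_def by (intro DERIV_minus DERIV_cmult)
      moreover have "- (C / (\<kappa> - 1) * ((1 - \<kappa>) * (x - r0) powr (- \<kappa>))) = C * (x - r0) powr (- \<kappa>)"
      proof -
        have "- (k * ((1 - \<kappa>) * y)) = k * (\<kappa> - 1) * y" for k y by (simp add: algebra_simps)
        moreover have "C / (\<kappa> - 1) * (\<kappa> - 1) = C" using \<kappa>(2) by simp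
        ultimately show ?thesis by (simp only:)
      qed
      ultimately show "((\<lambda>x. - G x) has_vector_derivative C * (x - r0) powr (- \<kappa>)) (at x within {r..R})"
        by (simp add: has_real_derivative_iff_has_vector_derivative has_vector_derivative_at_within)
    qed
    have "integral {r..R} (\<lambda>x. C * (x - r0) powr (- \<kappa>)) \<le> w A r"
      unfolding w_def
    proof (rule Henstock_Kurzweil_Integration.integral_le)
      show "(\<lambda>x. C * (x - r0) powr (- \<kappa>)) integrable_on {r..R}" using i by blast
      show "z A integrable_on {r..R}" using r r0 pos by (intro z_integrable) auto
    qed (use zge r in auto)
    then show ?thesis unfolding integral_unique [OF i] by simp
  qed
  have "filterlim (\<lambda>x. x powr (1 - \<kappa>)) at_top (at_right (0::real))"
  proof -
    have "filterlim (\<lambda>x::real. - ln x) at_top (at_right 0)"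
      by (rule filterlim_uminus_at_bot [THEN iffD1, OF ln_at_0])
    then have "filterlim (\<lambda>x::real. (\<kappa> - 1) * - ln x) at_top (at_right 0)"
      by (rule filterlim_tendsto_pos_mult_at_top [OF tendsto_const, rotated]) (use \<kappa>(2) in simp)
    then have "filterlim (\<lambda>x::real. exp ((\<kappa> - 1) * - ln x)) at_top (at_right 0)"
      by (rule filterlim_compose [OF exp_at_top])
    moreover have "\<forall>\<^sub>F x::real in at_right 0. exp ((\<kappa> - 1) * - ln x) = x powr (1 - \<kappa>)"
      using eventually_at_right_less [of 0] by eventually_elim (simp add: powr_def algebra_simps)
    ultimately show ?thesis by (rule filterlim_cong [OF refl refl, THEN iffD1, rotated])
  qed
  then have "\<forall>\<^sub>F x in at_right (0::real). (M + G R) * ((\<kappa> - 1) / C) \<le> x powr (1 - \<kappa>)"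
    by (simp add: filterlim_at_top)
  moreover have "\<forall>\<^sub>F x in at_right (0::real). x \<in> {0<..<s - r0}" by (rule eventually_at_right_real) (use s in simp)
  ultimately have "\<forall>\<^sub>F x in at_right (0::real). (M + G R) * ((\<kappa> - 1) / C) \<le> x powr (1 - \<kappa>) \<and> x \<in> {0<..<s - r0}"
    by eventually_elim simp
  then obtain x where x: "(M + G R) * ((\<kappa> - 1) / C) \<le> x powr (1 - \<kappa>)" "0 < x" "x < s - r0"
    using eventually_happens' [OF trivial_limit_at_right_real] by fastforce
  have "C / (\<kappa> - 1) * ((M + G R) * ((\<kappa> - 1) / C)) \<le> C / (\<kappa> - 1) * x powr (1 - \<kappa>)"
    using x(1) C \<kappa>(2) by (intro mult_left_mono) auto
  moreover have "C / (\<kappa> - 1) * ((M + G R) * ((\<kappa> - 1) / C)) = M + G R" using C \<kappa>(2) by simp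
  ultimately have "M + G R \<le> G (r0 + x)" by (simp add: G_def)
  then have "M \<le> w A (r0 + x)" using wG [of "r0 + x"] x s by simp
  then show ?thesis using x s by (intro exI [of _ "r0 + x"]) auto
qed

end

text \<open>Stated outside the locale, which knows only a number N, because here N must be the
  dimension of a type. In the divergence the two terms with factor N cancel, and the rest is z^q by
  the choice of B and \<kappa>.\<close>

lemma radial_HJ_sol:
  fixes W :: "real \<Rightarrow> real"
  assumes rad: "radial DIM('a::euclidean_space) p q R"
    and I: "open I" "I \<subseteq> {0<..}" "\<And>r. r \<in> I \<Longrightarrow> 0 < A + radial.B DIM('a) p q * r powr radial.\<theta> DIM('a) p q"
    and W: "\<And>r. r \<in> I \<Longrightarrow> (W has_real_derivative - radial.z DIM('a) p q A r) (at r)"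
  shows "HJ_sol p q {x :: 'a. norm x \<in> I} (\<lambda>x. W (norm x)) (\<lambda>x. - radial.z DIM('a) p q A (norm x) *\<^sub>R sgn x)"
proof -
  interpret radial "DIM('a)" p q R by (rule rad)
  let ?N = "real DIM('a)"
  let ?G = "\<lambda>r. A + B * r powr \<theta>"
  have rp: "0 < r" "0 < ?G r" if "r \<in> I" for r using I that by auto
  have zp: "0 < z A r" if "r \<in> I" for r using z_pos rp [OF that] by blast
  have cz: "continuous_on I (z A)" by (rule continuous_on_z) (use rp in auto)
  have C: "C1_on {x. norm x \<in> I} (\<lambda>x::'a. W (norm x)) (\<lambda>x. - z A (norm x) *\<^sub>R sgn x)"
    using C1_on_radial [OF W _ I(2), of 0] continuous_on_minus [OF cz] by simp
  let ?w = "\<lambda>r. - (r powr (- ?N) * ?G r powr (- (\<kappa> * (p - 1))))"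
  let ?w' = "\<lambda>r. - (r powr (- ?N) * ((- (\<kappa> * (p - 1))) * ?G r powr (- (\<kappa> * (p - 1)) - 1) * (0 + B * (\<theta> * r powr (\<theta> - 1))))
      + (- ?N) * r powr (- ?N - 1) * ?G r powr (- (\<kappa> * (p - 1))))"
  have d: "(?w has_real_derivative ?w' r) (at r)" if r: "r \<in> I" for r
  proof -
    have "(?G has_real_derivative (0 + B * (\<theta> * r powr (\<theta> - 1)))) (at r)"
      using rp [OF r] by (intro DERIV_add DERIV_const DERIV_cmult has_real_derivative_powr)
    then have "((\<lambda>r. ?G r powr (- (\<kappa> * (p - 1)))) has_real_derivative
       (- (\<kappa> * (p - 1))) * ?G r powr (- (\<kappa> * (p - 1)) - 1) * (0 + B * (\<theta> * r powr (\<theta> - 1)))) (at r)"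
      by (rule DERIV_chain2 [where f = "\<lambda>y. y powr (- (\<kappa> * (p - 1)))" and g = ?G, OF has_real_derivative_powr [OF rp(2) [OF r]]])
    from DERIV_minus [OF DERIV_mult [OF has_real_derivative_powr [OF rp(1) [OF r]] this, of "- ?N"]]
    show ?thesis by (simp add: algebra_simps)
  qed
  have cw: "continuous_on I ?w'"
  proof -
    have "r \<noteq> 0" "?G r \<noteq> 0" if "r \<in> I" for r using rp [OF that] by auto
    then show ?thesis by (intro continuous_intros) auto
  qed
  have weak: "weak_eq {x::'a. norm (x - 0) \<in> I} (\<lambda>x. ?w (norm (x - 0)) *\<^sub>R (x - 0))
      (\<lambda>x. norm (x - 0) * ?w' (norm (x - 0)) + ?N * ?w (norm (x - 0))) 0"
    by (rule weak_eq_radial [OF d cw I(2,1)])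
  have wk: "weak_eq {x::'a. norm (x - 0) \<in> I} (\<lambda>x. flux p (- z A (norm x) *\<^sub>R sgn x)) (\<lambda>x. norm (- z A (norm x) *\<^sub>R sgn x) powr q) 0"
  proof (rule weak_eq_cong [OF weak])
    fix x :: 'a assume "x \<in> {x. norm (x - 0) \<in> I}"
    then have r: "norm x \<in> I" by simp
    let ?r = "norm x"
    have x0: "x \<noteq> 0" using rp [OF r] by auto
    have e1: "z A ?r powr (p - 1) = ?r powr (1 - ?N) * ?G ?r powr (- (\<kappa> * (p - 1)))"
    proof -
      have "- \<alpha> * (p - 1) = 1 - ?N" using \<alpha>(2) by simp
      then show ?thesis unfolding z_def by (simp add: powr_mult powr_powr)
    qed
    have "flux p (- z A ?r *\<^sub>R sgn x) = - ((z A ?r powr (p - 1) / ?r) *\<^sub>R x)"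
      using flux_radial [OF zp [OF r] x0, of p] by simp
    also have "z A ?r powr (p - 1) / ?r = ?r powr (- ?N) * ?G ?r powr (- (\<kappa> * (p - 1)))"
      unfolding e1 using powr_diff [of ?r "1 - ?N" 1] x0 by simp
    finally show "?w (norm (x - 0)) *\<^sub>R (x - 0) = flux p (- z A (norm x) *\<^sub>R sgn x)" by simp
    have nz: "norm (- z A ?r *\<^sub>R sgn x) = z A ?r" using zp [OF r] x0 by (simp add: norm_sgn)
    have a: "?r * (?r powr (- ?N) * r' * ?r powr (\<theta> - 1)) = ?r powr (- (\<alpha> * q)) * r'" for r'
    proof -
      have "- (\<alpha> * q) = 1 + - ?N + (\<theta> - 1)" using \<alpha>(2) by (simp add: \<theta>_def algebra_simps)
      then have "?r powr (- (\<alpha> * q)) = ?r powr 1 * ?r powr (- ?N) * ?r powr (\<theta> - 1)" by (simp only: powr_add)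
      then show ?thesis by simp
    qed
    have b: "?r * ?r powr (- ?N - 1) = ?r powr (- ?N)"
      using powr_add [of ?r 1 "- ?N - 1"] x0 by simp
    have "?r * ?w' ?r + ?N * ?w ?r = (\<kappa> * (p - 1) * (B * \<theta>)) * (?r * (?r powr (- ?N) * ?G ?r powr (- (\<kappa> * (p - 1)) - 1) * ?r powr (\<theta> - 1)))
        + ?N * (?r * ?r powr (- ?N - 1)) * ?G ?r powr (- (\<kappa> * (p - 1))) - ?N * ?r powr (- ?N) * ?G ?r powr (- (\<kappa> * (p - 1)))"
      by (simp add: algebra_simps)
    also have "\<dots> = ?r powr (- (\<alpha> * q)) * ?G ?r powr (- (\<kappa> * (p - 1)) - 1)"
      unfolding B(2) a b by simp
    also have "\<dots> = z A ?r powr q"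
    proof -
      have "- (\<kappa> * (p - 1)) - 1 = - (\<kappa> * q)" using \<kappa>(3) by (simp add: algebra_simps)
      then show ?thesis unfolding z_def by (simp add: powr_mult powr_powr)
    qed
    finally show "norm (x - 0) * ?w' (norm (x - 0)) + ?N * ?w (norm (x - 0)) = norm (- z A (norm x) *\<^sub>R sgn x) powr q"
      unfolding nz by simp
  qed
  show ?thesis using C wk by (simp add: HJ_sol_def)
qed

lemma (in radial) extend_left:
  assumes "0 < r1" "0 < A + B * r1 powr \<theta>"
  obtains c where "0 < c" "c < r1" "0 < A + B * c powr \<theta>"
proof -
  have "isCont (\<lambda>r. A + B * r powr \<theta>) r1" using assms(1) by (intro continuous_intros) auto
  then have "((\<lambda>r. A + B * r powr \<theta>) \<longlongrightarrow> A + B * r1 powr \<theta>) (at_left r1)"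
    by (simp add: isCont_def filterlim_at_split)
  then have "\<forall>\<^sub>F r in at_left r1. 0 < A + B * r powr \<theta>" using assms(2) by (rule order_tendstoD)
  moreover have "\<forall>\<^sub>F r in at_left r1. r \<in> {0<..<r1}" by (rule eventually_at_left_real [OF assms(1)])
  ultimately have "\<forall>\<^sub>F r in at_left r1. 0 < A + B * r powr \<theta> \<and> r \<in> {0<..<r1}" by eventually_elim simp
  then obtain r where "0 < A + B * r powr \<theta>" "0 < r" "r < r1"
    using eventually_happens' [OF trivial_limit_at_left_real] by fastforce
  then show thesis by (intro that)
qed

section \<open>A given solution against the radial family\<close>

context
  fixes p q R K :: real and \<Omega> :: "'a::euclidean_space set" and u D
  assumes rad: "radial DIM('a) p q R"
    and \<Omega>: "open \<Omega>" "cball 0 R \<subseteq> \<Omega>" and u: "HJ_sol p q (\<Omega> - {0}) u D"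
    and nn: "\<And>x. x \<in> \<Omega> - {0} \<Longrightarrow> 0 \<le> u x" and K: "\<And>x. norm x = R \<Longrightarrow> u x \<le> K"
begin

interpretation radial "DIM('a)" p q R by (rule rad)

lemma annulus_setup:
  assumes r1: "0 < r1" "r1 < R" "0 < A + B * r1 powr \<theta>"
  obtains S W E where "open S" "cball 0 R - ball 0 r1 \<subseteq> S" "HJ_sol p q S u D"
    "HJ_sol p q S W E" "\<And>x. r1 \<le> norm x \<Longrightarrow> norm x \<le> R \<Longrightarrow> W x = w A (norm x)"
proof -
  obtain c where c: "0 < c" "c < r1" "0 < A + B * c powr \<theta>" by (rule extend_left [OF r1(1,3)])
  obtain W where W: "\<And>r. r \<in> {c<..<R + 1} \<Longrightarrow> (W has_real_derivative - z A r) (at r)"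
    "\<And>r. r \<in> {c..R} \<Longrightarrow> W r = w A r"
    by (rule z_antiderivative [OF c(1,3)]) (use c r1 in auto)
  have pos: "0 < A + B * r powr \<theta>" if "r \<in> {c<..<R + 1}" for r
    using pos_mono [OF c(3), of r] c that by auto
  have sol: "HJ_sol p q {x :: 'a. norm x \<in> {c<..<R + 1}} (\<lambda>x. W (norm x)) (\<lambda>x. - z A (norm x) *\<^sub>R sgn x)"
    by (rule radial_HJ_sol [OF rad _ _ pos W(1)]) (use c in auto)
  let ?S = "{x :: 'a. norm x \<in> {c<..<R + 1}} \<inter> (\<Omega> - {0})"
  show thesis
  proof (rule that [of ?S "\<lambda>x. W (norm x)" "\<lambda>x. - z A (norm x) *\<^sub>R sgn x"])
    have "open {x :: 'a. norm (x - 0) \<in> {c<..<R + 1}}" by (rule open_radial) simp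
    moreover have "open (\<Omega> - {0})" using \<Omega>(1) by auto
    ultimately show "open ?S" by (simp add: open_Int)
    show "cball 0 R - ball 0 r1 \<subseteq> ?S" using \<Omega>(2) c r1 by auto
    show "HJ_sol p q ?S u D" by (rule HJ_sol_subset [OF u]) auto
    show "HJ_sol p q ?S (\<lambda>x. W (norm x)) (\<lambda>x. - z A (norm x) *\<^sub>R sgn x)" by (rule HJ_sol_subset [OF sol]) auto
    show "W (norm x) = w A (norm x)" if "r1 \<le> norm x" "norm x \<le> R" for x :: 'a
      using W(2) that c by simp
  qed
qed

lemma w_R [simp]: "w A R = 0" by (simp add: w_def)

lemma annulus_sets:
  fixes r1 :: real
  shows "compact (cball (0::'a) R - ball 0 r1)" "open (ball (0::'a) R - cball 0 r1)"
    "ball (0::'a) R - cball 0 r1 \<subseteq> cball 0 R - ball 0 r1"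
    "x \<in> (cball (0::'a) R - ball 0 r1) - (ball 0 R - cball 0 r1) \<Longrightarrow> norm x = r1 \<or> norm x = R"
    "x \<in> (cball (0::'a) R - ball 0 r1) \<longleftrightarrow> r1 \<le> norm x \<and> norm x \<le> R"
  by (auto simp: compact_diff)

lemma upper_barrier:
  assumes r1: "0 < r1" "r1 < R" "0 < A + B * r1 powr \<theta>"
    and le: "\<And>x. norm x = r1 \<Longrightarrow> u x \<le> w A r1 + K" and x: "r1 \<le> norm x" "norm x \<le> R"
  shows "u x \<le> w A (norm x) + K"
proof -
  obtain S W E where S: "open S" "cball 0 R - ball 0 r1 \<subseteq> S" "HJ_sol p q S u D"
    "HJ_sol p q S W E" "\<And>x. r1 \<le> norm x \<Longrightarrow> norm x \<le> R \<Longrightarrow> W x = w A (norm x)"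
    by (rule annulus_setup [OF r1]) blast
  have "u x \<le> W x + K"
  proof (rule comparison_solutions [OF p q(1) q_less annulus_sets(1-3) [where ?r1.0 = r1] S(2,3) HJ_sol_add_const [OF S(4)]])
    fix y :: 'a assume y: "y \<in> cball 0 R - ball 0 r1 - (ball 0 R - cball 0 r1)"
    then have n: "norm y = r1 \<or> norm y = R" by (rule annulus_sets(4))
    have "y \<in> \<Omega> - {0}" using y \<Omega>(2) r1 by auto
    then show "0 \<le> u y" by (rule nn)
    have Wy: "W y = w A (norm y)" using S(5) n r1 by auto
    from n show "u y \<le> W y + K"
    proof
      assume y: "norm y = r1"
      from le [OF this] show ?thesis by (simp only: Wy y)
    next
      assume y: "norm y = R"
      from K [OF this] show ?thesis by (simp only: Wy y w_R)
    qed
  qed (use x annulus_sets(5) in blast)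
  then show ?thesis using S(5) x by simp
qed

lemma lower_barrier:
  assumes r1: "0 < r1" "r1 < R" "0 < A + B * r1 powr \<theta>"
    and le: "\<And>x. norm x = r1 \<Longrightarrow> w A r1 \<le> u x" and x: "r1 \<le> norm x" "norm x \<le> R"
  shows "w A (norm x) \<le> u x"
proof -
  obtain S W E where S: "open S" "cball 0 R - ball 0 r1 \<subseteq> S" "HJ_sol p q S u D"
    "HJ_sol p q S W E" "\<And>x. r1 \<le> norm x \<Longrightarrow> norm x \<le> R \<Longrightarrow> W x = w A (norm x)"
    by (rule annulus_setup [OF r1]) blast
  have "W x \<le> u x"
  proof (rule comparison_solutions [OF p q(1) q_less annulus_sets(1-3) [where ?r1.0 = r1] S(2,4,3)])
    fix y :: 'a assume y: "y \<in> cball 0 R - ball 0 r1 - (ball 0 R - cball 0 r1)"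
    then have n: "norm y = r1 \<or> norm y = R" by (rule annulus_sets(4))
    have y\<Omega>: "y \<in> \<Omega> - {0}" using y \<Omega>(2) r1 by auto
    have Wy: "W y = w A (norm y)" using S(5) n r1 by auto
    have "0 \<le> W y \<and> W y \<le> u y"
      using n
    proof
      assume y: "norm y = r1"
      with le [OF this] w_nonneg [OF r1(1,3)] show ?thesis by (simp only: Wy y simp_thms)
    next
      assume y: "norm y = R"
      with nn [OF y\<Omega>] show ?thesis by (simp only: Wy y w_R simp_thms order_refl)
    qed
    then show "0 \<le> W y" "W y \<le> u y" by simp_all
  qed (use x annulus_sets(5) in blast)
  then show ?thesis using S(5) x by simp
qed

text \<open>If w_A <= u fails at y, it fails somewhere on every smaller sphere, as otherwise
  \<open>lower_barrier\<close> would carry it out to y. \<open>oscillation\<close> turns this single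
  point into u <= w_A + K on the whole sphere, and \<open>upper_barrier\<close> carries that
  outwards.\<close>

lemma dichotomy:
  assumes A: "0 < A"
  shows "(\<forall>x. 0 < norm x \<and> norm x \<le> R \<longrightarrow> w A (norm x) \<le> u x) \<or>
    (\<forall>x. 0 < norm x \<and> norm x \<le> R \<longrightarrow> u x \<le> w A (norm x) + K)"
proof (rule disjCI, intro allI impI)
  fix y :: 'a assume no: "\<not> (\<forall>x. 0 < norm x \<and> norm x \<le> R \<longrightarrow> u x \<le> w A (norm x) + K)" and y: "0 < norm y \<and> norm y \<le> R"
  show "w A (norm y) \<le> u y"
  proof (rule ccontr)
    assume bad: "\<not> w A (norm y) \<le> u y"
    have "u x \<le> w A (norm x) + K" if x: "0 < norm x" "norm x \<le> R" for x
    proof -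
      \<comment> \<open>Below both norms, so that one sphere serves for the barrier reaching x and
        for the one reaching y.\<close>
      define r1 where "r1 = min (norm x) (norm y) / 2"
      have r1: "0 < r1" "r1 < R" "r1 \<le> norm x" "r1 \<le> norm y" 
      proof -
        have "0 < min (norm x) (norm y)" "min (norm x) (norm y) \<le> norm x" "min (norm x) (norm y) \<le> norm y"
          using x y by auto
        with x y show "0 < r1" "r1 < R" "r1 \<le> norm x" "r1 \<le> norm y" unfolding r1_def by linarith+
      qed
      have pos: "0 < A + B * r1 powr \<theta>" using A r1 by (intro pos_nonneg) auto
      have "\<exists>x1. norm x1 = r1 \<and> u x1 < w A r1"
      proof (rule ccontr)
        assume no1: "\<not> ?thesis"
        have "w A r1 \<le> u v" if "norm v = r1" for v
          using no1 that by (auto simp: not_less)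
        from lower_barrier [OF r1(1,2) pos this, of y] r1 y have "w A (norm y) \<le> u y" by simp
        with bad show False ..
      qed
      then obtain x1 where x1: "norm x1 = r1" "u x1 < w A r1" by blast
      have "u v \<le> w A r1 + K" if v: "norm v = r1" for v
        using oscillation [OF p q(1) q_less \<Omega> u nn K, of v x1] v x1 r1 by simp
      from upper_barrier [OF r1(1,2) pos this] r1 x show ?thesis by simp
    qed
    with no show False by blast
  qed
qed

text \<open>A Keller-Osserman argument: for A < 0 the radial solution is infinite on the sphere of
  radius \<open>r0\<close>, so close to that sphere it lies above u whatever u does, and then up to
  R. Letting A -> 0 from below shrinks the blow-up sphere to the origin.\<close>

lemma strong_upper:
  assumes x: "0 < norm x" "norm x \<le> R"
  shows "u x \<le> w 0 (norm x) + K"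
proof -
  define b where "b = B * norm x powr \<theta>"
  have b: "0 < b" using B(1) x by (simp add: b_def)
  have bd: "u x \<le> (1 + A / b) powr (- \<kappa>) * w 0 (norm x) + K" if A: "- b < A" "A < 0" for A
  proof -
    \<comment> \<open>The zero of A + B r^\<theta>; the condition - b < A places it below
      |x|.\<close>
    define r0 where "r0 = (- A / B) powr (1 / \<theta>)"
    have r0: "0 < r0" using A B(1) by (simp add: r0_def)
    have "r0 powr \<theta> = - A / B" using A B(1) \<theta> by (simp add: r0_def powr_powr)
    then have Ar0: "A + B * r0 powr \<theta> = 0" using B(1) by simp
    have r0x: "r0 < norm x"
    proof (rule ccontr)
      assume "\<not> r0 < norm x"
      then have "B * norm x powr \<theta> \<le> B * r0 powr \<theta>" using B(1) \<theta> x by (intro mult_left_mono powr_mono2) auto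
      then show False using Ar0 A by (simp add: b_def)
    qed
    have cu: "continuous_on (cball 0 R - ball 0 r0) u"
    proof (rule C1_on_continuous [OF C1_on_subset])
      show "C1_on (\<Omega> - {0}) u D" using u by (simp add: HJ_sol_def)
      show "cball 0 R - ball 0 r0 \<subseteq> \<Omega> - {0}" using \<Omega>(2) r0 by auto
    qed
    obtain M where M: "\<And>v. r0 \<le> norm v \<Longrightarrow> norm v \<le> R \<Longrightarrow> u v \<le> M"
      by (rule C1_on_bounded_shell [OF cu]) blast
    obtain r1 where r1: "r0 < r1" "r1 < norm x" "M - K \<le> w A r1"
      using w_blowup [OF r0 Ar0 r0x x(2), of "M - K"] by blast
    have pos: "0 < A + B * r1 powr \<theta>"
    proof -
      have "B * r0 powr \<theta> < B * r1 powr \<theta>" using B(1) \<theta> r0 r1 by (simp add: powr_less_mono2)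
      then show ?thesis using Ar0 by linarith
    qed
    have "u x \<le> w A (norm x) + K"
    proof (rule upper_barrier [OF _ _ pos])
      show "u v \<le> w A r1 + K" if "norm v = r1" for v using M [of v] r1 that x by simp
    qed (use r0 r1 x in auto)
    also have "w A (norm x) \<le> (1 + A / b) powr (- \<kappa>) * w 0 (norm x)"
      using w_le_w0 [OF A(2) x(1)] A by (simp add: b_def)
    finally show ?thesis by simp
  qed
  have "((\<lambda>A. (1 + A / b) powr (- \<kappa>) * w 0 (norm x) + K) \<longlongrightarrow> (1 + 0 / b) powr (- \<kappa>) * w 0 (norm x) + K) (at_left 0)"
    using b by (intro tendsto_intros) auto
  moreover have "\<forall>\<^sub>F A in at_left 0. A \<in> {- b<..<0}" by (rule eventually_at_left_real) (use b in simp)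
  then have "\<forall>\<^sub>F A in at_left 0. u x \<le> (1 + A / b) powr (- \<kappa>) * w 0 (norm x) + K"
    by eventually_elim (use bd in auto)
  ultimately have "u x \<le> (1 + 0 / b) powr (- \<kappa>) * w 0 (norm x) + K"
    by (intro tendsto_lowerbound) auto
  then show ?thesis by simp
qed

lemma near0: "\<forall>\<^sub>F x in at (0::'a). 0 < norm x \<and> norm x < r" if "0 < r"
  unfolding eventually_at using that by (intro exI [of _ r]) auto

lemma mu_large: "\<forall>\<^sub>F x in at (0::'a). M < mu p x"
  using mu_at_0 [OF p] by (simp add: filterlim_at_top_dense)

text \<open>\<open>P\<close> is upward closed in A, and its failure gives the reverse bound up to K.
  If the infimum a of the admissible A is positive, both bounds hold with A arbitrarily close to a,
  so the limit is a^(-\<kappa>): additive constants disappear after division by mu_p. Without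
  admissible A, letting A tend to infinity leaves only K.\<close>

lemma trichotomy:
  obtains (bounded) "\<And>x. 0 < norm x \<Longrightarrow> norm x \<le> R \<Longrightarrow> u x \<le> K"
  | (weak) c where "0 < c" "((\<lambda>x. u x / mu p x) \<longlongrightarrow> c) (at 0)"
  | (strong) "((\<lambda>x. norm x powr \<beta> * u x) \<longlongrightarrow> \<Lambda>) (at 0)"
proof -
  define P where "P = (\<lambda>A. \<forall>x. 0 < norm x \<and> norm x \<le> R \<longrightarrow> w A (norm x) \<le> u x)"
  have Q: "u x \<le> w A (norm x) + K" if "0 < A" "\<not> P A" "0 < norm x" "norm x \<le> R" for A x
    using dichotomy [OF that(1)] that by (auto simp: P_def)
  have Pmono: "P A'" if "P A" "0 < A" "A \<le> A'" for A A'
    unfolding P_def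
  proof (intro allI impI)
    fix x :: 'a assume x: "0 < norm x \<and> norm x \<le> R"
    have "w A' (norm x) \<le> w A (norm x)"
      by (rule w_antimono) (use x that pos_nonneg [of A "norm x"] in auto)
    also have "\<dots> \<le> u x" using that(1) x by (simp add: P_def)
    finally show "w A' (norm x) \<le> u x" .
  qed
  define S where "S = {A. 0 < A \<and> P A}"
  have bS: "bdd_below S" by (rule bdd_belowI [of _ 0]) (auto simp: S_def)
  show thesis
  proof (cases "S = {}")
    case True
    show thesis
    proof (rule bounded)
      fix x :: 'a assume x: "0 < norm x" "norm x \<le> R"
      have le: "u x \<le> A powr (- \<kappa>) * (\<mu> (norm x) - \<mu> R) + K" if "0 < A" for A
      proof -
        have nP: "\<not> P A" using True that by (auto simp: S_def)
        from Q [OF that nP x] w_le_mu [OF that x] show ?thesis by linarith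
      qed
      have "((\<lambda>A. A powr (- \<kappa>) * (\<mu> (norm x) - \<mu> R) + K) \<longlongrightarrow> 0 * (\<mu> (norm x) - \<mu> R) + K) at_top"
        by (intro tendsto_add tendsto_mult tendsto_const tendsto_neg_powr [OF _ filterlim_ident]) (use \<kappa>(1) in simp)
      moreover have "\<forall>\<^sub>F A in at_top. u x \<le> A powr (- \<kappa>) * (\<mu> (norm x) - \<mu> R) + K"
        using eventually_gt_at_top [of 0] by eventually_elim (rule le)
      ultimately have "u x \<le> 0 * (\<mu> (norm x) - \<mu> R) + K" by (intro tendsto_lowerbound) auto
      then show "u x \<le> K" by simp
    qed
  next
    case False
    define a where "a = Inf S"
    have a0: "0 \<le> a" unfolding a_def by (rule cInf_greatest [OF False]) (auto simp: S_def)
    have Pa: "P A" if A: "a < A" for A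
    proof -
      obtain A1 where A1: "A1 \<in> S" "A1 < A" using cInf_less_iff [OF False bS, of A] A by (auto simp: a_def)
      then show ?thesis using Pmono [of A1 A] by (auto simp: S_def)
    qed
    have Na: "\<not> P A" if A: "0 < A" "A < a" for A
    proof
      assume "P A"
      then have "a \<le> A" unfolding a_def using A bS by (intro cInf_lower) (auto simp: S_def)
      with A show False by simp
    qed
    show thesis
    proof (cases "a = 0")
      case True
      have low: "w 0 (norm x) \<le> u x" if x: "0 < norm x" "norm x \<le> R" for x
      proof -
        define b where "b = B * norm x powr \<theta>"
        have b: "0 < b" using B(1) x by (simp add: b_def)
        have "((\<lambda>A. (1 + A / b) powr (- \<kappa>) * w 0 (norm x)) \<longlongrightarrow> (1 + 0 / b) powr (- \<kappa>) * w 0 (norm x)) (at_right 0)"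
          using b by (intro tendsto_intros) auto
        moreover have "\<forall>\<^sub>F A in at_right 0. (1 + A / b) powr (- \<kappa>) * w 0 (norm x) \<le> u x"
          using eventually_at_right_less [of 0]
        proof eventually_elim
          case (elim A)
          have "(1 + A / b) powr (- \<kappa>) * w 0 (norm x) \<le> w A (norm x)"
            using w_ge_w0 [OF elim x(1)] by (simp add: b_def)
          also have "\<dots> \<le> u x" using Pa [of A] elim True x by (simp add: P_def)
          finally show ?case .
        qed
        ultimately have "(1 + 0 / b) powr (- \<kappa>) * w 0 (norm x) \<le> u x"
          by (intro tendsto_upperbound) auto
        then show ?thesis by simp
      qed
      show thesis
      proof (rule strong)
        have n0: "((\<lambda>x::'a. norm x powr \<beta>) \<longlongrightarrow> 0) (at 0)"
        proof -
          have "((\<lambda>x::'a. norm x powr \<beta>) \<longlongrightarrow> norm (0::'a) powr \<beta>) (at 0)"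
            using \<beta>(1) by (intro tendsto_powr' tendsto_norm tendsto_ident_at tendsto_const) auto
          then show ?thesis by simp
        qed
        have l1: "((\<lambda>x::'a. \<Lambda> - norm x powr \<beta> * (\<Lambda> * R powr (- \<beta>))) \<longlongrightarrow> \<Lambda> - 0 * (\<Lambda> * R powr (- \<beta>))) (at 0)"
          by (intro tendsto_diff tendsto_add tendsto_mult tendsto_const n0)
        have l2: "((\<lambda>x::'a. \<Lambda> - norm x powr \<beta> * (\<Lambda> * R powr (- \<beta>)) + norm x powr \<beta> * K) \<longlongrightarrow> \<Lambda> - 0 * (\<Lambda> * R powr (- \<beta>)) + 0 * K) (at 0)"
          by (intro tendsto_diff tendsto_add tendsto_mult tendsto_const n0)
        have w0': "norm x powr \<beta> * w 0 (norm x) = \<Lambda> - norm x powr \<beta> * (\<Lambda> * R powr (- \<beta>))"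
          if x: "0 < norm x" "norm x \<le> R" for x :: 'a
        proof -
          have "norm x powr \<beta> * norm x powr (- \<beta>) = 1" using x by (simp add: powr_minus)
          then have "norm x powr \<beta> * (\<Lambda> * norm x powr (- \<beta>)) = \<Lambda>" by simp
          then show ?thesis using w0 [OF x] by (simp only: right_diff_distrib)
        qed
        show "((\<lambda>x. norm x powr \<beta> * u x) \<longlongrightarrow> \<Lambda>) (at 0)"
        proof (rule real_tendsto_sandwich)
          show "\<forall>\<^sub>F x in at 0. \<Lambda> - norm x powr \<beta> * (\<Lambda> * R powr (- \<beta>)) \<le> norm x powr \<beta> * u x"
            using near0 [OF R]
          proof eventually_elim
            case (elim x)
            have x: "0 < norm x" "norm x \<le> R" using elim by auto
            have "norm x powr \<beta> * w 0 (norm x) \<le> norm x powr \<beta> * u x"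
              by (intro mult_left_mono low x) simp
            then show ?case unfolding w0' [OF x] .
          qed
          show "\<forall>\<^sub>F x in at 0. norm x powr \<beta> * u x \<le> \<Lambda> - norm x powr \<beta> * (\<Lambda> * R powr (- \<beta>)) + norm x powr \<beta> * K"
            using near0 [OF R]
          proof eventually_elim
            case (elim x)
            have x: "0 < norm x" "norm x \<le> R" using elim by auto
            have "norm x powr \<beta> * u x \<le> norm x powr \<beta> * (w 0 (norm x) + K)"
              by (intro mult_left_mono strong_upper x) simp
            then show ?case unfolding distrib_left w0' [OF x] .
          qed
        qed (use l1 l2 in simp_all)
      qed
    next
      case False
      then have a: "0 < a" using a0 by simp
      have ct: "((\<lambda>A. A powr (- \<kappa>)) \<longlongrightarrow> a powr (- \<kappa>)) (at a)" using a by (intro tendsto_intros) auto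
      show thesis
      proof (rule weak)
        show "0 < a powr (- \<kappa>)" using a by simp
        show "((\<lambda>x. u x / mu p x) \<longlongrightarrow> a powr (- \<kappa>)) (at 0)"
        proof (rule order_tendstoI)
          fix h assume h: "h < a powr (- \<kappa>)"
          have "\<forall>\<^sub>F A in at_right a. h < A powr (- \<kappa>)"
            using order_tendstoD(1) [OF ct h] unfolding eventually_at_split by blast
          moreover have "\<forall>\<^sub>F A in at_right a. a < A" by (rule eventually_at_right_less)
          ultimately have "\<forall>\<^sub>F A in at_right a. h < A powr (- \<kappa>) \<and> a < A" by eventually_elim simp
          from eventually_happens' [OF trivial_limit_at_right_real this]
          obtain A3 where A3: "h < A3 powr (- \<kappa>)" "a < A3" by auto
          define A2 where "A2 = (a + A3) / 2"
          have A2: "a < A2" "A2 < A3" using A3 by (auto simp: A2_def)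
          \<comment> \<open>A2 lies strictly between a and A3, which leaves room for the second
            term: A2 + B r^\<theta> stays below A3 up to r2.\<close>
          define r2 where "r2 = min R (((A3 - A2) / B) powr (1 / \<theta>))"
          have r2: "0 < r2" "r2 \<le> R" using R A2 B(1) by (auto simp: r2_def)
          have "r2 powr \<theta> \<le> (((A3 - A2) / B) powr (1 / \<theta>)) powr \<theta>"
            using r2 \<theta> by (intro powr_mono2) (auto simp: r2_def)
          also have "\<dots> = (A3 - A2) / B" using \<theta> A2 B(1) by (simp add: powr_powr)
          finally have "A2 + B * r2 powr \<theta> \<le> A3" using B(1) by (simp add: field_simps)
          then have k3: "A3 powr (- \<kappa>) \<le> (A2 + B * r2 powr \<theta>) powr (- \<kappa>)"
            using \<kappa>(1) pos_nonneg [of A2 r2] a A2 r2 by (intro powr_mono2') auto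
          define k where "k = A3 powr (- \<kappa>)"
          have hk: "0 < k - h" using A3 by (simp add: k_def)
          have "\<forall>\<^sub>F x in at (0::'a). 0 < mu p x \<and> \<mu> r2 < mu p x \<and> k * \<mu> r2 / (k - h) < mu p x \<and> 0 < norm x \<and> norm x < r2"
            by (intro eventually_conj mu_large) (use near0 [OF r2(1)] in \<open>simp_all add: eventually_conj_iff\<close>)
          then show "\<forall>\<^sub>F x in at 0. h < u x / mu p x"
          proof eventually_elim
            case (elim x)
            have x: "0 < norm x" "norm x \<le> r2" "norm x \<le> R" using elim r2 by auto
            have m: "mu p x = \<mu> (norm x)" by (rule mu_eq_profile)
            have "h * mu p x < k * (mu p x - \<mu> r2)"
              using elim hk by (simp add: pos_divide_less_eq algebra_simps)
            also have "\<dots> \<le> (A2 + B * r2 powr \<theta>) powr (- \<kappa>) * (mu p x - \<mu> r2)"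
              using k3 elim by (intro mult_right_mono) (auto simp: k_def)
            also have "\<dots> \<le> w A2 (norm x)"
              unfolding m using w_ge_mu [of A2 "norm x" r2] a A2 x r2 by auto
            also have "\<dots> \<le> u x" using Pa [OF A2(1)] x by (simp add: P_def)
            finally show ?case using elim by (simp add: pos_less_divide_eq)
          qed
        next
          fix h assume h: "a powr (- \<kappa>) < h"
          have "\<forall>\<^sub>F A in at_left a. A powr (- \<kappa>) < h"
            using order_tendstoD(2) [OF ct h] unfolding eventually_at_split by blast
          moreover have "\<forall>\<^sub>F A in at_left a. A \<in> {0<..<a}" by (rule eventually_at_left_real [OF a])
          ultimately have "\<forall>\<^sub>F A in at_left a. A powr (- \<kappa>) < h \<and> A \<in> {0<..<a}" by eventually_elim simp
          from eventually_happens' [OF trivial_limit_at_left_real this]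
          obtain A1 where A1: "A1 powr (- \<kappa>) < h" "0 < A1" "A1 < a" by auto
          define k where "k = A1 powr (- \<kappa>)"
          have hk: "0 < h - k" using A1 by (simp add: k_def)
          have "\<forall>\<^sub>F x in at (0::'a). 0 < mu p x \<and> (K - k * \<mu> R) / (h - k) < mu p x \<and> 0 < norm x \<and> norm x < R"
            by (intro eventually_conj mu_large) (use near0 [OF R] in \<open>simp_all add: eventually_conj_iff\<close>)
          then show "\<forall>\<^sub>F x in at 0. u x / mu p x < h"
          proof eventually_elim
            case (elim x)
            have x: "0 < norm x" "norm x \<le> R" using elim by auto
            have m: "mu p x = \<mu> (norm x)" by (rule mu_eq_profile)
            have "u x \<le> w A1 (norm x) + K" by (rule Q [OF A1(2) Na [OF A1(2,3)] x])
            also have "\<dots> \<le> k * (mu p x - \<mu> R) + K"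
              using w_le_mu [OF A1(2) x] by (simp add: k_def m)
            also have "\<dots> < h * mu p x"
              using elim hk by (simp add: pos_divide_less_eq algebra_simps)
            finally show ?case using elim by (simp add: pos_divide_less_eq)
          qed
        qed
      qed
    qed
  qed
qed

end

section \<open>The equation across the origin\<close>

text \<open>Caccioppoli inequality, from the test function \<open>u \<eta>\<^sup>p\<close>; the absorption term has a favourable sign.\<close>

lemma caccioppoli:
  fixes u :: "'a::euclidean_space \<Rightarrow> real"
  assumes p: "1 < p" "0 < q" and U: "open U" and u: "HJ_sol p q U u D" and nn: "\<And>x. x \<in> U \<Longrightarrow> 0 \<le> u x"
    and \<eta>: "C1c U \<eta> E" "\<And>x. 0 \<le> \<eta> x"
  shows "integrable lborel (\<lambda>x. (norm (D x) * \<eta> x) powr p)"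
    and "integrable lborel (\<lambda>x. (u x * norm (E x)) powr p)"
    and "(LINT x|lborel. (norm (D x) * \<eta> x) powr p) \<le> (2 * p) powr p * (LINT x|lborel. (u x * norm (E x)) powr p)"
proof -
  obtain C where C: "compact C" "C \<subseteq> U" "\<And>x. x \<notin> C \<Longrightarrow> \<eta> x = 0" "\<And>x. x \<notin> C \<Longrightarrow> E x = 0"
    "continuous_on UNIV \<eta>" "continuous_on UNIV E"
    by (rule C1cE [OF \<eta>(1)]) blast
  have uC: "C1_on U u D" using u by (simp add: HJ_sol_def)
  have cu: "continuous_on C u" using C1_on_continuous [OF uC] C(2) by (rule continuous_on_subset)
  have cD: "continuous_on C D" using uC C(2) by (auto simp: C1_on_def intro: continuous_on_subset)
  have cE: "continuous_on C E" "continuous_on C \<eta>" using C(5,6) by (auto intro: continuous_on_subset)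
  have E1: "C1_on U \<eta> E" using \<eta>(1) by (auto simp: C1c_def intro: C1_on_subset)
  have pw: "C1_on U (\<lambda>x. max 0 (\<eta> x) powr p) (\<lambda>x. (p * max 0 (\<eta> x) powr (p - 1)) *\<^sub>R E x)"
  proof (rule C1_on_compose [OF E1, where h = "\<lambda>t. max 0 t powr p" and h' = "\<lambda>t. p * max 0 t powr (p - 1)"])
    show "((\<lambda>t. max 0 t powr p) has_real_derivative p * max 0 (\<eta> x) powr (p - 1)) (at (\<eta> x))" for x
      by (rule DERIV_pos_part_powr [OF p(1)])
    show "continuous_on (\<eta> ` U) (\<lambda>t. p * max 0 t powr (p - 1))"
      using p by (intro continuous_intros continuous_on_powr') auto
  qed
  have m0: "max 0 (\<eta> x) = \<eta> x" for x using \<eta>(2) [of x] by simp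
  let ?f = "\<lambda>x. u x * \<eta> x powr p" and ?Df = "\<lambda>x. u x *\<^sub>R ((p * \<eta> x powr (p - 1)) *\<^sub>R E x) + \<eta> x powr p *\<^sub>R D x"
  have f: "C1_on U ?f ?Df" using C1_on_mult [OF uC pw] by (simp only: m0)
  have fc: "C1c U (\<lambda>x. if x \<in> U then ?f x else 0) (\<lambda>x. if x \<in> U then ?Df x else 0)"
    by (rule C1c_extend [OF f U C(1,2) _ C(2)]) (use C(3) in auto)
  let ?h = "\<lambda>x. flux p (D x) \<bullet> (if x \<in> U then ?Df x else 0) + norm (D x) powr q * (if x \<in> U then ?f x else 0)"
  have W: "weak_eq U (\<lambda>x. flux p (D x)) (\<lambda>x. norm (D x) powr q) 0" using u by (simp add: HJ_sol_def)
  have ih: "integrable lborel ?h"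
  proof (rule weak_integrable(3) [OF _ _ fc])
    show "continuous_on U (\<lambda>x. flux p (D x))"
      using uC p by (intro continuous_on_flux_comp) (auto simp: C1_on_def)
    show "continuous_on U (\<lambda>x. norm (D x) powr q)"
      using uC p by (intro continuous_on_norm_powr) (auto simp: C1_on_def)
  qed
  have h0: "integral\<^sup>L lborel ?h = 0" using weak_eqD [OF W fc] by simp
  show i1: "integrable lborel (\<lambda>x. (norm (D x) * \<eta> x) powr p)"
    by (rule integrable_compact_support [OF C(1)])
       (use p C(3) \<eta>(2) in \<open>auto intro!: continuous_intros continuous_on_powr' cD cE\<close>)
  show i2: "integrable lborel (\<lambda>x. (u x * norm (E x)) powr p)"
    by (rule integrable_compact_support [OF C(1)])
       (use p C(2,4) nn in \<open>auto intro!: continuous_intros continuous_on_powr' cu cE\<close>)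
  \<comment> \<open>Young's inequality with \<epsilon> = 1/2 moves half of the gradient term to the
    left; doubling what remains gives the constant (2 p)^p.\<close>
  define c where "c = (1/2) powr (1 - p) * p powr p"
  have pt: "(1/2) * (norm (D x) * \<eta> x) powr p - c * (u x * norm (E x)) powr p \<le> ?h x" for x
  proof (cases "x \<in> U")
    case False
    then have "\<eta> x = 0" "E x = 0" using C(2-4) by auto
    then show ?thesis using False p by simp
  next
    case True
    have ux: "0 \<le> u x" using nn True .
    have y: "(norm (D x) * \<eta> x) powr (p - 1) * (p * (u x * norm (E x))) \<le>
        (1/2) * (norm (D x) * \<eta> x) powr p + (1/2) powr (1 - p) * (p * (u x * norm (E x))) powr p"
      by (rule young_simple) (use p \<eta>(2) ux in auto)
    have y': "(1/2) powr (1 - p) * (p * (u x * norm (E x))) powr p = c * (u x * norm (E x)) powr p"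
      unfolding c_def using p ux by (subst powr_mult) auto
    have e1: "flux p (D x) \<bullet> (u x *\<^sub>R ((p * \<eta> x powr (p - 1)) *\<^sub>R E x)) = (u x * p * \<eta> x powr (p - 1)) * (flux p (D x) \<bullet> E x)"
      by simp
    have "(u x * p * \<eta> x powr (p - 1)) * - (flux p (D x) \<bullet> E x) \<le> (u x * p * \<eta> x powr (p - 1)) * (norm (D x) powr (p - 1) * norm (E x))"
      using flux_inner_le [of p "D x" "- E x"] ux p by (intro mult_left_mono) auto
    also have "\<dots> = (norm (D x) * \<eta> x) powr (p - 1) * (p * (u x * norm (E x)))"
      using \<eta>(2) [of x] by (subst powr_mult) auto
    finally have e2: "- ((norm (D x) * \<eta> x) powr (p - 1) * (p * (u x * norm (E x)))) \<le> flux p (D x) \<bullet> (u x *\<^sub>R ((p * \<eta> x powr (p - 1)) *\<^sub>R E x))"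
      unfolding e1 by simp
    have e3: "flux p (D x) \<bullet> (\<eta> x powr p *\<^sub>R D x) = (norm (D x) * \<eta> x) powr p"
      using \<eta>(2) [of x] by (simp add: flux_inner powr_mult)
    have e4: "0 \<le> norm (D x) powr q * ?f x" using ux by simp
    show ?thesis using True y y' e2 e3 e4 by (simp only: if_True inner_add_right)
  qed
  have "(LINT x|lborel. (1/2) * (norm (D x) * \<eta> x) powr p - c * (u x * norm (E x)) powr p) \<le> integral\<^sup>L lborel ?h"
    by (rule Bochner_Integration.integral_mono [OF _ ih pt]) (intro Bochner_Integration.integrable_diff integrable_mult_right i1 i2)
  then have "(1/2) * (LINT x|lborel. (norm (D x) * \<eta> x) powr p) - c * (LINT x|lborel. (u x * norm (E x)) powr p) \<le> 0"
    unfolding h0 by (subst (asm) Bochner_Integration.integral_diff) (use i1 i2 in \<open>auto simp del: integral_mult_right_zero simp: integral_mult_right\<close>)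
  moreover have "2 * c = (2 * p) powr p"
  proof -
    have "2 * (1/2::real) powr (1 - p) = 2 powr p"
      by (simp add: powr_divide powr_diff)
    then show ?thesis using p by (simp add: c_def powr_mult)
  qed
  ultimately show "(LINT x|lborel. (norm (D x) * \<eta> x) powr p) \<le> (2 * p) powr p * (LINT x|lborel. (u x * norm (E x)) powr p)"
    by (simp only: mult.assoc flip: \<open>2 * c = _\<close>)
qed

text \<open>Caccioppoli with a cutoff living on r / 2 <= |x| <= 3 r. The result scales as expected
  for gradients of size M / r on a set of volume r^N.\<close>

lemma annulus_energy:
  fixes u :: "'a::euclidean_space \<Rightarrow> real"
  assumes p: "1 < p" "0 < q" and \<Omega>: "open \<Omega>" and u: "HJ_sol p q (\<Omega> - {0}) u D" and nn: "\<And>x. x \<in> \<Omega> - {0} \<Longrightarrow> 0 \<le> u x"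
    and r: "0 < r" "cball 0 (3 * r) \<subseteq> \<Omega>" and M: "\<And>x. r / 2 \<le> norm x \<Longrightarrow> norm x \<le> 3 * r \<Longrightarrow> u x \<le> M" and M0: "0 < M"
  shows "(LINT x|lborel. indicator (cball 0 (2 * r) - ball 0 r) x * norm (D x) powr p)
    \<le> (2 * p) powr p * (24 powr p * (unit_ball_vol (real DIM('a)) * 3 ^ DIM('a))) * ((M / r) powr p * r powr real DIM('a))"
proof -
  obtain \<phi> E where \<phi>: "C1c (ball (0::'a) (3 * r)) \<phi> E" "\<And>x. norm (x - 0) \<le> 2 * r \<Longrightarrow> \<phi> x = 1" "\<And>x. 0 \<le> \<phi> x" "\<And>x. \<phi> x \<le> 1"
    "\<And>x. norm (E x) \<le> 8 / (3 * r - 2 * r)" "\<And>x. 3 * r < norm (x - 0) \<Longrightarrow> E x = 0"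
    by (rule radial_cutoff [of "2 * r" "3 * r" "0::'a"]) (use r in auto)
  obtain \<chi>' E' where \<chi>: "C1c (ball (0::'a) r) \<chi>' E'" "\<And>x. norm (x - 0) \<le> r / 2 \<Longrightarrow> \<chi>' x = 1" "\<And>x. 0 \<le> \<chi>' x" "\<And>x. \<chi>' x \<le> 1"
    "\<And>x. norm (E' x) \<le> 8 / (r - r / 2)" "\<And>x. norm (x - 0) < r / 2 \<Longrightarrow> E' x = 0" "\<And>x. r < norm (x - 0) \<Longrightarrow> E' x = 0"
    by (rule radial_cutoff [of "r / 2" r "0::'a"]) (use r in auto)
  have off1: "\<phi> x = 0" if "3 * r \<le> norm x" for x
    using \<phi>(1) that unfolding C1c_def by (metis subsetD mem_ball_0 not_le)
  have off2: "\<chi>' x = 0" if "r \<le> norm x" for x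
    using \<chi>(1) that unfolding C1c_def by (metis subsetD mem_ball_0 not_le)
  let ?\<eta> = "\<lambda>x. (1 - \<chi>' x) * \<phi> x" and ?E = "\<lambda>x. (1 - \<chi>' x) *\<^sub>R E x + \<phi> x *\<^sub>R (0 - E' x)"
  have C: "C1c (ball 0 (3 * r)) ?\<eta> ?E"
    by (rule C1c_mult [OF \<phi>(1) C1_on_diff [OF C1_on_const]]) (use \<chi>(1) in \<open>simp add: C1c_def\<close>)
  have C': "C1c (\<Omega> - {0}) ?\<eta> ?E"
    unfolding C1c_def
  proof (intro conjI exI)
    show "C1_on UNIV ?\<eta> ?E" using C by (simp add: C1c_def)
    show "compact (cball (0::'a) (3 * r) - ball 0 (r / 2))" by (simp add: compact_diff)
    show "cball 0 (3 * r) - ball 0 (r / 2) \<subseteq> \<Omega> - {0}" using r by auto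
    show "\<forall>x. x \<notin> cball 0 (3 * r) - ball 0 (r / 2) \<longrightarrow> ?\<eta> x = 0" using \<chi>(2) off1 by auto
  qed
  have \<eta>0: "0 \<le> ?\<eta> x" for x using \<chi>(4) \<phi>(3) by simp
  have o: "open (\<Omega> - {0})" using \<Omega> by auto
  note cac = caccioppoli [OF p o u nn C' \<eta>0]
  \<comment> \<open>24 = 8 + 16: the outer transition has width r, the inner one width r /
    2.\<close>
  have nE: "norm (?E x) \<le> 24 / r" for x
  proof -
    have "norm (?E x) \<le> norm ((1 - \<chi>' x) *\<^sub>R E x) + norm (\<phi> x *\<^sub>R (0 - E' x))" by (rule norm_triangle_ineq)
    also have "\<dots> = (1 - \<chi>' x) * norm (E x) + \<phi> x * norm (E' x)" using \<chi>(4) [of x] \<phi>(3) [of x] by simp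
    also have "\<dots> \<le> 1 * (8 / (3 * r - 2 * r)) + 1 * (8 / (r - r / 2))"
      using \<chi>(3,4) \<phi>(3,4) by (intro add_mono mult_mono \<phi>(5) \<chi>(5)) auto
    also have "\<dots> = 24 / r" using r by (simp add: field_simps)
    finally show ?thesis .
  qed
  have bd: "(u x * norm (?E x)) powr p \<le> indicator (cball 0 (3 * r)) x * (24 * (M / r)) powr p" for x
  proof (cases "r / 2 \<le> norm x \<and> norm x \<le> 3 * r")
    case False
    then have "?E x = 0"
      using \<phi>(6) [of x] \<chi>(2,6) [of x] off1 [of x] by (auto simp: not_le)
    then show ?thesis using p by (simp add: indicator_def)
  next
    case True
    then have "x \<in> \<Omega> - {0}" using r by auto
    then have "0 \<le> u x" by (rule nn)
    moreover have "u x * norm (?E x) \<le> M * (24 / r)" using M True M0 by (intro mult_mono nE) auto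
    ultimately have "(u x * norm (?E x)) powr p \<le> (M * (24 / r)) powr p" using p by (intro powr_mono2) auto
    then show ?thesis using True by (simp add: mult.commute)
  qed
  have fin: "emeasure lborel (cball (0::'a) (3 * r)) < \<infinity>" by (rule emeasure_lborel_cball_finite)
  have iI: "integrable lborel (\<lambda>x::'a. indicator (cball 0 (3 * r)) x * (24 * (M / r)) powr p)"
    using fin by (intro integrable_mult_left integrable_real_indicator) auto
  have "(LINT x|lborel. indicator (cball 0 (2 * r) - ball 0 r) x * norm (D x) powr p) \<le> (LINT x|lborel. (norm (D x) * ?\<eta> x) powr p)"
  proof (rule integral_mono_AE' [OF cac(1)])
    show "AE x in lborel. indicator (cball 0 (2 * r) - ball 0 r) x * norm (D x) powr p \<le> (norm (D x) * ?\<eta> x) powr p"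
      using \<phi>(2) off2 by (intro AE_I2) (auto simp: indicator_def)
  qed auto
  also have "\<dots> \<le> (2 * p) powr p * (LINT x|lborel. (u x * norm (?E x)) powr p)" by (rule cac(3))
  also have "\<dots> \<le> (2 * p) powr p * (LINT x|lborel. indicator (cball (0::'a) (3 * r)) x * (24 * (M / r)) powr p)"
    by (intro mult_left_mono Bochner_Integration.integral_mono [OF cac(2) iI bd] powr_ge_zero)
  also have "(LINT x|lborel. indicator (cball (0::'a) (3 * r)) x * (24 * (M / r)) powr p) = measure lborel (cball (0::'a) (3 * r)) * (24 * (M / r)) powr p"
    by simp
  also have "measure lborel (cball (0::'a) (3 * r)) = unit_ball_vol (real DIM('a)) * (3 ^ DIM('a) * r powr real DIM('a))"
    using r content_cball [of "3 * r" "0::'a"] by (simp add: power_mult_distrib powr_realpow measure_completion)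
  also have "(24 * (M / r)) powr p = 24 powr p * (M / r) powr p"
    by (rule powr_mult)
  finally show ?thesis by (simp only: mult_ac)
qed

text \<open>Takes the place of Hoelder's inequality. With t = M / r, the natural size of the
  gradient on the annulus, both terms on the right scale alike after integration.\<close>

lemma powr_interpolate:
  fixes y t :: real
  assumes "0 \<le> y" "0 < t" "0 < s" "s \<le> p"
  shows "y powr s \<le> t powr s + t powr (s - p) * y powr p"
proof (cases "y \<le> t")
  case True
  then have "y powr s \<le> t powr s" using assms by (intro powr_mono2) auto
  then show ?thesis by (smt (verit) mult_nonneg_nonneg powr_ge_zero)
next
  case False
  have "y powr s = y powr (s - p) * y powr p" by (simp add: powr_add [symmetric])
  also have "\<dots> \<le> t powr (s - p) * y powr p"
    using False assms by (intro mult_right_mono powr_antimono_base) auto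
  finally show ?thesis by (smt (verit) powr_ge_zero)
qed

text \<open>M / r is of order r^(-k-1), so the annulus of radius r contributes at most a constant
  times r^(N - s (k + 1)), and a positive exponent makes the annuli summable. Exponents up to p are
  reached, which covers both p - 1 and q.\<close>

lemma gradient_integrable:
  fixes u :: "'a::euclidean_space \<Rightarrow> real"
  assumes p: "1 < p" "0 < q" and \<Omega>: "open \<Omega>" "cball 0 \<rho> \<subseteq> \<Omega>" and u: "HJ_sol p q (\<Omega> - {0}) u D"
    and nn: "\<And>x. x \<in> \<Omega> - {0} \<Longrightarrow> 0 \<le> u x" and \<rho>: "0 < \<rho>"
    and growth: "\<And>x. 0 < norm x \<Longrightarrow> norm x \<le> \<rho> \<Longrightarrow> u x \<le> c * norm x powr (- k)"
    and c: "0 < c" and k: "0 \<le> k" and s: "0 < s" "s \<le> p" "s * (k + 1) < real DIM('a)"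
  shows "set_integrable lborel (ball 0 (\<rho> / 4)) (\<lambda>x. norm (D x) powr s)"
proof -
  define c1 where "c1 = (2 * p) powr p * (24 powr p * (unit_ball_vol (real DIM('a)) * 3 ^ DIM('a)))"
  define c2 where "c2 = unit_ball_vol (real DIM('a)) * 2 ^ DIM('a)"
  define c3 where "c3 = c * 2 powr k"
  have c3: "0 < c3" using c by (simp add: c3_def)
  have cn: "0 \<le> c1" "0 \<le> c2" by (auto simp: c1_def c2_def)
  have sub: "ball 0 \<rho> - {0} \<subseteq> \<Omega> - {0}" using \<Omega>(2) by auto
  have uC: "C1_on (\<Omega> - {0}) u D" using u by (simp add: HJ_sol_def)
  have cD: "continuous_on (\<Omega> - {0}) D" using uC by (simp add: C1_on_def)
  have "set_integrable lborel (ball 0 ((\<rho> / 2) / 2)) (\<lambda>x. norm (D x) powr s)"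
  proof (rule annuli_integrable [where k = "real DIM('a) - s * (k + 1)" and C = "c3 powr s * (c2 + c1)"])
    show "continuous_on (ball 0 (\<rho> / 2) - {0}) (\<lambda>x. norm (D x) powr s)"
    proof (intro continuous_on_norm_powr continuous_on_subset [OF cD] s)
      show "ball 0 (\<rho> / 2) - {0} \<subseteq> \<Omega> - {0}" by (rule order_trans [OF _ sub]) (use \<rho> in auto)
    qed
    fix r :: real assume r: "0 < r" "2 * r < \<rho> / 2"
    define A where "A = cball (0::'a) (2 * r) - ball 0 r"
    define M where "M = c3 * r powr (- k)"
    have M0: "0 < M" using c3 r by (simp add: M_def)
    have Mb: "u x \<le> M" if "r / 2 \<le> norm x" "norm x \<le> 3 * r" for x
    proof -
      have "u x \<le> c * norm x powr (- k)" using that r by (intro growth) auto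
      also have "\<dots> \<le> c * (r / 2) powr (- k)" using that r c k by (intro mult_left_mono powr_antimono_base) auto
      also have "(r / 2) powr (- k) = 2 powr k * r powr (- k)" using r by (simp add: powr_divide powr_minus field_simps)
      finally show ?thesis by (simp add: M_def c3_def)
    qed
    have r3: "cball (0::'a) (3 * r) \<subseteq> \<Omega>" using \<Omega>(2) r by auto
    have en: "(LINT x|lborel. indicator A x * norm (D x) powr p) \<le> c1 * ((M / r) powr p * r powr real DIM('a))"
      unfolding A_def c1_def by (rule annulus_energy [OF p \<Omega>(1) u nn r(1) r3 Mb M0])
    have cA: "compact A" by (simp add: A_def compact_diff)
    have A\<Omega>: "A \<subseteq> \<Omega> - {0}" using r3 r by (auto simp: A_def)
    have iD: "integrable lborel (\<lambda>x. indicator A x * norm (D x) powr t)" if "0 < t" for t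
    proof -
      have "set_integrable lborel A (\<lambda>x. norm (D x) powr t)"
        unfolding set_integrable_def using cA A\<Omega> that
        by (intro borel_integrable_compact continuous_on_norm_powr continuous_on_subset [OF cD]) auto
      then show ?thesis by (simp add: set_integrable_def)
    qed
    have mA: "emeasure lborel A < \<infinity>" using cA by (rule emeasure_compact_finite)
    have "measure lborel A \<le> c2 * r powr real DIM('a)"
      unfolding A_def c2_def by (rule annulus_measure [OF r(1)])
    let ?t = "M / r"
    have t: "0 < ?t" using M0 r by simp
    have iA: "integrable lborel (\<lambda>x. ?t powr s * indicator A x)"
      using mA cA by (intro integrable_mult_right integrable_real_indicator) (auto simp: borel_compact)
    have iB: "integrable lborel (\<lambda>x. ?t powr (s - p) * (indicator A x * norm (D x) powr p))"
      using iD [of p] p by (intro integrable_mult_right) auto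
    have "(LINT x|lborel. indicator A x * norm (D x) powr s) \<le>
        (LINT x|lborel. ?t powr s * indicator A x + ?t powr (s - p) * (indicator A x * norm (D x) powr p))"
    proof (rule Bochner_Integration.integral_mono [OF iD [OF s(1)] Bochner_Integration.integrable_add [OF iA iB]])
      fix x
      show "indicator A x * norm (D x) powr s \<le> ?t powr s * indicator A x + ?t powr (s - p) * (indicator A x * norm (D x) powr p)"
        using powr_interpolate [OF norm_ge_zero t s(1,2), of "D x"] by (cases "x \<in> A") auto
    qed
    also have "\<dots> = ?t powr s * measure lborel A + ?t powr (s - p) * (LINT x|lborel. indicator A x * norm (D x) powr p)"
      by (subst Bochner_Integration.integral_add [OF iA iB]) (use cA in \<open>simp add: borel_compact\<close>)
    also have "\<dots> \<le> ?t powr s * (c2 * r powr real DIM('a)) + ?t powr (s - p) * (c1 * (?t powr p * r powr real DIM('a)))"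
      by (intro add_mono mult_left_mono en) (use \<open>measure lborel A \<le> _\<close> in auto)
    also have "?t powr (s - p) * (c1 * (?t powr p * r powr real DIM('a))) = c1 * (?t powr s * r powr real DIM('a))"
    proof -
      have "?t powr (s - p) * ?t powr p = ?t powr s" by (simp add: powr_add [symmetric])
      then show ?thesis by (metis (no_types, opaque_lifting) mult.assoc mult.left_commute)
    qed
    also have "?t powr s * (c2 * r powr real DIM('a)) + c1 * (?t powr s * r powr real DIM('a)) = (c2 + c1) * (?t powr s * r powr real DIM('a))"
      by (simp add: algebra_simps)
    also have "?t powr s = c3 powr s * r powr (- (s * (k + 1)))"
    proof -
      have "?t = c3 * r powr (- (k + 1))" using r by (simp add: M_def powr_diff powr_minus field_simps)
      then have "?t powr s = (c3 * r powr (- (k + 1))) powr s" by simp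
      also have "\<dots> = c3 powr s * r powr (- (s * (k + 1)))"
        using c3 by (subst powr_mult) (auto simp: powr_powr algebra_simps)
      finally show ?thesis .
    qed
    also have "(c2 + c1) * (c3 powr s * r powr (- (s * (k + 1))) * r powr real DIM('a)) = c3 powr s * (c2 + c1) * r powr (real DIM('a) - s * (k + 1))"
    proof -
      have "r powr (- (s * (k + 1))) * r powr real DIM('a) = r powr (real DIM('a) - s * (k + 1))"
        by (simp add: powr_add [symmetric])
      then show ?thesis by (metis (no_types, opaque_lifting) mult.assoc mult.commute)
    qed
    finally show "(LINT x|lborel. indicator (cball 0 (2 * r) - ball 0 r) x * norm (D x) powr s) \<le> c3 powr s * (c2 + c1) * r powr (real DIM('a) - s * (k + 1))"
      unfolding A_def .
  qed (use \<rho> s cn c3 in auto)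
  then show ?thesis by simp
qed

text \<open>The condition on k is the integrability of r^(-(k+1) q), the expected size of |grad
  u|^q; the flux involves the smaller exponent p - 1. Both being integrable,
  \<open>point_mass\<close> applies.\<close>

lemma mass_exists:
  fixes u :: "'a::euclidean_space \<Rightarrow> real"
  assumes p: "1 < p" and q: "p - 1 < q" "q < p" and \<Omega>: "open \<Omega>" "cball 0 \<rho> \<subseteq> \<Omega>" and u: "HJ_sol p q (\<Omega> - {0}) u D"
    and nn: "\<And>x. x \<in> \<Omega> - {0} \<Longrightarrow> 0 \<le> u x" and \<rho>: "0 < \<rho>"
    and growth: "\<And>x. 0 < norm x \<Longrightarrow> norm x \<le> \<rho> \<Longrightarrow> u x \<le> c * norm x powr (- k)"
    and c: "0 < c" and k: "0 \<le> k" and s: "q * (k + 1) < real DIM('a)"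
  shows "L1_loc \<Omega> (\<lambda>x. flux p (D x))" "L1_loc \<Omega> (\<lambda>x. norm (D x) powr q)"
    "\<exists>m. weak_eq \<Omega> (\<lambda>x. flux p (D x)) (\<lambda>x. norm (D x) powr q) m"
proof -
  have q0: "0 < q" using p q by simp
  have cD: "continuous_on (\<Omega> - {0}) D" using u by (simp add: HJ_sol_def C1_on_def)
  have sub: "ball 0 (\<rho> / 4) - {0} \<subseteq> \<Omega> - {0}" using \<Omega>(2) \<rho> by auto
  have p1: "(p - 1) * (k + 1) < real DIM('a)"
  proof -
    have "(p - 1) * (k + 1) \<le> q * (k + 1)" using q k by (intro mult_right_mono) auto
    with s show ?thesis by linarith
  qed
  have cF: "continuous_on (\<Omega> - {0}) (\<lambda>x. flux p (D x))" by (rule continuous_on_flux_comp [OF p cD])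
  have iF: "set_integrable lborel (ball 0 (\<rho> / 4)) (\<lambda>x. flux p (D x))"
  proof (rule set_integrable_norm_cancel)
    show "set_integrable lborel (ball 0 (\<rho> / 4)) (\<lambda>x. norm (flux p (D x)))"
      unfolding norm_flux
      by (rule gradient_integrable [OF p q0 \<Omega> u nn \<rho> growth c k _ _ p1]) (use p in auto)
  qed (rule continuous_on_subset [OF cF sub])
  have ig: "set_integrable lborel (ball 0 (\<rho> / 4)) (\<lambda>x. norm (D x) powr q)"
    by (rule gradient_integrable [OF p q0 \<Omega> u nn \<rho> growth c k q0 _ s]) (use q in auto)
  show LF: "L1_loc \<Omega> (\<lambda>x. flux p (D x))"
    by (rule L1_loc_punctured [OF \<Omega>(1) cF _ iF]) (use \<rho> in simp)
  show Lg: "L1_loc \<Omega> (\<lambda>x. norm (D x) powr q)"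
    by (rule L1_loc_punctured [OF \<Omega>(1) continuous_on_norm_powr [OF cD q0] _ ig]) (use \<rho> in simp)
  have "0 \<in> \<Omega>" using \<Omega>(2) \<rho> by auto
  with u show "\<exists>m. weak_eq \<Omega> (\<lambda>x. flux p (D x)) (\<lambda>x. norm (D x) powr q) m"
    by (intro point_mass [OF _ \<Omega>(1) _ LF Lg]) (auto simp: HJ_sol_def)
qed

section \<open>Determination of the mass\<close>

lemma small_ball_integral:
  fixes g :: "'a::euclidean_space \<Rightarrow> real"
  assumes g: "set_integrable lborel (ball 0 \<rho>) g" and \<rho>: "0 < \<rho>"
  shows "((\<lambda>r. LINT x|lborel. indicator (ball 0 r) x * g x) \<longlongrightarrow> 0) (at_right 0)"
  unfolding tendsto_at_iff_sequentially
proof (intro allI impI)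
  fix X :: "nat \<Rightarrow> real" assume X: "\<forall>i. X i \<in> {0<..} - {0}" "X \<longlonglongrightarrow> 0"
  define h where "h = (\<lambda>x. indicator (ball 0 \<rho>) x * g x)"
  have h: "integrable lborel h" using g by (simp add: h_def set_integrable_def)
  have hm: "h \<in> borel_measurable borel" using borel_measurable_integrable [OF h] by simp
  have "\<forall>\<^sub>F n in sequentially. X n < \<rho>" using X(2) \<rho> by (rule order_tendstoD)
  then obtain n0 where n0: "\<And>n. n0 \<le> n \<Longrightarrow> X n < \<rho>" by (auto simp: eventually_sequentially)
  have "(\<lambda>n. LINT x|lborel. indicator (ball 0 (X (n + n0))) x * h x) \<longlonglongrightarrow> (LINT (x::'a)|lborel. 0)"
  proof (rule integral_dominated_convergence [where w = "\<lambda>x. norm (h x)"])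
    show "AE x in lborel. (\<lambda>n. indicator (ball 0 (X (n + n0))) x * h x) \<longlonglongrightarrow> 0"
      using AE_lborel_singleton [of "0::'a"]
    proof eventually_elim
      case (elim x)
      then have "0 < norm x" by simp
      have "(\<lambda>n. X (n + n0)) \<longlonglongrightarrow> 0" using X(2) by (rule LIMSEQ_ignore_initial_segment)
      then have "\<forall>\<^sub>F n in sequentially. X (n + n0) < norm x" using \<open>0 < norm x\<close> by (rule order_tendstoD)
      then have "\<forall>\<^sub>F n in sequentially. indicator (ball 0 (X (n + n0))) x * h x = 0"
        by eventually_elim simp
      then show ?case by (rule tendsto_eventually)
    qed
    show "AE x in lborel. norm (indicator (ball 0 (X (n + n0))) x * h x) \<le> norm (h x)" for n
      by (intro AE_I2) (simp add: indicator_def)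
  qed (use h hm in \<open>auto intro!: borel_measurable_times borel_measurable_indicator\<close>)
  moreover have "indicator (ball 0 (X (n + n0))) x * h x = indicator (ball 0 (X (n + n0))) x * g x" for n x
    using n0 [of "n + n0"] by (auto simp: h_def indicator_def)
  ultimately have "(\<lambda>n. LINT x|lborel. indicator (ball 0 (X (n + n0))) x * g x) \<longlonglongrightarrow> 0" by simp
  then show "((\<lambda>r. LINT x|lborel. indicator (ball 0 r) x * g x) \<circ> X) \<longlonglongrightarrow> 0"
    unfolding comp_def by (rule LIMSEQ_offset)
qed

text \<open>The sharp weights matter: in \<open>mass_step\<close> the two energies are bounded by
  about m1 J and m2 J, and from m1 <= (p - 1) / p m1 + m2 / p the desired m1 <= m2 follows.\<close>

lemma flux_inner_young:
  assumes "1 < p"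
  shows "flux p a \<bullet> b \<le> (p - 1) / p * norm a powr p + 1 / p * norm b powr p"
proof -
  have "norm b * norm a powr (p - 1) \<le> norm b powr p / p + (norm a powr (p - 1)) powr (p / (p - 1)) / (p / (p - 1))"
    by (rule Youngs_inequality) (use assms in \<open>auto simp: field_simps\<close>)
  also have "(norm a powr (p - 1)) powr (p / (p - 1)) = norm a powr p" using assms by (simp add: powr_powr)
  finally show ?thesis using flux_inner_le [of p a b] by (simp add: field_simps)
qed

lemma L1_loc_subset: "L1_loc U f \<Longrightarrow> V \<subseteq> U \<Longrightarrow> L1_loc V f"
  unfolding L1_loc_def by blast

lemma L1_loc_ball:
  assumes "L1_loc (ball 0 \<rho>) g" "r < \<rho>"
  shows "set_integrable lborel (ball 0 r) g"
proof -
  have "cball 0 r \<subseteq> ball 0 \<rho>" using assms(2) by auto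
  then have "set_integrable lborel (cball 0 r) g" using assms(1) compact_cball unfolding L1_loc_def by blast
  then show ?thesis by (rule set_integrable_subset) auto
qed

text \<open>Comparing masses: the equation for \<open>u\<^sub>1\<close> is tested with a truncation of \<open>u\<^sub>2\<close>. As
  \<open>u\<^sub>1 / u\<^sub>2 \<rightarrow> 1\<close>, the energies \<open>\<integral>\<bar>\<nabla>u\<^sub>i\<bar>\<^sup>p\<close> over level sets, which are asymptotically the
  masses times the height of the truncation, control the mixed term by Young's inequality.\<close>

lemma mass_step:
  fixes u1 u2 :: "'a::euclidean_space \<Rightarrow> real"
  assumes p: "1 < p" and \<rho>: "0 < \<rho>"
    and u1: "C1_on (ball 0 \<rho> - {0}) u1 D1" and u2: "C1_on (ball 0 \<rho> - {0}) u2 D2"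
    and W1: "weak_eq (ball 0 \<rho>) (\<lambda>x. flux p (D1 x)) g1 m1" and W2: "weak_eq (ball 0 \<rho>) (\<lambda>x. flux p (D2 x)) g2 m2"
    and g: "\<And>x. 0 \<le> g1 x" "\<And>x. 0 \<le> g2 x"
    and L1: "L1_loc (ball 0 \<rho>) (\<lambda>x. flux p (D1 x))" "L1_loc (ball 0 \<rho>) g1"
    and L2: "L1_loc (ball 0 \<rho>) (\<lambda>x. flux p (D2 x))" "L1_loc (ball 0 \<rho>) g2"
    and lim1: "filterlim u1 at_top (at 0)" and lim2: "filterlim u2 at_top (at 0)"
    and e: "0 < \<epsilon>" "\<epsilon> < 1" and near: "\<And>x. x \<in> ball 0 \<rho> - {0} \<Longrightarrow> (1 - \<epsilon>) * u2 x \<le> u1 x \<and> u1 x \<le> (1 + \<epsilon>) * u2 x"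
    and r: "0 < r" "r < \<rho>"
  shows "0 \<le> m1 \<and> m1 / p \<le> m2 / p + 2 * \<epsilon> * m1 + (LINT x|lborel. indicator (ball 0 r) x * g1 x)"
proof -
  define B where "B = ball (0::'a) r - {0}"
  have Bsub: "ball (0::'a) r \<subseteq> ball 0 \<rho>" "B \<subseteq> ball 0 \<rho> - {0}" using r by (auto simp: B_def)
  have sh: "cball (0::'a) r - ball 0 (r / 2) \<subseteq> ball 0 \<rho> - {0}" using r by auto
  obtain a1 where a1: "\<And>x. r / 2 \<le> norm x \<Longrightarrow> norm x \<le> r \<Longrightarrow> u1 x \<le> a1"
    by (rule C1_on_bounded_shell [OF C1_on_continuous [OF C1_on_subset [OF u1 sh]]]) blast
  obtain a2 where a2: "\<And>x. r / 2 \<le> norm x \<Longrightarrow> norm x \<le> r \<Longrightarrow> u2 x \<le> a2"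
    by (rule C1_on_bounded_shell [OF C1_on_continuous [OF C1_on_subset [OF u2 sh]]]) blast
  define a where "a = max 0 (max a2 ((a1 + 1) / (1 - \<epsilon>)))"
  have a: "0 \<le> a" "a2 \<le> a" "(a1 + 1) / (1 - \<epsilon>) \<le> a" by (auto simp: a_def)
  then have a': "a1 \<le> (1 - \<epsilon>) * a - 1" using e by (simp add: pos_divide_le_eq mult.commute)
  \<comment> \<open>b is so large against a that the height of the truncation of u1, at most l - k,
    exceeds J by at most the factor 1 + 2 \<epsilon>.\<close>
  define b where "b = ((1 + 2 * \<epsilon>) * (a + 2) + 2) / \<epsilon> + a + 3"
  have b: "a + 3 \<le> b" using a e by (simp add: b_def)
  have "\<epsilon> * (((1 + 2 * \<epsilon>) * (a + 2) + 2) / \<epsilon>) = (1 + 2 * \<epsilon>) * (a + 2) + 2" using e by simp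
  then have eb: "(1 + 2 * \<epsilon>) * (a + 2) + 2 \<le> \<epsilon> * b"
    using a e unfolding b_def by (simp add: distrib_left)
  \<comment> \<open>Where a <= u2 <= b, the ratio bound puts u1 between k + 1 and l - 1, so the
    slope \<tau>' equals 1 there and dominates \<tau>.\<close>
  define k where "k = (1 - \<epsilon>) * a - 1"
  define l where "l = (1 + \<epsilon>) * b + 1"
  have ab: "0 \<le> \<epsilon> * a" "0 \<le> \<epsilon> * b" "\<epsilon> * a \<le> a" using a b e by (auto simp: mult_left_le_one_le)
  then have kl: "k + 2 \<le> l" using b by (simp add: k_def l_def algebra_simps)
  obtain \<theta> \<tau> J where t: "\<And>s. (\<theta> has_real_derivative \<tau> s) (at s)" "continuous_on UNIV \<tau>"
    "\<And>s. 0 \<le> \<tau> s" "\<And>s. \<tau> s \<le> 1" "\<And>s. s \<le> a \<Longrightarrow> \<tau> s = 0" "\<And>s. b \<le> s \<Longrightarrow> \<tau> s = 0"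
    "\<And>s. s \<le> a \<Longrightarrow> \<theta> s = 0" "\<And>s. b \<le> s \<Longrightarrow> \<theta> s = J" "\<And>s. 0 \<le> \<theta> s" "\<And>s. \<theta> s \<le> J" "b - a - 2 \<le> J" "0 < J"
    by (rule smooth_step [of a b]) (use b in auto)
  obtain \<theta>' \<tau>' J' where t': "\<And>s. (\<theta>' has_real_derivative \<tau>' s) (at s)" "continuous_on UNIV \<tau>'"
    "\<And>s. 0 \<le> \<tau>' s" "\<And>s. k + 1 \<le> s \<Longrightarrow> s \<le> l - 1 \<Longrightarrow> \<tau>' s = 1" "\<And>s. l \<le> s \<Longrightarrow> \<tau>' s = 0"
    "\<And>s. s \<le> k \<Longrightarrow> \<theta>' s = 0" "\<And>s. l \<le> s \<Longrightarrow> \<theta>' s = J'" "\<And>s. 0 \<le> \<theta>' s" "J' \<le> l - k" "0 < J'"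
    by (rule smooth_step [OF kl]) blast
  have r2: "0 < r / 2" "r / 2 < r" using r by auto
  note sub = weak_eq_subset [OF _ Bsub(1)] C1_on_subset [OF _ Bsub(2)] L1_loc_subset [OF _ Bsub(1)]
  have sh1: "u1 x \<le> k" if "r / 2 \<le> norm x" "norm x < r" for x using a1 [of x] a' that by (simp add: k_def)
  have sh2: "u2 x \<le> a" if "r / 2 \<le> norm x" "norm x < r" for x using a2 [of x] a that by simp
  note T12 = truncation_test [where b = b, OF sub(1) [OF W1] sub(2) [OF u2, unfolded B_def] lim2 r2 sh2 t(1,2,7,8,6) sub(3) [OF L1(1)] sub(3) [OF L1(2)], folded B_def]
  note T11 = truncation_test [where b = l, OF sub(1) [OF W1] sub(2) [OF u1, unfolded B_def] lim1 r2 sh1 t'(1,2,6,7,5) sub(3) [OF L1(1)] sub(3) [OF L1(2)], folded B_def]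
  note T22 = truncation_test [where b = b, OF sub(1) [OF W2] sub(2) [OF u2, unfolded B_def] lim2 r2 sh2 t(1,2,7,8,6) sub(3) [OF L2(1)] sub(3) [OF L2(2)], folded B_def]
  define P where "P = (LINT x|lborel. indicator B x * (\<tau>' (u1 x) * (flux p (D1 x) \<bullet> D1 x)))"
  define Q where "Q = (LINT x|lborel. indicator B x * (\<tau> (u2 x) * (flux p (D2 x) \<bullet> D2 x)))"
  define G where "G = (LINT x|lborel. indicator (ball 0 r) x * g1 x)"
  have "0 \<le> (LINT x|lborel. indicator B x * (g1 x * \<theta>' (u1 x)))"
    using g t'(8) by (intro Bochner_Integration.integral_nonneg) auto
  then have P: "P \<le> m1 * J'" using T11(3) by (simp add: P_def)
  have "0 \<le> P" unfolding P_def using t'(3) by (intro Bochner_Integration.integral_nonneg) (auto simp: flux_inner)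
  then have "0 \<le> m1 * J'" using P by linarith
  then have m1: "0 \<le> m1" using t'(10) by (simp add: zero_le_mult_iff)
  have "0 \<le> (LINT x|lborel. indicator B x * (g2 x * \<theta> (u2 x)))"
    using g t(9) by (intro Bochner_Integration.integral_nonneg) auto
  then have Q: "Q \<le> m2 * J" using T22(3) by (simp add: Q_def)
  have ig: "integrable lborel (\<lambda>x. indicator (ball 0 r) x * g1 x)"
    using L1_loc_ball [OF L1(2) r(2)] by (simp add: set_integrable_def)
  have "(LINT x|lborel. indicator B x * (g1 x * \<theta> (u2 x))) \<le> (LINT x|lborel. J * (indicator (ball 0 r) x * g1 x))"
  proof (rule Bochner_Integration.integral_mono [OF T12(2)])
    show "integrable lborel (\<lambda>x. J * (indicator (ball 0 r) x * g1 x))" using ig by simp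
    show "indicator B x * (g1 x * \<theta> (u2 x)) \<le> J * (indicator (ball 0 r) x * g1 x)" for x
    proof -
      have "g1 x * \<theta> (u2 x) \<le> g1 x * J" by (intro mult_left_mono t(10) g(1))
      moreover have "0 \<le> g1 x * J" using t(12) g(1) by simp
      ultimately show ?thesis by (auto simp: indicator_def B_def mult.commute)
    qed
  qed
  then have G: "(LINT x|lborel. indicator B x * (g1 x * \<theta> (u2 x))) \<le> J * G" by (simp add: G_def)
  have "(LINT x|lborel. indicator B x * (\<tau> (u2 x) * (flux p (D1 x) \<bullet> D2 x))) \<le>
      (LINT x|lborel. (p - 1) / p * (indicator B x * (\<tau>' (u1 x) * (flux p (D1 x) \<bullet> D1 x))) + 1 / p * (indicator B x * (\<tau> (u2 x) * (flux p (D2 x) \<bullet> D2 x))))"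
  proof (rule Bochner_Integration.integral_mono [OF T12(1)])
    show "integrable lborel (\<lambda>x. (p - 1) / p * (indicator B x * (\<tau>' (u1 x) * (flux p (D1 x) \<bullet> D1 x))) + 1 / p * (indicator B x * (\<tau> (u2 x) * (flux p (D2 x) \<bullet> D2 x))))"
      by (intro Bochner_Integration.integrable_add integrable_mult_right T11(1) T22(1))
    fix x
    show "indicator B x * (\<tau> (u2 x) * (flux p (D1 x) \<bullet> D2 x)) \<le> (p - 1) / p * (indicator B x * (\<tau>' (u1 x) * (flux p (D1 x) \<bullet> D1 x))) + 1 / p * (indicator B x * (\<tau> (u2 x) * (flux p (D2 x) \<bullet> D2 x)))"
    proof (cases "x \<in> B")
      case True
      have ty: "\<tau> (u2 x) * (flux p (D1 x) \<bullet> D2 x) \<le> \<tau> (u2 x) * ((p - 1) / p * norm (D1 x) powr p + 1 / p * norm (D2 x) powr p)"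
        by (intro mult_left_mono flux_inner_young p t(3))
      have "\<tau> (u2 x) \<le> \<tau>' (u1 x)"
      proof (cases "a \<le> u2 x \<and> u2 x \<le> b")
        case False
        then show ?thesis using t(5,6) [of "u2 x"] t'(3) by auto
      next
        case ux: True
        have n: "(1 - \<epsilon>) * u2 x \<le> u1 x" "u1 x \<le> (1 + \<epsilon>) * u2 x" 
          using near [OF subsetD [OF Bsub(2) True]] by auto
        have "(1 - \<epsilon>) * a \<le> (1 - \<epsilon>) * u2 x" "(1 + \<epsilon>) * u2 x \<le> (1 + \<epsilon>) * b"
          using ux e by (auto intro: mult_left_mono)
        with n have "\<tau>' (u1 x) = 1" by (intro t'(4)) (auto simp: k_def l_def)
        then show ?thesis using t(4) by simp
      qed
      then have "\<tau> (u2 x) * ((p - 1) / p * norm (D1 x) powr p) \<le> \<tau>' (u1 x) * ((p - 1) / p * norm (D1 x) powr p)"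
        using p by (intro mult_right_mono) auto
      with ty True show ?thesis by (simp add: flux_inner distrib_left mult_ac)
    qed simp
  qed
  also have "\<dots> = (p - 1) / p * P + 1 / p * Q"
    unfolding P_def Q_def
    by (subst Bochner_Integration.integral_add) (simp_all only: integrable_mult_right T11(1) T22(1) integral_mult_right_zero)
  finally have "m1 * J \<le> (p - 1) / p * P + 1 / p * Q + J * G" using T12(3) G by linarith
  also have "\<dots> \<le> (p - 1) / p * (m1 * ((1 + 2 * \<epsilon>) * J)) + 1 / p * (m2 * J) + J * G"
  proof -
    have "J' \<le> (1 + \<epsilon>) * b - (1 - \<epsilon>) * a + 2" using t'(9) by (simp add: k_def l_def)
    also have "\<dots> \<le> (1 + 2 * \<epsilon>) * (b - a - 2)" using eb a ab by (simp add: algebra_simps)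
    also have "\<dots> \<le> (1 + 2 * \<epsilon>) * J" using t(11) e by (intro mult_left_mono) auto
    finally have "m1 * J' \<le> m1 * ((1 + 2 * \<epsilon>) * J)" using m1 by (intro mult_left_mono) auto
    then have "P \<le> m1 * ((1 + 2 * \<epsilon>) * J)" using P by linarith
    then show ?thesis using Q p t(12) by (intro add_mono mult_left_mono) auto
  qed
  also have "\<dots> = ((p - 1) / p * (m1 * (1 + 2 * \<epsilon>)) + 1 / p * m2 + G) * J" by (simp add: algebra_simps)
  finally have "m1 \<le> (p - 1) / p * (m1 * (1 + 2 * \<epsilon>)) + 1 / p * m2 + G" using t(12) by simp
  moreover have "(p - 1) / p * (m1 * (1 + 2 * \<epsilon>)) = m1 * (1 + 2 * \<epsilon>) - m1 / p - m1 / p * (2 * \<epsilon>)"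
    using p by (simp add: field_simps)
  moreover have "0 \<le> m1 / p * (2 * \<epsilon>)" using m1 e p by simp
  ultimately have "m1 / p \<le> m2 / p + 2 * \<epsilon> * m1 + G" by (simp add: algebra_simps)
  then show ?thesis using m1 by (simp add: G_def)
qed

text \<open>\<open>mass_step\<close> with r so small that the absorption integral is below
  \<epsilon>, then \<epsilon> -> 0. Exchanging the two functions gives the opposite
  inequality.\<close>

lemma mass_le:
  fixes u1 u2 :: "'a::euclidean_space \<Rightarrow> real"
  assumes p: "1 < p" and \<rho>: "0 < \<rho>"
    and u1: "C1_on (ball 0 \<rho> - {0}) u1 D1" and u2: "C1_on (ball 0 \<rho> - {0}) u2 D2"
    and W1: "weak_eq (ball 0 \<rho>) (\<lambda>x. flux p (D1 x)) g1 m1" and W2: "weak_eq (ball 0 \<rho>) (\<lambda>x. flux p (D2 x)) g2 m2"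
    and g: "\<And>x. 0 \<le> g1 x" "\<And>x. 0 \<le> g2 x"
    and L1: "L1_loc (ball 0 \<rho>) (\<lambda>x. flux p (D1 x))" "L1_loc (ball 0 \<rho>) g1"
    and L2: "L1_loc (ball 0 \<rho>) (\<lambda>x. flux p (D2 x))" "L1_loc (ball 0 \<rho>) g2"
    and lim1: "filterlim u1 at_top (at 0)" and lim2: "filterlim u2 at_top (at 0)"
    and ratio: "((\<lambda>x. u1 x / u2 x) \<longlongrightarrow> 1) (at 0)"
  shows "m1 \<le> m2"
proof -
  have est: "0 \<le> m1 \<and> m1 / p \<le> m2 / p + 2 * \<epsilon> * m1 + \<epsilon>" if e: "0 < \<epsilon>" "\<epsilon> < 1" for \<epsilon>
  proof -
    have "\<forall>\<^sub>F x in at 0. 1 - \<epsilon> < u1 x / u2 x" "\<forall>\<^sub>F x in at 0. u1 x / u2 x < 1 + \<epsilon>" "\<forall>\<^sub>F x in at 0. 0 < u2 x"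
      using order_tendstoD [OF ratio] lim2 e by (auto simp: filterlim_at_top_dense)
    then have "\<forall>\<^sub>F x in at 0. (1 - \<epsilon>) * u2 x \<le> u1 x \<and> u1 x \<le> (1 + \<epsilon>) * u2 x"
      by eventually_elim (simp add: pos_less_divide_eq pos_divide_less_eq)
    then obtain d where d: "0 < d" "\<And>x. x \<noteq> 0 \<Longrightarrow> dist x 0 < d \<Longrightarrow> (1 - \<epsilon>) * u2 x \<le> u1 x \<and> u1 x \<le> (1 + \<epsilon>) * u2 x"
      unfolding eventually_at by blast
    define s where "s = min d \<rho>"
    have s: "0 < s" "s \<le> \<rho>" "s \<le> d" using d \<rho> by (auto simp: s_def)
    have sub: "ball (0::'a) s \<subseteq> ball 0 \<rho>" "ball (0::'a) s - {0} \<subseteq> ball 0 \<rho> - {0}" using s by auto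
    have near: "(1 - \<epsilon>) * u2 x \<le> u1 x \<and> u1 x \<le> (1 + \<epsilon>) * u2 x" if "x \<in> ball 0 s - {0}" for x
      using that s by (intro d(2)) auto
    have si: "set_integrable lborel (ball 0 (\<rho> / 2)) g1" using L1_loc_ball [OF L1(2)] \<rho> by simp
    have "((\<lambda>r. LINT x|lborel. indicator (ball 0 r) x * g1 x) \<longlongrightarrow> 0) (at_right 0)"
      by (rule small_ball_integral [OF si]) (use \<rho> in simp)
    then have "\<forall>\<^sub>F r in at_right 0. (LINT x|lborel. indicator (ball 0 r) x * g1 x) < \<epsilon>" using e(1) by (rule order_tendstoD)
    moreover have "\<forall>\<^sub>F r in at_right 0. r \<in> {0<..<s}" by (rule eventually_at_right_real [OF s(1)])
    ultimately have "\<forall>\<^sub>F r in at_right 0. (LINT x|lborel. indicator (ball 0 r) x * g1 x) < \<epsilon> \<and> r \<in> {0<..<s}"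
      by eventually_elim simp
    from eventually_happens' [OF trivial_limit_at_right_real this]
    obtain r where r: "(LINT x|lborel. indicator (ball 0 r) x * g1 x) < \<epsilon>" "0 < r" "r < s" by auto
    from mass_step [OF p s(1) C1_on_subset [OF u1 sub(2)] C1_on_subset [OF u2 sub(2)] weak_eq_subset [OF W1 sub(1)]
        weak_eq_subset [OF W2 sub(1)] g L1_loc_subset [OF L1(1) sub(1)] L1_loc_subset [OF L1(2) sub(1)]
        L1_loc_subset [OF L2(1) sub(1)] L1_loc_subset [OF L2(2) sub(1)] lim1 lim2 e near r(2,3)] r(1)
    show ?thesis by linarith
  qed
  have "((\<lambda>\<epsilon>. m2 / p + 2 * \<epsilon> * m1 + \<epsilon>) \<longlongrightarrow> m2 / p + 2 * 0 * m1 + 0) (at_right 0)" by (intro tendsto_intros)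
  moreover have "\<forall>\<^sub>F \<epsilon> in at_right 0. \<epsilon> \<in> {0<..<1::real}" by (rule eventually_at_right_real) simp
  then have "\<forall>\<^sub>F \<epsilon> in at_right 0. m1 / p \<le> m2 / p + 2 * \<epsilon> * m1 + \<epsilon>" by eventually_elim (use est in auto)
  ultimately have "m1 / p \<le> m2 / p + 2 * 0 * m1 + 0" by (intro tendsto_lowerbound) auto
  then show ?thesis using p by (simp add: divide_le_cancel)
qed

text \<open>A bounded solution carries no mass: points have zero \<open>p\<close>-capacity for \<open>p \<le> N\<close>.\<close>

lemma mass_zero:
  fixes u :: "'a::euclidean_space \<Rightarrow> real"
  assumes p: "1 < p" "p \<le> real DIM('a)" and q: "0 < q" and \<Omega>: "open \<Omega>" "cball 0 \<rho> \<subseteq> \<Omega>" and u: "HJ_sol p q (\<Omega> - {0}) u D"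
    and nn: "\<And>x. x \<in> \<Omega> - {0} \<Longrightarrow> 0 \<le> u x" and \<rho>: "0 < \<rho>"
    and bd: "\<And>x. 0 < norm x \<Longrightarrow> norm x \<le> \<rho> \<Longrightarrow> u x \<le> K"
    and L: "L1_loc \<Omega> (\<lambda>x. flux p (D x))" "L1_loc \<Omega> (\<lambda>x. norm (D x) powr q)"
    and W: "weak_eq \<Omega> (\<lambda>x. flux p (D x)) (\<lambda>x. norm (D x) powr q) m"
  shows "m = 0"
proof -
  have o: "open (\<Omega> - {0})" using \<Omega>(1) by auto
  have W0: "weak_eq (\<Omega> - {0}) (\<lambda>x. flux p (D x)) (\<lambda>x. norm (D x) powr q) 0" using u by (simp add: HJ_sol_def)
  obtain \<phi> E where \<phi>: "C1c (ball (0::'a) \<rho>) \<phi> E" "\<And>x. norm (x - 0) \<le> \<rho> / 2 \<Longrightarrow> \<phi> x = 1" "\<And>x. 0 \<le> \<phi> x" "\<And>x. \<phi> x \<le> 1"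
    "\<And>x. norm (x - 0) < \<rho> / 2 \<Longrightarrow> E x = 0"
    by (rule radial_cutoff [of "\<rho> / 2" \<rho> "0::'a"]) (use \<rho> in auto)
  have \<phi>\<Omega>: "C1c \<Omega> \<phi> E" by (rule C1c_mono [OF \<phi>(1)]) (use \<Omega>(2) in auto)
  have off: "\<phi> x = 0" if "\<rho> \<le> norm x" for x
    using \<phi>(1) that unfolding C1c_def by (metis subsetD mem_ball_0 not_le)
  obtain Cp where Cp: "compact Cp" "Cp \<subseteq> \<Omega>" "\<And>x. x \<notin> Cp \<Longrightarrow> \<phi> x = 0" "\<And>x. x \<notin> Cp \<Longrightarrow> E x = 0" "continuous_on UNIV E"
    by (rule C1cE [OF \<phi>\<Omega>]) blast
  have iE: "integrable lborel (\<lambda>x. norm (E x) powr p)"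
    by (rule integrable_compact_support [OF Cp(1) continuous_on_norm_powr [OF continuous_on_subset [OF Cp(5)]]]) (use Cp(4) p in auto)
  define K1 where "K1 = max K 1"
  have K1: "0 < K1" "K \<le> K1" by (auto simp: K1_def)
  define I where "I = (LINT x|lborel. norm (E x) powr p)"
  define C where "C = (2 * p) powr p * (K1 powr p * (2 powr p * (1 + I)))"
  \<comment> \<open>Three limits in a fixed order: \<epsilon> -> 0 removes the capacity term in
    spite of its factor \<delta>^(1-p), then \<delta> -> 0 the energy term, then r -> 0 the
    absorption. The energy bound C must therefore depend on none of the three.\<close>
  have est: "\<bar>m\<bar> \<le> (LINT x|lborel. indicator (ball 0 r) x * norm (D x) powr q) + p * (\<delta> * C + \<delta> powr (1 - p) * \<epsilon>)"
    if r: "0 < r" "r < \<rho> / 2" and \<delta>: "0 < \<delta>" and \<epsilon>: "0 < \<epsilon>" "\<epsilon> \<le> 1" for r \<delta> \<epsilon>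
  proof -
    obtain \<psi> F d where \<psi>: "C1_on UNIV \<psi> F" "\<And>x. 0 \<le> \<psi> x" "\<And>x. \<psi> x \<le> 1" "0 < d"
      "\<And>x. norm (x - 0) < d \<Longrightarrow> \<psi> x = 0" "\<And>x. r \<le> norm (x - (0::'a)) \<Longrightarrow> \<psi> x = 1" "\<And>x. r < norm (x - 0) \<Longrightarrow> F x = 0"
      "integrable lborel (\<lambda>x. norm (F x) powr p)" "(LINT x|lborel. norm (F x) powr p) \<le> \<epsilon>"
      by (rule capacity_cutoff [OF p r(1) \<epsilon>(1), of "0::'a"]) blast
    let ?\<eta> = "\<lambda>x. \<psi> x * \<phi> x" and ?H = "\<lambda>x. \<psi> x *\<^sub>R E x + \<phi> x *\<^sub>R F x"
    have pc: "C1c (\<Omega> - {0}) (\<lambda>x. f x * \<phi> x) (\<lambda>x. f x *\<^sub>R E x + \<phi> x *\<^sub>R Df x)"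
      if f: "C1_on UNIV f Df" "\<And>x. norm x < d \<Longrightarrow> f x = 0" for f Df
      unfolding C1c_def
    proof (intro conjI exI)
      show "C1_on UNIV (\<lambda>x. f x * \<phi> x) (\<lambda>x. f x *\<^sub>R E x + \<phi> x *\<^sub>R Df x)"
        using C1c_mult [OF \<phi>(1) f(1)] by (simp add: C1c_def)
      show "compact (cball (0::'a) \<rho> - ball 0 d)" by (simp add: compact_diff)
      show "cball 0 \<rho> - ball 0 d \<subseteq> \<Omega> - {0}" using \<Omega>(2) \<psi>(4) by auto
      show "\<forall>x. x \<notin> cball 0 \<rho> - ball 0 d \<longrightarrow> f x * \<phi> x = 0" using f(2) off by auto
    qed
    have \<psi>0: "\<psi> x = 0" if "norm x < d" for x using \<psi>(5) [of x] that by simp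
    have \<psi>1: "\<psi> x = 1" if "r \<le> norm x" for x using \<psi>(6) [of x] that by simp
    have F0: "F x = 0" if "r < norm x" for x using \<psi>(7) [of x] that by simp
    note cac = caccioppoli [OF p(1) q o u nn pc [OF \<psi>(1) \<psi>0] mult_nonneg_nonneg [OF \<psi>(2) \<phi>(3)]]
    have en: "(LINT x|lborel. (norm (D x) * ?\<eta> x) powr p) \<le> C"
    proof -
      have "(LINT x|lborel. (u x * norm (?H x)) powr p) \<le> (LINT x|lborel. K1 powr p * (2 powr p * (norm (F x) powr p + norm (E x) powr p)))"
      proof (rule Bochner_Integration.integral_mono [OF cac(2)])
        show "integrable lborel (\<lambda>x. K1 powr p * (2 powr p * (norm (F x) powr p + norm (E x) powr p)))"
          using \<psi>(8) iE by simp
        fix x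
        \<comment> \<open>At 0 and outside the ball no bound on u is available, so the gradient of
          the cutoff has to vanish there.\<close>
        have h0: "?H x = 0" if "x = 0 \<or> \<rho> < norm x"
        proof (cases "x = 0")
          case True
          have "F 0 = 0"
            by (rule C1_on_zero_off [where f = \<psi> and U = UNIV and K = "- ball 0 d"]) (use \<psi>(1,4) \<psi>0 in auto)
          then show ?thesis using True \<psi>0 [of 0] \<psi>(4) by simp
        next
          case False
          have "E x = 0"
            by (rule C1_on_zero_off [where f = \<phi> and U = UNIV and K = "cball 0 \<rho>"])
               (use \<phi>(1) off False that in \<open>auto simp: C1c_def\<close>)
          then show ?thesis using False that off [of x] by simp
        qed
        show "(u x * norm (?H x)) powr p \<le> K1 powr p * (2 powr p * (norm (F x) powr p + norm (E x) powr p))"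
        proof (cases "x = 0 \<or> \<rho> < norm x")
          case True
          then show ?thesis using h0 p by simp
        next
          case False
          then have "x \<in> cball 0 \<rho>" by simp
          then have "x \<in> \<Omega>" using \<Omega>(2) by blast
          then have ux: "0 \<le> u x" "u x \<le> K1" using False nn [of x] bd [of x] K1(2) by auto
          define M where "M = max (norm (F x)) (norm (E x))"
          have "norm (?H x) \<le> norm (\<psi> x *\<^sub>R E x) + norm (\<phi> x *\<^sub>R F x)" by (rule norm_triangle_ineq)
          also have "\<dots> = \<psi> x * norm (E x) + \<phi> x * norm (F x)" using \<psi>(2) \<phi>(3) by simp
          also have "\<dots> \<le> 1 * M + 1 * M" using \<psi>(2,3) \<phi>(3,4) by (intro add_mono mult_mono) (auto simp: M_def)
          finally have nH: "norm (?H x) \<le> 2 * M" by simp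
          have M0: "0 \<le> M" by (simp add: M_def le_max_iff_disj)
          have "u x * norm (?H x) \<le> K1 * (2 * M)" using ux nH K1 by (intro mult_mono) auto
          then have "(u x * norm (?H x)) powr p \<le> (K1 * (2 * M)) powr p" using ux p by (intro powr_mono2) auto
          also have "\<dots> = K1 powr p * (2 powr p * M powr p)" using K1 M0 by (simp add: powr_mult)
          also have "\<dots> \<le> K1 powr p * (2 powr p * (norm (F x) powr p + norm (E x) powr p))"
            by (intro mult_left_mono) (auto simp: M_def max_def)
          finally show ?thesis .
        qed
      qed
      also have "\<dots> = K1 powr p * (2 powr p * ((LINT x|lborel. norm (F x) powr p) + I))"
        using \<psi>(8) iE by (simp add: I_def)
      also have "\<dots> \<le> K1 powr p * (2 powr p * (1 + I))"
        using \<psi>(9) \<epsilon> by (intro mult_left_mono) auto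
      finally have "(2 * p) powr p * (LINT x|lborel. (u x * norm (?H x)) powr p) \<le> C"
        unfolding C_def by (intro mult_left_mono) auto
      with cac(3) show ?thesis by linarith
    qed
    have m0: "max 0 (\<psi> x) = \<psi> x" for x using \<psi>(2) [of x] by simp
    have "C1_on UNIV (\<lambda>x. max 0 (\<psi> x) powr p) (\<lambda>x. (p * max 0 (\<psi> x) powr (p - 1)) *\<^sub>R F x)"
    proof (rule C1_on_compose [OF \<psi>(1), where h = "\<lambda>t. max 0 t powr p" and h' = "\<lambda>t. p * max 0 t powr (p - 1)"])
      show "((\<lambda>t. max 0 t powr p) has_real_derivative p * max 0 (\<psi> x) powr (p - 1)) (at (\<psi> x))" for x
        by (rule DERIV_pos_part_powr [OF p(1)])
      show "continuous_on (range \<psi>) (\<lambda>t. p * max 0 t powr (p - 1))"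
        using p by (intro continuous_intros continuous_on_powr') auto
    qed
    then have pw: "C1_on UNIV (\<lambda>x. \<psi> x powr p) (\<lambda>x. (p * \<psi> x powr (p - 1)) *\<^sub>R F x)" by (simp only: m0)
    have C2: "C1c (\<Omega> - {0}) (\<lambda>x. \<psi> x powr p * \<phi> x) (\<lambda>x. \<psi> x powr p *\<^sub>R E x + \<phi> x *\<^sub>R ((p * \<psi> x powr (p - 1)) *\<^sub>R F x))"
      by (rule pc [OF pw]) (use \<psi>0 p in simp)
    let ?h1 = "\<lambda>x. flux p (D x) \<bullet> E x + norm (D x) powr q * \<phi> x"
    let ?h2 = "\<lambda>x. flux p (D x) \<bullet> (\<psi> x powr p *\<^sub>R E x + \<phi> x *\<^sub>R ((p * \<psi> x powr (p - 1)) *\<^sub>R F x)) + norm (D x) powr q * (\<psi> x powr p * \<phi> x)"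
    have i1: "integrable lborel ?h1"
      by (intro Bochner_Integration.integrable_add L1_loc_integrable_mult [OF \<phi>\<Omega>] L)
    have C2': "C1c \<Omega> (\<lambda>x. \<psi> x powr p * \<phi> x) (\<lambda>x. \<psi> x powr p *\<^sub>R E x + \<phi> x *\<^sub>R ((p * \<psi> x powr (p - 1)) *\<^sub>R F x))"
      by (rule C1c_mono [OF C2]) auto
    have i2: "integrable lborel ?h2"
      by (intro Bochner_Integration.integrable_add L1_loc_integrable_mult [OF C2'] L)
    \<comment> \<open>Testing with \<phi> yields m; testing with \<psi>^p \<phi> yields 0, since
      this function vanishes near the origin. The difference lives on the ball of radius r.\<close>
    have "m = integral\<^sup>L lborel ?h1 - integral\<^sup>L lborel ?h2"
      using weak_eqD [OF W \<phi>\<Omega>] weak_eqD [OF W0 C2] \<phi>(2) [of 0] \<rho> by simp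
    also have "\<dots> = (LINT x|lborel. ?h1 x - ?h2 x)"
      by (rule Bochner_Integration.integral_diff [OF i1 i2, symmetric])
    finally have m: "m = (LINT x|lborel. ?h1 x - ?h2 x)" .
    let ?T = "\<lambda>x. indicator (ball 0 r) x * norm (D x) powr q + p * (\<delta> * (norm (D x) * ?\<eta> x) powr p + \<delta> powr (1 - p) * norm (F x) powr p)"
    have "cball 0 r \<subseteq> \<Omega>" by (rule order_trans [OF _ \<Omega>(2)]) (use r in auto)
    then have "set_integrable lborel (cball 0 r) (\<lambda>x. norm (D x) powr q)"
      using L(2) compact_cball unfolding L1_loc_def by blast
    then have "set_integrable lborel (ball 0 r) (\<lambda>x. norm (D x) powr q)" by (rule set_integrable_subset) auto
    then have ig: "integrable lborel (\<lambda>x. indicator (ball 0 r) x * norm (D x) powr q)" by (simp add: set_integrable_def)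
    have iT2: "integrable lborel (\<lambda>x. p * (\<delta> * (norm (D x) * ?\<eta> x) powr p + \<delta> powr (1 - p) * norm (F x) powr p))"
      by (intro integrable_mult_right Bochner_Integration.integrable_add cac(1) \<psi>(8))
    have pt: "\<bar>?h1 x - ?h2 x\<bar> \<le> ?T x" if x: "norm x \<noteq> r" for x
    proof (cases "r < norm x")
      case True
      then show ?thesis using \<psi>1 F0 p \<delta> by (simp add: mult_nonneg_nonneg)
    next
      case False
      then have xr: "norm x < r" using x by simp
      then have e: "\<phi> x = 1" "E x = 0" using \<phi>(2,5) [of x] r by auto
      have p1: "0 \<le> \<psi> x powr p" "\<psi> x powr p \<le> 1" using \<psi>(2,3) [of x] p powr_mono2 [of p "\<psi> x" 1] by auto
      have "?h1 x - ?h2 x = norm (D x) powr q * (1 - \<psi> x powr p) - p * \<psi> x powr (p - 1) * (flux p (D x) \<bullet> F x)"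
        using e by (simp add: algebra_simps)
      also have "\<bar>\<dots>\<bar> \<le> \<bar>norm (D x) powr q * (1 - \<psi> x powr p)\<bar> + \<bar>p * \<psi> x powr (p - 1) * (flux p (D x) \<bullet> F x)\<bar>"
        by (rule abs_triangle_ineq4)
      also have "\<bar>norm (D x) powr q * (1 - \<psi> x powr p)\<bar> \<le> norm (D x) powr q"
        using p1 by (simp add: abs_mult mult_left_le)
      also have "\<bar>p * \<psi> x powr (p - 1) * (flux p (D x) \<bullet> F x)\<bar> = p * \<psi> x powr (p - 1) * \<bar>flux p (D x) \<bullet> F x\<bar>"
        using p by (simp add: abs_mult)
      also have "\<bar>flux p (D x) \<bullet> F x\<bar> \<le> norm (D x) powr (p - 1) * norm (F x)"
        using Cauchy_Schwarz_ineq2 [of "flux p (D x)" "F x"] by (simp add: norm_flux)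
      also have "p * \<psi> x powr (p - 1) * (norm (D x) powr (p - 1) * norm (F x)) = p * ((norm (D x) * \<psi> x) powr (p - 1) * norm (F x))"
        using \<psi>(2) by (simp add: powr_mult)
      also have "(norm (D x) * \<psi> x) powr (p - 1) * norm (F x) \<le> \<delta> * (norm (D x) * \<psi> x) powr p + \<delta> powr (1 - p) * norm (F x) powr p"
        by (rule young_simple) (use p \<psi>(2) \<delta> in auto)
      finally show ?thesis using xr e p by (simp add: mult_left_mono)
    qed
    \<comment> \<open>The sphere |x| = r, left out of the pointwise estimate, is a null set.\<close>
    have "AE x in lborel. norm (x::'a) \<noteq> r"
    proof -
      have "negligible (sphere (0::'a) r)" by (rule negligible_sphere)
      then have "sphere (0::'a) r \<in> null_sets lebesgue" by (simp only: negligible_iff_null_sets)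
      from AE_not_in [OF this]
      have "AE x in lborel. x \<notin> sphere (0::'a) r"
        by (simp only: AE_completion_iff)
      then show ?thesis by simp
    qed
    then have ae: "AE x in lborel. \<bar>?h1 x - ?h2 x\<bar> \<le> ?T x" by eventually_elim (rule pt)
    have "\<bar>m\<bar> \<le> (LINT x|lborel. \<bar>?h1 x - ?h2 x\<bar>)" unfolding m by (rule integral_abs_bound)
    also have "\<dots> \<le> integral\<^sup>L lborel ?T"
      by (rule integral_mono_AE [OF _ _ ae]) (intro integrable_abs Bochner_Integration.integrable_diff Bochner_Integration.integrable_add i1 i2 ig iT2)+
    also have "\<dots> = (LINT x|lborel. indicator (ball 0 r) x * norm (D x) powr q) +
        p * (\<delta> * (LINT x|lborel. (norm (D x) * ?\<eta> x) powr p) + \<delta> powr (1 - p) * (LINT x|lborel. norm (F x) powr p))"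
      using ig iT2 cac(1) \<psi>(8) by (simp add: Bochner_Integration.integral_add)
    also have "\<dots> \<le> (LINT x|lborel. indicator (ball 0 r) x * norm (D x) powr q) + p * (\<delta> * C + \<delta> powr (1 - p) * \<epsilon>)"
      using en \<psi>(9) \<delta> p by (intro add_mono mult_left_mono) auto
    finally show ?thesis .
  qed
  have ev: "\<forall>\<^sub>F t in at_right 0. t \<in> {0<..<b}" if "0 < b" for b :: real
    by (rule eventually_at_right_real [OF that])
  have e1: "\<bar>m\<bar> \<le> (LINT x|lborel. indicator (ball 0 r) x * norm (D x) powr q) + p * (\<delta> * C)"
    if r: "0 < r" "r < \<rho> / 2" and \<delta>: "0 < \<delta>" for r \<delta>
  proof -
    let ?G = "LINT x|lborel. indicator (ball 0 r) x * norm (D x) powr q"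
    have "((\<lambda>\<epsilon>. ?G + p * (\<delta> * C + \<delta> powr (1 - p) * \<epsilon>)) \<longlongrightarrow> ?G + p * (\<delta> * C + \<delta> powr (1 - p) * 0)) (at_right 0)"
      by (intro tendsto_add tendsto_mult tendsto_const tendsto_ident_at)
    moreover have "\<forall>\<^sub>F \<epsilon> in at_right 0. \<bar>m\<bar> \<le> ?G + p * (\<delta> * C + \<delta> powr (1 - p) * \<epsilon>)"
      using ev [OF zero_less_one] by eventually_elim (rule est [OF r \<delta>], auto)
    ultimately have "\<bar>m\<bar> \<le> ?G + p * (\<delta> * C + \<delta> powr (1 - p) * 0)" by (intro tendsto_lowerbound) auto
    then show ?thesis by simp
  qed
  have e2: "\<bar>m\<bar> \<le> (LINT x|lborel. indicator (ball 0 r) x * norm (D x) powr q)" if r: "0 < r" "r < \<rho> / 2" for r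
  proof -
    let ?G = "LINT x|lborel. indicator (ball 0 r) x * norm (D x) powr q"
    have "((\<lambda>\<delta>. ?G + p * (\<delta> * C)) \<longlongrightarrow> ?G + p * (0 * C)) (at_right 0)"
      by (intro tendsto_add tendsto_mult tendsto_const tendsto_ident_at)
    moreover have "\<forall>\<^sub>F \<delta> in at_right 0. \<bar>m\<bar> \<le> ?G + p * (\<delta> * C)"
      using ev [OF zero_less_one] by eventually_elim (rule e1 [OF r], auto)
    ultimately have "\<bar>m\<bar> \<le> ?G + p * (0 * C)" by (intro tendsto_lowerbound) auto
    then show ?thesis by simp
  qed
  have "set_integrable lborel (cball 0 \<rho>) (\<lambda>x. norm (D x) powr q)"
    using L(2) \<Omega>(2) unfolding L1_loc_def by auto
  then have "set_integrable lborel (ball 0 \<rho>) (\<lambda>x. norm (D x) powr q)" by (rule set_integrable_subset) auto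
  from small_ball_integral [OF this \<rho>]
  have "((\<lambda>r. LINT x|lborel. indicator (ball 0 r) x * norm (D x) powr q) \<longlongrightarrow> 0) (at_right 0)" .
  moreover have "\<forall>\<^sub>F r in at_right 0. \<bar>m\<bar> \<le> (LINT x|lborel. indicator (ball 0 r) x * norm (D x) powr q)"
    using ev [of "\<rho> / 2"] \<rho> by (auto elim!: eventually_mono intro: e2)
  ultimately have "\<bar>m\<bar> \<le> 0" by (intro tendsto_lowerbound) auto
  then show ?thesis by simp
qed

section \<open>Mollification\<close>

lemma GDERIV_cmult: "GDERIV f x :> D \<Longrightarrow> GDERIV (\<lambda>x. c * f x) x :> c *\<^sub>R D"
  unfolding gderiv_def using has_derivative_mult_right [of f "\<lambda>h. h \<bullet> D" "at x" c] by simp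

text \<open>The classical exp(-1/t), with powers of 1/t in front so that the family is closed under
  differentiation up to linear combinations.\<close>

definition exp_hump :: "nat \<Rightarrow> real \<Rightarrow> real" where
  "exp_hump m t = (if 0 < t then inverse t ^ m * exp (- inverse t) else 0)"

lemma exp_hump_at_0: "((exp_hump m) \<longlongrightarrow> 0) (at 0)"
proof -
  have "((\<lambda>x::real. x ^ m / exp x) \<longlongrightarrow> 0) at_top" by (rule tendsto_power_div_exp_0)
  then have "((\<lambda>t::real. inverse t ^ m / exp (inverse t)) \<longlongrightarrow> 0) (at_right 0)"
    by (rule filterlim_compose [OF _ filterlim_inverse_at_top_right])
  moreover have "\<forall>\<^sub>F t in at_right 0. exp_hump m t = inverse t ^ m / exp (inverse t)"
    using eventually_at_right_less [of 0] by eventually_elim (simp add: exp_hump_def exp_minus divide_inverse)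
  ultimately have r: "((exp_hump m) \<longlongrightarrow> 0) (at_right 0)"
    by (subst filterlim_cong [OF refl refl]) auto
  have "\<forall>\<^sub>F t in at_left 0. exp_hump m t = 0"
    unfolding eventually_at by (intro exI [of _ 1]) (auto simp: exp_hump_def)
  then have "((exp_hump m) \<longlongrightarrow> 0) (at_left 0)" by (rule tendsto_eventually)
  with r show ?thesis by (simp add: filterlim_at_split)
qed

lemma DERIV_exp_hump:
  "(exp_hump m has_real_derivative exp_hump (m + 2) t - real m * exp_hump (m + 1) t) (at t)"
proof -
  consider "t < 0" | "t = 0" | "0 < t" by linarith
  then show ?thesis
  proof cases
    case 1
    have "((\<lambda>_. 0) has_real_derivative 0) (at t)" by simp
    then have "(exp_hump m has_real_derivative 0) (at t)"
      by (rule has_field_derivative_transform_within_open [where S = "{..<0}"]) (use 1 in \<open>auto simp: exp_hump_def\<close>)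
    then show ?thesis using 1 by (simp add: exp_hump_def)
  next
    case 2
    have "\<forall>\<^sub>F h in at 0. exp_hump (m + 1) h = (exp_hump m (0 + h) - exp_hump m 0) / h"
      by (intro always_eventually) (auto simp: exp_hump_def field_simps)
    then have "((\<lambda>h. (exp_hump m (0 + h) - exp_hump m 0) / h) \<longlongrightarrow> 0) (at 0)"
      by (rule Lim_transform_eventually [OF exp_hump_at_0])
    then show ?thesis using 2 by (simp add: DERIV_def exp_hump_def)
  next
    case 3
    have "((\<lambda>t. inverse t ^ m * exp (- inverse t)) has_real_derivative
        inverse t ^ m * (exp (- inverse t) * (inverse t * inverse t)) + (real m * inverse t ^ (m - 1) * - (inverse t * inverse t)) * exp (- inverse t)) (at t)"
      using 3 by (auto intro!: derivative_eq_intros simp: algebra_simps)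
    moreover have "inverse t ^ m * (exp (- inverse t) * (inverse t * inverse t)) + (real m * inverse t ^ (m - 1) * - (inverse t * inverse t)) * exp (- inverse t)
        = exp_hump (m + 2) t - real m * exp_hump (m + 1) t"
      using 3 by (cases m) (simp_all add: exp_hump_def algebra_simps)
    ultimately have "((\<lambda>t. inverse t ^ m * exp (- inverse t)) has_real_derivative exp_hump (m + 2) t - real m * exp_hump (m + 1) t) (at t)"
      by (simp only:)
    then show ?thesis
      by (rule has_field_derivative_transform_within_open [where S = "{0<..}"]) (use 3 in \<open>auto simp: exp_hump_def\<close>)
  qed
qed

text \<open>A class of functions supported in the ball of radius \<open>\<delta>\<close> and closed under partial derivatives.\<close>

inductive bump :: "real \<Rightarrow> ('a::euclidean_space \<Rightarrow> real) \<Rightarrow> bool" for \<delta> where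
  hump: "bump \<delta> (\<lambda>x. exp_hump m (\<delta>\<^sup>2 - x \<bullet> x))"
| scale: "bump \<delta> f \<Longrightarrow> bump \<delta> (\<lambda>x. c * f x)"
| coord: "bump \<delta> f \<Longrightarrow> bump \<delta> (\<lambda>x. (x \<bullet> a) * f x)"
| add: "bump \<delta> f \<Longrightarrow> bump \<delta> g \<Longrightarrow> bump \<delta> (\<lambda>x. f x + g x)"

lemma bump_off: "bump \<delta> f \<Longrightarrow> 0 \<le> \<delta> \<Longrightarrow> \<delta> \<le> norm x \<Longrightarrow> f x = 0"
proof (induction rule: bump.induct)
  case (hump m)
  then have "\<delta>\<^sup>2 \<le> x \<bullet> x" by (simp add: power_mono dot_square_norm)
  then show ?case by (simp add: exp_hump_def)
qed auto

lemma bump_deriv: "bump \<delta> f \<Longrightarrow> \<exists>D. (\<forall>x. GDERIV f x :> D x) \<and> (\<forall>e. bump \<delta> (\<lambda>x. D x \<bullet> e))"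
proof (induction rule: bump.induct)
  case (hump m)
  let ?h = "\<lambda>x::'a. exp_hump (m + 2) (\<delta>\<^sup>2 - x \<bullet> x) - real m * exp_hump (m + 1) (\<delta>\<^sup>2 - x \<bullet> x)"
  show ?case
  proof (intro exI conjI allI)
    fix x :: 'a
    have "GDERIV (\<lambda>x. \<delta>\<^sup>2 - x \<bullet> x) x :> - 2 *\<^sub>R x"
      unfolding gderiv_def by (auto intro!: derivative_eq_intros simp: inner_commute)
    then show "GDERIV (\<lambda>x. exp_hump m (\<delta>\<^sup>2 - x \<bullet> x)) x :> ?h x *\<^sub>R (- 2 *\<^sub>R x)"
      by (rule GDERIV_DERIV_compose) (rule DERIV_exp_hump)
  next
    fix e :: 'a
    have "bump \<delta> (\<lambda>x. (x \<bullet> e) * ((- 2) * exp_hump (m + 2) (\<delta>\<^sup>2 - x \<bullet> x) + (2 * real m) * exp_hump (m + 1) (\<delta>\<^sup>2 - x \<bullet> x)))"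
      by (intro bump.intros)
    moreover have "(?h x *\<^sub>R (- 2 *\<^sub>R x)) \<bullet> e = (x \<bullet> e) * ((- 2) * exp_hump (m + 2) (\<delta>\<^sup>2 - x \<bullet> x) + (2 * real m) * exp_hump (m + 1) (\<delta>\<^sup>2 - x \<bullet> x))" for x
      by (simp add: algebra_simps)
    ultimately show "bump \<delta> (\<lambda>x. (?h x *\<^sub>R (- 2 *\<^sub>R x)) \<bullet> e)" by (simp only:)
  qed
next
  case (scale f c)
  then obtain D where D: "\<And>x. GDERIV f x :> D x" "\<And>e. bump \<delta> (\<lambda>x. D x \<bullet> e)" by blast
  show ?case
  proof (intro exI conjI allI)
    show "GDERIV (\<lambda>x. c * f x) x :> c *\<^sub>R D x" for x
      by (rule GDERIV_cmult [OF D(1)])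
    show "bump \<delta> (\<lambda>x. (c *\<^sub>R D x) \<bullet> e)" for e using bump.scale [OF D(2)] by simp
  qed
next
  case (coord f a)
  then obtain D where D: "\<And>x. GDERIV f x :> D x" "\<And>e. bump \<delta> (\<lambda>x. D x \<bullet> e)" by blast
  show ?case
  proof (intro exI conjI allI)
    show "GDERIV (\<lambda>x. (x \<bullet> a) * f x) x :> (x \<bullet> a) *\<^sub>R D x + f x *\<^sub>R a" for x
      using D(1) [of x] unfolding gderiv_def by (auto intro!: derivative_eq_intros simp: inner_add_right algebra_simps)
    show "bump \<delta> (\<lambda>x. ((x \<bullet> a) *\<^sub>R D x + f x *\<^sub>R a) \<bullet> e)" for e
      using bump.add [OF bump.coord [OF D(2) [of e], of a] bump.scale [OF coord(1), of "a \<bullet> e"]]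
      by (simp add: inner_add_left mult.commute)
  qed
next
  case (add f g)
  then obtain D E where D: "\<And>x. GDERIV f x :> D x" "\<And>e. bump \<delta> (\<lambda>x. D x \<bullet> e)"
    and E: "\<And>x. GDERIV g x :> E x" "\<And>e. bump \<delta> (\<lambda>x. E x \<bullet> e)" by blast
  show ?case
  proof (intro exI conjI allI)
    show "GDERIV (\<lambda>x. f x + g x) x :> D x + E x" for x by (rule GDERIV_add [OF D(1) E(1)])
    show "bump \<delta> (\<lambda>x. (D x + E x) \<bullet> e)" for e
      using bump.add [OF D(2) E(2), of e e] by (simp add: inner_add_left)
  qed
qed

lemma bump_C1c:
  fixes f :: "'a::euclidean_space \<Rightarrow> real"
  assumes f: "bump \<delta> f" and \<delta>: "0 \<le> \<delta>"
  obtains D where "C1c UNIV f D" "\<And>e. bump \<delta> (\<lambda>x. D x \<bullet> e)"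
proof -
  obtain D where D: "\<And>x. GDERIV f x :> D x" "\<And>e. bump \<delta> (\<lambda>x. D x \<bullet> e)" using bump_deriv [OF f] by blast
  have "continuous_on UNIV (\<lambda>x. D x \<bullet> e)" for e
  proof -
    obtain E where "\<And>x. GDERIV (\<lambda>x. D x \<bullet> e) x :> E x" using bump_deriv [OF D(2)] by blast
    then show ?thesis by (intro continuous_at_imp_continuous_on ballI GDERIV_isCont)
  qed
  then have "continuous_on UNIV D" using continuous_on_componentwise [of UNIV D] by blast
  then have "C1_on UNIV f D" using D(1) by (simp add: C1_on_def)
  then have "C1c UNIV f D"
    unfolding C1c_def using bump_off [OF f \<delta>] by (intro conjI exI [of _ "cball 0 \<delta>"]) auto
  then show thesis using D(2) by (rule that)
qed

section \<open>Convolution and approximation of C1 test functions\<close>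

lemma lint_norm_bound:
  fixes f :: "'a \<Rightarrow> 'b::{banach, second_countable_topology}"
  assumes "integrable M f" "integrable M g" "\<And>x. norm (f x) \<le> g x"
  shows "norm (integral\<^sup>L M f) \<le> integral\<^sup>L M g"
  using Bochner_Integration.integral_norm_bound [of M f]
    Bochner_Integration.integral_mono [OF integrable_norm [OF assms(1)] assms(2,3)] by linarith

text \<open>The roles are asymmetric: the first argument is the C1 function to be smoothed, the
  second the bump, on which all derivatives fall.\<close>

definition convolve :: "('a::euclidean_space \<Rightarrow> real) \<Rightarrow> ('a \<Rightarrow> 'b::euclidean_space) \<Rightarrow> 'a \<Rightarrow> 'b" where
  "convolve \<phi> f x = (LINT y|lborel. \<phi> y *\<^sub>R f (x - y))"

lemma convolve_integrable:
  fixes f :: "'a::euclidean_space \<Rightarrow> 'b::euclidean_space"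
  assumes \<phi>: "C1c UNIV \<phi> E" and f: "continuous_on UNIV f"
  shows "integrable lborel (\<lambda>y. \<phi> y *\<^sub>R f (x - y))"
proof -
  obtain K where K: "compact K" "\<And>x. x \<notin> K \<Longrightarrow> \<phi> x = 0" "continuous_on UNIV \<phi>"
    by (rule C1cE [OF \<phi>]) blast
  have "continuous_on UNIV (\<lambda>y. f (x - y))"
    by (rule continuous_on_compose2 [OF f]) (auto intro: continuous_intros)
  then have "continuous_on K (\<lambda>y. \<phi> y *\<^sub>R f (x - y))"
    using K(3) by (intro continuous_intros) (auto intro: continuous_on_subset)
  then show ?thesis using K(2) by (intro integrable_compact_support [OF K(1)]) auto
qed

lemma convolve_deriv:
  fixes f :: "'a::euclidean_space \<Rightarrow> real"
  assumes \<phi>: "C1c UNIV \<phi> E" and f: "C1c UNIV f D"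
  shows "GDERIV (convolve \<phi> f) x :> convolve \<phi> D x"
proof -
  have cf: "continuous_on UNIV f" "continuous_on UNIV D" using f by (auto elim: C1cE)
  have i\<phi>: "integrable lborel (\<lambda>y. \<bar>\<phi> y\<bar>)"
    using convolve_integrable [OF \<phi>, of "\<lambda>_. 1::real" 0] by simp
  define I where "I = (LINT y|lborel. \<bar>\<phi> y\<bar>)"
  have I: "0 \<le> I" by (simp add: I_def)
  have "((\<lambda>h. h \<bullet> convolve \<phi> D x) has_derivative (\<lambda>h. h \<bullet> convolve \<phi> D x)) (at 0)"
    by (auto intro!: derivative_eq_intros)
  have "(convolve \<phi> f has_derivative (\<lambda>h. h \<bullet> convolve \<phi> D x)) (at x)"
    unfolding has_derivative_at_alt
  proof (intro conjI allI impI)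
    show "bounded_linear (\<lambda>h. h \<bullet> convolve \<phi> D x)" by (rule bounded_linear_inner_left)
    fix e :: real assume e: "0 < e"
    obtain d where d: "0 < d" "\<And>x h. norm h < d \<Longrightarrow> \<bar>f (x + h) - f x - h \<bullet> D x\<bar> \<le> e / (I + 1) * norm h"
      using C1c_uniform_diff [OF f, of "e / (I + 1)"] e I by auto
    have "norm (convolve \<phi> f y - convolve \<phi> f x - (y - x) \<bullet> convolve \<phi> D x) \<le> e * norm (y - x)" if y: "norm (y - x) < d" for y
    proof -
      let ?R = "\<lambda>z. \<phi> z * (f (y - z) - f (x - z) - (y - x) \<bullet> D (x - z))"
      have i1: "integrable lborel (\<lambda>z. \<phi> z * f (y - z))" for y using convolve_integrable [OF \<phi> cf(1)] by simp
      have i2: "integrable lborel (\<lambda>z. \<phi> z *\<^sub>R D (x - z))" by (rule convolve_integrable [OF \<phi> cf(2)])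
      have i3: "integrable lborel (\<lambda>z. (y - x) \<bullet> (\<phi> z *\<^sub>R D (x - z)))" using i2 by (rule integrable_inner_right)
      have eq: "?R z = \<phi> z * f (y - z) - \<phi> z * f (x - z) - (y - x) \<bullet> (\<phi> z *\<^sub>R D (x - z))" for z
        by (simp add: algebra_simps)
      have iR: "integrable lborel ?R"
        unfolding eq by (intro Bochner_Integration.integrable_diff i1 i3)
      have "convolve \<phi> f y - convolve \<phi> f x - (y - x) \<bullet> convolve \<phi> D x = integral\<^sup>L lborel ?R"
        unfolding eq convolve_def
        by (subst Bochner_Integration.integral_diff, intro Bochner_Integration.integrable_diff i1, rule i3,
            subst Bochner_Integration.integral_diff, rule i1, rule i1)
           (simp add: integral_inner_right [OF i2, symmetric] del: inner_scaleR_right)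
      also have "norm \<dots> \<le> (LINT z|lborel. \<bar>\<phi> z\<bar> * (e / (I + 1) * norm (y - x)))"
      proof (rule lint_norm_bound [OF iR])
        show "integrable lborel (\<lambda>z. \<bar>\<phi> z\<bar> * (e / (I + 1) * norm (y - x)))" using i\<phi> by (rule integrable_mult_left)
        fix z
        have "\<bar>f ((x - z) + (y - x)) - f (x - z) - (y - x) \<bullet> D (x - z)\<bar> \<le> e / (I + 1) * norm (y - x)"
          by (rule d(2) [OF y])
        moreover have "(x - z) + (y - x) = y - z" by simp
        ultimately have "\<bar>f (y - z) - f (x - z) - (y - x) \<bullet> D (x - z)\<bar> \<le> e / (I + 1) * norm (y - x)" by (simp only:)
        then show "norm (?R z) \<le> \<bar>\<phi> z\<bar> * (e / (I + 1) * norm (y - x))"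
          by (simp only: real_norm_def abs_mult) (rule mult_left_mono, auto)
      qed
      also have "\<dots> = I * (e / (I + 1) * norm (y - x))" by (simp add: I_def)
      also have "\<dots> = I / (I + 1) * (e * norm (y - x))" by simp
      also have "\<dots> \<le> 1 * (e * norm (y - x))" using I e by (intro mult_right_mono) auto
      finally show ?thesis by simp
    qed
    then show "\<exists>d>0. \<forall>y. norm (y - x) < d \<longrightarrow> norm (convolve \<phi> f y - convolve \<phi> f x - (y - x) \<bullet> convolve \<phi> D x) \<le> e * norm (y - x)"
      using d(1) by blast
  qed
  then show ?thesis by (simp add: gderiv_def)
qed

lemma convolve_smooth:
  fixes f :: "'a::euclidean_space \<Rightarrow> real"
  assumes \<phi>: "C1c UNIV \<phi> E" and \<delta>: "0 \<le> \<delta>"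
  shows "bump \<delta> f \<Longrightarrow> C_k_on k UNIV (\<lambda>x. c * convolve \<phi> f x)"
proof (induction k arbitrary: f)
  case (0 f)
  obtain D where "C1c UNIV f D" using bump_C1c [OF 0 \<delta>] by blast
  then have "isCont (convolve \<phi> f) x" for x using convolve_deriv [OF \<phi>] GDERIV_isCont by blast
  then show ?case by (auto intro!: continuous_intros continuous_at_imp_continuous_on)
next
  case (Suc k f)
  obtain D where D: "C1c UNIV f D" "\<And>e. bump \<delta> (\<lambda>x. D x \<bullet> e)" using bump_C1c [OF Suc.prems \<delta>] by blast
  have cD: "continuous_on UNIV D" using D(1) by (auto elim: C1cE)
  have g: "GDERIV (\<lambda>x. c * convolve \<phi> f x) x :> c *\<^sub>R convolve \<phi> D x" for x
    by (rule GDERIV_cmult [OF convolve_deriv [OF \<phi> D(1)]])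
  have "convolve \<phi> D x \<bullet> e = convolve \<phi> (\<lambda>x. D x \<bullet> e) x" for x e
    using integral_inner_left [OF convolve_integrable [OF \<phi> cD], of x e] by (simp add: convolve_def)
  then have e: "(\<lambda>x. grad (\<lambda>x. c * convolve \<phi> f x) x \<bullet> e) = (\<lambda>x. c * convolve \<phi> (\<lambda>x. D x \<bullet> e) x)" for e
    using grad_eqI [OF g] by (intro ext) simp
  have "(\<lambda>x. c * convolve \<phi> f x) differentiable (at x)" for x
    using g [of x] unfolding gderiv_def differentiable_def by blast
  then show ?case using Suc.IH [OF D(2)] unfolding C_k_on.simps e by blast
qed

text \<open>Smoothness needs the derivatives on the bump, but the gradient also has to approximate
  E; one integration by parts moves the first derivative onto \<phi>.\<close>

lemma convolve_parts:
  fixes f :: "'a::euclidean_space \<Rightarrow> real"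
  assumes \<phi>: "C1c UNIV \<phi> E" and f: "C1c UNIV f D"
  shows "convolve \<phi> D x = (LINT y|lborel. f (x - y) *\<^sub>R E y)"
proof -
  have cf: "continuous_on UNIV f" "continuous_on UNIV D" using f by (auto elim: C1cE)
  have "C1_on UNIV (\<lambda>y. f (x - y)) (\<lambda>y. - D (x - y))"
    unfolding C1_on_def
  proof (intro conjI ballI)
    fix y
    have "(f has_derivative (\<lambda>h. h \<bullet> D (x - y))) (at (x - y))" using f by (simp add: C1c_def C1_on_def gderiv_def)
    then have "((\<lambda>y. f (x - y)) has_derivative (\<lambda>h. (- h) \<bullet> D (x - y))) (at y)"
      by (rule has_derivative_compose [rotated]) (auto intro!: derivative_eq_intros)
    then show "GDERIV (\<lambda>y. f (x - y)) y :> - D (x - y)" by (simp add: gderiv_def)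
    show "continuous_on UNIV (\<lambda>y. - D (x - y))"
      by (intro continuous_on_minus continuous_on_compose2 [OF cf(2)] continuous_intros) auto
  qed
  from C1c_mult [OF \<phi> this]
  have C: "C1c UNIV (\<lambda>y. f (x - y) * \<phi> y) (\<lambda>y. f (x - y) *\<^sub>R E y + \<phi> y *\<^sub>R - D (x - y))" .
  have i1: "integrable lborel (\<lambda>y. \<phi> y *\<^sub>R D (x - y))" by (rule convolve_integrable [OF \<phi> cf(2)])
  obtain K where K: "compact K" "\<And>x. x \<notin> K \<Longrightarrow> E x = 0" "continuous_on UNIV E"
    by (rule C1cE [OF \<phi>]) blast
  have "continuous_on UNIV (\<lambda>y. f (x - y))"
    by (rule continuous_on_compose2 [OF cf(1)]) (auto intro: continuous_intros)
  then have "continuous_on K (\<lambda>y. f (x - y) *\<^sub>R E y)"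
    using K(3) by (intro continuous_intros) (auto intro: continuous_on_subset)
  then have i2: "integrable lborel (\<lambda>y. f (x - y) *\<^sub>R E y)" using K(2) by (intro integrable_compact_support [OF K(1)]) auto
  have "(LINT y|lborel. f (x - y) *\<^sub>R E y) \<bullet> e = convolve \<phi> D x \<bullet> e" for e
  proof -
    have j: "integrable lborel (\<lambda>y. (f (x - y) *\<^sub>R E y) \<bullet> e)" "integrable lborel (\<lambda>y. (\<phi> y *\<^sub>R D (x - y)) \<bullet> e)"
      by (rule integrable_inner_left, rule i2) (rule integrable_inner_left, rule i1)
    have "0 = (LINT y|lborel. (f (x - y) *\<^sub>R E y) \<bullet> e - (\<phi> y *\<^sub>R D (x - y)) \<bullet> e)"
      using C1c_integral_partial [OF C, of e] by (simp add: inner_add_left inner_diff_left)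
    also have "\<dots> = (LINT y|lborel. (f (x - y) *\<^sub>R E y) \<bullet> e) - (LINT y|lborel. (\<phi> y *\<^sub>R D (x - y)) \<bullet> e)"
      by (rule Bochner_Integration.integral_diff [OF j])
    also have "\<dots> = (LINT y|lborel. f (x - y) *\<^sub>R E y) \<bullet> e - convolve \<phi> D x \<bullet> e"
      unfolding convolve_def by (simp only: integral_inner_left [OF i1] integral_inner_left [OF i2])
    finally show ?thesis by simp
  qed
  then show ?thesis by (metis vector_eq_rdot)
qed

lemma mollifier_close:
  fixes \<phi> :: "'a::euclidean_space \<Rightarrow> 'b::euclidean_space"
  assumes w: "integrable lborel w" "\<And>y. 0 \<le> w y" "(LINT y|lborel. w y) = 1"
    and iw: "integrable lborel (\<lambda>y. w y *\<^sub>R \<phi> y)" and close: "\<And>y. w y \<noteq> 0 \<Longrightarrow> norm (\<phi> y - c) \<le> \<epsilon>"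
  shows "norm ((LINT y|lborel. w y *\<^sub>R \<phi> y) - c) \<le> \<epsilon>"
proof -
  have iwc: "integrable lborel (\<lambda>y. w y *\<^sub>R c)" by (rule integrable_scaleR_left) (use w in auto)
  have "(LINT y|lborel. w y *\<^sub>R \<phi> y) - c = (LINT y|lborel. w y *\<^sub>R \<phi> y) - (LINT y|lborel. w y *\<^sub>R c)"
    using w by simp
  also have "\<dots> = (LINT y|lborel. w y *\<^sub>R \<phi> y - w y *\<^sub>R c)" by (rule Bochner_Integration.integral_diff [OF iw iwc, symmetric])
  also have "norm \<dots> \<le> (LINT y|lborel. w y * \<epsilon>)"
  proof (rule lint_norm_bound)
    show "norm (w y *\<^sub>R \<phi> y - w y *\<^sub>R c) \<le> w y * \<epsilon>" for y
      using close [of y] w(2) [of y] by (cases "w y = 0") (auto simp: scaleR_diff_right [symmetric] mult_left_mono)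
  qed (use iw iwc w in auto)
  also have "\<dots> = \<epsilon>" using w by simp
  finally show ?thesis .
qed

text \<open>The compact set is fixed before \<epsilon>; uniform closeness of function and gradient
  then suffices against locally integrable coefficients.\<close>

lemma mollify:
  fixes \<phi> :: "'a::euclidean_space \<Rightarrow> real"
  assumes \<phi>: "C1c U \<phi> E" and U: "open U"
  obtains K where "compact K" "K \<subseteq> U" "\<And>x. x \<notin> K \<Longrightarrow> \<phi> x = 0 \<and> E x = 0"
    "\<And>\<epsilon>. 0 < \<epsilon> \<Longrightarrow> \<exists>\<psi>\<in>test_functions U. (\<forall>x. \<bar>\<psi> x - \<phi> x\<bar> \<le> \<epsilon> \<and> norm (grad \<psi> x - E x) \<le> \<epsilon>) \<and>
        (\<forall>x. x \<notin> K \<longrightarrow> \<psi> x = 0 \<and> grad \<psi> x = 0)"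
proof -
  obtain C where C: "compact C" "C \<subseteq> U" "\<And>x. x \<notin> C \<Longrightarrow> \<phi> x = 0" "\<And>x. x \<notin> C \<Longrightarrow> E x = 0"
    "continuous_on UNIV \<phi>" "continuous_on UNIV E"
    by (rule C1cE [OF \<phi>]) blast
  obtain d where d: "0 < d" "(\<Union>x\<in>C. cball x d) \<subseteq> U"
    using compact_subset_open_imp_cball_epsilon_subset [OF C(1) U C(2)] by blast
  \<comment> \<open>The closed d-neighbourhood of the support: bumps of radius at most d leave the
    mollified function inside it.\<close>
  define K where "K = {x + y |x y. x \<in> C \<and> y \<in> cball 0 d}"
  have K: "compact K" unfolding K_def by (rule compact_sums [OF C(1) compact_cball])
  have KI: "x \<in> K" if "y \<in> C" "norm (x - y) \<le> d" for x y
    unfolding K_def using that by (intro CollectI exI [of _ y] exI [of _ "x - y"]) auto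
  have KU: "K \<subseteq> U"
  proof
    fix z assume "z \<in> K"
    then obtain x y where z: "z = x + y" "x \<in> C" "norm y \<le> d" unfolding K_def by auto
    then have "z \<in> cball x d" by (simp add: dist_norm)
    then show "z \<in> U" using d(2) z(2) by blast
  qed
  have CK: "C \<subseteq> K" using KI d by force
  have \<phi>U: "C1c UNIV \<phi> E" by (rule C1c_mono [OF \<phi>]) auto
  show thesis
  proof (rule that [OF K KU])
    show "\<phi> x = 0 \<and> E x = 0" if "x \<notin> K" for x using C(3,4) CK that by blast
    fix \<epsilon> :: real assume \<epsilon>: "0 < \<epsilon>"
    obtain d1 where d1: "0 < d1" "\<And>x y. dist x y < d1 \<Longrightarrow> dist (\<phi> x) (\<phi> y) < \<epsilon>"
      using uniformly_continuous_compact_support [OF C(5,1,3)] \<epsilon> unfolding uniformly_continuous_on_def by (metis UNIV_I)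
    obtain d2 where d2: "0 < d2" "\<And>x y. dist x y < d2 \<Longrightarrow> dist (E x) (E y) < \<epsilon>"
      using uniformly_continuous_compact_support [OF C(6,1,4)] \<epsilon> unfolding uniformly_continuous_on_def by (metis UNIV_I)
    define \<delta> where "\<delta> = min d (min d1 d2)"
    have \<delta>: "0 < \<delta>" "\<delta> \<le> d" "\<delta> \<le> d1" "\<delta> \<le> d2" using d d1 d2 by (auto simp: \<delta>_def)
    define f where "f = (\<lambda>x::'a. exp_hump 0 (\<delta>\<^sup>2 - x \<bullet> x))"
    have bf: "bump \<delta> f" unfolding f_def by (rule bump.hump)
    obtain D where D: "C1c UNIV f D" by (rule bump_C1c [OF bf]) (use \<delta> in auto)
    have f0: "0 \<le> f x" for x by (simp add: f_def exp_hump_def)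
    have foff: "f x = 0" if "\<delta> \<le> norm x" for x using bump_off [OF bf _ that] \<delta> by simp
    have cf: "continuous_on UNIV f" using D by (auto elim: C1cE)
    have if0: "integrable lborel f"
      by (rule integrable_compact_support [of "cball 0 \<delta>"]) (auto intro: continuous_on_subset [OF cf] foff)
    define I where "I = (LINT x|lborel. f x)"
    have I: "0 < I"
      unfolding I_def
    proof (rule integral_pos_continuous [OF if0 f0, of 0])
      show "isCont f 0" using cf by (simp add: continuous_on_eq_continuous_at)
      show "0 < f 0" using \<delta> by (simp add: f_def exp_hump_def)
    qed
    have mf: "f \<in> borel_measurable borel" using borel_measurable_integrable [OF if0] by simp
    define w where "w = (\<lambda>x y. f (x - y) / I)"
    have sym: "f (x - y) = f (- x + y)" for x y
      by (simp add: f_def algebra_simps inner_commute)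
    have w1: "(LINT y|lborel. w x y) = 1" for x
      using lborel_integral_shift [OF mf, of "- x"] I unfolding w_def sym by (simp add: I_def)
    \<comment> \<open>Integrability is read off from the value 1, because a function that is not
      integrable has integral 0.\<close>
    have wi: "integrable lborel (w x)" for x
    proof (rule ccontr)
      assume "\<not> ?thesis"
      from not_integrable_integral_eq [OF this] w1 [of x] show False by simp
    qed
    have w0: "0 \<le> w x y" for x y using f0 I by (simp add: w_def)
    have wd: "norm (x - y) < \<delta>" if "w x y \<noteq> 0" for x y
      using that foff [of "x - y"] by (force simp: w_def)
    define \<psi> where "\<psi> = (\<lambda>x. (1 / I) * convolve \<phi> f x)"
    have \<psi>e: "\<psi> x = (LINT y|lborel. w x y *\<^sub>R \<phi> y)" for x
      unfolding \<psi>_def convolve_def by (subst integral_mult_right_zero [symmetric]) (simp add: w_def mult.commute)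
    have \<psi>d: "GDERIV \<psi> x :> (1 / I) *\<^sub>R convolve \<phi> D x" for x
      unfolding \<psi>_def by (rule GDERIV_cmult [OF convolve_deriv [OF \<phi>U D]])
    have g\<psi>: "grad \<psi> x = (LINT y|lborel. w x y *\<^sub>R E y)" for x
    proof -
      have "grad \<psi> x = (1 / I) *\<^sub>R (LINT y|lborel. f (x - y) *\<^sub>R E y)"
        using grad_eqI [OF \<psi>d] by (simp add: convolve_parts [OF \<phi>U D])
      then show ?thesis by (simp add: w_def flip: integral_scaleR_right)
    qed
    have cw: "continuous_on UNIV (w x)" for x
      unfolding w_def using I by (intro continuous_intros continuous_on_compose2 [OF cf]) auto
    have wK: "w x y = 0" if "x \<notin> K" "y \<in> C" for x y
      using wd [of x y] KI [OF that(2), of x] that(1) \<delta> by force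
    have off: "\<psi> x = 0" "grad \<psi> x = 0" if x: "x \<notin> K" for x
    proof -
      have "w x y *\<^sub>R \<phi> y = 0" "w x y *\<^sub>R E y = 0" for y
        using wK [OF x, of y] C(3,4) [of y] by (cases "y \<in> C"; simp)+
      then show "\<psi> x = 0" "grad \<psi> x = 0" by (simp_all only: \<psi>e g\<psi> integral_zero)
    qed
    have supp: "closure {x. \<psi> x \<noteq> 0} \<subseteq> K" using off K by (intro closure_minimal compact_imp_closed) auto
    have "C_k_on k UNIV \<psi>" for k unfolding \<psi>_def by (rule convolve_smooth [OF \<phi>U _ bf]) (use \<delta> in simp)
    then have "\<psi> \<in> test_functions U"
      unfolding test_functions_def using supp KU compact_Int_closed [OF K closed_closure, of "{x. \<psi> x \<noteq> 0}"]
      by (auto simp: Int_absorb1)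
    moreover have "\<bar>\<psi> x - \<phi> x\<bar> \<le> \<epsilon> \<and> norm (grad \<psi> x - E x) \<le> \<epsilon>" for x
    proof
      have "norm ((LINT y|lborel. w x y *\<^sub>R \<phi> y) - \<phi> x) \<le> \<epsilon>"
      proof (rule mollifier_close [OF wi w0 w1])
        show "integrable lborel (\<lambda>y. w x y *\<^sub>R \<phi> y)"
          by (rule integrable_compact_support [OF C(1)]) (use C(3) in \<open>auto intro!: continuous_intros continuous_on_subset [OF cw] continuous_on_subset [OF C(5)]\<close>)
        show "norm (\<phi> y - \<phi> x) \<le> \<epsilon>" if "w x y \<noteq> 0" for y
          using d1(2) [of y x] wd [OF that] \<delta> by (simp add: dist_norm norm_minus_commute)
      qed
      then show "\<bar>\<psi> x - \<phi> x\<bar> \<le> \<epsilon>" by (simp only: \<psi>e real_norm_def)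
      have "norm ((LINT y|lborel. w x y *\<^sub>R E y) - E x) \<le> \<epsilon>"
      proof (rule mollifier_close [OF wi w0 w1])
        show "integrable lborel (\<lambda>y. w x y *\<^sub>R E y)"
          by (rule integrable_compact_support [OF C(1)]) (use C(4) in \<open>auto intro!: continuous_intros continuous_on_subset [OF cw] continuous_on_subset [OF C(6)]\<close>)
        show "norm (E y - E x) \<le> \<epsilon>" if "w x y \<noteq> 0" for y
          using d2(2) [of y x] wd [OF that] \<delta> by (simp add: dist_norm norm_minus_commute)
      qed
      then show "norm (grad \<psi> x - E x) \<le> \<epsilon>" by (simp only: g\<psi>)
    qed
    ultimately show "\<exists>\<psi>\<in>test_functions U. (\<forall>x. \<bar>\<psi> x - \<phi> x\<bar> \<le> \<epsilon> \<and> norm (grad \<psi> x - E x) \<le> \<epsilon>) \<and> (\<forall>x. x \<notin> K \<longrightarrow> \<psi> x = 0 \<and> grad \<psi> x = 0)"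
      using off by blast
  qed
qed

section \<open>Equivalence of smooth and C1 test functions\<close>

lemma C_k_on_1_C1_on:
  fixes f :: "'a::euclidean_space \<Rightarrow> real"
  assumes "C_k_on 1 U f"
  shows "C1_on U f (grad f)"
proof -
  have f: "\<And>x. x \<in> U \<Longrightarrow> f differentiable (at x)" "\<And>e. e \<in> Basis \<Longrightarrow> continuous_on U (\<lambda>x. grad f x \<bullet> e)"
    using assms by (auto simp: One_nat_def)
  have "GDERIV f x :> grad f x" if x: "x \<in> U" for x
  proof -
    obtain f' where f': "(f has_derivative f') (at x)" using f(1) [OF x] by (auto simp: differentiable_def)
    interpret f': bounded_linear f' using f' by (rule has_derivative_bounded_linear)
    have "f' h = h \<bullet> (\<Sum>e\<in>Basis. f' e *\<^sub>R e)" for h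
    proof -
      have "f' h = f' (\<Sum>e\<in>Basis. (h \<bullet> e) *\<^sub>R e)" by (simp only: euclidean_representation)
      also have "\<dots> = (\<Sum>e\<in>Basis. (h \<bullet> e) * f' e)" by (simp add: f'.sum f'.scaleR)
      also have "\<dots> = h \<bullet> (\<Sum>e\<in>Basis. f' e *\<^sub>R e)" by (simp add: inner_sum_right mult.commute)
      finally show ?thesis .
    qed
    then have "f' = (\<lambda>h. h \<bullet> (\<Sum>e\<in>Basis. f' e *\<^sub>R e))" by (rule ext)
    with f' have G: "GDERIV f x :> (\<Sum>e\<in>Basis. f' e *\<^sub>R e)" unfolding gderiv_def by (rule back_subst)
    then show ?thesis by (simp only: grad_eqI [OF G])
  qed
  moreover have "continuous_on U (grad f)"
    using f(2) continuous_on_componentwise [of U "grad f"] by blast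
  ultimately show ?thesis by (simp add: C1_on_def)
qed

lemma test_function_C1c:
  assumes "\<phi> \<in> test_functions U"
  shows "C1c U \<phi> (grad \<phi>)"
proof -
  let ?K = "closure {x. \<phi> x \<noteq> 0}"
  from assms have a: "\<forall>k. C_k_on k UNIV \<phi>" "compact ?K" "?K \<subseteq> U"
    unfolding test_functions_def mem_Collect_eq by blast+
  from a(1) have "C1_on UNIV \<phi> (grad \<phi>)" by (intro C_k_on_1_C1_on) (rule spec)
  moreover have "\<forall>x. x \<notin> ?K \<longrightarrow> \<phi> x = 0"
    using closure_subset [of "{x. \<phi> x \<noteq> 0}"] by blast
  ultimately show ?thesis unfolding C1c_def using a(2,3) by blast
qed

lemma set_integral_C1c:
  assumes "C1c U \<phi> D"
  shows "(LINT x:U|lborel. F x \<bullet> D x + g x * \<phi> x) = (LINT x|lborel. F x \<bullet> D x + g x * \<phi> x)"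
proof -
  obtain K where "K \<subseteq> U" "\<And>x. x \<notin> K \<Longrightarrow> \<phi> x = 0" "\<And>x. x \<notin> K \<Longrightarrow> D x = 0" by (rule C1cE [OF assms]) blast
  then have "indicator U x *\<^sub>R (F x \<bullet> D x + g x * \<phi> x) = F x \<bullet> D x + g x * \<phi> x" for x
    by (cases "x \<in> U"; cases "x \<in> K") auto
  then show ?thesis by (simp only: set_lebesgue_integral_def)
qed

lemma weak_eq_imp_dist_eq: "weak_eq U F g m \<Longrightarrow> L1_loc U F \<Longrightarrow> L1_loc U g \<Longrightarrow> dist_eq U F g m"
  unfolding dist_eq_def
proof (intro conjI ballI)
  fix \<phi> assume W: "weak_eq U F g m" and \<phi>: "\<phi> \<in> test_functions U"
  note C = test_function_C1c [OF \<phi>]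
  show "(LINT x:U|lborel. F x \<bullet> grad \<phi> x + g x * \<phi> x) = m * \<phi> 0"
    unfolding set_integral_C1c [OF C] by (rule weak_eqD [OF W C])
qed

text \<open>Replacing a C1 test function by its mollification costs at most \<epsilon> times the
  integrals of |F| and |g| over one compact set, plus \<epsilon> |m| from the Dirac mass.\<close>

lemma dist_eq_imp_weak_eq:
  fixes F :: "'a::euclidean_space \<Rightarrow> 'a"
  assumes d: "dist_eq U F g m" and U: "open U"
  shows "weak_eq U F g m"
  unfolding weak_eq_def
proof (intro allI impI)
  fix \<phi> and E :: "'a \<Rightarrow> 'a" assume \<phi>: "C1c U \<phi> E"
  have L: "L1_loc U F" "L1_loc U g" using d by (auto simp: dist_eq_def)
  obtain K where K: "compact K" "K \<subseteq> U" "\<And>x. x \<notin> K \<Longrightarrow> \<phi> x = 0 \<and> E x = 0"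
    "\<And>\<epsilon>. 0 < \<epsilon> \<Longrightarrow> \<exists>\<psi>\<in>test_functions U. (\<forall>x. \<bar>\<psi> x - \<phi> x\<bar> \<le> \<epsilon> \<and> norm (grad \<psi> x - E x) \<le> \<epsilon>) \<and>
        (\<forall>x. x \<notin> K \<longrightarrow> \<psi> x = 0 \<and> grad \<psi> x = 0)"
    by (rule mollify [OF \<phi> U]) blast
  have iK: "integrable lborel (\<lambda>x. indicator K x *\<^sub>R F x)" "integrable lborel (\<lambda>x. indicator K x *\<^sub>R g x)"
    using L K(1,2) by (auto simp: L1_loc_def set_integrable_def)
  have iN: "integrable lborel (\<lambda>x. norm (indicator K x *\<^sub>R F x) + norm (indicator K x *\<^sub>R g x))"
    by (intro Bochner_Integration.integrable_add integrable_norm iK)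
  define M where "M = (LINT x|lborel. norm (indicator K x *\<^sub>R F x) + norm (indicator K x *\<^sub>R g x))"
  define V where "V = (LINT x|lborel. F x \<bullet> E x + g x * \<phi> x)"
  have est: "\<bar>V - m * \<phi> 0\<bar> \<le> \<epsilon> * (M + \<bar>m\<bar>)" if \<epsilon>: "0 < \<epsilon>" for \<epsilon>
  proof -
    obtain \<psi> where \<psi>: "\<psi> \<in> test_functions U" "\<And>x. \<bar>\<psi> x - \<phi> x\<bar> \<le> \<epsilon>" "\<And>x. norm (grad \<psi> x - E x) \<le> \<epsilon>"
      "\<And>x. x \<notin> K \<Longrightarrow> \<psi> x = 0" "\<And>x. x \<notin> K \<Longrightarrow> grad \<psi> x = 0" using K(4) [OF \<epsilon>] by blast
    note C = test_function_C1c [OF \<psi>(1)]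
    have W: "(LINT x|lborel. F x \<bullet> grad \<psi> x + g x * \<psi> x) = m * \<psi> 0"
      using d \<psi>(1) set_integral_C1c [OF C, of F g] by (simp add: dist_eq_def)
    have i1: "integrable lborel (\<lambda>x. F x \<bullet> E x + g x * \<phi> x)"
      by (intro Bochner_Integration.integrable_add L1_loc_integrable_mult [OF \<phi>] L)
    have i2: "integrable lborel (\<lambda>x. F x \<bullet> grad \<psi> x + g x * \<psi> x)"
      by (intro Bochner_Integration.integrable_add L1_loc_integrable_mult [OF C] L)
    have "V - m * \<psi> 0 = (LINT x|lborel. (F x \<bullet> E x + g x * \<phi> x) - (F x \<bullet> grad \<psi> x + g x * \<psi> x))"
      unfolding V_def W [symmetric] by (rule Bochner_Integration.integral_diff [OF i1 i2, symmetric])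
    also have "norm \<dots> \<le> (LINT x|lborel. \<epsilon> * (norm (indicator K x *\<^sub>R F x) + norm (indicator K x *\<^sub>R g x)))"
    proof (rule lint_norm_bound [OF Bochner_Integration.integrable_diff [OF i1 i2] integrable_mult_right [OF iN]])
      fix x
      show "norm ((F x \<bullet> E x + g x * \<phi> x) - (F x \<bullet> grad \<psi> x + g x * \<psi> x)) \<le> \<epsilon> * (norm (indicator K x *\<^sub>R F x) + norm (indicator K x *\<^sub>R g x))"
      proof (cases "x \<in> K")
        case False
        then show ?thesis using K(3) \<psi>(4,5) \<epsilon> by simp
      next
        case True
        have e: "(F x \<bullet> E x + g x * \<phi> x) - (F x \<bullet> grad \<psi> x + g x * \<psi> x) = - (F x \<bullet> (grad \<psi> x - E x)) - g x * (\<psi> x - \<phi> x)"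
          by (simp add: algebra_simps)
        have "\<bar>F x \<bullet> (grad \<psi> x - E x)\<bar> \<le> norm (F x) * \<epsilon>"
          using Cauchy_Schwarz_ineq2 [of "F x" "grad \<psi> x - E x"] mult_left_mono [OF \<psi>(3) norm_ge_zero] by (rule order_trans)
        moreover have "\<bar>g x * (\<psi> x - \<phi> x)\<bar> \<le> \<bar>g x\<bar> * \<epsilon>" unfolding abs_mult by (intro mult_left_mono \<psi>(2)) simp
        ultimately show ?thesis unfolding e using True by (simp add: algebra_simps)
      qed
    qed
    also have "\<dots> = \<epsilon> * M" by (simp add: M_def)
    finally have "\<bar>V - m * \<psi> 0\<bar> \<le> \<epsilon> * M" by simp
    moreover have "\<bar>m * \<psi> 0 - m * \<phi> 0\<bar> \<le> \<epsilon> * \<bar>m\<bar>"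
      using mult_left_mono [OF \<psi>(2) [of 0], of "\<bar>m\<bar>"] by (simp add: abs_mult [symmetric] right_diff_distrib mult.commute)
    ultimately show ?thesis by (simp add: distrib_left)
  qed
  have "\<bar>V - m * \<phi> 0\<bar> \<le> 0"
  proof (rule tendsto_lowerbound [OF _ _ trivial_limit_at_right_real])
    show "((\<lambda>\<epsilon>. \<epsilon> * (M + \<bar>m\<bar>)) \<longlongrightarrow> 0) (at_right 0)"
    proof -
      have "((\<lambda>\<epsilon>. \<epsilon> * (M + \<bar>m\<bar>)) \<longlongrightarrow> 0 * (M + \<bar>m\<bar>)) (at_right 0)"
        by (intro tendsto_mult tendsto_ident_at tendsto_const)
      then show ?thesis by simp
    qed
    show "\<forall>\<^sub>F \<epsilon> in at_right 0. \<bar>V - m * \<phi> 0\<bar> \<le> \<epsilon> * (M + \<bar>m\<bar>)"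
      using eventually_at_right_less [of 0] by eventually_elim (rule est)
  qed
  then show "(LINT x|lborel. F x \<bullet> E x + g x * \<phi> x) = m * \<phi> 0" by (simp add: V_def)
qed

section \<open>Classification\<close>

text \<open>The strict inequality for k pays for the logarithm when p = N, which any negative power
  of |x| dominates.\<close>

lemma mu_growth:
  assumes p: "1 < p" "p \<le> real DIM('a::euclidean_space)" and k: "(real DIM('a) - p) / (p - 1) < k"
  obtains C where "0 < C" "\<And>x::'a. 0 < norm x \<Longrightarrow> norm x \<le> 1 \<Longrightarrow> mu p x \<le> C * norm x powr (- k)"
proof (cases "p = real DIM('a)")
  case True
  then have k0: "0 < k" using k by simp
  show thesis
  proof (rule that [of "1 / k"])
    fix x :: 'a assume x: "0 < norm x" "norm x \<le> 1"
    have "ln (norm x powr (- k)) \<le> norm x powr (- k)" using x by (intro ln_bound) auto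
    then have "k * - ln (norm x) \<le> norm x powr (- k)" using x by (simp add: ln_powr)
    then have "- ln (norm x) \<le> norm x powr (- k) / k"
      using k0 by (simp add: pos_le_divide_eq mult.commute)
    then show "mu p x \<le> 1 / k * norm x powr (- k)" using True by (simp add: mu_def)
  qed (use k0 in simp)
next
  case False
  define c where "c = (p - 1) / (real DIM('a) - p)"
  have c: "0 < c" using p False by (simp add: c_def)
  show thesis
  proof (rule that [OF c])
    fix x :: 'a assume x: "0 < norm x" "norm x \<le> 1"
    have "(p - real DIM('a)) / (p - 1) = - ((real DIM('a) - p) / (p - 1))"
      by (metis minus_diff_eq minus_divide_left)
    then have "- k \<le> (p - real DIM('a)) / (p - 1)" using k by linarith
    then have "norm x powr ((p - real DIM('a)) / (p - 1)) \<le> norm x powr (- k)"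
      using x by (intro powr_mono') auto
    then show "mu p x \<le> c * norm x powr (- k)" using False c by (simp add: mu_def c_def [symmetric])
  qed
qed

text \<open>By homogeneity of the flux, c mu_p solves the equation without absorption and has mass
  \<open>cN * c powr (p - 1)\<close>. Both functions tend to infinity with ratio tending to 1, so
  \<open>mass_le\<close> applies in both directions.\<close>

lemma mass_of_weak_singularity:
  fixes u :: "'a::euclidean_space \<Rightarrow> real"
  assumes p: "1 < p" "p \<le> real DIM('a)" and \<Omega>: "open \<Omega>" "cball 0 \<rho> \<subseteq> \<Omega>" "0 < \<rho>" and u: "HJ_sol p q (\<Omega> - {0}) u D"
    and L: "L1_loc \<Omega> (\<lambda>x. flux p (D x))" "L1_loc \<Omega> (\<lambda>x. norm (D x) powr q)"
    and W: "weak_eq \<Omega> (\<lambda>x. flux p (D x)) (\<lambda>x. norm (D x) powr q) m"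
    and cN: "weak_eq (UNIV :: 'a set) (\<lambda>x. flux p (grad_mu p x)) (\<lambda>x. 0) cN"
    and c: "0 < c" and lim: "((\<lambda>x. u x / mu p x) \<longlongrightarrow> c) (at 0)"
  shows "m = cN * c powr (p - 1)"
proof -
  let ?v = "\<lambda>x::'a. c * mu p x" and ?E = "\<lambda>x::'a. c *\<^sub>R grad_mu p x"
  have sub: "ball 0 \<rho> \<subseteq> \<Omega>" "ball 0 \<rho> - {0} \<subseteq> \<Omega> - {0}" "ball (0::'a) \<rho> - {0} \<subseteq> - {0}"
    using \<Omega>(2) by auto
  have u1: "C1_on (ball 0 \<rho> - {0}) u D" using u sub(2) by (auto simp: HJ_sol_def intro: C1_on_subset)
  have v1: "C1_on (ball 0 \<rho> - {0}) ?v ?E" by (rule C1_on_subset [OF C1_on_cmult [OF C1_on_mu [OF p(1)]] sub(3)])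
  note W1 = weak_eq_subset [OF W sub(1)]
  have fl: "flux p (?E x) = c powr (p - 1) *\<^sub>R flux p (grad_mu p x)" for x by (rule flux_scale [OF c])
  have "weak_eq UNIV (\<lambda>x. flux p (?E x)) (\<lambda>x. 0) (c powr (p - 1) * cN)"
    using weak_eq_scale [OF cN, of "c powr (p - 1)"] unfolding fl by simp
  then have W2: "weak_eq (ball 0 \<rho>) (\<lambda>x. flux p (?E x)) (\<lambda>x. 0) (c powr (p - 1) * cN)"
    by (rule weak_eq_subset) simp
  have L1: "L1_loc (ball 0 \<rho>) (\<lambda>x. flux p (D x))" "L1_loc (ball 0 \<rho>) (\<lambda>x. norm (D x) powr q)"
    using L1_loc_subset [OF L(1) sub(1)] L1_loc_subset [OF L(2) sub(1)] .
  have "L1_loc (ball (0::'a) \<rho>) (\<lambda>x. flux p (grad_mu p x))" by (rule L1_loc_flux_mu [OF p(1)]) simp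
  then have L2: "L1_loc (ball 0 \<rho>) (\<lambda>x. flux p (?E x))"
    unfolding fl L1_loc_def by (auto intro: set_integrable_scaleR_right)
  have L0: "L1_loc (ball (0::'a) \<rho>) (\<lambda>x. 0 :: real)" by (simp add: L1_loc_def set_integrable_def)
  have mu: "filterlim (mu p :: 'a \<Rightarrow> real) at_top (at 0)" by (rule mu_at_0 [OF p])
  have mu0: "\<forall>\<^sub>F x in at (0::'a). 0 < mu p x" using mu by (simp add: filterlim_at_top_dense)
  have vlim: "filterlim ?v at_top (at 0)"
    by (rule filterlim_tendsto_pos_mult_at_top [OF tendsto_const c mu])
  have ulim: "filterlim u at_top (at 0)"
  proof -
    have "filterlim (\<lambda>x. u x / mu p x * mu p x) at_top (at 0)"
      by (rule filterlim_tendsto_pos_mult_at_top [OF lim c mu])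
    moreover have "\<forall>\<^sub>F x in at 0. u x / mu p x * mu p x = u x" using mu0 by eventually_elim simp
    ultimately show ?thesis by (rule filterlim_cong [OF refl refl, THEN iffD1, rotated])
  qed
  have r1: "((\<lambda>x. u x / ?v x) \<longlongrightarrow> 1) (at 0)"
    using tendsto_divide [OF lim tendsto_const, of c] c by (simp add: mult.commute)
  have r2: "((\<lambda>x. ?v x / u x) \<longlongrightarrow> 1) (at 0)"
    using tendsto_divide [OF tendsto_const lim, of c] c by simp
  have "m \<le> c powr (p - 1) * cN"
    by (rule mass_le [OF p(1) \<Omega>(3) u1 v1 W1 W2 _ _ L1 L2 L0 ulim vlim r1]) auto
  moreover have "c powr (p - 1) * cN \<le> m"
    by (rule mass_le [OF p(1) \<Omega>(3) v1 u1 W2 W1 _ _ L2 L0 L1 vlim ulim r2]) auto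
  ultimately show ?thesis by (simp add: mult.commute)
qed

lemma integral_cong_off_0:
  fixes f h :: "'a::euclidean_space \<Rightarrow> 'b::euclidean_space"
  assumes "\<And>x. x \<noteq> 0 \<Longrightarrow> f x = h x"
  shows "integrable lborel f \<longleftrightarrow> integrable lborel h" "integral\<^sup>L lborel f = integral\<^sup>L lborel h"
proof -
  have ae: "AE x in lborel. f x = h x" if "\<And>x. x \<noteq> 0 \<Longrightarrow> f x = h x" for f h :: "'a \<Rightarrow> 'b"
    using AE_lborel_singleton [of "0::'a"] by eventually_elim (rule that)
  have m: "h \<in> borel_measurable lborel" if "f \<in> borel_measurable lborel" "\<And>x. x \<noteq> 0 \<Longrightarrow> f x = h x" for f h :: "'a \<Rightarrow> 'b"
  proof -
    have "h = (\<lambda>x. if x \<in> {0} then h 0 else f x)" using that(2) by auto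
    moreover have "(\<lambda>x. if x \<in> {0} then h 0 else f x) \<in> borel_measurable lborel"
      using that(1) by (intro measurable_If_set) auto
    ultimately show ?thesis by (simp only:)
  qed
  have i: "integrable lborel h" if "integrable lborel f" "\<And>x. x \<noteq> 0 \<Longrightarrow> f x = h x" for f h :: "'a \<Rightarrow> 'b"
  proof (rule integrable_cong_AE_imp [OF that(1)])
    show "h \<in> borel_measurable lborel" by (rule m [OF borel_measurable_integrable [OF that(1)]]) (rule that(2))
    show "AE x in lborel. f x = h x" by (rule ae) (rule that(2))
  qed
  show iff: "integrable lborel f \<longleftrightarrow> integrable lborel h" 
  proof
    assume "integrable lborel f"
    then show "integrable lborel h" by (rule i) (rule assms)
  next
    assume "integrable lborel h"
    then show "integrable lborel f" by (rule i) (rule assms [symmetric])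
  qed
  show "integral\<^sup>L lborel f = integral\<^sup>L lborel h"
  proof (cases "integrable lborel f")
    case True
    then show ?thesis
      using iff by (intro integral_cong_AE ae assms borel_measurable_integrable) auto
  next
    case False
    then show ?thesis using iff by (simp add: not_integrable_integral_eq)
  qed
qed

text \<open>One cutoff equal to 1 at the origin separates two candidate constants.
  \<open>grad (mu p)\<close> has an unspecified value at 0, hence the passage through
  \<open>integral_cong_off_0\<close>.\<close>

lemma dirac_const_eq:
  assumes p: "1 < p" and cN: "0 < cN" "weak_eq (UNIV :: 'a::euclidean_space set) (\<lambda>x. flux p (grad_mu p x)) (\<lambda>x. 0) cN"
  shows "dirac_const TYPE('a) p = cN"
  unfolding dirac_const_def
proof (rule the_equality)
  have F: "p_flux p (mu p) x = flux p (grad_mu p x)" if "x \<noteq> 0" for x :: 'a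
    using C1_on_grad [OF C1_on_mu [OF p], of x] that by (simp add: p_flux_def flux_def)
  have L: "L1_loc (UNIV :: 'a set) (p_flux p (mu p))"
    unfolding L1_loc_def set_integrable_def
  proof (intro allI impI)
    fix K :: "'a set" assume "compact K \<and> K \<subseteq> UNIV"
    then have "integrable lborel (\<lambda>x. indicator K x *\<^sub>R flux p (grad_mu p x))"
      using L1_loc_flux_mu [OF p, of "UNIV :: 'a set"] by (auto simp: L1_loc_def set_integrable_def)
    then show "integrable lborel (\<lambda>x. indicator K x *\<^sub>R p_flux p (mu p) x)"
      by (subst integral_cong_off_0(1)) (auto simp: F)
  qed
  have W: "weak_eq (UNIV :: 'a set) (p_flux p (mu p)) (\<lambda>x. 0) cN"
    unfolding weak_eq_def
  proof (intro allI impI)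
    fix \<phi> :: "'a \<Rightarrow> real" and D assume C: "C1c UNIV \<phi> D"
    have "(LINT x|lborel. p_flux p (mu p) x \<bullet> D x + 0 * \<phi> x) = (LINT x|lborel. flux p (grad_mu p x) \<bullet> D x + 0 * \<phi> x)"
      by (rule integral_cong_off_0(2)) (simp add: F)
    then show "(LINT x|lborel. p_flux p (mu p) x \<bullet> D x + 0 * \<phi> x) = cN * \<phi> 0"
      using weak_eqD [OF cN(2) C] by simp
  qed
  have "L1_loc (UNIV :: 'a set) (\<lambda>_. 0 :: real)" by (simp add: L1_loc_def set_integrable_def)
  with W L cN(1) show "0 < cN \<and> dist_eq (UNIV :: 'a set) (p_flux p (mu p)) (\<lambda>_. 0) cN"
    by (simp add: weak_eq_imp_dist_eq)
  fix c assume "0 < c \<and> dist_eq (UNIV :: 'a set) (p_flux p (mu p)) (\<lambda>_. 0) c"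
  then have W': "weak_eq (UNIV :: 'a set) (p_flux p (mu p)) (\<lambda>_. 0) c" by (intro dist_eq_imp_weak_eq) auto
  obtain \<phi> D where \<phi>: "C1c (ball (0::'a) 2) \<phi> D" "\<And>x. norm (x - 0) \<le> 1 \<Longrightarrow> \<phi> x = 1"
    by (rule radial_cutoff [of 1 2 "0::'a"]) auto
  have C: "C1c UNIV \<phi> D" by (rule C1c_mono [OF \<phi>(1)]) simp
  show "c = cN" using weak_eqD [OF W C] weak_eqD [OF W' C] \<phi>(2) [of 0] by simp
qed

lemma p_flux_eq: "p_flux p u = (\<lambda>x. flux p (grad u x))"
  by (simp add: fun_eq_iff p_flux_def flux_def)

theorem theoremC:
  fixes \<Omega> :: "'a::euclidean_space set" and u :: "'a \<Rightarrow> real" and p q :: real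
  assumes "2 \<le> DIM('a)"
    and "1 < p" and "p \<le> real DIM('a)"
    and "p - 1 < q" and "q < q_crit DIM('a) p"
    and "open \<Omega>" and "connected \<Omega>" and "0 \<in> \<Omega>"
    and "C_k_on 1 (\<Omega> - {0}) u"
    and "\<And>x. x \<in> \<Omega> - {0} \<Longrightarrow> 0 \<le> u x"
    and "HJ_eq p q (\<Omega> - {0}) u 0"
  shows "(\<exists>c\<ge>0. ((\<lambda>x. u x / mu p x) \<longlongrightarrow> c) (at 0) \<and>
                 HJ_eq p q \<Omega> u (dirac_const TYPE('a) p * c powr (p - 1)))
       \<or> ((\<lambda>x. norm x powr beta_exp p q * u x) \<longlongrightarrow> lambda_const DIM('a) p q) (at 0)"
proof -
  note p = assms(2,3) and nn = assms(10)
  have o: "open (\<Omega> - {0})" using assms(6) by auto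
  have "weak_eq (\<Omega> - {0}) (\<lambda>x. flux p (grad u x)) (\<lambda>x. norm (grad u x) powr q) 0"
    using dist_eq_imp_weak_eq [OF assms(11) [unfolded HJ_eq_def p_flux_eq] o] .
  then have u: "HJ_sol p q (\<Omega> - {0}) u (grad u)"
    using C_k_on_1_C1_on [OF assms(9)] by (simp add: HJ_sol_def)
  obtain R where R: "0 < R" "cball 0 R \<subseteq> \<Omega>" using assms(6,8) open_contains_cball by blast
  \<comment> \<open>The shell degenerates to the sphere of radius R, where the bound K is
    wanted.\<close>
  have cu: "continuous_on (cball 0 R - ball 0 R) u"
  proof (rule C1_on_continuous [OF C1_on_subset])
    show "C1_on (\<Omega> - {0}) u (grad u)" using u by (simp add: HJ_sol_def)
    show "cball 0 R - ball 0 R \<subseteq> \<Omega> - {0}" using R by auto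
  qed
  obtain K where "\<And>x. R \<le> norm x \<Longrightarrow> norm x \<le> R \<Longrightarrow> u x \<le> K" by (rule C1_on_bounded_shell [OF cu]) blast
  then have K: "\<And>x. norm x = R \<Longrightarrow> u x \<le> K" by simp
  have rad: "radial DIM('a) p q R" by unfold_locales (use assms R in auto)
  have qp: "q < p" by (rule radial.q_less [OF rad])
  have q0: "0 < q" using assms by simp
  obtain cN where cN: "0 < cN" "weak_eq (UNIV :: 'a set) (\<lambda>x. flux p (grad_mu p x)) (\<lambda>x. 0) cN"
    by (rule weak_eq_mu [OF p]) blast
  have dc: "dirac_const TYPE('a) p = cN" by (rule dirac_const_eq [OF p(1) cN])
  have HJ: "HJ_eq p q \<Omega> u m" if "weak_eq \<Omega> (\<lambda>x. flux p (grad u x)) (\<lambda>x. norm (grad u x) powr q) m"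
    "L1_loc \<Omega> (\<lambda>x. flux p (grad u x))" "L1_loc \<Omega> (\<lambda>x. norm (grad u x) powr q)" for m
    unfolding HJ_eq_def p_flux_eq by (rule weak_eq_imp_dist_eq [OF that])
  show ?thesis
  proof (rule trichotomy [OF rad assms(6) R(2) u nn K])
    assume bd: "\<And>x. 0 < norm x \<Longrightarrow> norm x \<le> R \<Longrightarrow> u x \<le> K"
    \<comment> \<open>Boundedness is growth with exponent k = 0; the maximum with 1 makes the
      constant positive.\<close>
    have gr: "u x \<le> max K 1 * norm x powr (- 0)" if "0 < norm x" "norm x \<le> R" for x using bd [OF that] that by auto
    have K1: "0 < max K 1" by simp
    note ex = mass_exists [OF p(1) assms(4) qp assms(6) R(2) u nn R(1) gr K1 order_refl]
    have q1: "q * (0 + 1) < real DIM('a)" using qp p by simp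
    note L = ex(1,2) [OF _ _ _ q1]
    obtain m where m: "weak_eq \<Omega> (\<lambda>x. flux p (grad u x)) (\<lambda>x. norm (grad u x) powr q) m" using ex(3) [OF _ _ _ q1] by blast
    have "m = 0" by (rule mass_zero [OF p q0 assms(6) R(2) u nn R(1) bd L m])
    then have eq: "HJ_eq p q \<Omega> u (dirac_const TYPE('a) p * 0 powr (p - 1))" using HJ [OF m L] by simp
    have mu: "filterlim (mu p :: 'a \<Rightarrow> real) at_top (at 0)" by (rule mu_at_0 [OF p])
    have "((\<lambda>x. u x / mu p x) \<longlongrightarrow> 0) (at 0)"
    proof (rule real_tendsto_sandwich)
      have ev: "\<forall>\<^sub>F x in at (0::'a). 0 < mu p x" using mu by (simp add: filterlim_at_top_dense)
      have n: "\<forall>\<^sub>F x in at (0::'a). x \<noteq> 0 \<and> norm x < R" unfolding eventually_at using R by (intro exI [of _ R]) auto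
      show "\<forall>\<^sub>F x in at 0. 0 \<le> u x / mu p x"
        using ev n
      proof eventually_elim
        case (elim x)
        then have "x \<in> cball 0 R" by simp
        then have "0 \<le> u x" using elim R(2) by (intro nn) blast
        then show ?case using elim by simp
      qed
      show "\<forall>\<^sub>F x in at 0. u x / mu p x \<le> K / mu p x"
        using ev n by eventually_elim (intro divide_right_mono bd, auto)
      show "((\<lambda>x::'a. K / mu p x) \<longlongrightarrow> 0) (at 0)"
        by (rule tendsto_divide_0 [OF tendsto_const filterlim_at_top_imp_at_infinity [OF mu]])
    qed auto
    with eq show ?thesis by blast
  next
    fix c assume c: "0 < c" and lim: "((\<lambda>x. u x / mu p x) \<longlongrightarrow> c) (at 0)"
    let ?N = "real DIM('a)"
    define k0 where "k0 = (?N - p) / (p - 1)"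
    define X where "X = ?N / q - 1"
    \<comment> \<open>The exponent must exceed the growth exponent k0 of mu_p and satisfy q (k + 1)
      < N, that is k < X. There is room between k0 and X exactly when q is subcritical.\<close>
    define k where "k = (k0 + X) / 2"
    have N1: "1 < ?N" using assms(1) by simp
    have "q * (?N - 1) < ?N * (p - 1)"
      using assms(5) N1 by (simp add: q_crit_def pos_less_divide_eq)
    then have "(?N - 1) / (p - 1) < ?N / q" using p q0 by (simp add: field_simps)
    moreover have "k0 = (?N - 1) / (p - 1) - 1" using p by (simp add: k0_def field_simps)
    ultimately have X: "k0 < X" unfolding X_def by linarith
    have "k0 < k" "k < X" using X by (simp_all add: k_def)
    then have kk: "k0 < k" "k + 1 < ?N / q" by (simp_all add: X_def)
    have "0 \<le> k0" using p by (simp add: k0_def)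
    then have k: "0 \<le> k" "q * (k + 1) < ?N" using kk q0 by (auto simp: pos_less_divide_eq mult.commute)
    obtain C where C: "0 < C" "\<And>x::'a. 0 < norm x \<Longrightarrow> norm x \<le> 1 \<Longrightarrow> mu p x \<le> C * norm x powr (- k)"
      by (rule mu_growth [OF p kk(1) [unfolded k0_def]]) blast
    have "\<forall>\<^sub>F x in at (0::'a). u x / mu p x < c + 1" using order_tendstoD(2) [OF lim, of "c + 1"] by simp
    moreover have "\<forall>\<^sub>F x in at (0::'a). 0 < mu p x" using mu_at_0 [OF p] by (simp add: filterlim_at_top_dense)
    ultimately have "\<forall>\<^sub>F x in at 0. u x \<le> (c + 1) * mu p x" by eventually_elim (simp add: pos_divide_less_eq)
    then obtain d where d: "0 < d" "\<And>x. x \<noteq> 0 \<Longrightarrow> dist x 0 < d \<Longrightarrow> u x \<le> (c + 1) * mu p x"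
      unfolding eventually_at by blast
    define \<rho> where "\<rho> = min (d / 2) (min 1 R)"
    have \<rho>: "0 < \<rho>" "\<rho> \<le> 1" "\<rho> \<le> R" "\<rho> < d" using d R by (auto simp: \<rho>_def)
    have \<rho>\<Omega>: "cball 0 \<rho> \<subseteq> \<Omega>" by (rule order_trans [OF _ R(2)]) (use \<rho> in auto)
    have gr: "u x \<le> ((c + 1) * C) * norm x powr (- k)" if x: "0 < norm x" "norm x \<le> \<rho>" for x
    proof -
      have "u x \<le> (c + 1) * mu p x" using x \<rho> by (intro d(2)) auto
      also have "\<dots> \<le> (c + 1) * (C * norm x powr (- k))" using x \<rho> c by (intro mult_left_mono C(2)) auto
      finally show ?thesis by simp
    qed
    have cC: "0 < (c + 1) * C" using c C by simp
    note L = mass_exists(1,2) [OF p(1) assms(4) qp assms(6) \<rho>\<Omega> u nn \<rho>(1) gr cC k]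
    obtain m where m: "weak_eq \<Omega> (\<lambda>x. flux p (grad u x)) (\<lambda>x. norm (grad u x) powr q) m"
      using mass_exists(3) [OF p(1) assms(4) qp assms(6) \<rho>\<Omega> u nn \<rho>(1) gr cC k] by blast
    have "m = cN * c powr (p - 1)"
      by (rule mass_of_weak_singularity [OF p assms(6) \<rho>\<Omega> \<rho>(1) u L m cN(2) c lim])
    then have "HJ_eq p q \<Omega> u (dirac_const TYPE('a) p * c powr (p - 1))" using HJ [OF m L] by (simp add: dc)
    with c lim show ?thesis by (intro disjI1 exI [of _ c]) auto
  next
    assume "((\<lambda>x. norm x powr beta_exp p q * u x) \<longlongrightarrow> lambda_const DIM('a) p q) (at 0)"
    then show ?thesis ..
  qed
qed

end
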